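(* Let $C_1,\dots,C_k$ be conjugacy classes in $\mathrm{GL}_n(\mathbb{C})$. Let $w=(w_1,\dots,w_k)$ be positive integers and let $\xi_{ij}\in\mathbb{C}^*$ ($1\le i\le k$, $1\le j\le w_i$) be such that $(A_i-\xi_{i1}1)(A_i-\xi_{i2}1)\cdots(A_i-\xi_{i,w_i}1)=0$ for $A_i\in C_i$. Let $\alpha\in\mathbb{Z}^I$ be given by $\alpha_0=n$ and $\alpha_{ij}=\operatorname{rank}\,(A_i-\xi_{i1}1)\cdots(A_i-\xi_{ij}1)$ for $A_i\in C_i$, $1\le i\le k$, $1\le j\le w_i-1$. Then there is a rigid irreducible solution to $A_1\cdots A_k=1$ with $A_i\in C_i$ for all $i$ if and only if $\alpha$ is a positive real root for $\Gamma_w$, $\xi^{[\alpha]}=1$, and there is no nontrivial decomposition of $\alpha$ as a sum of positive roots $\alpha=\beta+\gamma+\dots$ with $\xi^{[\beta]}=\xi^{[\gamma]}=\dots=1$.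
   Context: A solution $(A_1,\dots,A_k)$ of $A_1\cdots A_k=1$ with $A_i\in C_i$ is irreducible if the $A_i$ have no common invariant subspace (other than $0$ and $\mathbb{C}^n$), and rigid if it is the unique solution with $A_i\in C_i$ up to simultaneous conjugacy. A decomposition as a sum of positive roots is nontrivial if it has at least two terms. For $\beta\in\mathbb{Z}^I$, $\xi^{[\beta]}=\prod_{i=1}^k\prod_{j=1}^{w_i}\xi_{ij}^{\beta_{i,j-1}-\beta_{ij}}$, with the convention $\beta_{i0}=\beta_0$ and $\beta_{i,w_i}=0$ for all $i$. Graph and roots. $\Gamma_w$ is the star-shaped graph with vertex set $I=\{0\}\cup\{[i,j]:1\le i\le k,\ 1\le j\le w_i-1\}$ and edges joining $0$ to $[i,1]$ and $[i,j]$ to $[i,j+1]$. Components of $\alpha\in\mathbb{Z}^I$ are written $\alpha_0$ and $\alpha_{ij}$; $\epsilon_v$ is the coordinate vector at $v\in I$. There is a symmetric bilinear form on $\mathbb{Z}^I$ with $(\epsilon_v,\epsilon_v)=2$, $(\epsilon_v,\epsilon_{v'})=-1$ if an edge joins $v$ and $v'$, and $0$ otherwise. The reflection at $v$ is $s_v(\alpha)=\alpha-(\alpha,\epsilon_v)\epsilon_v$, and $W\subseteq\operatorname{Aut}(\mathbb{Z}^I)$ is the group generated by the $s_v$. Real roots are the elements of the $W$-orbits of the coordinate vectors. The fundamental region is the set of nonzero $\alpha\in\mathbb{N}^I$ with connected support and $(\alpha,\epsilon_v)\le 0$ for all $v\in I$; imaginary roots are the elements $\pm w(\alpha)$ with $w\in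 W$ and $\alpha$ in the fundamental region. Roots are the real and imaginary roots; a root is positive if it lies in $\mathbb{N}^I$. *)

theory Defs
  imports Complex_Main "Jordan_Normal_Form.DL_Rank"
begin

text \<open>
  A finite simple graph is a finite vertex set \<open>I\<close> with a symmetric, irreflexive edge relation
  \<open>E \<subseteq> I \<times> I\<close>. An element of \<open>\<int>\<^sup>I\<close> is a total function that vanishes outside \<open>I\<close>.
\<close>

definition root_lattice :: "'v set \<Rightarrow> ('v \<Rightarrow> int) set" where
  "root_lattice I = {a. \<forall>v. v \<notin> I \<longrightarrow> a v = 0}"

definition coord_vec :: "'v \<Rightarrow> 'v \<Rightarrow> int" where
  "coord_vec v = (\<lambda>u. if u = v then 1 else 0)"

definition bilin_form :: "'v set \<Rightarrow> ('v \<times> 'v) set \<Rightarrow> ('v \<Rightarrow> int) \<Rightarrow> ('v \<Rightarrow> int) \<Rightarrow> int" where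
  "bilin_form I E a b =
     (\<Sum>u\<in>I. \<Sum>v\<in>I. (if u = v then 2 else if (u, v) \<in> E then - 1 else 0) * a u * b v)"

definition reflection :: "'v set \<Rightarrow> ('v \<times> 'v) set \<Rightarrow> 'v \<Rightarrow> ('v \<Rightarrow> int) \<Rightarrow> ('v \<Rightarrow> int)" where
  "reflection I E v a = (\<lambda>u. a u - bilin_form I E a (coord_vec v) * coord_vec v u)"

text \<open>
  The formula for a reflection at a vertex of a finite \<open>I\<close> defines
  an involution of the space of all functions, which preserves \<open>root_lattice I\<close>, so the
  elements below are bijections and \<open>inv_into UNIV g\<close> is a genuine inverse.
\<close>

inductive_set weyl_group :: "'v set \<Rightarrow> ('v \<times> 'v) set \<Rightarrow> (('v \<Rightarrow> int) \<Rightarrow> ('v \<Rightarrow> int)) set"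
  for I :: "'v set" and E :: "('v \<times> 'v) set" where
  one: "id \<in> weyl_group I E"
| refl: "v \<in> I \<Longrightarrow> reflection I E v \<in> weyl_group I E"
| inverse: "g \<in> weyl_group I E \<Longrightarrow> inv_into UNIV g \<in> weyl_group I E"
| comp: "g \<in> weyl_group I E \<Longrightarrow> h \<in> weyl_group I E \<Longrightarrow> g \<circ> h \<in> weyl_group I E"

definition real_roots :: "'v set \<Rightarrow> ('v \<times> 'v) set \<Rightarrow> ('v \<Rightarrow> int) set" where
  "real_roots I E = {g (coord_vec v) | g v. g \<in> weyl_group I E \<and> v \<in> I}"

definition connected_support :: "('v \<times> 'v) set \<Rightarrow> ('v \<Rightarrow> int) \<Rightarrow> bool" where
  "connected_support E a \<longleftrightarrow>
     (let S = {v. a v \<noteq> 0} in \<forall>u\<in>S. \<forall>v\<in>S. (u, v) \<in> (E \<inter> S \<times> S)\<^sup>*)"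

definition fundamental_region :: "'v set \<Rightarrow> ('v \<times> 'v) set \<Rightarrow> ('v \<Rightarrow> int) set" where
  "fundamental_region I E =
     {a \<in> root_lattice I. (\<forall>v\<in>I. 0 \<le> a v) \<and> a \<noteq> (\<lambda>v. 0) \<and> connected_support E a \<and>
        (\<forall>v\<in>I. bilin_form I E a (coord_vec v) \<le> 0)}"

definition imaginary_roots :: "'v set \<Rightarrow> ('v \<times> 'v) set \<Rightarrow> ('v \<Rightarrow> int) set" where
  "imaginary_roots I E =
     {g a | g a. g \<in> weyl_group I E \<and> a \<in> fundamental_region I E} \<union>
     {(\<lambda>v. - g a v) | g a. g \<in> weyl_group I E \<and> a \<in> fundamental_region I E}"

definition roots :: "'v set \<Rightarrow> ('v \<times> 'v) set \<Rightarrow> ('v \<Rightarrow> int) set" where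
  "roots I E = real_roots I E \<union> imaginary_roots I E"

definition positive_real_roots :: "'v set \<Rightarrow> ('v \<times> 'v) set \<Rightarrow> ('v \<Rightarrow> int) set" where
  "positive_real_roots I E = {a \<in> real_roots I E. \<forall>v\<in>I. 0 \<le> a v}"

definition positive_roots :: "'v set \<Rightarrow> ('v \<times> 'v) set \<Rightarrow> ('v \<Rightarrow> int) set" where
  "positive_roots I E = {a \<in> roots I E. \<forall>v\<in>I. 0 \<le> a v}"

datatype vertex = Centre | Arm nat nat

definition star_vertices :: "nat \<Rightarrow> (nat \<Rightarrow> nat) \<Rightarrow> vertex set" where
  "star_vertices k w = insert Centre {Arm i j | i j. i \<in> {1..k} \<and> j \<in> {1..w i - 1}}"

definition star_edges :: "nat \<Rightarrow> (nat \<Rightarrow> nat) \<Rightarrow> (vertex \<times> vertex) set" where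
  "star_edges k w =
     (let F = {(Centre, Arm i 1) | i. Arm i 1 \<in> star_vertices k w} \<union>
              {(Arm i j, Arm i (j + 1)) | i j.
                 Arm i j \<in> star_vertices k w \<and> Arm i (j + 1) \<in> star_vertices k w}
      in F \<union> F\<inverse>)"

text \<open>
  The coordinate \<open>b\<^bsub>ij\<^esub>\<close> for \<open>0 \<le> j \<le> w i\<close>, with the conventions \<open>b\<^bsub>i0\<^esub> = b\<^sub>0\<close> and
  \<open>b\<^bsub>i,w i\<^esub> = 0\<close>.
\<close>

definition arm_coord :: "(nat \<Rightarrow> nat) \<Rightarrow> (vertex \<Rightarrow> int) \<Rightarrow> nat \<Rightarrow> nat \<Rightarrow> int" where
  "arm_coord w b i j = (if j = 0 then b Centre else if j = w i then 0 else b (Arm i j))"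

definition xi_power ::
  "nat \<Rightarrow> (nat \<Rightarrow> nat) \<Rightarrow> (nat \<Rightarrow> nat \<Rightarrow> complex) \<Rightarrow> (vertex \<Rightarrow> int) \<Rightarrow> complex" where
  "xi_power k w \<xi> b =
     (\<Prod>i = 1..k. \<Prod>j = 1..w i. \<xi> i j powi (arm_coord w b i (j - 1) - arm_coord w b i j))"

definition GL :: "nat \<Rightarrow> complex mat set" where
  "GL n = {A \<in> carrier_mat n n. invertible_mat A}"

definition GL_conjugacy_class :: "nat \<Rightarrow> complex mat set \<Rightarrow> bool" where
  "GL_conjugacy_class n C \<longleftrightarrow> (\<exists>A \<in> GL n. C = {B. similar_mat B A})"

definition mat_prod :: "nat \<Rightarrow> (nat \<Rightarrow> complex mat) \<Rightarrow> nat \<Rightarrow> complex mat" where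
  "mat_prod n M m = foldr (\<lambda>l P. M l * P) [1..<Suc m] (1\<^sub>m n)"

definition shifted_prod :: "nat \<Rightarrow> complex mat \<Rightarrow> (nat \<Rightarrow> complex) \<Rightarrow> nat \<Rightarrow> complex mat" where
  "shifted_prod n A x m = mat_prod n (\<lambda>j. A - x j \<cdot>\<^sub>m 1\<^sub>m n) m"

text \<open>Only the values \<open>A 1, \<dots>, A k\<close> of the family \<open>A\<close> are relevant below.\<close>

definition is_solution ::
  "nat \<Rightarrow> nat \<Rightarrow> (nat \<Rightarrow> complex mat set) \<Rightarrow> (nat \<Rightarrow> complex mat) \<Rightarrow> bool" where
  "is_solution n k C A \<longleftrightarrow> (\<forall>i\<in>{1..k}. A i \<in> C i) \<and> mat_prod n A k = 1\<^sub>m n"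

definition irreducible_tuple :: "nat \<Rightarrow> nat \<Rightarrow> (nat \<Rightarrow> complex mat) \<Rightarrow> bool" where
  "irreducible_tuple n k A \<longleftrightarrow>
     (\<forall>U. VectorSpace.subspace class_ring U (module_vec TYPE(complex) n) \<and>
          (\<forall>i\<in>{1..k}. \<forall>u\<in>U. A i *\<^sub>v u \<in> U)
          \<longrightarrow> U = {0\<^sub>v n} \<or> U = carrier_vec n)"

definition simultaneously_conjugate ::
  "nat \<Rightarrow> nat \<Rightarrow> (nat \<Rightarrow> complex mat) \<Rightarrow> (nat \<Rightarrow> complex mat) \<Rightarrow> bool" where
  "simultaneously_conjugate n k A B \<longleftrightarrow>
     (\<exists>P \<in> carrier_mat n n. \<exists>Q \<in> carrier_mat n n. P * Q = 1\<^sub>m n \<and> Q * P = 1\<^sub>m n \<and>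
        (\<forall>i\<in>{1..k}. B i = P * A i * Q))"

definition rigid_solution ::
  "nat \<Rightarrow> nat \<Rightarrow> (nat \<Rightarrow> complex mat set) \<Rightarrow> (nat \<Rightarrow> complex mat) \<Rightarrow> bool" where
  "rigid_solution n k C A \<longleftrightarrow>
     is_solution n k C A \<and> (\<forall>B. is_solution n k C B \<longrightarrow> simultaneously_conjugate n k A B)"

end

theory Submission
  imports Defs "HOL-Library.Function_Algebras" "Jordan_Normal_Form.Spectral_Radius"
begin

text \<open>
  A tuple with product \<open>1\<close> and a choice of the \<open>\<xi>\<^sub>i\<^sub>j\<close> has a type \<open>\<alpha>\<close>. Exchanging \<open>\<xi>\<^sub>i\<^sub>j\<close> and
  \<open>\<xi>\<^sub>i\<^sub>,\<^sub>j\<^sub>+\<^sub>1\<close> reflects \<open>\<alpha>\<close> at an arm vertex, middle convolution reflects it at the centre, and both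
  preserve irreducibility. So irreducible tuples with \<open>(\<alpha>, \<alpha>) > 0\<close>, and likewise the roots \<open>\<alpha>\<close>
  satisfying the right-hand condition, can be reduced to coordinate vectors by decreasing the sum of
  the coordinates of \<open>\<alpha>\<close>.

  Since \<open>(\<alpha>, \<alpha>) = 2 n\<^sup>2 - \<Sum>\<^sub>i (n\<^sup>2 - dim Z(A\<^sub>i))\<close>, Scott's inequality for the action on matrices produces
  a nonzero intertwiner between any two solutions when \<open>(\<alpha>, \<alpha>) = 2\<close>, which gives rigidity. Conversely,
  if \<open>(\<alpha>, \<alpha>) \<le> 0\<close>, then there are infinitesimal deformations of the solution inside the classes that
  do not come from conjugation. A Newton iteration integrates one of them to actual solutions, and
  comparing first order terms shows that these are not all conjugate to the given one.
\<close>

text \<open>The reduction succeeds because both sides exclude the same obstruction at a vertex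
  \<open>v\<close> with \<open>(\<alpha>, coord_vec v) > 0\<close>, namely that the character of
  \<open>\<xi>\<close> is 1 on \<open>coord_vec v\<close>. For tuples this would mean equal
  neighbouring parameters on an arm or, at the centre in dimension at least 2, a product relation to
  which Scott's inequality applies; either forces a nonpositive value of the form. For roots it
  would split copies of \<open>coord_vec v\<close> off \<open>\<alpha>\<close>. Swaps and
  convolutions are undone by repeating them, so a tuple can also be built upwards from a line.

  The obstacle in extracting \<open>(\<alpha>, \<alpha>) > 0\<close> is that rigidity is only
  uniqueness up to conjugacy and says nothing about dimensions. Conjugating each \<open>A i\<close>
  by a partial product of matrices \<open>1 + x i\<close> turns the product relation into a
  polynomial equation without inverses. Its linearisation takes values in the traceless matrices, so
  it is not onto; a scalar \<open>1 + c\<close> is added as an unknown, and comparing determinants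
  afterwards makes it an \<open>n\<close>-th root of unity, hence 1 for small
  \<open>c\<close>.\<close>

section \<open>Complex linear algebra\<close>

text \<open>Vector spaces are finite-dimensional subspaces of types of class \<open>cvec\<close>, and linear maps are
  total functions, so that the dimension may change inside a proof and spaces of tuples and of
  linear maps need no new types.\<close>

class cvec = ab_group_add +
  fixes cscale :: "complex \<Rightarrow> 'a \<Rightarrow> 'a" (infixr \<open>*c\<close> 75)
  assumes cscale_right_distrib: "a *c (x + y) = a *c x + a *c y"
    and cscale_left_distrib: "(a + b) *c x = a *c x + b *c x"
    and cscale_cscale: "a *c (b *c x) = (a * b) *c x"
    and cscale_one: "1 *c x = x"

instantiation complex :: cvec
begin
definition cscale_complex :: "complex \<Rightarrow> complex \<Rightarrow> complex" where "cscale_complex a b = a * b"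
instance by standard (simp_all add: cscale_complex_def algebra_simps)
end

instantiation "fun" :: (type, cvec) cvec
begin
definition cscale_fun :: "complex \<Rightarrow> ('a \<Rightarrow> 'b) \<Rightarrow> 'a \<Rightarrow> 'b" where "cscale_fun a f = (\<lambda>x. a *c f x)"
instance by standard
  (simp_all add: cscale_fun_def fun_eq_iff cscale_right_distrib cscale_left_distrib cscale_cscale cscale_one)
end

lemma cscale_fun_apply: "(a *c f) x = a *c f x"
  by (simp add: cscale_fun_def)

lemma minus_fun_apply' [simp]: "(f - g) x = f x - (g x :: 'a::ab_group_add)"
  by (simp add: fun_diff_def)

lemma uminus_fun_apply' [simp]: "(- f) x = - (f x :: 'a::ab_group_add)"
  by (simp add: fun_Compl_def)

lemma sum_fun_apply: "(\<Sum>i\<in>I. f i) x = (\<Sum>i\<in>I. f i x :: 'a::ab_group_add)"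
  by (induction I rule: infinite_finite_induct) auto

interpretation cv: vector_space "cscale :: complex \<Rightarrow> 'a::cvec \<Rightarrow> 'a"
  by standard (simp_all add: cscale_right_distrib cscale_left_distrib cscale_cscale cscale_one)

interpretation cvp: vector_space_pair "cscale :: complex \<Rightarrow> 'a::cvec \<Rightarrow> 'a" "cscale :: complex \<Rightarrow> 'b::cvec \<Rightarrow> 'b"
  by standard

definition clin :: "('a::cvec \<Rightarrow> 'b::cvec) \<Rightarrow> bool" where
  "clin f \<longleftrightarrow> (\<forall>x y. f (x + y) = f x + f y) \<and> (\<forall>c x. f (c *c x) = c *c f x)"

lemma clin_iff: "clin f \<longleftrightarrow> Vector_Spaces.linear cscale cscale f"
  unfolding clin_def Vector_Spaces.linear_iff by (simp add: cv.vector_space_axioms)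

lemma clinI: "(\<And>x y. f (x + y) = f x + f y) \<Longrightarrow> (\<And>c x. f (c *c x) = c *c f x) \<Longrightarrow> clin f"
  by (simp add: clin_def)

lemma clin_add: "clin f \<Longrightarrow> f (x + y) = f x + f y" by (simp add: clin_def)
lemma clin_scale: "clin f \<Longrightarrow> f (c *c x) = c *c f x" by (simp add: clin_def)
lemma clin_0: "clin f \<Longrightarrow> f 0 = 0" using clin_scale[of f 0 0] by simp
lemma clin_minus: "clin f \<Longrightarrow> f (- x) = - f x" using clin_scale[of f "- 1" x] by simp
lemma clin_diff: "clin f \<Longrightarrow> f (x - y) = f x - f y"
  using clin_add[of f x "- y"] by (simp add: clin_minus)
lemma clin_sum: "clin f \<Longrightarrow> f (\<Sum>i\<in>I. g i) = (\<Sum>i\<in>I. f (g i))"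
  by (induction I rule: infinite_finite_induct) (auto simp: clin_0 clin_add)

lemmas clin_simps = clin_add clin_scale clin_0 clin_minus clin_diff clin_sum

lemma clin_id: "clin (\<lambda>x. x)" by (simp add: clin_def)
lemma clin_zero: "clin (\<lambda>x. 0)" by (simp add: clin_def)
lemma clin_comp: "clin f \<Longrightarrow> clin g \<Longrightarrow> clin (\<lambda>x. f (g x))" by (simp add: clin_def)
lemma clin_plus: "clin f \<Longrightarrow> clin g \<Longrightarrow> clin (\<lambda>x. f x + g x)"
  by (simp add: clin_def algebra_simps cscale_right_distrib)
lemma clin_uminus: "clin f \<Longrightarrow> clin (\<lambda>x. - f x)"
  by (simp add: clin_def cv.scale_minus_right)
lemma clin_sub: "clin f \<Longrightarrow> clin g \<Longrightarrow> clin (\<lambda>x. f x - g x)"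
  by (simp add: clin_def cv.scale_right_diff_distrib)
lemma clin_cscale: "clin f \<Longrightarrow> clin (\<lambda>x. c *c f x)"
  by (simp add: clin_def cscale_right_distrib mult.commute cscale_cscale)
lemma clin_setsum: "(\<And>i. i \<in> I \<Longrightarrow> clin (f i)) \<Longrightarrow> clin (\<lambda>x. \<Sum>i\<in>I. f i x)"
  by (induction I rule: infinite_finite_induct) (auto simp: clin_zero clin_plus)
lemma clin_fun: "(\<And>i. clin (\<lambda>x. f x i)) \<Longrightarrow> clin f"
  by (simp add: clin_def fun_eq_iff cscale_fun_apply)
lemma clin_apply: "clin (\<lambda>x. x i)"
  by (simp add: clin_def cscale_fun_apply)

lemma clin_if: "(P \<Longrightarrow> clin f) \<Longrightarrow> (\<not> P \<Longrightarrow> clin g) \<Longrightarrow> clin (\<lambda>x. if P then f x else g x)"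
  by (cases P) auto

lemma subspaceI: "0 \<in> S \<Longrightarrow> (\<And>x y. x \<in> S \<Longrightarrow> y \<in> S \<Longrightarrow> x + y \<in> S) \<Longrightarrow>
    (\<And>c x. x \<in> S \<Longrightarrow> c *c x \<in> S) \<Longrightarrow> cv.subspace S"
  by (simp add: cv.subspace_def)

lemma subspace_image: "clin f \<Longrightarrow> cv.subspace S \<Longrightarrow> cv.subspace (f ` S)"
  unfolding clin_iff by (rule cvp.linear_subspace_image)

lemma subspace_ker: "clin f \<Longrightarrow> cv.subspace S \<Longrightarrow> cv.subspace {x \<in> S. f x = 0}"
  by (rule subspaceI) (auto simp: clin_simps cv.subspace_def)

section \<open>Finite-dimensional subspaces\<close>

text \<open>The finite set \<open>B\<close> may lie outside \<open>V\<close>; this makes the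
  property pass to smaller subspaces at once, while \<open>fsub_basis\<close> recovers a basis
  inside \<open>V\<close>.\<close>

definition fsub :: "'a::cvec set \<Rightarrow> bool" where
  "fsub V \<longleftrightarrow> cv.subspace V \<and> (\<exists>B. finite B \<and> V \<subseteq> cv.span B)"

lemma fsubD: "fsub V \<Longrightarrow> cv.subspace V" by (simp add: fsub_def)

lemma fsub_zero_mem: "fsub V \<Longrightarrow> 0 \<in> V" by (simp add: fsub_def cv.subspace_0)
lemma fsub_add: "fsub V \<Longrightarrow> x \<in> V \<Longrightarrow> y \<in> V \<Longrightarrow> x + y \<in> V" by (simp add: fsub_def cv.subspace_add)
lemma fsub_diff: "fsub V \<Longrightarrow> x \<in> V \<Longrightarrow> y \<in> V \<Longrightarrow> x - y \<in> V" by (simp add: fsub_def cv.subspace_diff)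
lemma fsub_scale: "fsub V \<Longrightarrow> x \<in> V \<Longrightarrow> c *c x \<in> V" by (simp add: fsub_def cv.subspace_scale)

lemma independent_in_fsub:
  assumes "fsub V" "cv.independent B" "B \<subseteq> V"
  shows "finite B"
  using assms cv.independent_span_bound unfolding fsub_def by (meson order_trans)

lemma fsub_basis_extend:
  assumes "fsub V" "cv.independent B0" "B0 \<subseteq> V"
  obtains B where "B0 \<subseteq> B" "B \<subseteq> V" "cv.independent B" "finite B" "cv.span B = V" "card B = cv.dim V"
proof -
  obtain B where B: "B0 \<subseteq> B" "B \<subseteq> V" "cv.independent B" "V \<subseteq> cv.span B"
    using cv.maximal_independent_subset_extend[OF assms(3,2)] by blast
  have "cv.span B = V"
    using B assms(1) cv.span_minimal[of B V] by (auto simp: fsub_def)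
  moreover have "finite B" using independent_in_fsub assms(1) B by blast
  moreover have "card B = cv.dim V" using cv.basis_card_eq_dim B by blast
  ultimately show ?thesis using that B by blast
qed

lemma fsub_basis:
  assumes "fsub V"
  obtains B where "B \<subseteq> V" "cv.independent B" "finite B" "cv.span B = V" "card B = cv.dim V"
  using fsub_basis_extend[OF assms cv.independent_empty] by auto

lemma fsub_ex_span: "fsub V \<Longrightarrow> \<exists>B. finite B \<and> cv.span B = V"
  by (erule fsub_basis) auto

lemma fsub_subset: "fsub V \<Longrightarrow> cv.subspace S \<Longrightarrow> S \<subseteq> V \<Longrightarrow> fsub S"
  unfolding fsub_def by (meson order_trans)

lemma fsub_span: "finite B \<Longrightarrow> fsub (cv.span B)"
  unfolding fsub_def by auto

lemma fsub_image:
  assumes "clin f" "fsub V" shows "fsub (f ` V)"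
proof -
  obtain B where B: "finite B" "cv.span B = V" using fsub_ex_span[OF assms(2)] by auto
  have "f ` V = cv.span (f ` B)"
    using assms(1) B cvp.linear_span_image[of f B] unfolding clin_iff by auto
  then show ?thesis using B fsub_span by (metis finite_imageI)
qed

lemma fsub_dim_subset:
  assumes "fsub V" "fsub S" "S \<subseteq> V" shows "cv.dim S \<le> cv.dim V"
proof -
  obtain B where B: "B \<subseteq> S" "cv.independent B" "card B = cv.dim S" using fsub_basis[OF assms(2)] by blast
  obtain B' where B': "B \<subseteq> B'" "finite B'" "card B' = cv.dim V"
    using fsub_basis_extend[OF assms(1) B(2) subset_trans[OF B(1) assms(3)]] by blast
  show ?thesis using B B' card_mono by metis
qed

lemma fsub_dim_eq:
  assumes "fsub V" "cv.subspace S" "S \<subseteq> V" "cv.dim S \<ge> cv.dim V" shows "S = V"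
proof -
  obtain B where B: "B \<subseteq> S" "cv.independent B" "cv.span B = S" "card B = cv.dim S"
    using fsub_basis[OF fsub_subset[OF assms(1,2,3)]] by blast
  obtain B' where B': "B \<subseteq> B'" "finite B'" "card B' = cv.dim V" "cv.span B' = V"
    using fsub_basis_extend[OF assms(1) B(2) subset_trans[OF B(1) assms(3)]] by blast
  have "B = B'" using B B' assms(4) card_seteq by metis
  then show ?thesis using B B' by simp
qed

lemma dim_zero_space: "cv.dim {0::'a::cvec} = 0"
  using cv.dim_le_card[of "{0::'a}" "{}"] by simp

lemma fsub_zero: "fsub {0::'a::cvec}"
  unfolding fsub_def by (auto intro!: exI[of _ "{}"] simp: cv.subspace_single_0)

lemma fsub_dim_0: "fsub V \<Longrightarrow> cv.dim V = 0 \<longleftrightarrow> V = {0}"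
  using fsub_dim_eq[of V "{0}"] fsub_zero_mem[of V] dim_zero_space by (auto simp: cv.subspace_single_0)

text \<open>A linear map that is the identity on \<open>B1\<close> and zero on the rest of
  \<open>B\<close> must both fix and kill a common vector.\<close>

lemma span_Int_trivial:
  fixes B :: "'a::cvec set"
  assumes "cv.independent B" "B1 \<subseteq> B" "B2 \<subseteq> B" "B1 \<inter> B2 = {}"
  shows "cv.span B1 \<inter> cv.span B2 = {0}"
proof -
  obtain f :: "'a \<Rightarrow> 'a" where f: "Vector_Spaces.linear cscale cscale f" "\<And>x. x \<in> B \<Longrightarrow> f x = (if x \<in> B1 then x else 0)"
    using cvp.linear_independent_extend[OF assms(1), of "\<lambda>x. if x \<in> B1 then x else 0"] by blast
  have "f x = x" if "x \<in> cv.span B1" for x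
    using cvp.linear_eq_on[OF f(1) clin_id[unfolded clin_iff] that] f(2) assms(2) by (simp add: subset_iff)
  moreover have "f x = 0" if "x \<in> cv.span B2" for x
    using cvp.linear_eq_on[OF f(1) clin_zero[unfolded clin_iff] that] f(2) assms(3,4)
    by (simp add: subset_iff) (metis IntI empty_iff)
  ultimately show ?thesis using cv.span_zero by fastforce
qed

lemma independent_Un:
  assumes B: "cv.independent B" and D: "cv.independent D" and 0: "cv.span B \<inter> cv.span D = {0}"
  shows "cv.independent (B \<union> D)"
  unfolding cv.dependent_def
proof (clarify)
  have key: False if a: "a \<in> X" "a \<in> cv.span (X \<union> Y - {a})" and X: "cv.independent X" and
      XY: "cv.span X \<inter> cv.span Y = {0}" for a and X Y :: "'a set"
  proof -
    have "a \<in> cv.span ((X - {a}) \<union> Y)" using a(2) cv.span_mono[of "X \<union> Y - {a}" "(X - {a}) \<union> Y"] by blast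
    then obtain x y where xy: "x \<in> cv.span (X - {a})" "y \<in> cv.span Y" "a = x + y" unfolding cv.span_Un by blast
    have "a - x \<in> cv.span X"
      using a(1) xy(1) cv.span_mono[of "X - {a}" X] cv.span_diff cv.span_base by blast
    then have "y = 0" using xy XY by auto
    then show False using xy X a(1) unfolding cv.dependent_def by auto
  qed
  fix a assume "a \<in> B \<union> D" "a \<in> cv.span (B \<union> D - {a})"
  then show False using key[of a B D] key[of a D B] B D 0 by (auto simp: Un_commute Int_commute)
qed

text \<open>A basis \<open>B0\<close> of the kernel is extended to a basis of \<open>V\<close>. On
  the span of the added vectors \<open>f\<close> is injective, so their images form a basis of the
  image.\<close>

lemma rank_nullity:
  assumes f: "clin f" and V: "fsub V"
  shows "cv.dim V = cv.dim (f ` V) + cv.dim {x \<in> V. f x = 0}"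
proof -
  let ?K = "{x \<in> V. f x = 0}"
  have K: "fsub ?K" using subspace_ker[OF f fsubD[OF V]] fsub_subset[OF V] by auto
  obtain B0 where B0: "B0 \<subseteq> ?K" "cv.independent B0" "finite B0" "cv.span B0 = ?K" "card B0 = cv.dim ?K"
    using fsub_basis[OF K] by blast
  obtain B where B: "B0 \<subseteq> B" "B \<subseteq> V" "cv.independent B" "finite B" "cv.span B = V" "card B = cv.dim V"
    using fsub_basis_extend[OF V B0(2)] B0(1) by blast
  let ?C = "B - B0"
  have lf: "Vector_Spaces.linear cscale cscale f" using f clin_iff by blast
  have C: "cv.independent ?C" using B(3) cv.independent_mono by blast
  have zero: "x = 0" if "x \<in> cv.span ?C" "f x = 0" for x
  proof -
    have "x \<in> cv.span B0" using that B B0 cv.span_mono[of ?C B] by auto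
    moreover have "cv.span ?C \<inter> cv.span B0 = {0}"
      using B by (intro span_Int_trivial[of B]) auto
    ultimately show "x = 0" using that(1) by blast
  qed
  have inj: "inj_on f (cv.span ?C)"
    using cvp.linear_inj_on_iff_eq_0[OF lf cv.subspace_span] zero by metis
  have "cv.independent (f ` ?C)" using cvp.linear_independent_injective_image[OF lf C inj] .
  moreover have "f ` V = cv.span (f ` ?C)"
  proof -
    have "f ` V = cv.span (f ` B)" using B cvp.linear_span_image[OF lf, of B] by simp
    also have "\<dots> = cv.span (f ` ?C)"
    proof (rule antisym)
      have "f ` B \<subseteq> insert 0 (f ` ?C)" using B0(1) by auto
      then show "cv.span (f ` B) \<subseteq> cv.span (f ` ?C)" by (metis cv.span_insert_0 cv.span_mono)
      show "cv.span (f ` ?C) \<subseteq> cv.span (f ` B)" by (intro cv.span_mono) auto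
    qed
    finally show ?thesis .
  qed
  moreover have "card (f ` ?C) = card ?C"
    using inj card_image inj_on_subset cv.span_superset by metis
  ultimately have "cv.dim (f ` V) = card ?C"
    using cv.dim_span_eq_card_independent by metis
  moreover have "card ?C = card B - card B0" "card B0 \<le> card B"
    using card_Diff_subset[OF B0(3) B(1)] card_mono[OF B(4) B(1)] by auto
  ultimately show ?thesis using B B0 by linarith
qed

lemma dim_image_inj:
  assumes "clin f" "fsub V" "\<And>x. x \<in> V \<Longrightarrow> f x = 0 \<Longrightarrow> x = 0"
  shows "cv.dim (f ` V) = cv.dim V"
proof -
  have "{x \<in> V. f x = 0} = {0}" using assms fsub_zero_mem clin_0 by blast
  then show ?thesis using rank_nullity[OF assms(1,2)] dim_zero_space by simp
qed

lemma inj_image_eq: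
  assumes "clin f" "fsub V" "fsub W" "\<And>x. x \<in> V \<Longrightarrow> f x = 0 \<Longrightarrow> x = 0" "f ` V \<subseteq> W" "cv.dim W \<le> cv.dim V"
  shows "f ` V = W"
proof (rule fsub_dim_eq[OF assms(3) _ assms(5)])
  show "cv.subspace (f ` V)" using subspace_image[OF assms(1)] fsubD[OF assms(2)] .
  show "cv.dim W \<le> cv.dim (f ` V)" using dim_image_inj[OF assms(1,2,4)] assms(6) by simp
qed

lemma surj_imp_inj:
  assumes "clin f" "fsub V" "cv.dim V \<le> cv.dim (f ` V)" "x \<in> V" "f x = 0"
  shows "x = 0"
proof -
  have K: "fsub {x \<in> V. f x = 0}" using subspace_ker[OF assms(1) fsubD[OF assms(2)]] fsub_subset[OF assms(2)] by auto
  have "cv.dim {x \<in> V. f x = 0} = 0" using rank_nullity[OF assms(1,2)] assms(3) by linarith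
  then show ?thesis using fsub_dim_0[OF K] assms by blast
qed

lemma complement_exists:
  assumes "cv.subspace S" "cv.subspace V" "S \<subseteq> V"
  obtains C where "cv.subspace C" "C \<subseteq> V" "S \<inter> C = {0}" "\<And>x. x \<in> V \<Longrightarrow> \<exists>s\<in>S. \<exists>c\<in>C. x = s + c"
proof -
  obtain B0 where B0: "B0 \<subseteq> S" "cv.independent B0" "S \<subseteq> cv.span B0"
    using cv.maximal_independent_subset by blast
  obtain B where B: "B0 \<subseteq> B" "B \<subseteq> V" "cv.independent B" "V \<subseteq> cv.span B"
    using cv.maximal_independent_subset_extend[OF subset_trans[OF B0(1) assms(3)] B0(2)] by blast
  let ?C = "cv.span (B - B0)"
  have S: "S = cv.span B0" using B0 cv.span_minimal assms by blast
  have V: "V = cv.span B" using B cv.span_minimal assms by blast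
  have "cv.span B0 \<inter> cv.span (B - B0) = {0}"
    using B by (intro span_Int_trivial[of B]) auto
  then have "S \<inter> ?C = {0}" using S by simp
  moreover have "\<exists>s\<in>S. \<exists>c\<in>?C. x = s + c" if "x \<in> V" for x
  proof -
    have "B = B0 \<union> (B - B0)" using B by auto
    then have "x \<in> cv.span (B0 \<union> (B - B0))" using that V by simp
    then show ?thesis unfolding cv.span_Un S by blast
  qed
  moreover have "?C \<subseteq> V" using V cv.span_mono by blast
  ultimately show ?thesis using that[of ?C] by auto
qed

lemma glue_maps:
  assumes "cv.subspace S" "cv.subspace C" "S \<inter> C = {0}" "clin f" "clin g"
  obtains h where "clin h" "\<And>x. x \<in> S \<Longrightarrow> h x = f x" "\<And>x. x \<in> C \<Longrightarrow> h x = g x"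
proof -
  obtain B where B: "B \<subseteq> S" "cv.independent B" "S \<subseteq> cv.span B"
    using cv.maximal_independent_subset by blast
  obtain D where D: "D \<subseteq> C" "cv.independent D" "C \<subseteq> cv.span D"
    using cv.maximal_independent_subset by blast
  have sB: "cv.span B = S" using B cv.span_minimal assms by blast
  have sD: "cv.span D = C" using D cv.span_minimal assms by blast
  have ind: "cv.independent (B \<union> D)" using independent_Un[of B D] B D sB sD assms by simp
  have "x \<noteq> 0" if "x \<in> B" for x using B(2) that cv.dependent_zero by blast
  then have disj: "B \<inter> D = {}" using B(1) D(1) assms(3) by auto
  obtain h where h: "Vector_Spaces.linear cscale cscale h" "\<And>x. x \<in> B \<union> D \<Longrightarrow> h x = (if x \<in> B then f x else g x)"
    using cvp.linear_independent_extend[OF ind, of "\<lambda>x. if x \<in> B then f x else g x"] by blast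
  show ?thesis
  proof
    show "clin h" using h clin_iff by blast
    show "h x = f x" if "x \<in> S" for x
      by (rule cvp.linear_eq_on[OF h(1) assms(4)[unfolded clin_iff], of x B]) (use that h(2) sB in auto)
    show "h x = g x" if "x \<in> C" for x
      by (rule cvp.linear_eq_on[OF h(1) assms(5)[unfolded clin_iff], of x D]) (use that h(2) sD disj in auto)
  qed
qed

lemma linear_section:
  assumes "clin f" "cv.subspace V"
  obtains s where "clin s" "\<And>y. s y \<in> V" "\<And>y. y \<in> f ` V \<Longrightarrow> f (s y) = y"
proof -
  obtain s where "range s \<subseteq> V" "Vector_Spaces.linear cscale cscale s" "\<forall>v\<in>f ` V. f (s v) = v"
    using cvp.linear_exists_right_inverse_on[OF assms(1)[unfolded clin_iff] assms(2)] by auto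
  then show ?thesis by (intro that[of s]) (auto simp: clin_iff)
qed

lemma linear_retraction:
  assumes "clin f" "cv.subspace V" "\<And>x. x \<in> V \<Longrightarrow> f x = 0 \<Longrightarrow> x = 0"
  obtains r where "clin r" "\<And>y. r y \<in> V" "\<And>x. x \<in> V \<Longrightarrow> r (f x) = x"
proof -
  have "inj_on f V"
    using cvp.linear_inj_on_iff_eq_0[OF assms(1)[unfolded clin_iff] assms(2)] assms(3) by blast
  then obtain r where "range r \<subseteq> V" "Vector_Spaces.linear cscale cscale r" "\<forall>v\<in>V. r (f v) = v"
    using cvp.linear_exists_left_inverse_on[OF assms(1)[unfolded clin_iff] assms(2)] by auto
  then show ?thesis by (intro that[of r]) (auto simp: clin_iff)
qed

lemma projection_exists:
  assumes "cv.subspace V"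
  obtains p where "clin p" "\<And>x. p x \<in> V" "\<And>x. x \<in> V \<Longrightarrow> p x = x"
  by (rule linear_retraction[OF clin_id assms]) (use that in auto)

lemma iso_exists:
  assumes "fsub V" "fsub W" "cv.dim V = cv.dim W"
  obtains f g where "clin f" "clin g" "\<And>x. x \<in> V \<Longrightarrow> f x \<in> W \<and> g (f x) = x" "\<And>y. y \<in> W \<Longrightarrow> g y \<in> V \<and> f (g y) = y"
proof -
  obtain B where B: "B \<subseteq> V" "cv.independent B" "finite B" "cv.span B = V" "card B = cv.dim V"
    using fsub_basis[OF assms(1)] by blast
  obtain D where D: "D \<subseteq> W" "cv.independent D" "finite D" "cv.span D = W" "card D = cv.dim W"
    using fsub_basis[OF assms(2)] by blast
  obtain f0 where "Vector_Spaces.linear cscale cscale f0" "f0 ` B = D" "f0 ` V = W" "inj_on f0 V"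
    using cvp.finite_basis_to_basis_subspace_isomorphism[OF fsubD[OF assms(1)] fsubD[OF assms(2)] assms(3)
      B(3,1,2) equalityD2[OF B(4)] B(5) D(3,1,2) equalityD2[OF D(4)] D(5)] by blast
  note f = this
  have cf: "clin f0" using f clin_iff by blast
  have "x = 0" if "x \<in> V" "f0 x = 0" for x
    using inj_onD[OF f(4), of x 0] that clin_0[OF cf] fsub_zero_mem[OF assms(1)] by simp
  then obtain g where g: "clin g" "\<And>x. g x \<in> V" "\<And>x. x \<in> V \<Longrightarrow> g (f0 x) = x"
    using linear_retraction[OF cf fsubD[OF assms(1)]] by blast
  show ?thesis
  proof (rule that[OF cf g(1)])
    show "f0 x \<in> W \<and> g (f0 x) = x" if "x \<in> V" for x using f g that by auto
    show "g y \<in> V \<and> f0 (g y) = y" if y: "y \<in> W" for y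
    proof -
      obtain x where "x \<in> V" "y = f0 x" using f(3) y by blast
      then show ?thesis using g by simp
    qed
  qed
qed

lemma separating_functional:
  fixes x :: "'a::cvec"
  assumes "cv.subspace S" "x \<notin> S"
  obtains l :: "'a \<Rightarrow> complex" where "clin l" "\<And>y. y \<in> S \<Longrightarrow> l y = 0" "l x = 1"
proof -
  obtain B where B: "B \<subseteq> S" "cv.independent B" "S \<subseteq> cv.span B"
    using cv.maximal_independent_subset by blast
  have sB: "cv.span B = S" using B cv.span_minimal assms by blast
  have ind: "cv.independent (insert x B)" using B sB assms by (simp add: cv.independent_insert)
  obtain h :: "'a \<Rightarrow> complex" where h: "Vector_Spaces.linear cscale cscale h"
      "\<And>y. y \<in> insert x B \<Longrightarrow> h y = (if y = x then 1 else 0)"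
    using cvp.linear_independent_extend[OF ind, of "\<lambda>y. if y = x then 1 else 0"] by blast
  show ?thesis
  proof
    show "clin h" using h clin_iff by blast
    show "h y = 0" if "y \<in> S" for y
    proof (rule cvp.linear_eq_on[OF h(1) clin_zero[unfolded clin_iff]])
      show "y \<in> cv.span B" using that sB by simp
      show "h b = 0" if "b \<in> B" for b using that h(2)[of b] B(1) assms(2) by auto
    qed
    show "h x = 1" using h by simp
  qed
qed

text \<open>Any linear section \<open>r\<close> of \<open>f\<close> works:
  \<open>r (f x) - x\<close> lies in the kernel of \<open>f\<close> on \<open>V\<close>, where
  \<open>g\<close> vanishes. Combined with boundedness of linear maps, this later estimates
  \<open>g x\<close> by the size of \<open>f x\<close>.\<close>

lemma linear_factor:
  assumes f: "clin f" and g: "clin g" and V: "cv.subspace V" and k: "\<And>x. x \<in> V \<Longrightarrow> f x = 0 \<Longrightarrow> g x = 0"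
  obtains s where "clin s" "\<And>x. x \<in> V \<Longrightarrow> s (f x) = g x"
proof -
  obtain r where r: "clin r" "\<And>y. r y \<in> V" "\<And>y. y \<in> f ` V \<Longrightarrow> f (r y) = y"
    using linear_section[OF f V] by blast
  show ?thesis
  proof (rule that[of "\<lambda>y. g (r y)"])
    show "clin (\<lambda>y. g (r y))" using clin_comp[OF g r(1)] .
    fix x assume x: "x \<in> V"
    have "f (r (f x) - x) = 0" using r x f by (simp add: clin_diff)
    then have "g (r (f x) - x) = 0" using k r x V cv.subspace_diff by blast
    then show "g (r (f x)) = g x" using g by (simp add: clin_diff)
  qed
qed

section \<open>Direct sums and spaces of linear maps\<close>

definition dsum :: "'i set \<Rightarrow> ('i \<Rightarrow> 'a::cvec set) \<Rightarrow> ('i \<Rightarrow> 'a) set" where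
  "dsum I W = {f. \<forall>i. if i \<in> I then f i \<in> W i else f i = 0}"

lemma dsumD: "f \<in> dsum I W \<Longrightarrow> i \<in> I \<Longrightarrow> f i \<in> W i" "f \<in> dsum I W \<Longrightarrow> i \<notin> I \<Longrightarrow> f i = 0"
  unfolding dsum_def by (auto split: if_splits)

lemma dsumI: "(\<And>i. i \<in> I \<Longrightarrow> f i \<in> W i) \<Longrightarrow> (\<And>i. i \<notin> I \<Longrightarrow> f i = 0) \<Longrightarrow> f \<in> dsum I W"
  unfolding dsum_def by auto

lemma subspace_dsum: "(\<And>i. i \<in> I \<Longrightarrow> cv.subspace (W i)) \<Longrightarrow> cv.subspace (dsum I W)"
  unfolding dsum_def by (rule subspaceI) (auto simp: cv.subspace_def cscale_fun_apply split: if_splits)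

lemma fsub_dsum_dim:
  assumes "finite I" "\<And>i. i \<in> I \<Longrightarrow> fsub (W i)"
  shows "fsub (dsum I W) \<and> cv.dim (dsum I W) = (\<Sum>i\<in>I. cv.dim (W i))"
  using assms
proof (induction I rule: finite_induct)
  case empty
  have "dsum {} W = {0}" by (auto simp: dsum_def fun_eq_iff)
  then show ?case by (simp add: fsub_zero dim_zero_space)
next
  case (insert j I)
  let ?D = "dsum (insert j I) W"
  have IH: "fsub (dsum I W)" "cv.dim (dsum I W) = (\<Sum>i\<in>I. cv.dim (W i))" using insert by auto
  have Wj: "fsub (W j)" using insert by auto
  define e :: "'b \<Rightarrow> 'a \<Rightarrow> 'b" where "e = (\<lambda>x i. if i = j then x else 0)"
  have ce: "clin e" unfolding e_def by (rule clin_fun) (intro clin_if clin_id clin_zero)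
  obtain B where B: "finite B" "cv.span B = dsum I W" using fsub_ex_span[OF IH(1)] by auto
  obtain B' where B': "finite B'" "cv.span B' = e ` W j" using fsub_ex_span[OF fsub_image[OF ce Wj]] by auto
  have sub: "cv.subspace ?D" using insert by (intro subspace_dsum) (auto simp: fsub_def)
  have dec: "x - e (x j) \<in> dsum I W" if "x \<in> ?D" for x
    using that insert(2) unfolding dsum_def e_def by auto
  have "?D \<subseteq> cv.span (B \<union> B')"
  proof
    fix x assume x: "x \<in> ?D"
    have "x - e (x j) \<in> cv.span B" "e (x j) \<in> cv.span B'" using dec[OF x] B(2) B'(2) dsumD(1)[OF x, of j] by auto
    then have "x - e (x j) \<in> cv.span (B \<union> B')" "e (x j) \<in> cv.span (B \<union> B')"
      using cv.span_mono[of B "B \<union> B'"] cv.span_mono[of B' "B \<union> B'"] by auto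
    then show "x \<in> cv.span (B \<union> B')" using cv.span_add by fastforce
  qed
  then have fin: "fsub ?D" using sub B(1) B'(1) unfolding fsub_def by blast
  have "(\<lambda>f. f j) ` ?D = W j"
  proof (intro antisym subsetI)
    fix y assume "y \<in> W j"
    then have "e y \<in> ?D" using insert fsub_zero_mem unfolding dsum_def e_def by auto
    then show "y \<in> (\<lambda>f. f j) ` ?D" by (intro image_eqI[of _ _ "e y"]) (auto simp: e_def)
  qed (auto simp: dsum_def)
  moreover have "{f \<in> ?D. f j = 0} = dsum I W"
    using insert(2) fsub_zero_mem[OF Wj] unfolding dsum_def by (auto split: if_splits)
  ultimately have "cv.dim ?D = cv.dim (W j) + cv.dim (dsum I W)"
    using rank_nullity[OF clin_apply fin, of j] by simp
  then show ?case using fin IH insert by simp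
qed

lemmas fsub_dsum = fsub_dsum_dim[THEN conjunct1]
lemmas dim_dsum = fsub_dsum_dim[THEN conjunct2]

lemma dim_direct_sum:
  assumes "fsub V" "cv.subspace S" "cv.subspace C" "S \<subseteq> V" "C \<subseteq> V" "S \<inter> C = {0}"
    "\<And>x. x \<in> V \<Longrightarrow> \<exists>s\<in>S. \<exists>c\<in>C. x = s + c"
  shows "cv.dim V = cv.dim S + cv.dim C"
proof -
  obtain p where p: "clin p" "\<And>x. x \<in> S \<Longrightarrow> p x = x" "\<And>x. x \<in> C \<Longrightarrow> p x = 0"
    using glue_maps[OF assms(2,3,6) clin_id clin_zero] by blast
  have "p ` V = S"
  proof (intro antisym subsetI)
    fix y assume "y \<in> p ` V"
    then show "y \<in> S" using assms(7) p clin_add[OF p(1)] by fastforce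
  next
    fix y assume "y \<in> S" then show "y \<in> p ` V" using p assms by (intro image_eqI[of _ _ y]) auto
  qed
  moreover have "{x \<in> V. p x = 0} = C"
  proof (intro antisym subsetI)
    fix x assume x: "x \<in> {x \<in> V. p x = 0}"
    then obtain s c where "s \<in> S" "c \<in> C" "x = s + c" using assms(7) by blast
    moreover then have "s = 0" using x p clin_add[OF p(1), of s c] by auto
    ultimately show "x \<in> C" by simp
  qed (use p assms in auto)
  ultimately show ?thesis using rank_nullity[OF p(1) assms(1)] by simp
qed

text \<open>Linear maps on \<open>V\<close> are represented by their composites with a fixed projection \<open>\<pi>\<close> onto \<open>V\<close>.\<close>

definition homs :: "('a::cvec \<Rightarrow> 'a) \<Rightarrow> 'a set \<Rightarrow> 'b::cvec set \<Rightarrow> ('a \<Rightarrow> 'b) set" where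
  "homs \<pi> V K = {h. clin h \<and> (\<forall>x. h (\<pi> x) = h x) \<and> (\<forall>x\<in>V. h x \<in> K)}"

text \<open>Evaluation at the basis vectors of \<open>V\<close> that were added to a basis of
  \<open>V1\<close> identifies these maps with families in \<open>K\<close>. The retraction
  \<open>s\<close> of this evaluation exhibits the space as an image of the family space;
  finite-dimensionality has to be known before dimensions can be compared.\<close>

lemma dim_homs_vanishing:
  assumes V: "fsub V" and V1: "cv.subspace V1" "V1 \<subseteq> V" and K: "fsub K"
    and p: "clin \<pi>" "\<And>x. \<pi> x \<in> V" "\<And>x. x \<in> V \<Longrightarrow> \<pi> x = x"
  shows "fsub {h \<in> homs \<pi> V K. \<forall>x\<in>V1. h x = 0} \<and>
    cv.dim {h \<in> homs \<pi> V K. \<forall>x\<in>V1. h x = 0} = (cv.dim V - cv.dim V1) * cv.dim K"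
proof -
  let ?H = "{h \<in> homs \<pi> V K. \<forall>x\<in>V1. h x = 0}"
  have fV1: "fsub V1" using fsub_subset V V1 by blast
  obtain B1 where B1: "B1 \<subseteq> V1" "cv.independent B1" "finite B1" "cv.span B1 = V1" "card B1 = cv.dim V1"
    using fsub_basis[OF fV1] by blast
  obtain B where B: "B1 \<subseteq> B" "B \<subseteq> V" "cv.independent B" "finite B" "cv.span B = V" "card B = cv.dim V"
    using fsub_basis_extend[OF V B1(2) subset_trans[OF B1(1) V1(2)]] by blast
  let ?I = "B - B1"
  define r :: "('a \<Rightarrow> 'b) \<Rightarrow> 'a \<Rightarrow> 'b" where "r = (\<lambda>h b. if b \<in> ?I then h b else 0)"
  have cr: "clin r" unfolding r_def by (rule clin_fun) (intro clin_if clin_apply clin_zero)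
  have subK: "cv.subspace K" using K fsubD by blast
  have sH: "cv.subspace ?H"
    unfolding homs_def using subK
    by (intro subspaceI) (auto simp: cv.subspace_def clin_def algebra_simps cscale_right_distrib cscale_cscale cscale_fun_apply)
  have inj: "h = 0" if h: "h \<in> ?H" "r h = 0" for h
  proof
    fix x
    have ch: "Vector_Spaces.linear cscale cscale h" using h by (simp add: homs_def clin_iff)
    have hb: "h b = 0" if "b \<in> B" for b
    proof (cases "b \<in> B1")
      case True then show ?thesis using h B1 by auto
    next
      case False then show ?thesis using fun_cong[OF h(2), of b] that by (simp add: r_def)
    qed
    have "h (\<pi> x) = 0"
      by (rule cvp.linear_eq_on[OF ch clin_zero[unfolded clin_iff], of "\<pi> x" B]) (use p B(5) hb in auto)
    then show "h x = 0 x" using h by (simp add: homs_def)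
  qed
  have img: "r ` ?H = dsum ?I (\<lambda>_. K)"
  proof (intro antisym subsetI)
    fix f assume "f \<in> r ` ?H"
    then show "f \<in> dsum ?I (\<lambda>_. K)" using B(2) by (auto simp: r_def dsum_def homs_def)
  next
    fix f assume f: "f \<in> dsum ?I (\<lambda>_. K)"
    obtain h0 where h0: "Vector_Spaces.linear cscale cscale h0" "\<And>b. b \<in> B \<Longrightarrow> h0 b = f b"
      using cvp.linear_independent_extend[OF B(3), of f] by blast
    have c0: "clin h0" using h0 clin_iff by blast
    let ?h = "\<lambda>x. h0 (\<pi> x)"
    have 1: "h0 x \<in> K" if "x \<in> V" for x
    proof -
      have "h0 x \<in> cv.span (h0 ` B)" using cvp.linear_span_image[OF h0(1), of B] B that by auto
      moreover have "h0 ` B \<subseteq> K"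
        using h0(2) dsumD[OF f] fsub_zero_mem[OF K] by force
      ultimately show ?thesis using cv.span_minimal[OF _ subK] by blast
    qed
    have 2: "h0 x = 0" if "x \<in> V1" for x
      by (rule cvp.linear_eq_on[OF h0(1) clin_zero[unfolded clin_iff], of x B1]) (use that B1(4) h0(2) B(1) dsumD(2)[OF f] in auto)
    have "?h \<in> ?H"
      using c0 p 1 2 V1 unfolding homs_def by (auto intro: clin_comp)
    moreover have "r ?h = f"
    proof
      fix b show "r ?h b = f b"
        using B(2) p h0(2)[of b] dsumD(2)[OF f, of b] by (auto simp: r_def subset_iff)
    qed
    ultimately show "f \<in> r ` ?H" by blast
  qed
  have fD: "fsub (dsum ?I (\<lambda>_. K))" using fsub_dsum[of ?I "\<lambda>_. K"] B K by auto
  obtain s where s: "clin s" "\<And>y. s y \<in> ?H" "\<And>h. h \<in> ?H \<Longrightarrow> s (r h) = h"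
    using linear_retraction[OF cr sH] inj by blast
  have "?H = s ` dsum ?I (\<lambda>_. K)" unfolding img[symmetric] using s by (auto simp: image_iff) 
  then have fH: "fsub ?H" using fsub_image[OF s(1) fD] by simp
  have "cv.dim ?H = cv.dim (dsum ?I (\<lambda>_. K))" using dim_image_inj[OF cr fH inj] img by simp
  also have "\<dots> = card ?I * cv.dim K" using dim_dsum[of ?I "\<lambda>_. K"] B K by simp
  also have "card ?I = cv.dim V - cv.dim V1" using B B1 by (simp add: card_Diff_subset)
  finally show ?thesis using fH by blast
qed


section \<open>Iterated images and centralisers\<close>

text \<open>The dimensions of these images are the coordinates of \<open>\<alpha>\<close> along an
  arm. Parameters are counted from 1, so index 0 is the whole space and corresponds to the
  centre.\<close>

primrec img :: "('a::cvec \<Rightarrow> 'a) \<Rightarrow> (nat \<Rightarrow> complex) \<Rightarrow> 'a set \<Rightarrow> nat \<Rightarrow> 'a set" where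
  "img A x V 0 = V"
| "img A x V (Suc j) = (\<lambda>v. A v - x (Suc j) *c v) ` img A x V j"

lemma clin_shift: "clin A \<Longrightarrow> clin (\<lambda>v. A v - c *c v)"
  by (intro clin_sub clin_cscale clin_id)

lemma img_shift: "img A x V (Suc j) = img A (\<lambda>l. x (Suc l)) ((\<lambda>v. A v - x 1 *c v) ` V) j"
  by (induction j) simp_all

lemma img_cong: "(\<And>l. l \<in> {1..j} \<Longrightarrow> x l = y l) \<Longrightarrow> img A x V j = img A y V j"
  by (induction j) auto

lemma img_fsub:
  assumes "clin A" "fsub V" shows "fsub (img A x V j)"
  using assms by (induction j) (auto intro: fsub_image clin_shift)

lemma img_invariant:
  assumes A: "clin A" and "\<And>v. v \<in> V \<Longrightarrow> A v \<in> V"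
  shows "v \<in> img A x V j \<Longrightarrow> A v \<in> img A x V j"
proof (induction j arbitrary: v)
  case (Suc j)
  then obtain u where u: "u \<in> img A x V j" "v = A u - x (Suc j) *c u" by auto
  have "A v = A (A u) - x (Suc j) *c A u" using u A by (simp add: clin_simps)
  then show ?case using Suc.IH[OF u(1)] by auto
qed (use assms in auto)

lemma img_Suc_subset:
  assumes "clin A" "fsub V" "\<And>v. v \<in> V \<Longrightarrow> A v \<in> V"
  shows "img A x V (Suc j) \<subseteq> img A x V j"
  using img_invariant[OF assms(1,3)] img_fsub[OF assms(1,2), of x j] fsub_diff fsub_scale by fastforce

lemma img_subset:
  assumes "clin A" "fsub V" "\<And>v. v \<in> V \<Longrightarrow> A v \<in> V"
  shows "img A x V j \<subseteq> V"
proof (induction j)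
  case (Suc j) then show ?case using img_Suc_subset[OF assms, of x j] by (rule subset_trans[rotated])
qed simp

lemma dim_img_antimono:
  assumes "clin A" "fsub V" "\<And>v. v \<in> V \<Longrightarrow> A v \<in> V"
  shows "cv.dim (img A x V (Suc j)) \<le> cv.dim (img A x V j)"
  using img_Suc_subset[OF assms] img_fsub[OF assms(1,2)] fsub_dim_subset by blast

section \<open>Commuting shifts and the exchange of two parameters\<close>

lemma shift_commute:
  assumes "clin A" shows "A (A v - a *c v) - b *c (A v - a *c v) = A (A v - b *c v) - a *c (A v - b *c v)"
  using assms by (simp add: clin_simps cv.scale_right_diff_distrib cscale_cscale mult.commute algebra_simps)

text \<open>For \<open>a \<noteq> b\<close> the kernel of \<open>(A - b)(A - a)\<close> is the
  direct sum of the two eigenspaces, and rank-nullity converts this into ranks. It is the source of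
  the reflection at an arm vertex: the new coordinate is the sum of the two neighbours minus the old
  coordinate.\<close>

lemma dim_shift_swap:
  assumes A: "clin A" and Q: "fsub Q" and inv: "\<And>v. v \<in> Q \<Longrightarrow> A v \<in> Q" and "a \<noteq> b"
  shows "cv.dim ((\<lambda>v. A v - a *c v) ` Q) + cv.dim ((\<lambda>v. A v - b *c v) ` Q)
    = cv.dim Q + cv.dim ((\<lambda>v. A v - b *c v) ` (\<lambda>v. A v - a *c v) ` Q)"
proof -
  let ?a = "\<lambda>v. A v - a *c v" and ?b = "\<lambda>v. A v - b *c v"
  note ca = clin_shift[OF A, of a] and cb = clin_shift[OF A, of b]
  let ?Ka = "{v \<in> Q. ?a v = 0}" and ?Kb = "{v \<in> Q. ?b v = 0}" and ?K = "{v \<in> Q. ?b (?a v) = 0}"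
  have cba: "clin (\<lambda>v. ?b (?a v))" using clin_comp[OF cb ca] .
  have "cv.dim ?K = cv.dim ?Ka + cv.dim ?Kb"
  proof (rule dim_direct_sum)
    show "fsub ?K" using fsub_subset[OF Q subspace_ker[OF cba fsubD[OF Q]]] by auto
    show "cv.subspace ?Ka" "cv.subspace ?Kb" using subspace_ker ca cb fsubD[OF Q] by blast+
    show "?Ka \<subseteq> ?K" using cb by (auto simp: clin_0[OF A])
    show "?Kb \<subseteq> ?K"
    proof clarify
      fix v assume "?b v = 0"
      then have "?a (?b v) = 0" by (simp only: clin_0[OF ca])
      then show "?b (?a v) = 0" using shift_commute[OF A, of v a b] by simp
    qed
    show "?Ka \<inter> ?Kb = {0}"
    proof -
      have "v = 0" if "A v = a *c v" "A v = b *c v" for v using that \<open>a \<noteq> b\<close> by simp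
      then show ?thesis using fsub_zero_mem[OF Q] clin_0[OF A] by auto
    qed
    fix v assume v: "v \<in> ?K"
    \<comment> \<open>Partial fractions: \<open>(A - b) v - (A - a) v = (a - b) v\<close>, so
      scaling by \<open>d\<close> splits \<open>v\<close> into an eigenvector for \<open>a\<close>
      and one for \<open>b\<close>.\<close>
    define d where "d = inverse (a - b)"
    have dab: "d * (a - b) = 1" using \<open>a \<noteq> b\<close> by (simp add: d_def)
    have 1: "d *c ?b v \<in> ?Ka"
    proof -
      have "?a (d *c ?b v) = d *c ?b (?a v)"
        using clin_scale[OF ca, of d "?b v"] shift_commute[OF A, of v b a] by simp
      then show ?thesis using v inv Q fsub_diff[OF Q] fsub_scale[OF Q] by auto
    qed
    have 2: "- (d *c ?a v) \<in> ?Kb"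
    proof -
      have "?b (- (d *c ?a v)) = - (d *c ?b (?a v))"
        using clin_scale[OF cb, of d "?a v"] clin_minus[OF cb, of "d *c ?a v"] by simp
      moreover have "- (d *c ?a v) \<in> Q" 
        using v inv fsub_diff[OF Q] fsub_scale[OF Q] fsubD[OF Q] cv.subspace_neg by blast
      moreover have "?b (?a v) = 0" using v by blast
      ultimately show ?thesis by (simp only: mem_Collect_eq cv.scale_zero_right neg_0_equal_iff_equal simp_thms minus_zero)
    qed
    have "d *c ?b v + - (d *c ?a v) = d *c (?b v - ?a v)" by (simp add: cv.scale_right_diff_distrib)
    also have "?b v - ?a v = (a - b) *c v" by (simp add: cv.scale_left_diff_distrib)
    also have "d *c ((a - b) *c v) = v" by (simp only: cscale_cscale dab cscale_one)
    finally have "v = d *c ?b v + - (d *c ?a v)" by (rule sym)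
    then show "\<exists>s\<in>?Ka. \<exists>c\<in>?Kb. v = s + c" by (rule bexI[OF bexI[OF _ 2] 1])
  qed
  moreover have "(\<lambda>v. ?b (?a v)) ` Q = ?b ` ?a ` Q" by (auto simp: image_image)
  ultimately show ?thesis
    using rank_nullity[OF ca Q] rank_nullity[OF cb Q] rank_nullity[OF cba Q] by simp
qed

text \<open>With equal parameters the ranks are convex, because the kernel of the second shift is
  contained in that of the first. This rules out a positive value of the form at such an arm
  vertex.\<close>

lemma dim_shift_repeat:
  assumes A: "clin A" and Q: "fsub Q" and inv: "\<And>v. v \<in> Q \<Longrightarrow> A v \<in> Q"
  shows "2 * cv.dim ((\<lambda>v. A v - a *c v) ` Q) \<le> cv.dim Q + cv.dim ((\<lambda>v. A v - a *c v) ` (\<lambda>v. A v - a *c v) ` Q)"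
proof -
  let ?a = "\<lambda>v. A v - a *c v"
  note ca = clin_shift[OF A, of a]
  have sub: "?a ` Q \<subseteq> Q" using inv fsub_diff[OF Q] fsub_scale[OF Q] by blast
  have f1: "fsub (?a ` Q)" using fsub_image[OF ca Q] .
  have "cv.dim {v \<in> ?a ` Q. ?a v = 0} \<le> cv.dim {v \<in> Q. ?a v = 0}"
  proof (rule fsub_dim_subset)
    show "fsub {v \<in> Q. ?a v = 0}" using fsub_subset[OF Q subspace_ker[OF ca fsubD[OF Q]]] by auto
    show "fsub {v \<in> ?a ` Q. ?a v = 0}" using fsub_subset[OF f1 subspace_ker[OF ca fsubD[OF f1]]] by auto
  qed (use sub in auto)
  then show ?thesis using rank_nullity[OF ca Q] rank_nullity[OF ca f1] by linarith
qed

definition swap_at :: "nat \<Rightarrow> (nat \<Rightarrow> 'b) \<Rightarrow> nat \<Rightarrow> 'b" where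
  "swap_at j x = (\<lambda>l. if l = j then x (Suc j) else if l = Suc j then x j else x l)"

text \<open>The two exchanged factors commute, so only the image taken between them can
  change.\<close>

lemma img_swap:
  assumes A: "clin A" and "j \<ge> 1" "l \<noteq> j"
  shows "img A (swap_at j x) V l = img A x V l"
proof (cases "l < j")
  case True then show ?thesis by (intro img_cong) (auto simp: swap_at_def)
next
  case False
  obtain i where i: "j = Suc i" using assms(2) by (cases j) auto
  have base: "img A (swap_at j x) V i = img A x V i" using i by (intro img_cong) (auto simp: swap_at_def)
  have "img A (swap_at j x) V (Suc j) = img A x V (Suc j)"
    using base i shift_commute[OF A] by (simp add: swap_at_def image_image)
  then have "img A (swap_at j x) V (Suc j + m) = img A x V (Suc j + m)" for m
    by (induction m) (auto simp: swap_at_def)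
  then show ?thesis using False assms(3) by (metis le_add_diff_inverse not_less_eq_eq linorder_not_less nat_neq_iff Suc_leI)
qed

lemma dim_img_swap:
  assumes A: "clin A" and V: "fsub V" and inv: "\<And>v. v \<in> V \<Longrightarrow> A v \<in> V" and "x (Suc j) \<noteq> x (Suc (Suc j))"
  shows "cv.dim (img A (swap_at (Suc j) x) V (Suc j)) + cv.dim (img A x V (Suc j))
    = cv.dim (img A x V j) + cv.dim (img A x V (Suc (Suc j)))"
proof -
  have base: "img A (swap_at (Suc j) x) V j = img A x V j" by (intro img_cong) (auto simp: swap_at_def)
  show ?thesis
    using dim_shift_swap[OF A img_fsub[OF A V] img_invariant[OF A inv] assms(4), of x j] base
    by (simp add: swap_at_def add.commute)
qed

text \<open>The dimension of the centraliser: restriction to the image of \<open>A - \<xi>\<^sub>1\<close> is onto the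
  centraliser there, and its kernel consists of the maps from the cokernel to the kernel.\<close>

definition centralizer :: "('a::cvec \<Rightarrow> 'a) \<Rightarrow> ('a \<Rightarrow> 'a) \<Rightarrow> 'a set \<Rightarrow> ('a \<Rightarrow> 'a) set" where
  "centralizer A \<pi> V = {h \<in> homs \<pi> V V. \<forall>x\<in>V. h (A x) = A (h x)}"

lemma fsub_centralizer:
  assumes "clin A" "fsub V" "clin \<pi>" "\<And>x. \<pi> x \<in> V" "\<And>x. x \<in> V \<Longrightarrow> \<pi> x = x"
  shows "fsub (centralizer A \<pi> V)"
proof -
  have sub: "cv.subspace {0::'a}" "{0} \<subseteq> V" using fsub_zero_mem[OF assms(2)] by (auto simp: cv.subspace_single_0)
  have "fsub {h \<in> homs \<pi> V V. \<forall>x\<in>{0}. h x = 0}"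
    using dim_homs_vanishing[OF assms(2) sub assms(2-5)] by blast
  moreover have "{h \<in> homs \<pi> V V. \<forall>x\<in>{0}. h x = 0} = homs \<pi> V V" by (auto simp: homs_def clin_0)
  ultimately have "fsub (homs \<pi> V V)" by simp
  moreover have "cv.subspace (centralizer A \<pi> V)"
    using fsubD[OF \<open>fsub (homs \<pi> V V)\<close>] assms(1)
    unfolding centralizer_def by (intro subspaceI) (auto simp: cv.subspace_def cscale_fun_apply clin_simps)
  ultimately show ?thesis by (rule fsub_subset) (auto simp: centralizer_def)
qed

lemma dim_centralizer:
  assumes "clin A" "fsub V" "\<And>v. v \<in> V \<Longrightarrow> A v \<in> V" "img A x V w = {0}"
    "clin \<pi>" "\<And>v. \<pi> v \<in> V" "\<And>v. v \<in> V \<Longrightarrow> \<pi> v = v"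
  shows "cv.dim (centralizer A \<pi> V) = (\<Sum>j<w. (cv.dim (img A x V j) - cv.dim (img A x V (Suc j)))\<^sup>2)"
  using assms
proof (induction w arbitrary: V x \<pi>)
  case 0
  have "h = 0" if "h \<in> centralizer A \<pi> V" for h
  proof
    fix v have "h v = h (\<pi> v)" using that by (simp add: centralizer_def homs_def)
    also have "\<pi> v = 0" using 0 by auto
    finally show "h v = 0 v" using that by (simp add: centralizer_def homs_def clin_0)
  qed
  moreover have "0 \<in> centralizer A \<pi> V" using fsub_zero_mem[OF fsub_centralizer] 0 by blast
  ultimately have "centralizer A \<pi> V = {0}" by auto
  then show ?case by (simp add: dim_zero_space)
next
  case (Suc w)
  note A = Suc.prems(1) and V = Suc.prems(2) and inv = Suc.prems(3) and p = Suc.prems(5-7)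
  define N where "N = (\<lambda>v. A v - x 1 *c v)"
  have cN: "clin N" unfolding N_def by (rule clin_shift[OF A])
  let ?V1 = "N ` V" let ?K = "{v \<in> V. N v = 0}"
  have AN: "A v = N v + x 1 *c v" for v by (simp add: N_def)
  have V1: "fsub ?V1" using fsub_image[OF cN V] .
  have NV: "N v \<in> V" if "v \<in> V" for v using that inv fsub_diff[OF V] fsub_scale[OF V] by (auto simp: N_def)
  have inv1: "A v \<in> ?V1" if "v \<in> ?V1" for v
    using that img_invariant[OF A inv, where x=x and j=1] by (simp add: N_def)
  have K: "fsub ?K" using fsub_subset[OF V subspace_ker[OF cN fsubD[OF V]]] by auto
  have dK: "cv.dim ?K = cv.dim V - cv.dim ?V1" using rank_nullity[OF cN V] by simp
  obtain \<pi>1 where p1: "clin \<pi>1" "\<And>v. \<pi>1 v \<in> ?V1" "\<And>v. v \<in> ?V1 \<Longrightarrow> \<pi>1 v = v"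
    using projection_exists[OF fsubD[OF V1]] by auto
  have shift: "img A (\<lambda>l. x (Suc l)) ?V1 j = img A x V (Suc j)" for j
    using img_shift[of A x V j] unfolding N_def by simp
  have IH: "cv.dim (centralizer A \<pi>1 ?V1) =
      (\<Sum>j<w. (cv.dim (img A x V (Suc j)) - cv.dim (img A x V (Suc (Suc j))))\<^sup>2)"
    using Suc.IH[OF A V1 inv1 _ p1, of "\<lambda>l. x (Suc l)"] Suc.prems(4) unfolding shift by simp
  have commN: "(h (A v) = A (h v)) \<longleftrightarrow> h (N v) = N (h v)" if "clin h" for h v
    using that by (simp add: N_def clin_simps)
  define r :: "('a \<Rightarrow> 'a) \<Rightarrow> 'a \<Rightarrow> 'a" where "r = (\<lambda>h v. h (\<pi>1 v))"
  have cr: "clin r" unfolding r_def by (rule clin_fun) (rule clin_apply)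
  obtain s where s: "clin s" "\<And>y. s y \<in> V" "\<And>y. y \<in> ?V1 \<Longrightarrow> N (s y) = y"
    using linear_section[OF cN fsubD[OF V]] by auto
  have img: "r ` centralizer A \<pi> V = centralizer A \<pi>1 ?V1"
  proof (intro antisym subsetI)
    fix g assume "g \<in> r ` centralizer A \<pi> V"
    then obtain h where h: "clin h" "\<And>v. v \<in> V \<Longrightarrow> h v \<in> V" "\<And>v. v \<in> V \<Longrightarrow> h (A v) = A (h v)" "g = r h"
      by (auto simp: centralizer_def homs_def)
    have hV1: "h v \<in> ?V1" if v: "v \<in> ?V1" for v
    proof -
      obtain u where u: "u \<in> V" "v = N u" using v by auto
      then have "h v = N (h u)" using commN[OF h(1)] h(3) by blast
      then show ?thesis using h(2) u by auto
    qed
    have "V1 \<subseteq> V" if "V1 = ?V1" for V1 using that NV by auto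
    then show "g \<in> centralizer A \<pi>1 ?V1"
      using h hV1 p1 inv1 NV clin_comp[OF h(1) p1(1)] unfolding centralizer_def homs_def r_def
      by auto
  next
    fix h1 assume h1: "h1 \<in> centralizer A \<pi>1 ?V1"
    have ch1: "clin h1" and h1V: "\<And>v. v \<in> ?V1 \<Longrightarrow> h1 v \<in> ?V1" and h1p: "\<And>v. h1 (\<pi>1 v) = h1 v"
      and h1N: "\<And>v. v \<in> ?V1 \<Longrightarrow> h1 (N v) = N (h1 v)"
      using h1 commN by (auto simp: centralizer_def homs_def)
    \<comment> \<open>\<open>h0\<close> extends \<open>h1\<close> from the image of
      \<open>N\<close>: the remaining component \<open>v - \<pi>1 v\<close> is sent to a preimage,
      under \<open>N\<close>, of the value that commutation with \<open>N\<close> forces.\<close>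
    define h0 where "h0 = (\<lambda>v. h1 (\<pi>1 v) + s (h1 (N (v - \<pi>1 v))))"
    have ch0: "clin h0" unfolding h0_def
      using clin_comp[OF ch1 p1(1)] clin_comp[OF s(1) clin_comp[OF ch1 clin_comp[OF cN clin_sub[OF clin_id p1(1)]]]]
      by (intro clin_plus) auto
    have h0V1: "h0 v = h1 v" if "v \<in> ?V1" for v
      using that p1(3) by (simp add: h0_def clin_0[OF cN] clin_0[OF ch1] clin_0[OF s(1)])
    have V1V: "v \<in> V" if "v \<in> ?V1" for v using that NV by auto
    have h0V: "h0 v \<in> V" if "v \<in> V" for v
      unfolding h0_def using s(2) V1V[OF h1V[OF p1(2)]] by (intro fsub_add[OF V]) auto
    have h0N: "h0 (N v) = N (h0 v)" if v: "v \<in> V" for v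
    proof -
      have in1: "N (v - \<pi>1 v) \<in> ?V1" using v V1V[OF p1(2)[of v]] fsub_diff[OF V] by blast
      have "N (h0 v) = N (h1 (\<pi>1 v)) + h1 (N (v - \<pi>1 v))"
        unfolding h0_def clin_add[OF cN] using s(3)[OF h1V[OF in1]] by simp
      also have "N (h1 (\<pi>1 v)) = h1 (N (\<pi>1 v))" using h1N p1(2) by simp
      also have "h1 (N (\<pi>1 v)) + h1 (N (v - \<pi>1 v)) = h1 (N v)"
        by (simp add: clin_diff[OF cN] clin_diff[OF ch1])
      also have "\<dots> = h0 (N v)" using h0V1 v by simp
      finally show ?thesis by simp
    qed
    let ?h = "\<lambda>v. h0 (\<pi> v)"
    have "?h \<in> centralizer A \<pi> V"
      unfolding centralizer_def homs_def
      using clin_comp[OF ch0 p(1)] p h0V h0N commN[OF ch0] inv by auto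
    moreover have "r ?h = h1"
      using p1(2) V1V p(3) h0V1 h1p by (simp add: r_def fun_eq_iff)
    ultimately show "h1 \<in> r ` centralizer A \<pi> V" by blast
  qed
  have ker: "{h \<in> centralizer A \<pi> V. r h = 0} = {h \<in> homs \<pi> V ?K. \<forall>v\<in>?V1. h v = 0}"
  proof (intro antisym subsetI)
    fix h assume h: "h \<in> {h \<in> centralizer A \<pi> V. r h = 0}"
    have ch: "clin h" using h by (simp add: centralizer_def homs_def)
    have z: "h v = 0" if "v \<in> ?V1" for v using h that p1(3) by (auto simp: r_def fun_eq_iff dest: spec[of _ v])
    have "N (h v) = 0" if "v \<in> V" for v
      using h that commN[OF ch, of v] z[of "N v"] by (auto simp: centralizer_def)
    then show "h \<in> {h \<in> homs \<pi> V ?K. \<forall>v\<in>?V1. h v = 0}"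
      using h z by (auto simp: centralizer_def homs_def)
  next
    fix h assume h: "h \<in> {h \<in> homs \<pi> V ?K. \<forall>v\<in>?V1. h v = 0}"
    have ch: "clin h" using h by (simp add: homs_def)
    have "h (A v) = A (h v)" if "v \<in> V" for v
      using commN[OF ch, of v] h that by (auto simp: homs_def)
    moreover have "h (\<pi>1 v) = 0" for v using h p1(2) by blast
    ultimately show "h \<in> {h \<in> centralizer A \<pi> V. r h = 0}"
      using h by (auto simp: centralizer_def homs_def r_def fun_eq_iff)
  qed
  have V1V: "?V1 \<subseteq> V" using NV by auto
  have "cv.dim {h \<in> homs \<pi> V ?K. \<forall>v\<in>?V1. h v = 0} = (cv.dim V - cv.dim ?V1) * cv.dim ?K"
    using dim_homs_vanishing[OF V fsubD[OF V1] V1V K p] by blast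
  then have "cv.dim (centralizer A \<pi> V) = cv.dim (centralizer A \<pi>1 ?V1) + (cv.dim V - cv.dim ?V1)\<^sup>2"
    using rank_nullity[OF cr fsub_centralizer[OF A V p]] img ker dK by (simp add: power2_eq_square)
  then show ?case
    using IH by (subst sum.lessThan_Suc_shift) (simp add: N_def)
qed

text \<open>The ranks determine an annihilated operator up to conjugacy, which replaces normal
  forms. An intertwiner \<open>h1\<close> of the images of \<open>A - x 1\<close> and
  \<open>B - x 1\<close>, given by induction, is extended by matching the parts of the two kernels
  outside the images and, on a complement of everything so far, by lifting through
  \<open>B - x 1\<close>.\<close>

lemma intertwiner_exists:
  fixes A :: "'a::cvec \<Rightarrow> 'a" and B :: "'b::cvec \<Rightarrow> 'b"
  assumes "clin A" "fsub V" "\<And>v. v \<in> V \<Longrightarrow> A v \<in> V" "img A x V w = {0}"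
    "clin B" "fsub W" "\<And>v. v \<in> W \<Longrightarrow> B v \<in> W" "img B x W w = {0}"
    "\<And>j. j \<le> w \<Longrightarrow> cv.dim (img A x V j) = cv.dim (img B x W j)"
  shows "\<exists>h. clin h \<and> h ` V = W \<and> (\<forall>v\<in>V. h v = 0 \<longrightarrow> v = 0) \<and> (\<forall>v\<in>V. h (A v) = B (h v))"
  using assms
proof (induction w arbitrary: V W x)
  case 0
  then show ?case by (intro exI[of _ "\<lambda>_. 0"]) (auto simp: clin_zero clin_0)
next
  case (Suc w)
  note A = Suc.prems(1) and V = Suc.prems(2) and invA = Suc.prems(3)
    and B = Suc.prems(5) and W = Suc.prems(6) and invB = Suc.prems(7)
  define N where "N = (\<lambda>v. A v - x 1 *c v)"
  define M where "M = (\<lambda>v. B v - x 1 *c v)"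
  have cN: "clin N" and cM: "clin M" unfolding N_def M_def by (rule clin_shift[OF A], rule clin_shift[OF B])
  let ?V1 = "N ` V" let ?W1 = "M ` W"
  let ?K = "{v \<in> V. N v = 0}" let ?L = "{v \<in> W. M v = 0}"
  have V1: "fsub ?V1" and W1: "fsub ?W1" using fsub_image cN V cM W by blast+
  have NV: "N v \<in> V" if "v \<in> V" for v using that invA fsub_diff[OF V] fsub_scale[OF V] by (auto simp: N_def)
  have MW: "M v \<in> W" if "v \<in> W" for v using that invB fsub_diff[OF W] fsub_scale[OF W] by (auto simp: M_def)
  have V1V: "?V1 \<subseteq> V" and W1W: "?W1 \<subseteq> W" using NV MW by auto
  have invA1: "A v \<in> ?V1" if "v \<in> ?V1" for v
    using that img_invariant[OF A invA, where x=x and j=1] by (simp add: N_def)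
  have invB1: "B v \<in> ?W1" if "v \<in> ?W1" for v
    using that img_invariant[OF B invB, where x=x and j=1] by (simp add: M_def)
  have shA: "img A (\<lambda>l. x (Suc l)) ?V1 j = img A x V (Suc j)" for j
    using img_shift[of A x V j] unfolding N_def by simp
  have shB: "img B (\<lambda>l. x (Suc l)) ?W1 j = img B x W (Suc j)" for j
    using img_shift[of B x W j] unfolding M_def by simp
  have dV: "cv.dim V = cv.dim W" using Suc.prems(9)[of 0] by simp
  have dV1: "cv.dim ?V1 = cv.dim ?W1" using Suc.prems(9)[of 1] by (simp add: N_def M_def)
  have "\<exists>h. clin h \<and> h ` ?V1 = ?W1 \<and> (\<forall>v\<in>?V1. h v = 0 \<longrightarrow> v = 0) \<and> (\<forall>v\<in>?V1. h (A v) = B (h v))"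
  proof (rule Suc.IH[OF A V1 invA1 _ B W1 invB1])
    show "img A (\<lambda>l. x (Suc l)) ?V1 w = {0}" unfolding shA by (rule Suc.prems(4))
    show "img B (\<lambda>l. x (Suc l)) ?W1 w = {0}" unfolding shB by (rule Suc.prems(8))
    show "cv.dim (img A (\<lambda>l. x (Suc l)) ?V1 j) = cv.dim (img B (\<lambda>l. x (Suc l)) ?W1 j)" if "j \<le> w" for j
      unfolding shA shB using that by (intro Suc.prems(9)) simp
  qed
  then obtain h1 where h1': "clin h1" "h1 ` ?V1 = ?W1" "\<forall>v\<in>?V1. h1 v = 0 \<longrightarrow> v = 0"
      "\<forall>v\<in>?V1. h1 (A v) = B (h1 v)" by (elim exE conjE)
  then have h1: "clin h1" "h1 ` ?V1 = ?W1" "\<And>v. v \<in> ?V1 \<Longrightarrow> h1 v = 0 \<Longrightarrow> v = 0"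
      "\<And>v. v \<in> ?V1 \<Longrightarrow> h1 (A v) = B (h1 v)" by blast+
  have h1N: "h1 (N v) = M (h1 v)" if "v \<in> ?V1" for v
    using h1(4)[OF that] by (simp add: N_def M_def clin_simps[OF h1(1)])
  have K: "fsub ?K" using fsub_subset[OF V subspace_ker[OF cN fsubD[OF V]]] by auto
  have L: "fsub ?L" using fsub_subset[OF W subspace_ker[OF cM fsubD[OF W]]] by auto
  have dKL: "cv.dim ?K = cv.dim ?L" using rank_nullity[OF cN V] rank_nullity[OF cM W] dV dV1 by simp
  \<comment> \<open>\<open>h1\<close> already matches the parts of the kernels inside the images.
    Their complements \<open>C\<close> and \<open>D\<close> in the kernels then have equal
    dimension, and any isomorphism between them will do.\<close>
  let ?K1 = "?K \<inter> ?V1" let ?L1 = "?L \<inter> ?W1"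
  have sK1: "cv.subspace ?K1" and sL1: "cv.subspace ?L1"
    using K V1 L W1 fsubD cv.subspace_inter by blast+
  have fK1: "fsub ?K1" and fL1: "fsub ?L1" using fsub_subset[OF K sK1] fsub_subset[OF L sL1] by auto
  have imgK1: "h1 ` ?K1 = ?L1"
  proof (intro antisym subsetI)
    fix y assume "y \<in> h1 ` ?K1"
    then obtain v where v: "v \<in> ?V1" "N v = 0" "y = h1 v" by auto
    then show "y \<in> ?L1" using h1N[OF v(1)] h1(2) W1W by (auto simp: clin_0[OF h1(1)])
  next
    fix y assume y: "y \<in> ?L1"
    then obtain v where v: "v \<in> ?V1" "y = h1 v" using h1(2) by blast
    have "N v \<in> ?V1" using v V1V by auto
    moreover have "h1 (N v) = 0" using h1N[OF v(1)] y v by simp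
    ultimately have "N v = 0" using h1(3) by blast
    then show "y \<in> h1 ` ?K1" using v V1V by auto
  qed
  have dK1: "cv.dim ?K1 = cv.dim ?L1" using dim_image_inj[OF h1(1) fK1] h1(3) imgK1 by auto
  obtain C where C: "cv.subspace C" "C \<subseteq> ?K" "?K1 \<inter> C = {0}" "\<And>v. v \<in> ?K \<Longrightarrow> \<exists>s\<in>?K1. \<exists>c\<in>C. v = s + c"
    using complement_exists[OF sK1 fsubD[OF K]] by (metis (no_types, lifting) inf_le1)
  obtain D where D: "cv.subspace D" "D \<subseteq> ?L" "?L1 \<inter> D = {0}" "\<And>v. v \<in> ?L \<Longrightarrow> \<exists>s\<in>?L1. \<exists>c\<in>D. v = s + c"
    using complement_exists[OF sL1 fsubD[OF L]] by (metis (no_types, lifting) inf_le1)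
  have "cv.dim C = cv.dim D"
    using dim_direct_sum[OF K sK1 C(1) _ C(2,3,4)] dim_direct_sum[OF L sL1 D(1) _ D(2,3,4)] dKL dK1 by auto
  then obtain \<gamma> \<gamma>' where g: "clin \<gamma>" "\<And>v. v \<in> C \<Longrightarrow> \<gamma> v \<in> D \<and> \<gamma>' (\<gamma> v) = v" "clin \<gamma>'"
    using iso_exists[OF fsub_subset[OF K C(1,2)] fsub_subset[OF L D(1,2)]] by metis
  have "?V1 \<inter> C = {0}" using C(2,3) by auto
  then obtain h0 where h0: "clin h0" "\<And>v. v \<in> ?V1 \<Longrightarrow> h0 v = h1 v" "\<And>v. v \<in> C \<Longrightarrow> h0 v = \<gamma> v"
    by (rule glue_maps[OF fsubD[OF V1] C(1) _ h1(1) g(1)]) (rule that)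
  let ?S = "{x + y | x y. x \<in> ?V1 \<and> y \<in> C}"
  have sS: "cv.subspace ?S" using cv.subspace_sums[OF fsubD[OF V1] C(1)] .
  have "C \<subseteq> V" using C(2) by auto
  then have SV: "?S \<subseteq> V" using V1V fsub_add[OF V] by blast
  obtain E where E: "cv.subspace E" "E \<subseteq> V" "?S \<inter> E = {0}" "\<And>v. v \<in> V \<Longrightarrow> \<exists>s\<in>?S. \<exists>c\<in>E. v = s + c"
    by (rule complement_exists[OF sS fsubD[OF V] SV]) (rule that)
  obtain s where s: "clin s" "\<And>y. s y \<in> W" "\<And>y. y \<in> ?W1 \<Longrightarrow> M (s y) = y"
    using linear_section[OF cM fsubD[OF W]] by auto
  have csh: "clin (\<lambda>v. s (h1 (N v)))" using clin_comp[OF s(1) clin_comp[OF h1(1) cN]] .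
  obtain h where h: "clin h" "\<And>v. v \<in> ?S \<Longrightarrow> h v = h0 v" "\<And>v. v \<in> E \<Longrightarrow> h v = s (h1 (N v))"
    by (rule glue_maps[OF sS E(1,3) h0(1) csh]) (rule that)
  have zC: "0 \<in> C" and zV1: "0 \<in> ?V1" using C(1) fsubD[OF V1] cv.subspace_0 by blast+
  have inS: "v \<in> ?S" if "v \<in> ?V1 \<or> v \<in> C" for v
    using that zC zV1 by (force intro: exI[of _ "0::'a"])
  have hV1: "h v = h1 v" if "v \<in> ?V1" for v using h(2)[OF inS[OF disjI1[OF that]]] h0(2)[OF that] by simp
  have hC: "h v = \<gamma> v" if "v \<in> C" for v using h(2)[OF inS[OF disjI2[OF that]]] h0(3)[OF that] by simp
  have dec: "\<exists>a\<in>?V1. \<exists>c\<in>C. \<exists>e\<in>E. v = a + c + e" if v: "v \<in> V" for v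
  proof -
    obtain s e where "s \<in> ?S" "e \<in> E" "v = s + e" using E(4)[OF v] by (elim bexE)
    moreover then obtain a c where "a \<in> ?V1" "c \<in> C" "s = a + c" by (elim CollectE exE conjE)
    ultimately show ?thesis by (intro bexI[of _ a] bexI[of _ c] bexI[of _ e]) simp_all
  qed
  have main: "h v \<in> W \<and> M (h v) = h1 (N v)" if v: "v \<in> V" for v
  proof -
    obtain a c e where ace: "a \<in> ?V1" "c \<in> C" "e \<in> E" "v = a + c + e" using dec[OF v] by (elim bexE)
    have hv: "h v = h1 a + \<gamma> c + s (h1 (N e))" using ace hV1 hC h(3) by (simp add: clin_add[OF h(1)])
    have W3: "h1 a \<in> W" "\<gamma> c \<in> W" "M (\<gamma> c) = 0" "N c = 0"
      using ace(1,2) h1(2) W1W g(2)[OF ace(2)] D(2) C(2) by auto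
    have "h1 (N e) \<in> ?W1" using h1(2) ace(3) E(2) by blast
    then have "M (h v) = h1 (N a) + h1 (N e)"
      using hv W3 s(3) h1N[OF ace(1)] by (simp add: clin_add[OF cM])
    also have "\<dots> = h1 (N v)" using ace(4) W3 by (simp add: clin_add[OF cN] clin_add[OF h1(1)])
    finally have "M (h v) = h1 (N v)" .
    moreover have "h v \<in> W" unfolding hv using W3 s(2) fsub_add[OF W] by blast
    ultimately show ?thesis by simp
  qed
  have comm: "h (A v) = B (h v)" if "v \<in> V" for v
  proof -
    have "h (N v) = M (h v)" using main[OF that] hV1 that by simp
    then show ?thesis by (simp add: N_def M_def clin_simps[OF h(1)])
  qed
  \<comment> \<open>A vector killed by \<open>h\<close> lies in the kernel of \<open>N\<close>,
    hence in \<open>?K1 + C\<close>; \<open>h\<close> sends these two summands injectively to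
    \<open>?L1\<close> and \<open>D\<close>, which meet only in 0.\<close>
  have inj: "v = 0" if v: "v \<in> V" "h v = 0" for v
  proof -
    have "h1 (N v) = 0" using main[OF v(1)] v(2) by (simp add: clin_0[OF cM])
    then have "v \<in> ?K" using h1(3)[of "N v"] v by auto
    from C(4)[OF this] obtain a c where ac: "a \<in> ?K1" "c \<in> C" "v = a + c" by (elim bexE)
    have "h1 a + \<gamma> c = 0" using v(2) ac hV1 hC by (simp add: clin_add[OF h(1)])
    then have eq: "h1 a = \<gamma> (- c)" by (simp add: clin_minus[OF g(1)] eq_neg_iff_add_eq_0)
    have mc: "- c \<in> C" using ac(2) C(1) cv.subspace_neg by blast
    have "h1 a \<in> ?L1" using ac(1) imgK1 by blast
    moreover have "h1 a \<in> D" using eq g(2)[OF mc] by simp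
    ultimately have "h1 a = 0" using D(3) by blast
    then have "a = 0" "- c = 0" using h1(3)[of a] ac(1) eq g(2)[OF mc] clin_0[OF g(3)] by auto
    then show "v = 0" using ac by simp
  qed
  have "h ` V = W" using inj_image_eq[OF h(1) V W inj] main dV by auto
  then show ?case using h(1) inj comm by (intro exI[of _ h]) blast
qed


section \<open>Ordered products and irreducible families\<close>

text \<open>\<open>T m\<close> acts first and \<open>T 1\<close> last, in accordance with the matrix
  product \<open>A 1 ... A m\<close> acting on column vectors.\<close>

primrec cprod :: "(nat \<Rightarrow> 'a \<Rightarrow> 'a) \<Rightarrow> nat \<Rightarrow> 'a \<Rightarrow> 'a" where
  "cprod T 0 v = v"
| "cprod T (Suc m) v = cprod T m (T (Suc m) v)"

lemma cprod_left: "cprod T (Suc m) v = T 1 (cprod (\<lambda>l. T (Suc l)) m v)"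
  by (induction m arbitrary: v) auto

lemma clin_cprod: "(\<And>i. i \<in> {1..m} \<Longrightarrow> clin (T i)) \<Longrightarrow> clin (cprod T m)"
proof (induction m)
  case (Suc m)
  then have "clin (cprod T m)" "clin (T (Suc m))" by auto
  then have "clin (\<lambda>v. cprod T m (T (Suc m) v))" by (rule clin_comp)
  then show ?case by simp
next
  case 0 show ?case by (rule clinI) simp_all
qed

lemma cprod_closed:
  "(\<And>i v. i \<in> {1..m} \<Longrightarrow> v \<in> V \<Longrightarrow> T i v \<in> V) \<Longrightarrow> v \<in> V \<Longrightarrow> cprod T m v \<in> V"
  by (induction m arbitrary: v) auto

text \<open>The product of the factors after position \<open>i\<close>, from
  \<open>T (i + 1)\<close> to \<open>T k\<close>.\<close>

definition tail :: "(nat \<Rightarrow> 'a \<Rightarrow> 'a) \<Rightarrow> nat \<Rightarrow> nat \<Rightarrow> 'a \<Rightarrow> 'a" where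
  "tail T k i = cprod (\<lambda>l. T (i + l)) (k - i)"

lemma tail_top: "tail T k k v = v" by (simp add: tail_def)
lemma tail_0: "tail T k 0 = cprod T k" by (simp add: tail_def)

lemma tail_step: "i < k \<Longrightarrow> tail T k i v = T (Suc i) (tail T k (Suc i) v)"
  unfolding tail_def using cprod_left[of "\<lambda>l. T (i + l)" "k - Suc i" v]
  by (simp add: Suc_diff_Suc)

lemma clin_tail: "(\<And>i. i \<in> {1..k} \<Longrightarrow> clin (T i)) \<Longrightarrow> clin (tail T k i)"
  unfolding tail_def by (intro clin_cprod) auto

lemma tail_closed:
  assumes "\<And>i v. i \<in> {1..k} \<Longrightarrow> v \<in> V \<Longrightarrow> T i v \<in> V" "v \<in> V" shows "tail T k i v \<in> V"
  unfolding tail_def by (rule cprod_closed[where V=V]) (use assms in auto)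

text \<open>The zero space counts as irreducible; nontriviality enters separately, through bounds on
  the dimension.\<close>

definition irred_family :: "'a::cvec set \<Rightarrow> nat \<Rightarrow> (nat \<Rightarrow> 'a \<Rightarrow> 'a) \<Rightarrow> bool" where
  "irred_family V k A \<longleftrightarrow> (\<forall>S. cv.subspace S \<and> S \<subseteq> V \<and> (\<forall>i\<in>{1..k}. \<forall>v\<in>S. A i v \<in> S) \<longrightarrow> S = {0} \<or> S = V)"

lemma irred_familyD:
  "irred_family V k A \<Longrightarrow> cv.subspace S \<Longrightarrow> S \<subseteq> V \<Longrightarrow> (\<And>i v. i \<in> {1..k} \<Longrightarrow> v \<in> S \<Longrightarrow> A i v \<in> S)
    \<Longrightarrow> S = {0} \<or> S = V"
  unfolding irred_family_def by blast

lemma dim_span_single: "cv.dim (cv.span {x::'a::cvec}) \<le> 1"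
  using cv.dim_le_card[of "cv.span {x}" "{x}"] by simp

text \<open>The line through a common eigenvector is invariant, hence all of \<open>V\<close>. This
  is how the degenerate cases of Scott's inequality and of the convolution are recognised.\<close>

lemma irred_family_eigenline:
  assumes irr: "irred_family V k A" and V: "fsub V" and x: "x \<in> V" "x \<noteq> 0"
    and A: "\<And>i. i \<in> {1..k} \<Longrightarrow> clin (A i)" "\<And>i. i \<in> {1..k} \<Longrightarrow> A i x = c i *c x"
  shows "V = cv.span {x}" "cv.dim V = 1" "\<And>v i. v \<in> V \<Longrightarrow> i \<in> {1..k} \<Longrightarrow> A i v = c i *c v"
proof -
  have sp: "v \<in> cv.span {x} \<longleftrightarrow> (\<exists>a. v = a *c x)" for v unfolding cv.span_singleton by auto
  have act: "A i v = c i *c v" if "v \<in> cv.span {x}" "i \<in> {1..k}" for i v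
    using that sp A by (auto simp: clin_scale cscale_cscale mult.commute)
  have "cv.span {x} = {0} \<or> cv.span {x} = V"
  proof (rule irred_familyD[OF irr])
    show "cv.span {x} \<subseteq> V" using x V by (intro cv.span_minimal) (auto dest: fsubD)
    show "A i v \<in> cv.span {x}" if "i \<in> {1..k}" "v \<in> cv.span {x}" for i v
      using act[OF that(2,1)] that cv.span_scale by auto
  qed simp
  moreover have "x \<in> cv.span {x}" by (simp add: cv.span_base)
  ultimately show eq: "V = cv.span {x}" using x(2) by auto
  then have "cv.dim V \<le> 1" using dim_span_single by simp
  moreover have "cv.dim V \<noteq> 0" using fsub_dim_0[OF V] x by auto
  ultimately show "cv.dim V = 1" by simp
  show "A i v = c i *c v" if "v \<in> V" "i \<in> {1..k}" for v i using act that eq by blast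
qed

lemma irred_family_scalars:
  assumes "irred_family V k A" "fsub V" "\<And>i. i \<in> {1..k} \<Longrightarrow> clin (A i)"
    "\<And>i v. i \<in> {1..k} \<Longrightarrow> v \<in> V \<Longrightarrow> A i v = c i *c v"
  shows "cv.dim V \<le> 1"
proof (cases "V = {0}")
  case True then show ?thesis by (simp add: dim_zero_space)
next
  case False
  then obtain x where x: "x \<in> V" "x \<noteq> 0" using fsub_zero_mem[OF assms(2)] by auto
  show ?thesis using irred_family_eigenline(2)[OF assms(1,2) x assms(3) assms(4)[OF _ x(1)]] by simp
qed

section \<open>Scott's inequality\<close>

text \<open>With the constant families and with \<open>fox\<close> it forms a complex
  \<open>Inv -> Zs -> Hs -> V\<close>, exact at the first two places. Scott's inequality is the
  Euler characteristic of this complex, and exactness at \<open>Hs\<close> is what rigidity will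
  provide for the action on matrices.\<close>

definition succ_diffs :: "nat \<Rightarrow> (nat \<Rightarrow> 'a::cvec) \<Rightarrow> nat \<Rightarrow> 'a" where
  "succ_diffs k z = (\<lambda>i. if i \<in> {1..<k} then z (Suc i) - z i else 0)"

text \<open>The linearised product relation, in the manner of Fox calculus. A term at
  \<open>i = k\<close> would vanish on \<open>V\<close>, since there the full product is the
  identity.\<close>

definition fox :: "(nat \<Rightarrow> 'a \<Rightarrow> 'a) \<Rightarrow> nat \<Rightarrow> (nat \<Rightarrow> 'a::cvec) \<Rightarrow> 'a" where
  "fox T k H = (\<Sum>i\<in>{1..<k}. cprod T i (H i) - H i)"

locale monodromy =
  fixes V :: "'a::cvec set" and k :: nat and T :: "nat \<Rightarrow> 'a \<Rightarrow> 'a"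
  assumes V: "fsub V" and kpos: "k \<ge> 1"
    and T: "\<And>i. i \<in> {1..k} \<Longrightarrow> clin (T i)"
    and TV: "\<And>i v. i \<in> {1..k} \<Longrightarrow> v \<in> V \<Longrightarrow> T i v \<in> V"
    and prod: "\<And>v. v \<in> V \<Longrightarrow> cprod T k v = v"
begin

abbreviation "Fix i \<equiv> {v \<in> V. T i v = v}"
abbreviation "Inv \<equiv> {v \<in> V. \<forall>i\<in>{1..k}. T i v = v}"
abbreviation "Zs \<equiv> dsum {1..k} Fix"
abbreviation "Hs \<equiv> dsum {1..<k} (\<lambda>_. V)"

lemma clin_succ_diffs: "clin (succ_diffs k :: (nat \<Rightarrow> 'a) \<Rightarrow> _)"
  unfolding succ_diffs_def by (intro clin_fun clin_if clin_sub clin_apply clin_zero)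

lemma clin_M: "i \<le> k \<Longrightarrow> clin (cprod T i)"
  using T by (intro clin_cprod) auto

lemma clin_fox: "clin (fox T k)"
proof -
  have "clin (\<lambda>H. cprod T i (H i))" if "i \<in> {1..<k}" for i
    using clin_comp[OF clin_M clin_apply[of i]] that by auto
  then show ?thesis unfolding fox_def by (intro clin_setsum clin_sub clin_apply)
qed

lemma fsub_Fix: "i \<in> {1..k} \<Longrightarrow> fsub (Fix i)"
proof -
  assume i: "i \<in> {1..k}"
  have "cv.subspace {v \<in> V. T i v - v = 0}"
    using subspace_ker[OF clin_sub[OF T[OF i] clin_id] fsubD[OF V]] .
  then have "cv.subspace (Fix i)" by simp
  then show ?thesis using fsub_subset[OF V] by blast
qed

lemma fsub_Inv: "fsub Inv"
proof -
  have "cv.subspace Inv"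
    using fsubD[OF V] T by (intro subspaceI) (auto simp: cv.subspace_def clin_simps)
  then show ?thesis using fsub_subset[OF V] by blast
qed

lemma M_closed: "i \<le> k \<Longrightarrow> v \<in> V \<Longrightarrow> cprod T i v \<in> V"
  by (rule cprod_closed) (use TV in auto)

lemma fsub_Zs: "fsub Zs" and dim_Zs: "cv.dim Zs = (\<Sum>i\<in>{1..k}. cv.dim (Fix i))"
  using fsub_dsum_dim[of "{1..k}" Fix] fsub_Fix by auto

lemma fsub_Hs: "fsub Hs" and dim_Hs: "cv.dim Hs = (k - 1) * cv.dim V"
  using fsub_dsum_dim[of "{1..<k}" "\<lambda>_. V"] V by auto

lemma diffs_Zs: "z \<in> Zs \<Longrightarrow> succ_diffs k z \<in> Hs"
proof (rule dsumI)
  fix i assume z: "z \<in> Zs" and i: "i \<in> {1..<k}"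
  have "z (Suc i) \<in> Fix (Suc i)" "z i \<in> Fix i" using dsumD(1)[OF z] i by auto
  then show "succ_diffs k z i \<in> V" using i fsub_diff[OF V] by (simp add: succ_diffs_def)
qed (auto simp: succ_diffs_def)

text \<open>The sum telescopes: \<open>T i\<close> fixes \<open>z i\<close>, so the partial products
  up to \<open>i\<close> and up to \<open>i - 1\<close> agree on \<open>z i\<close>. The boundary
  terms vanish because the empty and the full product are the identity.\<close>

lemma fox_diffs:
  assumes z: "z \<in> Zs" shows "fox T k (succ_diffs k z) = 0"
proof -
  define f where "f i = cprod T (i - 1) (z i) - z i" for i
  have fixed: "T i (z i) = z i" "z i \<in> V" if "i \<in> {1..k}" for i using dsumD(1)[OF z that] by auto
  have "cprod T i (succ_diffs k z i) - succ_diffs k z i = f (Suc i) - f i" if i: "i \<in> {1..<k}" for i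
  proof -
    obtain m where m: "i = Suc m" using i by (cases i) auto
    have "cprod T i (z i) = cprod T (i - 1) (z i)" using fixed(1)[of i] i m by simp
    then show ?thesis using i clin_diff[OF clin_M[of i]] by (simp add: succ_diffs_def f_def)
  qed
  then have "fox T k (succ_diffs k z) = (\<Sum>i\<in>{1..<k}. f (Suc i) - f i)" by (simp add: fox_def)
  also have "\<dots> = f k - f 1" using kpos by (rule sum_Suc_diff')
  also have "f 1 = 0" by (simp add: f_def)
  also have "f k = 0"
  proof -
    obtain m where m: "k = Suc m" using kpos by (cases k) auto
    have "cprod T (k - 1) (z k) = cprod T k (z k)" using fixed(1)[of k] m by simp
    then show ?thesis using prod fixed(2)[of k] kpos by (simp add: f_def)
  qed
  finally show ?thesis by simp
qed

text \<open>A family with vanishing differences is constant, and its value is then fixed by every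
  \<open>T i\<close>.\<close>

lemma dim_diffs: "cv.dim (succ_diffs k ` Zs) + cv.dim Inv = (\<Sum>i\<in>{1..k}. cv.dim (Fix i))"
proof -
  let ?K = "{z \<in> Zs. succ_diffs k z = 0}"
  have K: "fsub ?K" using fsub_subset[OF fsub_Zs subspace_ker[OF clin_succ_diffs fsubD[OF fsub_Zs]]] by auto
  have const: "z i = z 1" if z: "z \<in> ?K" and i: "i \<in> {1..k}" for z i
  proof -
    have "Suc m \<le> k \<Longrightarrow> z (Suc m) = z 1" for m
    proof (induction m)
      case (Suc m)
      have "succ_diffs k z (Suc m) = 0" using z by simp
      then show ?case using Suc by (simp add: succ_diffs_def)
    qed simp
    from this[of "i - 1"] show ?thesis using i by simp
  qed
  have im: "(\<lambda>z. z 1) ` ?K = Inv"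
  proof (intro antisym subsetI)
    fix v assume "v \<in> (\<lambda>z. z 1) ` ?K"
    then obtain z where z: "z \<in> ?K" "v = z 1" by (elim imageE)
    have zi: "z i \<in> Fix i" if "i \<in> {1..k}" for i using dsumD(1)[of z "{1..k}" Fix] z(1) that by blast
    have "z 1 \<in> V" using zi[of 1] kpos by simp
    moreover have "T i (z 1) = z 1" if "i \<in> {1..k}" for i using zi[OF that] const[OF z(1) that] by simp
    ultimately show "v \<in> Inv" using z(2) by simp
  next
    fix v assume v: "v \<in> Inv"
    let ?z = "\<lambda>i. if i \<in> {1..k} then v else 0"
    have "?z \<in> ?K" using v by (auto simp: dsum_def succ_diffs_def fun_eq_iff)
    then show "v \<in> (\<lambda>z. z 1) ` ?K" using kpos by (intro image_eqI[of _ _ ?z]) auto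
  qed
  have inj: "z = 0" if "z \<in> ?K" "z 1 = 0" for z
  proof
    fix i show "z i = 0 i"
      using const[OF that(1), of i] that dsumD(2)[of z "{1..k}" Fix i] by (cases "i \<in> {1..k}") auto
  qed
  have "cv.dim ?K = cv.dim Inv" unfolding im[symmetric] by (rule dim_image_inj[OF clin_apply K inj, symmetric])
  then show ?thesis using rank_nullity[OF clin_succ_diffs fsub_Zs] dim_Zs by simp
qed

lemma dim_fox: "(k - 1) * cv.dim V = cv.dim (fox T k ` Hs) + cv.dim {H \<in> Hs. fox T k H = 0}"
  using rank_nullity[OF clin_fox fsub_Hs] dim_Hs by simp

lemma fsub_fox_ker: "fsub {H \<in> Hs. fox T k H = 0}"
  using fsub_subset[OF fsub_Hs subspace_ker[OF clin_fox fsubD[OF fsub_Hs]]] by auto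

lemma diffs_in_fox_ker: "succ_diffs k ` Zs \<subseteq> {H \<in> Hs. fox T k H = 0}"
  using diffs_Zs fox_diffs by auto

text \<open>Since \<open>fox\<close> kills all differences, rank-nullity for \<open>fox\<close>
  bounds the dimension of their space from above.\<close>

lemma scott:
  "(\<Sum>i\<in>{1..k}. cv.dim (Fix i)) + cv.dim (fox T k ` Hs) \<le> cv.dim Inv + (k - 1) * cv.dim V"
  using dim_diffs dim_fox
    fsub_dim_subset[OF fsub_fox_ker fsub_image[OF clin_succ_diffs fsub_Zs] diffs_in_fox_ker] by linarith

lemma fox_range_M:
  assumes "i \<le> k" "v \<in> V" shows "cprod T i v - v \<in> fox T k ` Hs"
proof (cases "i = 0 \<or> i = k")
  case True
  then show ?thesis using prod assms(2) fsub_zero_mem[OF fsub_image[OF clin_fox fsub_Hs]] by auto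
next
  case False
  let ?H = "\<lambda>j. if j = i then v else 0"
  have "fox T k ?H = (\<Sum>j\<in>{1..<k}. if j = i then cprod T i v - v else 0)"
    unfolding fox_def using clin_0[OF clin_M] by (intro sum.cong) auto
  also have "\<dots> = cprod T i v - v" using False assms by simp
  finally have "fox T k ?H = cprod T i v - v" .
  moreover have "?H \<in> Hs" using False assms fsub_zero_mem[OF V] by (auto simp: dsum_def)
  ultimately show ?thesis by (metis image_eqI)
qed

lemma fox_range_subset: "fox T k ` Hs \<subseteq> V"
proof -
  have "fox T k H \<in> V" if "H \<in> Hs" for H
    unfolding fox_def
  proof (rule cv.subspace_sum[OF fsubD[OF V]])
    fix i assume "i \<in> {1..<k}"
    then show "cprod T i (H i) - H i \<in> V" using M_closed[of i "H i"] dsumD(1)[OF that, of i] fsub_diff[OF V] by auto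
  qed
  then show ?thesis by blast
qed

text \<open>The range contains \<open>M v - v\<close> for every partial product \<open>M\<close>.
  Comparing the partial products before and after the factor \<open>T i\<close> isolates that
  factor, so the range is invariant under all \<open>T i\<close>.\<close>

lemma fox_range_T:
  assumes i: "i \<in> {1..k}" and v: "v \<in> V" shows "T i v - v \<in> fox T k ` Hs"
proof -
  let ?R = "fox T k ` Hs"
  have R: "fsub ?R" using fsub_image[OF clin_fox fsub_Hs] .
  obtain m where m: "i = Suc m" using i by (cases i) auto
  have cm: "clin (cprod T m)" using clin_M i m by auto
  let ?u = "T i v - v"
  have u: "?u \<in> V" using TV[OF i v] v fsub_diff[OF V] by blast
  have eq: "cprod T m ?u = (cprod T i v - v) - (cprod T m v - v)" using m by (simp add: clin_diff[OF cm])
  have "cprod T i v - v \<in> ?R" "cprod T m v - v \<in> ?R" using fox_range_M[of i v] fox_range_M[of m v] i m v by auto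
  then have "cprod T m ?u \<in> ?R" unfolding eq by (rule fsub_diff[OF R])
  moreover have "cprod T m ?u - ?u \<in> ?R" using fox_range_M[OF _ u, of m] i m by simp
  ultimately have "cprod T m ?u - (cprod T m ?u - ?u) \<in> ?R" using fsub_diff[OF R] by blast
  then show ?thesis by simp
qed

text \<open>Irreducibility in dimension at least 2 forces \<open>Inv\<close> to be zero and
  \<open>fox\<close> to be onto; each of the two contributes one copy of
  \<open>cv.dim V\<close>.\<close>

lemma scott_irreducible:
  assumes irr: "irred_family V k T" and "cv.dim V \<ge> 2"
  shows "(\<Sum>i\<in>{1..k}. cv.dim (Fix i)) + 2 * cv.dim V \<le> k * cv.dim V"
proof -
  have nontriv: False if "\<And>i v. i \<in> {1..k} \<Longrightarrow> v \<in> V \<Longrightarrow> T i v = v"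
    using irred_family_scalars[OF irr V T, of "\<lambda>_. 1"] that assms(2) by (simp add: cscale_one)
  have "Inv = {0} \<or> Inv = V"
    by (rule irred_familyD[OF irr fsubD[OF fsub_Inv]]) auto
  moreover have "Inv \<noteq> V" using nontriv by blast
  ultimately have 1: "cv.dim Inv = 0" by (simp add: dim_zero_space)
  let ?R = "fox T k ` Hs"
  have R: "fsub ?R" using fsub_image[OF clin_fox fsub_Hs] .
  have "?R = {0} \<or> ?R = V"
  proof (rule irred_familyD[OF irr fsubD[OF R] fox_range_subset])
    fix i v assume iv: "i \<in> {1..k}" "v \<in> ?R"
    then have "T i v - v \<in> ?R" using fox_range_T[OF iv(1) subsetD[OF fox_range_subset iv(2)]] by simp
    then have "(T i v - v) + v \<in> ?R" using iv(2) by (rule fsub_add[OF R])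
    then show "T i v \<in> ?R" by simp
  qed
  moreover have "?R \<noteq> {0}"
  proof
    assume "?R = {0}"
    then have "T i v = v" if "i \<in> {1..k}" "v \<in> V" for i v using fox_range_T[OF that] by simp
    then show False using nontriv by blast
  qed
  ultimately have "?R = V" by blast
  then have "(\<Sum>i\<in>{1..k}. cv.dim (Fix i)) + cv.dim V \<le> (k - 1) * cv.dim V" using scott 1 by simp
  moreover have "k * cv.dim V = (k - 1) * cv.dim V + cv.dim V" using kpos by (cases k) auto
  ultimately show ?thesis by linarith
qed

end


lemma image_cscale: "cv.subspace S \<Longrightarrow> c \<noteq> 0 \<Longrightarrow> (\<lambda>v. c *c v) ` S = S"
proof (intro antisym subsetI)
  fix v assume S: "cv.subspace S" "c \<noteq> 0" "v \<in> S"
  have "c *c (inverse c *c v) = v" using S(2) by (simp add: cscale_cscale cscale_one)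
  moreover have "inverse c *c v \<in> S" using S cv.subspace_scale by blast
  ultimately show "v \<in> (\<lambda>v. c *c v) ` S" by (metis image_eqI)
qed (auto intro: cv.subspace_scale)

section \<open>Middle convolution\<close>

text \<open>Models the tuple after division of each \<open>A i\<close> by its first parameter: the
  distinguished eigenvalue is 1 on every arm, and \<open>q\<close> is the product of the first
  parameters, that is, the value of the character at the centre.\<close>

locale convolution =
  fixes V :: "'a::cvec set" and k :: nat and B :: "nat \<Rightarrow> 'a \<Rightarrow> 'a" and q :: complex
  assumes V: "fsub V" and B: "\<And>i. i \<in> {1..k} \<Longrightarrow> clin (B i)"
    and BV: "\<And>i v. i \<in> {1..k} \<Longrightarrow> v \<in> V \<Longrightarrow> B i v \<in> V"
    and q: "q \<noteq> 0" "q \<noteq> 1"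
    and prod: "\<And>v. v \<in> V \<Longrightarrow> q *c cprod B k v = v"
begin

abbreviation "W i \<equiv> (\<lambda>v. B i v - v) ` V"
abbreviation "U \<equiv> dsum {1..k} W"
text \<open>On the direct sum \<open>U\<close> of the images of the \<open>B i - 1\<close>, the maps taking \<open>y\<close> to
  \<open>y + inj_at i (g i y)\<close> form the multiplicative (Dettweiler-Reiter) convolution; \<open>B' i\<close> is what they
  induce on \<open>U / psi V\<close>, identified with \<open>V'\<close>.\<close>
definition "tot (y :: nat \<Rightarrow> 'a) = (\<Sum>i\<in>{1..k}. y i)"
definition "V' = {y \<in> U. tot y = 0}"
definition "inj_at i (x :: 'a) = (\<lambda>j. if j = i then x else 0)"
definition "shift i y = q *c (\<Sum>j\<in>{1..i}. y j) + (\<Sum>j\<in>{Suc i..k}. y j)"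
definition "g i y = (B i (shift i y) - shift i y) + (q - 1) *c y i"
definition "psi v = (\<lambda>i. if i \<in> {1..k} then B i (tail B k i v) - tail B k i v else 0)"
text \<open>\<open>tot \<circ> psi\<close> is multiplication by \<open>1 / q - 1\<close>, so \<open>p\<close> is the projection along \<open>psi\<close>.\<close>
definition "e = inverse (inverse q - 1)"
definition "p y = y - e *c psi (tot y)"
definition "F i x = p (inj_at i x)"
definition "B' i y = y + F i (g i y)"

lemma e: "e * (inverse q - 1) = 1"
  using q by (simp add: e_def field_simps)

lemma clin_sub1: "i \<in> {1..k} \<Longrightarrow> clin (\<lambda>v. B i v - v)"
  using B by (intro clin_sub clin_id)

lemma W: "i \<in> {1..k} \<Longrightarrow> fsub (W i)"
  using fsub_image[OF clin_sub1 V] .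

lemma WV: "i \<in> {1..k} \<Longrightarrow> W i \<subseteq> V"
  using BV fsub_diff[OF V] by blast

lemma U: "fsub U" and dim_U: "cv.dim U = (\<Sum>i\<in>{1..k}. cv.dim (W i))"
  using fsub_dsum_dim[of "{1..k}" W] W by auto

lemma U_mem: "y \<in> U \<Longrightarrow> i \<in> {1..k} \<Longrightarrow> y i \<in> V"
  using dsumD(1)[of y "{1..k}" W i] WV by blast

lemma UI: "(\<And>i. i \<in> {1..k} \<Longrightarrow> y i \<in> W i) \<Longrightarrow> (\<And>i. i \<notin> {1..k} \<Longrightarrow> y i = 0) \<Longrightarrow> y \<in> U"
  by (rule dsumI)

lemma clin_tot: "clin tot" unfolding tot_def by (intro clin_setsum clin_apply)
lemma clin_inj_at: "clin (inj_at i)" unfolding inj_at_def by (intro clin_fun clin_if clin_id clin_zero)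
lemma clin_shift': "clin (shift i)" unfolding shift_def by (intro clin_setsum clin_apply clin_plus clin_cscale)
lemma clin_g: "i \<in> {1..k} \<Longrightarrow> clin (g i)"
  unfolding g_def using clin_comp[OF B clin_shift'] by (intro clin_plus clin_sub clin_cscale clin_shift' clin_apply) auto
lemma clin_psi: "clin psi"
  unfolding psi_def
proof (intro clin_fun clin_if clin_sub clin_zero)
  fix i assume i: "i \<in> {1..k}"
  show "clin (tail B k i)" using B by (rule clin_tail)
  then show "clin (\<lambda>v. B i (tail B k i v))" by (rule clin_comp[OF B[OF i]])
qed
lemma clin_p: "clin p"
  unfolding p_def using clin_comp[OF clin_psi clin_tot] by (intro clin_sub clin_id clin_cscale)
lemma clin_F: "clin (F i)" unfolding F_def using clin_comp[OF clin_p clin_inj_at] .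
lemma clin_B': "i \<in> {1..k} \<Longrightarrow> clin (B' i)"
  unfolding B'_def using clin_comp[OF clin_F clin_g] by (intro clin_plus clin_id)

lemma tail_V: "v \<in> V \<Longrightarrow> tail B k i v \<in> V"
  using tail_closed[of k V B] BV by blast

lemma psi_U: "v \<in> V \<Longrightarrow> psi v \<in> U"
  using tail_V by (intro UI) (auto simp: psi_def)

lemma psi_tail: "i \<in> {1..k} \<Longrightarrow> psi v i = tail B k (i - 1) v - tail B k i v"
  using tail_step[of "i - 1" k B v] by (auto simp: psi_def)

lemma sum_psi: "i \<le> l \<Longrightarrow> l \<le> k \<Longrightarrow> (\<Sum>j\<in>{Suc i..l}. psi v j) = tail B k i v - tail B k l v"
proof (induction l)
  case (Suc l)
  show ?case
  proof (cases "i \<le> l")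
    case True
    then have "{Suc i..Suc l} = insert (Suc l) {Suc i..l}" by auto
    then show ?thesis using Suc True psi_tail[of "Suc l" v] by simp
  next
    case False
    then have "i = Suc l" using Suc by simp
    then show ?thesis by simp
  qed
qed simp

lemma prod': "v \<in> V \<Longrightarrow> cprod B k v = inverse q *c v"
  using prod[of v] q cscale_cscale[of "inverse q" q "cprod B k v"] by (simp add: cscale_one)

lemma tot_psi: "v \<in> V \<Longrightarrow> tot (psi v) = (inverse q - 1) *c v"
  using sum_psi[of 0 k v] by (simp add: tot_def tail_0 tail_top prod' cscale_left_distrib cv.scale_left_diff_distrib cscale_one)

lemma tot_V: "y \<in> U \<Longrightarrow> tot y \<in> V"
  unfolding tot_def using U_mem by (intro cv.subspace_sum[OF fsubD[OF V]]) auto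

lemma shift_tot: "i \<in> {1..k} \<Longrightarrow> shift i y = q *c tot y - (q - 1) *c (\<Sum>j\<in>{Suc i..k}. y j)"
proof -
  assume i: "i \<in> {1..k}"
  have "{1..k} = {1..i} \<union> {Suc i..k}" using i by auto
  then have "tot y = (\<Sum>j\<in>{1..i}. y j) + (\<Sum>j\<in>{Suc i..k}. y j)"
    unfolding tot_def by (simp add: sum.union_disjoint)
  then show ?thesis unfolding shift_def
    by (simp add: cscale_right_distrib cv.scale_left_diff_distrib cscale_one)
qed

text \<open>At \<open>psi v\<close> the shift is \<open>1 - q\<close> times the tail of
  \<open>v\<close>; applying \<open>B i - 1\<close> to it cancels the second term of
  \<open>g\<close>. Hence the operators on \<open>U\<close> act trivially on the range of
  \<open>psi\<close> and descend to the quotient.\<close>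

lemma g_psi:
  assumes i: "i \<in> {1..k}" and v: "v \<in> V" shows "g i (psi v) = 0"
proof -
  let ?t = "tail B k i v"
  have "shift i (psi v) = q *c ((inverse q - 1) *c v) - (q - 1) *c (?t - v)"
    using shift_tot[OF i] tot_psi[OF v] sum_psi[of i k v] i by (simp add: tail_top)
  also have "\<dots> = (1 - q) *c ?t"
    using q by (simp add: cscale_cscale cv.scale_right_diff_distrib cv.scale_left_diff_distrib algebra_simps cscale_one)
  finally show ?thesis using i
    by (simp add: g_def psi_def clin_simps[OF B[OF i]] cv.scale_right_diff_distrib cv.scale_left_diff_distrib)
qed

lemma p_V': "y \<in> U \<Longrightarrow> p y \<in> V'"
proof -
  assume y: "y \<in> U"
  have "tot (p y) = tot y - e *c ((inverse q - 1) *c tot y)"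
    unfolding p_def using tot_psi[OF tot_V[OF y]] by (simp add: clin_simps[OF clin_tot])
  also have "\<dots> = 0" by (simp add: cscale_cscale e cscale_one)
  finally have "tot (p y) = 0" .
  moreover have "p y \<in> U" unfolding p_def
    using y psi_U[OF tot_V[OF y]] fsub_diff[OF U] fsub_scale[OF U] by blast
  ultimately show ?thesis by (simp add: V'_def)
qed

lemma p_id: "y \<in> V' \<Longrightarrow> p y = y"
  by (simp add: V'_def p_def clin_0[OF clin_psi])

lemma V'_U: "V' \<subseteq> U" by (auto simp: V'_def)

lemma V': "fsub V'"
  using fsub_subset[OF U subspace_ker[OF clin_tot fsubD[OF U]]] V'_U by (simp add: V'_def)

text \<open>\<open>tot\<close> is onto because \<open>tot \<circ> psi\<close> is a nonzero scalar.
  The resulting dimension, the sum of the ranks of the \<open>B i - 1\<close> minus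
  \<open>cv.dim V\<close>, is the reflected centre coordinate.\<close>

lemma dim_V': "cv.dim V' + cv.dim V = (\<Sum>i\<in>{1..k}. cv.dim (W i))"
proof -
  have "tot ` U = V"
  proof (intro antisym subsetI)
    fix v assume v: "v \<in> V"
    have "tot (psi (e *c v)) = v"
      using tot_psi[OF fsub_scale[OF V v], of e] e by (simp add: cscale_cscale mult.commute cscale_one)
    then show "v \<in> tot ` U" using psi_U[OF fsub_scale[OF V v], of e] by (intro image_eqI[of _ _ "psi (e *c v)"]) auto
  qed (use tot_V in auto)
  then show ?thesis using rank_nullity[OF clin_tot U] dim_U by (simp add: V'_def)
qed

lemma g_p: "y \<in> U \<Longrightarrow> i \<in> {1..k} \<Longrightarrow> g i (p y) = g i y"
  unfolding p_def using g_psi[OF _ tot_V] by (simp add: clin_simps[OF clin_g])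

lemma shift_V: "y \<in> U \<Longrightarrow> i \<in> {1..k} \<Longrightarrow> shift i y \<in> V"
  unfolding shift_def using U_mem
  by (intro fsub_add[OF V] fsub_scale[OF V] cv.subspace_sum[OF fsubD[OF V]]) auto

lemma g_W: "y \<in> U \<Longrightarrow> i \<in> {1..k} \<Longrightarrow> g i y \<in> W i"
  unfolding g_def using shift_V[of y i] dsumD(1)[of y "{1..k}" W i]
  by (intro fsub_add[OF W] fsub_scale[OF W]) auto

lemma inj_at_U: "i \<in> {1..k} \<Longrightarrow> x \<in> W i \<Longrightarrow> inj_at i x \<in> U"
  using fsub_zero_mem[OF W] by (intro UI) (auto simp: inj_at_def)

lemma F_V': "i \<in> {1..k} \<Longrightarrow> x \<in> W i \<Longrightarrow> F i x \<in> V'"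
  unfolding F_def by (intro p_V' inj_at_U)

lemma B'_V': "i \<in> {1..k} \<Longrightarrow> y \<in> V' \<Longrightarrow> B' i y \<in> V'"
  unfolding B'_def using V'_U by (intro fsub_add[OF V'] F_V' g_W) auto

text \<open>The convolution on all of \<open>U\<close>. Products are easier to compute there, and
  \<open>p\<close> carries the result over to \<open>V'\<close>.\<close>

definition "N i y = y + inj_at i (g i y)"

lemma N_U: "i \<in> {1..k} \<Longrightarrow> y \<in> U \<Longrightarrow> N i y \<in> U"
  unfolding N_def by (intro fsub_add[OF U] inj_at_U g_W)

lemma B'_p: "i \<in> {1..k} \<Longrightarrow> y \<in> U \<Longrightarrow> B' i (p y) = p (N i y)"
  unfolding B'_def N_def F_def by (simp add: g_p clin_add[OF clin_p])

lemma cprod_B'_p: "m \<le> k \<Longrightarrow> y \<in> U \<Longrightarrow> cprod B' m (p y) = p (cprod N m y)"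
proof (induction m arbitrary: y)
  case (Suc m)
  then show ?case using B'_p[of "Suc m" y] N_U[of "Suc m" y] by simp
qed simp

text \<open>Descending induction on \<open>m\<close>: when \<open>N i\<close> is applied, the
  already modified components beyond \<open>i\<close> combine with the others so that
  \<open>shift i\<close> becomes \<open>q\<close> times a tail of \<open>tot y\<close>, which
  reproduces \<open>psi\<close>. For \<open>tot y = 0\<close> the whole product is multiplication by
  \<open>q\<close>.\<close>

lemma tail_N:
  assumes y: "y \<in> U" and m: "m \<le> k"
  shows "tail N k m y = (\<lambda>i. if i \<in> {Suc m..k} then q *c y i + q *c psi (tot y) i else y i)"
  using m
proof (induction "k - m" arbitrary: m)
  case 0
  then show ?case by (simp add: tail_top)
next
  case (Suc d)
  let ?i = "Suc m" let ?s = "tot y"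
  let ?z = "\<lambda>i. if i \<in> {Suc ?i..k} then q *c y i + q *c psi ?s i else y i"
  have i: "?i \<in> {1..k}" using Suc by auto
  have z: "tail N k ?i y = ?z" using Suc by (intro Suc.hyps(1)) auto
  have "shift ?i ?z = q *c (\<Sum>j\<in>{1..?i}. y j) + (\<Sum>j\<in>{Suc ?i..k}. q *c y j + q *c psi ?s j)"
    unfolding shift_def by (intro arg_cong2[where f="(+)"] arg_cong[where f="cscale q"] sum.cong) auto
  also have "\<dots> = q *c tot y + q *c (\<Sum>j\<in>{Suc ?i..k}. psi ?s j)"
  proof -
    have "{1..k} = {1..?i} \<union> {Suc ?i..k}" using i by auto
    then have "tot y = (\<Sum>j\<in>{1..?i}. y j) + (\<Sum>j\<in>{Suc ?i..k}. y j)"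
      unfolding tot_def by (simp only: sum.union_disjoint) (simp add: sum.union_disjoint)
    then show ?thesis by (simp add: sum.distrib cscale_right_distrib cv.scale_sum_right)
  qed
  also have "\<dots> = q *c tail B k ?i ?s"
    using sum_psi[of ?i k ?s] i by (simp add: tail_top cv.scale_right_diff_distrib)
  finally have sh: "shift ?i ?z = q *c tail B k ?i ?s" .
  have gz: "g ?i ?z = q *c psi ?s ?i + (q - 1) *c y ?i"
    unfolding g_def sh using i by (simp add: psi_def clin_simps[OF B[OF i]] cv.scale_right_diff_distrib)
  have "tail N k m y = N ?i ?z" using tail_step[of m k N y] i z by simp
  also have "\<dots> = (\<lambda>i. if i \<in> {?i..k} then q *c y i + q *c psi ?s i else y i)"
    unfolding N_def gz inj_at_def using i
    by (auto simp: fun_eq_iff cv.scale_left_diff_distrib cscale_one)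
  finally show ?case .
qed

lemma cprod_B':
  assumes "y \<in> V'" shows "cprod B' k y = q *c y"
proof -
  have y: "y \<in> U" and t: "tot y = 0" and py: "p y = y" using assms p_id by (auto simp: V'_def)
  have "cprod N k y = q *c y"
    using tail_N[OF y, of 0] t dsumD(2)[OF y] by (auto simp: tail_0 fun_eq_iff cscale_fun_apply clin_0[OF clin_psi])
  then show ?thesis using cprod_B'_p[OF _ y, of k] py by (simp add: clin_scale[OF clin_p])
qed

lemma shift_inj_at: "j \<in> {1..k} \<Longrightarrow> shift i (inj_at j x) = (if j \<le> i then q *c x else x)"
proof -
  assume j: "j \<in> {1..k}"
  have "(\<Sum>l\<in>{1..i}. inj_at j x l) = (if j \<le> i then x else 0)" "(\<Sum>l\<in>{Suc i..k}. inj_at j x l) = (if j \<le> i then 0 else x)"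
    using j by (auto simp: inj_at_def)
  then show ?thesis by (simp add: shift_def)
qed

lemma g_inj_at_other: "i \<in> {1..k} \<Longrightarrow> j \<in> {1..k} \<Longrightarrow> i \<noteq> j \<Longrightarrow>
    g i (inj_at j x) = (if j < i then q else 1) *c (B i x - x)"
  by (simp add: g_def shift_inj_at clin_simps[OF B] cv.scale_right_diff_distrib cscale_one)
    (simp add: inj_at_def)

lemma g_inj_at_same: "i \<in> {1..k} \<Longrightarrow> g i (inj_at i x) = q *c B i x - x"
  by (simp add: g_def shift_inj_at clin_simps[OF B]) (simp add: inj_at_def cv.scale_left_diff_distrib cscale_one)

text \<open>On the range of \<open>F i\<close> the convolution acts as \<open>q B i\<close>. All
  rank conditions beyond the first shift are transported through this relation.\<close>

lemma B'_F: "i \<in> {1..k} \<Longrightarrow> x \<in> W i \<Longrightarrow> B' i (F i x) = F i (q *c B i x)"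
proof -
  assume i: "i \<in> {1..k}" and x: "x \<in> W i"
  have "g i (F i x) = q *c B i x - x" unfolding F_def using g_p[OF inj_at_U[OF i x] i] g_inj_at_same[OF i] by simp
  then show ?thesis by (simp add: B'_def clin_diff[OF clin_F])
qed

text \<open>A subspace \<open>S\<close> of the convolution invariant under \<open>B'\<close> comes from the invariant subspace
  \<open>\<Sum>\<^sub>j g\<^sub>j S\<close> of \<open>V\<close>.\<close>

lemma irred_convolution:
  assumes irr: "irred_family V k B"
  shows "irred_family V' k B'"
  unfolding irred_family_def
proof (intro allI impI)
  fix S assume "cv.subspace S \<and> S \<subseteq> V' \<and> (\<forall>i\<in>{1..k}. \<forall>v\<in>S. B' i v \<in> S)"
  then have S: "cv.subspace S" "S \<subseteq> V'" and inv: "\<And>i v. i \<in> {1..k} \<Longrightarrow> v \<in> S \<Longrightarrow> B' i v \<in> S" by auto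
  let ?R = "dsum {1..k} (\<lambda>i. g i ` S)"
  let ?T = "tot ` ?R"

  have gS: "cv.subspace (g i ` S)" if "i \<in> {1..k}" for i using subspace_image[OF clin_g[OF that] S(1)] .
  have gSW: "g i ` S \<subseteq> W i" if "i \<in> {1..k}" for i using g_W[OF _ that] S(2) V'_U by blast
  have RU: "?R \<subseteq> U"
  proof
    fix y assume "y \<in> ?R"
    from dsumD[OF this] show "y \<in> U" using gSW by (intro UI) blast+
  qed
  have sT: "cv.subspace ?T" by (intro subspace_image[OF clin_tot] subspace_dsum gS)
  have TV: "?T \<subseteq> V" by (rule image_subsetI) (rule tot_V[OF subsetD[OF RU]])
  have FS: "F i x \<in> S" if i: "i \<in> {1..k}" and x: "x \<in> g i ` S" for i x
  proof -
    obtain y where y: "y \<in> S" "x = g i y" using x by (elim imageE)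
    have "B' i y - y \<in> S" by (rule cv.subspace_diff[OF S(1) inv[OF i y(1)] y(1)])
    then show ?thesis using y by (simp add: B'_def)
  qed
  have gg: "g i (inj_at j x) \<in> g i ` S" if "i \<in> {1..k}" "j \<in> {1..k}" "x \<in> g j ` S" for i j x
  proof -
    have "g i (F j x) = g i (inj_at j x)" unfolding F_def using that gSW by (intro g_p inj_at_U) auto
    then show ?thesis using imageI[OF FS[OF that(2,3)], of "g i"] by simp
  qed
  \<comment> \<open>\<open>S\<close> contains \<open>F j x\<close>, so
    \<open>g i (inj_at j x)\<close> is a value of \<open>g i\<close> on \<open>S\<close>. Up to a
    nonzero factor, and up to a multiple of \<open>x\<close> when \<open>i = j\<close>, it equals
    \<open>B i x - x\<close>.\<close>
  have step: "B i x - x \<in> g i ` S" if i: "i \<in> {1..k}" and j: "j \<in> {1..k}" and x: "x \<in> g j ` S" for i j x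
  proof -
    have main: "a *c (B i x - x) \<in> g i ` S \<Longrightarrow> a \<noteq> 0 \<Longrightarrow> ?thesis" for a
      using cv.subspace_scale[OF gS[OF i], of "a *c (B i x - x)" "inverse a"] by (simp add: cscale_cscale cscale_one)
    show ?thesis
    proof (cases "i = j")
      case True
      have "(q *c B i x - x) - (q - 1) *c x \<in> g i ` S"
      proof (rule cv.subspace_diff[OF gS[OF i]])
        show "q *c B i x - x \<in> g i ` S" using gg[OF i j x] g_inj_at_same[OF i, of x] True by simp
        show "(q - 1) *c x \<in> g i ` S" using x True by (intro cv.subspace_scale[OF gS[OF i]]) simp
      qed
      then have "q *c (B i x - x) \<in> g i ` S"
        by (simp add: cv.scale_right_diff_distrib cv.scale_left_diff_distrib cscale_one)
      then show ?thesis using main q by blast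
    next
      case False
      then have "(if j < i then q else 1) *c (B i x - x) \<in> g i ` S"
        using gg[OF i j x] g_inj_at_other[OF i j] by simp
      then show ?thesis using main[of "if j < i then q else 1"] q by (auto split: if_splits)
    qed
  qed
  have stepT: "B i x - x \<in> g i ` S" if i: "i \<in> {1..k}" and x: "x \<in> ?T" for i x
  proof -
    obtain y where y: "y \<in> ?R" "x = tot y" using x by (elim imageE)
    have "B i x - x = (\<Sum>j\<in>{1..k}. B i (y j) - y j)"
      unfolding y(2) tot_def by (simp add: clin_sum[OF B[OF i]] sum_subtractf)
    also have "\<dots> \<in> g i ` S"
    proof (rule cv.subspace_sum[OF gS[OF i]])
      fix j assume j: "j \<in> {1..k}"
      have "y j \<in> g j ` S" by (rule dsumD(1)[OF y(1) j])
      then show "B i (y j) - y j \<in> g i ` S" by (rule step[OF i j])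
    qed
    finally show ?thesis .
  qed
  have inT: "x \<in> ?T" if i: "i \<in> {1..k}" and x: "x \<in> g i ` S" for i x
  proof -
    have "inj_at i x \<in> ?R" by (rule dsumI) (use x i cv.subspace_0[OF gS] in \<open>auto simp: inj_at_def\<close>)
    moreover have "tot (inj_at i x) = x" using i by (simp add: tot_def inj_at_def)
    ultimately show ?thesis by (intro image_eqI[of x tot "inj_at i x"]) auto
  qed
  have "?T = {0} \<or> ?T = V"
  proof (rule irred_familyD[OF irr sT TV])
    fix i x assume ix: "i \<in> {1..k}" "x \<in> ?T"
    have "(B i x - x) + x \<in> ?T" using cv.subspace_add[OF sT inT[OF ix(1) stepT[OF ix]] ix(2)] .
    then show "B i x \<in> ?T" by simp
  qed
  then show "S = {0} \<or> S = V'"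
  proof
    \<comment> \<open>Then every \<open>B' i\<close> is the identity on \<open>S\<close>, whereas
      their product is multiplication by \<open>q \<noteq> 1\<close>.\<close>
    assume T0: "?T = {0}"
    have "y = 0" if y: "y \<in> S" for y
    proof -
      have "g i y = 0" if "i \<in> {1..k}" for i using inT[OF that, of "g i y"] T0 y by auto
      then have B'y: "B' i y = y" if "i \<in> {1..k}" for i using that by (simp add: B'_def clin_0[OF clin_F])
      have "m \<le> k \<Longrightarrow> cprod B' m y = y" for m by (induction m) (simp_all add: B'y)
      from this[of k] have "q *c y = y" using cprod_B'[OF subsetD[OF S(2) y]] by simp
      then have "(q - 1) *c y = 0" by (simp add: cv.scale_left_diff_distrib cscale_one)
      then show "y = 0" using q by simp
    qed
    then have "S = {0}" using cv.subspace_0[OF S(1)] by auto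
    then show ?thesis ..
  next
    \<comment> \<open>Then \<open>g i\<close> maps \<open>S\<close> onto all of \<open>W i\<close>,
      so \<open>S\<close> contains every \<open>F i x\<close> with \<open>x\<close> in
      \<open>W i\<close>, and these span \<open>V'\<close>.\<close>
    assume TV': "?T = V"
    have W_S: "x \<in> g i ` S" if "i \<in> {1..k}" "x \<in> W i" for i x
      using that stepT[OF that(1)] TV' by auto
    have "y \<in> S" if y: "y \<in> V'" for y
    proof -
      have yU: "y \<in> U" using y V'_U by blast
      have "y = (\<Sum>i\<in>{1..k}. inj_at i (y i))"
        using dsumD(2)[OF yU] by (auto simp: fun_eq_iff sum_fun_apply inj_at_def)
      then have "y = p (\<Sum>i\<in>{1..k}. inj_at i (y i))" using p_id[OF y] by simp
      also have "\<dots> = (\<Sum>i\<in>{1..k}. F i (y i))" by (simp add: clin_sum[OF clin_p] F_def)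
      also have "\<dots> \<in> S" using dsumD(1)[OF yU] by (intro cv.subspace_sum[OF S(1)] FS W_S) auto
      finally show ?thesis .
    qed
    then have "S = V'" using S(2) by auto
    then show ?thesis ..
  qed
qed

text \<open>The degenerate case that \<open>F_inj\<close> and \<open>g_surj\<close> have to exclude:
  the total rank is at most \<open>cv.dim V\<close>, so nothing is left for the convolution.\<close>

lemma dim_V'_single:
  assumes i: "i \<in> {1..k}" and "\<And>j. j \<in> {1..k} \<Longrightarrow> j \<noteq> i \<Longrightarrow> W j = {0}"
  shows "cv.dim V' = 0"
proof -
  have "(\<Sum>j\<in>{1..k}. cv.dim (W j)) = cv.dim (W i)"
  proof -
    have "(\<Sum>j\<in>{1..k} - {i}. cv.dim (W j)) = 0"
    proof (rule sum.neutral, rule ballI)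
      fix j assume "j \<in> {1..k} - {i}"
      then have "W j = {0}" using assms(2) by blast
      then show "cv.dim (W j) = 0" using dim_zero_space by metis
    qed
    then show ?thesis using i by (subst sum.remove[OF _ i]) simp_all
  qed
  also have "\<dots> \<le> cv.dim V" using fsub_dim_subset[OF V W[OF i] WV[OF i]] .
  finally show ?thesis using dim_V' by simp
qed

text \<open>If \<open>F i x = 0\<close>, then \<open>inj_at i x\<close> lies in the range of
  \<open>psi\<close>, which every \<open>g j\<close> kills. Written out, \<open>x\<close> is a
  common eigenvector with eigenvalue \<open>1/q\<close> at \<open>i\<close> and 1 elsewhere, so
  \<open>V\<close> is a line and \<open>V'\<close> is zero.\<close>

lemma F_inj:
  assumes irr: "irred_family V k B" and n: "cv.dim V \<ge> 2 \<or> cv.dim V' \<ge> 1"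
    and i: "i \<in> {1..k}" and x: "x \<in> W i" "F i x = 0"
  shows "x = 0"
proof (rule ccontr)
  assume x0: "x \<noteq> 0"
  have xV: "x \<in> V" using x(1) WV[OF i] by blast
  have "tot (inj_at i x) = x" using i by (simp add: tot_def inj_at_def)
  then have eq: "inj_at i x = e *c psi x" using x(2) by (simp add: F_def p_def)
  have gz: "g j (inj_at i x) = 0" if "j \<in> {1..k}" for j
    unfolding eq using g_psi[OF that xV] by (simp add: clin_scale[OF clin_g[OF that]])
  have Bj: "B j x = (if j = i then inverse q else 1) *c x" if j: "j \<in> {1..k}" for j
  proof (cases "j = i")
    case True
    then have "q *c B i x = x" using gz[OF j] g_inj_at_same[OF i, of x] by simp
    then have "inverse q *c (q *c B i x) = inverse q *c x" by simp
    then show ?thesis using True q by (simp add: cscale_cscale cscale_one)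
  next
    case False
    then have "(if i < j then q else 1) *c (B j x - x) = 0" using gz[OF j] g_inj_at_other[OF j i, of x] by simp
    then show ?thesis using False q by (auto simp: cscale_one split: if_splits)
  qed
  have line: "cv.dim V = 1" "\<And>v j. v \<in> V \<Longrightarrow> j \<in> {1..k} \<Longrightarrow> B j v = (if j = i then inverse q else 1) *c v"
    using irred_family_eigenline(2,3)[OF irr V xV x0 B Bj] by blast+
  have "W j = {0}" if j: "j \<in> {1..k}" "j \<noteq> i" for j
  proof -
    have "B j v - v = 0" if "v \<in> V" for v using line(2)[OF that j(1)] j(2) by (simp add: cscale_one)
    then show ?thesis using fsub_zero_mem[OF W[OF j(1)]] by auto
  qed
  then have "cv.dim V' = 0" by (rule dim_V'_single[OF i])
  then show False using n line(1) by simp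
qed

text \<open>Dual to \<open>F_inj\<close>: a functional \<open>l\<close> that vanishes on the values
  of \<open>g i\<close> but not on \<open>W i\<close> yields, after composition with
  \<open>B i - 1\<close>, a common eigenfunctional \<open>h\<close>. Its kernel is invariant, hence
  zero, so \<open>V\<close> is at most a line.\<close>

lemma g_surj:
  assumes irr: "irred_family V k B" and n: "cv.dim V \<ge> 2 \<or> cv.dim V' \<ge> 1" and i: "i \<in> {1..k}"
  shows "g i ` V' = W i"
proof -
  have J: "g i ` V' = g i ` U"
  proof (intro antisym image_subsetI)
    show "g i y \<in> g i ` U" if "y \<in> V'" for y using that V'_U by blast
    show "g i y \<in> g i ` V'" if "y \<in> U" for y
      using imageI[OF p_V'[OF that], of "g i"] g_p[OF that i] by simp
  qed
  have sJ: "cv.subspace (g i ` U)" using subspace_image[OF clin_g[OF i] fsubD[OF U]] .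
  have "W i \<subseteq> g i ` U"
  proof (rule ccontr)
    assume "\<not> W i \<subseteq> g i ` U"
    then obtain x0 where x0: "x0 \<in> V" "B i x0 - x0 \<notin> g i ` U" by blast
    obtain l :: "'a \<Rightarrow> complex" where l: "clin l" "\<And>y. y \<in> g i ` U \<Longrightarrow> l y = 0" "l (B i x0 - x0) = 1"
      by (rule separating_functional[OF sJ x0(2)]) (rule that)
    define h where "h x = l (B i x - x)" for x
    have ch: "clin h" unfolding h_def using clin_comp[OF l(1) clin_sub1[OF i]] .
    let ?H = "{x \<in> V. h x = 0}"
    have other: "h x = 0" if j: "j \<in> {1..k}" "j \<noteq> i" and x: "x \<in> W j" for j x
    proof -
      have "l (g i (inj_at j x)) = 0" using inj_at_U[OF j(1) x] by (intro l(2) imageI)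
      then have "(if j < i then q else 1) *c h x = 0"
        using g_inj_at_other[OF i j(1), of x] j(2) by (simp add: clin_scale[OF l(1)] h_def)
      then show ?thesis using q by (auto simp: cscale_complex_def split: if_splits)
    qed
    have same: "q * h x = (1 - q) * l x" if x: "x \<in> W i" for x
    proof -
      have "l (g i (inj_at i x)) = 0" using inj_at_U[OF i x] by (intro l(2) imageI)
      then have "q * l (B i x) = l x"
        using g_inj_at_same[OF i, of x] by (simp add: clin_simps[OF l(1)] cscale_complex_def)
      then show ?thesis by (simp add: h_def clin_simps[OF l(1)] algebra_simps)
    qed
    have sH: "cv.subspace ?H" using subspace_ker[OF ch fsubD[OF V]] .
    have "?H = {0} \<or> ?H = V"
    proof (rule irred_familyD[OF irr sH])
      fix j x assume j: "j \<in> {1..k}" and x: "x \<in> ?H"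
      have in_W: "B j x - x \<in> W j" using x by blast
      have "h (B j x - x) = 0"
      proof (cases "j = i")
        case False then show ?thesis using other[OF j _ in_W] by simp
      next
        case True
        have "q * h (B i x - x) = (1 - q) * l (B i x - x)" using same in_W True by blast
        also have "l (B i x - x) = 0" using x by (simp add: h_def)
        finally show ?thesis using q True by simp
      qed
      then show "B j x \<in> ?H" using x BV[OF j] by (simp add: clin_diff[OF ch])
    qed auto
    moreover have "x0 \<notin> ?H" using l(3) by (simp add: h_def)
    ultimately have H0: "?H = {0}" using x0(1) by metis
    have fU: "fsub (UNIV :: complex set)"
      unfolding fsub_def by (auto intro!: exI[of _ "{1}"] simp: cv.span_singleton cscale_complex_def image_iff)
    have "cv.dim (UNIV :: complex set) \<le> 1"
      using cv.dim_le_card[of "UNIV :: complex set" "{1}"] by (auto simp: cv.span_singleton cscale_complex_def image_iff)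
    then have "cv.dim (h ` V) \<le> 1" using fsub_dim_subset[OF fU fsub_image[OF ch V]] by auto
    then have d: "cv.dim V \<le> 1" using rank_nullity[OF ch V] H0 by (simp add: dim_zero_space)
    have "W j = {0}" if j: "j \<in> {1..k}" "j \<noteq> i" for j
    proof -
      have "x \<in> ?H" if "x \<in> W j" for x using other[OF j that] that WV[OF j(1)] by blast
      then have "W j \<subseteq> {0}" unfolding H0[symmetric] by (rule subsetI)
      then show ?thesis using fsub_zero_mem[OF W[OF j(1)]] by (intro equalityI) simp_all
    qed
    then have "cv.dim V' = 0" by (rule dim_V'_single[OF i])
    then show False using n d by simp
  qed
  then show ?thesis using J g_W[OF _ i] by auto
qed

text \<open>After the first shift the images for the convolution are the images under
  \<open>F i\<close> of the old ones, and \<open>F i\<close> is injective there. Under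
  \<open>F i\<close> the operator \<open>a' B' i\<close> corresponds to \<open>a' q / a\<close>
  times \<open>a B i\<close>, which dictates the new later parameters.\<close>

lemma img_convolution:
  assumes irr: "irred_family V k B" and n: "cv.dim V \<ge> 2 \<or> cv.dim V' \<ge> 1" and i: "i \<in> {1..k}"
    and a: "a \<noteq> 0" "a' \<noteq> 0" and x1: "x (Suc 0) = a" "x' (Suc 0) = a'"
    and xl: "\<And>l. l \<ge> 2 \<Longrightarrow> x' l = (a' * q / a) * x l"
  shows "cv.dim (img (\<lambda>y. a' *c B' i y) x' V' (Suc m)) = cv.dim (img (\<lambda>v. a *c B i v) x V (Suc m))"
proof -
  let ?A = "\<lambda>v. a *c B i v" and ?A' = "\<lambda>y. a' *c B' i y"
  let ?c = "a' * q / a"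
  have c: "?c \<noteq> 0" using a q by simp
  have cA: "clin ?A" using clin_cscale[OF B[OF i]] .
  have AV: "?A v \<in> V" if "v \<in> V" for v using BV[OF i that] fsub_scale[OF V] by blast
  have one: "img ?A x V (Suc 0) = W i"
  proof -
    have "img ?A x V (Suc 0) = (\<lambda>v. a *c v) ` W i"
      by (simp add: x1 image_image cv.scale_right_diff_distrib)
    also have "\<dots> = W i" using image_cscale[OF fsubD[OF W[OF i]] a(1)] .
    finally show ?thesis .
  qed
  have sub: "img ?A x V (Suc m) \<subseteq> W i" for m
  proof (induction m)
    case (Suc m)
    show ?case using img_Suc_subset[OF cA V AV, of x "Suc m"] Suc by (rule subset_trans)
  qed (simp only: one)
  have step: "img ?A' x' V' (Suc m) = F i ` img ?A x V (Suc m)" for m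
  proof (induction m)
    case 0
    have "img ?A' x' V' (Suc 0) = (\<lambda>y. a' *c (B' i y - y)) ` V'"
      by (simp add: x1 cv.scale_right_diff_distrib)
    also have "\<dots> = (\<lambda>v. a' *c v) ` F i ` g i ` V'" by (simp add: B'_def image_image)
    also have "\<dots> = (\<lambda>v. a' *c v) ` F i ` W i" using g_surj[OF irr n i] by simp
    also have "\<dots> = F i ` W i"
      using image_cscale[OF subspace_image[OF clin_F fsubD[OF W[OF i]]] a(2)] .
    finally show ?case using one by simp
  next
    case (Suc m)
    let ?I = "img ?A x V (Suc m)" let ?x = "x (Suc (Suc m))"
    have pt: "?A' (F i v) - x' (Suc (Suc m)) *c F i v = F i (?c *c (?A v - ?x *c v))" if "v \<in> ?I" for v
    proof -
      have "v \<in> W i" using that sub by blast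
      then have "?A' (F i v) = F i (?c *c ?A v)"
        using a B'_F[OF i] by (simp add: clin_scale[OF clin_F, symmetric] cscale_cscale)
      moreover have "x' (Suc (Suc m)) *c F i v = F i (?c *c (?x *c v))"
        by (simp add: xl clin_scale[OF clin_F, symmetric] cscale_cscale)
      ultimately show ?thesis by (simp add: clin_diff[OF clin_F] cv.scale_right_diff_distrib)
    qed
    have "img ?A' x' V' (Suc (Suc m)) = (\<lambda>y. ?A' y - x' (Suc (Suc m)) *c y) ` F i ` ?I"
      using Suc by simp
    also have "\<dots> = F i ` (\<lambda>v. ?c *c v) ` (\<lambda>v. ?A v - ?x *c v) ` ?I"
      unfolding image_image using pt by (intro image_cong) auto
    also have "(\<lambda>v. ?c *c v) ` (\<lambda>v. ?A v - ?x *c v) ` ?I = (\<lambda>v. ?A v - ?x *c v) ` ?I"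
      using image_cscale[OF subspace_image[OF clin_shift[OF cA] fsubD[OF img_fsub[OF cA V]]] c] .
    finally show ?case by simp
  qed
  show ?thesis unfolding step
  proof (rule dim_image_inj[OF clin_F img_fsub[OF cA V]])
    show "v = 0" if "v \<in> img ?A x V (Suc m)" "F i v = 0" for v
      using F_inj[OF irr n i subsetD[OF sub that(1)] that(2)] .
  qed
qed

end


section \<open>Positivity of roots\<close>

locale graph =
  fixes I :: "'v set" and E :: "('v \<times> 'v) set"
  assumes finI: "finite I" and symE: "\<And>u v. (u, v) \<in> E \<Longrightarrow> (v, u) \<in> E" and irr: "\<And>u. (u, u) \<notin> E"
begin

definition cartan :: "'v \<Rightarrow> 'v \<Rightarrow> int" where
  "cartan u v = (if u = v then 2 else if (u, v) \<in> E then - 1 else 0)"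

abbreviation pr :: "('v \<Rightarrow> int) \<Rightarrow> 'v \<Rightarrow> int" where "pr a v \<equiv> bilin_form I E a (coord_vec v)"
abbreviation s :: "'v \<Rightarrow> ('v \<Rightarrow> int) \<Rightarrow> 'v \<Rightarrow> int" where "s \<equiv> reflection I E"

lemma cartan_sym: "cartan u v = cartan v u"
  using symE by (auto simp: cartan_def)

lemma sum_coord: "v \<in> I \<Longrightarrow> (\<Sum>w\<in>I. f w * coord_vec v w) = f v"
proof -
  assume v: "v \<in> I"
  have "(\<Sum>w\<in>I. f w * coord_vec v w) = (\<Sum>w\<in>I. if w = v then f w else 0)"
    by (intro sum.cong) (auto simp: coord_vec_def)
  then show ?thesis using v finI by simp
qed

lemma pr_eq: "v \<in> I \<Longrightarrow> pr a v = (\<Sum>u\<in>I. cartan u v * a u)"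
  unfolding bilin_form_def cartan_def[symmetric] by (simp add: sum_coord)

lemma form_eq: "bilin_form I E a b = (\<Sum>v\<in>I. pr a v * b v)"
proof -
  have "bilin_form I E a b = (\<Sum>v\<in>I. \<Sum>u\<in>I. cartan u v * a u * b v)"
    unfolding bilin_form_def cartan_def[symmetric] by (rule sum.swap)
  also have "\<dots> = (\<Sum>v\<in>I. pr a v * b v)"   proof (rule sum.cong, simp)
    fix x assume "x \<in> I"
    show "(\<Sum>u\<in>I. cartan u x * a u * b x) = pr a x * b x"
      unfolding pr_eq[OF \<open>x \<in> I\<close>] by (rule sum_distrib_right[symmetric])
  qed
  finally show ?thesis .
qed

lemma form_sym: "bilin_form I E a b = bilin_form I E b a"
  unfolding bilin_form_def by (subst sum.swap) (auto intro!: sum.cong dest: symE simp: mult.commute mult.left_commute)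

lemma pr_coord: "u \<in> I \<Longrightarrow> v \<in> I \<Longrightarrow> pr (coord_vec u) v = cartan u v"
  by (simp add: pr_eq sum_coord cartan_sym)

lemma pr_comb: "v \<in> I \<Longrightarrow> pr (\<lambda>u. x * a u + y * b u) v = x * pr a v + y * pr b v"
  by (simp add: pr_eq sum.distrib sum_distrib_left algebra_simps)

lemma s_apply: "s v a u = a u - pr a v * coord_vec v u"
  by (simp add: reflection_def)

lemma pr_s: "v \<in> I \<Longrightarrow> w \<in> I \<Longrightarrow> pr (s v a) w = pr a w - pr a v * cartan v w"
  using pr_comb[of w 1 a "- pr a v" "coord_vec v"] by (simp add: reflection_def pr_coord)

lemma s_s: "v \<in> I \<Longrightarrow> s v (s v a) = a"
  by (simp add: fun_eq_iff s_apply pr_s) (simp add: cartan_def)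

lemma s_comb: "v \<in> I \<Longrightarrow> s v (\<lambda>u. x * a u + y * b u) = (\<lambda>u. x * s v a u + y * s v b u)"
  by (simp add: fun_eq_iff s_apply pr_comb algebra_simps)

lemma s_coord: "v \<in> I \<Longrightarrow> w \<in> I \<Longrightarrow> s v (coord_vec w) = (\<lambda>u. coord_vec w u - cartan w v * coord_vec v u)"
  by (simp add: fun_eq_iff s_apply pr_coord)

lemma form_s: "v \<in> I \<Longrightarrow> bilin_form I E (s v a) b = bilin_form I E a b - pr a v * pr b v"
proof -
  assume v: "v \<in> I"
  have "bilin_form I E (s v a) b = (\<Sum>w\<in>I. pr a w * b w) - pr a v * (\<Sum>w\<in>I. cartan v w * b w)"
    by (subst form_eq) (use v in \<open>simp add: pr_s left_diff_distrib sum_subtractf sum_distrib_left mult.assoc\<close>)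
  also have "(\<Sum>w\<in>I. cartan v w * b w) = pr b v" using v by (simp add: pr_eq cartan_sym)
  finally show ?thesis by (simp add: form_eq[symmetric])
qed

lemma form_s_s: "v \<in> I \<Longrightarrow> bilin_form I E (s v a) (s v a) = bilin_form I E a a"
  using form_s[of v a "s v a"] form_s[of v a a] form_sym[of a "s v a"] pr_s[of v v a]
  by (simp add: cartan_def)

lemma s_commute: "u \<in> I \<Longrightarrow> v \<in> I \<Longrightarrow> cartan u v = 0 \<Longrightarrow> s u (s v a) = s v (s u a)"
  using cartan_sym[of u v] by (simp add: fun_eq_iff s_apply pr_s)

lemma s_braid: "u \<in> I \<Longrightarrow> v \<in> I \<Longrightarrow> cartan u v = - 1 \<Longrightarrow> s u (s v (s u a)) = s v (s u (s v a))"
  using cartan_sym[of u v] by (simp add: fun_eq_iff s_apply pr_s) (simp add: cartan_def algebra_simps)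

section \<open>Words in the simple reflections and the signs of roots\<close>

definition act :: "'v list \<Rightarrow> ('v \<Rightarrow> int) \<Rightarrow> 'v \<Rightarrow> int" where
  "act ws = foldr s ws"

lemma act_simps: "act [] a = a" "act (v # ws) a = s v (act ws a)" "act (us @ ws) a = act us (act ws a)"
  by (simp_all add: act_def)

lemma act_comb: "set ws \<subseteq> I \<Longrightarrow> act ws (\<lambda>u. x * a u + y * b u) = (\<lambda>u. x * act ws a u + y * act ws b u)"
  by (induction ws) (auto simp: act_simps s_comb)

lemma act_rev: "set ws \<subseteq> I \<Longrightarrow> act (rev ws) (act ws a) = a"
  by (induction ws arbitrary: a) (auto simp: act_simps s_s)

lemma act_form: "set ws \<subseteq> I \<Longrightarrow> bilin_form I E (act ws a) (act ws a) = bilin_form I E a a"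
  by (induction ws) (auto simp: act_simps form_s_s)

lemma s_lattice: "v \<in> I \<Longrightarrow> a \<in> root_lattice I \<Longrightarrow> s v a \<in> root_lattice I"
  by (auto simp: root_lattice_def s_apply coord_vec_def)

lemma act_lattice: "set ws \<subseteq> I \<Longrightarrow> a \<in> root_lattice I \<Longrightarrow> act ws a \<in> root_lattice I"
  by (induction ws) (auto simp: act_simps s_lattice)

text \<open>Reflections are involutions, so the inverse of a word is the reversed word and words
  already exhaust the group.\<close>

lemma weyl_group_words: "weyl_group I E = {act ws | ws. set ws \<subseteq> I}"
proof (intro antisym subsetI)
  fix f assume "f \<in> weyl_group I E"
  then show "f \<in> {act ws | ws. set ws \<subseteq> I}"
  proof induction
    case one
    have "id = act []" by (simp add: fun_eq_iff act_simps)
    then show ?case by fastforce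
  next
    case (refl v)
    have "s v = act [v]" by (simp add: fun_eq_iff act_simps)
    then show ?case using refl by fastforce
  next
    case (inverse f)
    then obtain ws where ws: "f = act ws" "set ws \<subseteq> I" by blast
    have 1: "act (rev ws) (act ws a) = a" "act ws (act (rev ws) a) = a" for a
      using act_rev[of ws a] act_rev[of "rev ws" a] ws by auto
    have "inv_into UNIV f = act (rev ws)"
      unfolding ws using 1 by (intro inv_unique_comp) (auto simp: fun_eq_iff)
    then show ?case using ws(2) by (intro CollectI exI[of _ "rev ws"]) auto
  next
    case (comp f h)
    then obtain us ws where "f = act us" "set us \<subseteq> I" "h = act ws" "set ws \<subseteq> I" by blast
    moreover then have "f \<circ> h = act (us @ ws)" by (intro ext) (simp add: act_simps)
    ultimately show ?case by (intro CollectI exI[of _ "us @ ws"]) auto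
  qed
next
  fix f assume "f \<in> {act ws | ws. set ws \<subseteq> I}"
  then obtain ws where f: "f = act ws" and "set ws \<subseteq> I" by blast
  from this(2) have "act ws \<in> weyl_group I E"
  proof (induction ws)
    case Nil
    have "act [] = id" by (simp add: fun_eq_iff act_simps)
    then show ?case using weyl_group.one[of I E] by (simp only:)
  next
    case (Cons v ws)
    have "act (v # ws) = s v \<circ> act ws" by (simp add: fun_eq_iff act_simps)
    moreover have "s v \<circ> act ws \<in> weyl_group I E" using Cons by (intro weyl_group.comp weyl_group.refl) auto
    ultimately show ?case by (simp only:)
  qed
  then show "f \<in> weyl_group I E" using f by simp
qed

text \<open>The Coxeter length, a function of the group element and not of a word for it.\<close>

definition len :: "(('v \<Rightarrow> int) \<Rightarrow> 'v \<Rightarrow> int) \<Rightarrow> nat" where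
  "len f = (LEAST n. \<exists>ws. length ws = n \<and> set ws \<subseteq> I \<and> act ws = f)"

lemma len_le: "set ws \<subseteq> I \<Longrightarrow> len (act ws) \<le> length ws"
  unfolding len_def by (rule Least_le) blast

lemma len_word: "set ws \<subseteq> I \<Longrightarrow> \<exists>us. length us = len (act ws) \<and> set us \<subseteq> I \<and> act us = act ws"
  unfolding len_def by (rule LeastI_ex) blast

lemma len_append: "set us \<subseteq> I \<Longrightarrow> set ws \<subseteq> I \<Longrightarrow> len (act (us @ ws)) \<le> len (act us) + length ws"
proof -
  assume a: "set us \<subseteq> I" "set ws \<subseteq> I"
  obtain us' where u: "length us' = len (act us)" "set us' \<subseteq> I" "act us' = act us" using len_word[OF a(1)] by blast
  have "act (us @ ws) = act (us' @ ws)" using u(3) by (simp add: fun_eq_iff act_simps)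
  then show ?thesis using len_le[of "us' @ ws"] u a by simp
qed

definition nonneg :: "('v \<Rightarrow> int) \<Rightarrow> bool" where "nonneg a \<longleftrightarrow> (\<forall>u. 0 \<le> a u)"

lemma reduced_last:
  assumes "set ws \<subseteq> I" "len (act ws) > 0"
  obtains us t where "set us \<subseteq> I" "t \<in> I" "act ws = act (us @ [t])" "Suc (len (act us)) = len (act ws)"
proof -
  obtain vs where vs: "length vs = len (act ws)" "set vs \<subseteq> I" "act vs = act ws" using len_word[OF assms(1)] by blast
  then have "vs \<noteq> []" using assms(2) by auto
  then obtain us t where ut: "vs = us @ [t]" by (metis append_butlast_last_id)
  then have I: "set us \<subseteq> I" "t \<in> I" using vs by auto
  have "len (act us) \<le> length us" using len_le I by blast
  moreover have "len (act ws) \<le> len (act us) + 1" using len_append[of us "[t]"] vs ut I by simp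
  ultimately show ?thesis using that[OF I] vs ut by simp
qed

lemma act_append_cong: "act us = act vs \<Longrightarrow> act (us @ ws) = act (vs @ ws)"
  by (simp add: fun_eq_iff act_simps)

lemma act_cancel: "t \<in> I \<Longrightarrow> act (us @ [t, t]) = act us"
  by (simp add: fun_eq_iff act_simps s_s)

text \<open>The basic positivity theorem for Coxeter groups, by induction on the length. After
  splitting off a last letter \<open>t\<close>, only the relation between \<open>t\<close> and
  \<open>v\<close> enters, and in a simple graph the two reflections either commute or satisfy the
  braid relation of order 3.\<close>

lemma act_coord_nonneg:
  assumes "set ws \<subseteq> I" "v \<in> I" "len (act (ws @ [v])) \<ge> len (act ws)"
  shows "nonneg (act ws (coord_vec v))"
  using assms
proof (induction "len (act ws)" arbitrary: ws v rule: less_induct)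
  case less
  note v = less.prems(2)
  show ?case
  proof (cases "len (act ws) = 0")
    case True
    then have "act ws = act []" using len_word[OF less.prems(1)] by auto
    then show ?thesis by (simp add: act_simps nonneg_def coord_vec_def)
  next
    case False
    then obtain us t where us: "set us \<subseteq> I" and t: "t \<in> I" and eq: "act ws = act (us @ [t])"
        and l: "Suc (len (act us)) = len (act ws)"
      using reduced_last[OF less.prems(1)] by auto
    have wv: "act (ws @ [v]) = act (us @ [t, v])" using act_append_cong[OF eq, of "[v]"] by simp
    have "v \<noteq> t"
    proof
      assume "v = t"
      then have "act (ws @ [v]) = act us" using wv act_cancel[OF t] by simp
      then show False using less.prems(3) l by simp
    qed
    then have "cartan t v = 0 \<or> cartan t v = - 1" by (simp add: cartan_def)
    then show ?thesis
    proof
      assume c: "cartan t v = 0"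
      have "act (us @ [t, v]) = act ((us @ [v]) @ [t])"
        by (intro ext) (simp add: act_simps s_commute[OF t v c])
      then have "len (act (ws @ [v])) \<le> len (act (us @ [v])) + 1"
        using len_append[of "us @ [v]" "[t]"] us t v wv by simp
      then have "nonneg (act us (coord_vec v))" using less.prems(3) l by (intro less.hyps us v) auto
      moreover have "act ws (coord_vec v) = act us (coord_vec v)"
        using eq s_coord[OF t v] c cartan_sym[of t v] by (simp add: act_simps)
      ultimately show ?thesis by simp
    next
      assume c: "cartan t v = - 1"
      have st: "s t (coord_vec v) = (\<lambda>u. 1 * coord_vec v u + 1 * coord_vec t u)"
        using s_coord[OF t v] c cartan_sym[of t v] by simp
      have sum: "act ws (coord_vec v) = (\<lambda>u. act us (coord_vec v) u + act us (coord_vec t) u)"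
        using eq act_comb[OF us, of 1 "coord_vec v" 1 "coord_vec t"] by (simp add: act_simps st)
      have post: "nonneg (act us (coord_vec t))" using eq l by (intro less.hyps us t) auto
      show ?thesis
      proof (cases "len (act (us @ [v])) \<ge> len (act us)")
        case True
        then have "nonneg (act us (coord_vec v))" using l by (intro less.hyps us v) auto
        then show ?thesis using post sum by (simp add: nonneg_def)
      next
        \<comment> \<open>Now \<open>us\<close> followed by \<open>v\<close> is shorter than
          \<open>us\<close>, and it maps \<open>coord_vec t\<close> to the vector in question. The
          braid relation supplies the length condition for the induction hypothesis.\<close>
        case False
        let ?xs = "us @ [v]"
        have xs: "set ?xs \<subseteq> I" using us v by simp
        have "act ((?xs @ [t]) @ [v, t]) = act (us @ [t, v])"
          by (intro ext) (simp add: act_simps s_braid[OF t v c, symmetric] s_s[OF t])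
        then have "len (act (ws @ [v])) \<le> len (act (?xs @ [t])) + 2"
          using len_append[of "?xs @ [t]" "[v, t]"] us t v wv by simp
        then have "nonneg (act ?xs (coord_vec t))"
          using less.prems(3) l False by (intro less.hyps xs t) auto
        moreover have "s v (coord_vec t) = (\<lambda>u. 1 * coord_vec v u + 1 * coord_vec t u)"
          using s_coord[OF v t] c by (simp add: add.commute)
        then have "act ?xs (coord_vec t) = act ws (coord_vec v)"
          using sum act_comb[OF us, of 1 "coord_vec v" 1 "coord_vec t"] by (simp add: act_simps)
        ultimately show ?thesis by simp
      qed
    qed
  qed
qed

lemma real_root_sign:
  assumes "set ws \<subseteq> I" "v \<in> I"
  shows "nonneg (act ws (coord_vec v)) \<or> nonneg (\<lambda>u. - act ws (coord_vec v) u)"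
proof (cases "len (act (ws @ [v])) \<ge> len (act ws)")
  case True then show ?thesis using act_coord_nonneg[OF assms] by blast
next
  case False
  have "len (act ((ws @ [v]) @ [v])) \<ge> len (act (ws @ [v]))"
    using False act_cancel[OF assms(2), of ws] by simp
  then have "nonneg (act (ws @ [v]) (coord_vec v))"
    using act_coord_nonneg[of "ws @ [v]" v] assms by simp
  moreover have "s v (coord_vec v) = (\<lambda>u. (- 1) * coord_vec v u + 0 * coord_vec v u)"
    using s_coord[OF assms(2,2)] by (simp add: cartan_def fun_eq_iff)
  then have "act (ws @ [v]) (coord_vec v) = (\<lambda>u. - act ws (coord_vec v) u)"
    using act_comb[OF assms(1), of "- 1" "coord_vec v" 0 "coord_vec v"] by (simp add: act_simps)
  ultimately show ?thesis by simp
qed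

text \<open>Induction on the length: as the form at a vertex is nonpositive on the fundamental
  region, the last reflection adds a nonnegative multiple of a coordinate vector, whose image under
  the shorter element is nonnegative.\<close>

lemma act_fundamental_nonneg:
  assumes "set ws \<subseteq> I" and a: "a \<in> fundamental_region I E"
  shows "nonneg (act ws a)"
  using assms(1)
proof (induction "len (act ws)" arbitrary: ws rule: less_induct)
  case less
  show ?case
  proof (cases "len (act ws) = 0")
    case True
    then have "act ws = act []" using len_word[OF less.prems] by auto
    then show ?thesis using a
      by (auto simp: act_simps nonneg_def fundamental_region_def root_lattice_def)
  next
    case False
    then obtain us t where us: "set us \<subseteq> I" and t: "t \<in> I" and eq: "act ws = act (us @ [t])"
        and l: "Suc (len (act us)) = len (act ws)"
      using reduced_last[OF less.prems] by auto
    have 1: "nonneg (act us (coord_vec t))" using eq l by (intro act_coord_nonneg us t) auto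
    have 2: "nonneg (act us a)" using l by (intro less.hyps us) auto
    have "s t a = (\<lambda>u. 1 * a u + (- pr a t) * coord_vec t u)" by (simp add: fun_eq_iff s_apply)
    then have "act ws a = (\<lambda>u. act us a u + (- pr a t) * act us (coord_vec t) u)"
      using eq act_comb[OF us, of 1 a "- pr a t" "coord_vec t"] by (simp add: act_simps)
    moreover have "- pr a t \<ge> 0" using a t by (auto simp: fundamental_region_def)
    then have "0 \<le> act us a u + (- pr a t) * act us (coord_vec t) u" for u
      using 1 2 by (intro add_nonneg_nonneg mult_nonneg_nonneg) (auto simp: nonneg_def)
    ultimately show ?thesis unfolding nonneg_def by (simp only:) blast
  qed
qed

lemma coord_lattice: "v \<in> I \<Longrightarrow> coord_vec v \<in> root_lattice I"
  by (auto simp: root_lattice_def coord_vec_def)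

lemma real_roots_words: "real_roots I E = {act ws (coord_vec v) | ws v. set ws \<subseteq> I \<and> v \<in> I}"
  unfolding real_roots_def weyl_group_words by blast

lemma real_root_lattice: "b \<in> real_roots I E \<Longrightarrow> b \<in> root_lattice I"
  using act_lattice coord_lattice by (auto simp: real_roots_words)

lemma real_root_form: "b \<in> real_roots I E \<Longrightarrow> bilin_form I E b b = 2"
  using act_form by (auto simp: real_roots_words pr_coord cartan_def)

lemma real_root_reflect:
  assumes "b \<in> real_roots I E" "v \<in> I" shows "s v b \<in> real_roots I E"
proof -
  obtain ws u where "b = act ws (coord_vec u)" "set ws \<subseteq> I" "u \<in> I"
    using assms(1) unfolding real_roots_words by blast
  then show ?thesis unfolding real_roots_words
    using assms(2) by (intro CollectI exI[of _ "v # ws"] exI[of _ u]) (simp add: act_simps)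
qed

lemma coord_positive_real: "v \<in> I \<Longrightarrow> coord_vec v \<in> positive_real_roots I E"
  unfolding positive_real_roots_def real_roots_words
  by (auto simp: coord_vec_def intro!: exI[of _ "[]"] exI[of _ v] simp: act_simps)

text \<open>A positive real root other than \<open>coord_vec v\<close> has a positive coordinate
  away from \<open>v\<close>, because a nonnegative multiple of \<open>coord_vec v\<close> with norm
  2 is \<open>coord_vec v\<close> itself. The reflection does not change that coordinate, and a real
  root has a sign.\<close>

lemma real_root_reflect_positive:
  assumes b: "b \<in> positive_real_roots I E" and v: "v \<in> I" and ne: "b \<noteq> coord_vec v"
  shows "s v b \<in> positive_real_roots I E"
proof -
  have br: "b \<in> real_roots I E" and pos: "\<forall>u\<in>I. 0 \<le> b u" using b by (auto simp: positive_real_roots_def)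
  have sr: "s v b \<in> real_roots I E" using real_root_reflect[OF br v] .
  have "\<exists>u\<in>I. u \<noteq> v \<and> b u > 0"
  proof (rule ccontr)
    assume "\<not> ?thesis"
    then have z: "b u = 0" if "u \<noteq> v" for u
      using pos that real_root_lattice[OF br] by (cases "u \<in> I") (force simp: root_lattice_def)+
    then have bc: "b = (\<lambda>u. b v * coord_vec v u + 0 * coord_vec v u)" by (auto simp: fun_eq_iff coord_vec_def)
    have "pr b v = 2 * b v" by (subst bc) (use v in \<open>simp only: pr_comb pr_coord cartan_def\<close>, simp)
    moreover have "bilin_form I E b b = pr b v * b v"
      using z finI by (subst form_eq) (subst sum.remove[OF finI v], auto)
    ultimately have "b v * b v = 1" using real_root_form[OF br] by simp
    then have "b v = 1" using pos v zmult_eq_1_iff[of "b v" "b v"] by fastforce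
    then have "b = coord_vec v" using z by (auto simp: fun_eq_iff coord_vec_def)
    then show False using ne by simp
  qed
  then obtain u where u: "u \<in> I" "u \<noteq> v" "b u > 0" by blast
  then have "s v b u > 0" by (simp add: s_apply coord_vec_def)
  moreover have "nonneg (s v b) \<or> nonneg (\<lambda>u. - s v b u)"
    using sr real_root_sign unfolding real_roots_words by (elim CollectE exE conjE) (simp only:)
  ultimately have "nonneg (s v b)" unfolding nonneg_def by (metis neg_0_le_iff_le not_le)
  then show ?thesis using sr by (auto simp: positive_real_roots_def nonneg_def)
qed

text \<open>The negated form of an imaginary root cannot be nonnegative: its negative is nonnegative
  as well, and it is not zero.\<close>

lemma imaginary_positive:
  assumes "b \<in> imaginary_roots I E" "\<forall>u\<in>I. 0 \<le> b u"
  obtains ws a where "set ws \<subseteq> I" "a \<in> fundamental_region I E" "b = act ws a"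
proof -
  consider ws a where "set ws \<subseteq> I" "a \<in> fundamental_region I E" "b = act ws a"
    | ws a where "set ws \<subseteq> I" "a \<in> fundamental_region I E" "b = (\<lambda>u. - act ws a u)"
    using assms(1) unfolding imaginary_roots_def weyl_group_words by blast
  then show ?thesis
  proof cases
    case 1 then show ?thesis using that by blast
  next
    case 2
    have "a \<in> root_lattice I" using 2(2) by (simp add: fundamental_region_def)
    then have L: "act ws a \<in> root_lattice I" using act_lattice 2(1) by blast
    have "nonneg (act ws a)" using act_fundamental_nonneg 2 by blast
    have "act ws a u = 0" for u
    proof (cases "u \<in> I")
      case True
      then have "0 \<le> - act ws a u" using assms(2) 2(3) by blast
      moreover have "0 \<le> act ws a u" using \<open>nonneg (act ws a)\<close> by (simp add: nonneg_def)
      ultimately show ?thesis by linarith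
    qed (use L in \<open>simp add: root_lattice_def\<close>)
    then have "act ws a = (\<lambda>u. 0 * a u + 0 * a u)" by (simp add: fun_eq_iff)
    then have "act (rev ws) (act ws a) = (\<lambda>u. 0)" using act_comb[of "rev ws" 0 a 0 a] 2(1) by simp
    then have "a = (\<lambda>u. 0)" using act_rev[OF 2(1)] by simp
    then show ?thesis using 2(2) by (simp add: fundamental_region_def)
  qed
qed

lemma fundamental_imaginary:
  "set ws \<subseteq> I \<Longrightarrow> a \<in> fundamental_region I E \<Longrightarrow> act ws a \<in> positive_roots I E"
  using act_fundamental_nonneg unfolding positive_roots_def roots_def imaginary_roots_def weyl_group_words nonneg_def
  by blast

lemma positive_real_root: "b \<in> positive_real_roots I E \<Longrightarrow> b \<in> positive_roots I E"
  by (auto simp: positive_real_roots_def positive_roots_def roots_def)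

lemma root_reflect_positive:
  assumes b: "b \<in> positive_roots I E" and v: "v \<in> I" and ne: "b \<noteq> coord_vec v"
  shows "s v b \<in> positive_roots I E"
proof (cases "b \<in> real_roots I E")
  case True
  then have "b \<in> positive_real_roots I E" using b by (auto simp: positive_real_roots_def positive_roots_def)
  then show ?thesis using real_root_reflect_positive[OF _ v ne] positive_real_root by blast
next
  case False
  then have "b \<in> imaginary_roots I E" "\<forall>u\<in>I. 0 \<le> b u" using b by (auto simp: positive_roots_def roots_def)
  then obtain ws a where wa: "set ws \<subseteq> I" "a \<in> fundamental_region I E" "b = act ws a" by (rule imaginary_positive)
  then have "s v b = act (v # ws) a" by (simp add: act_simps)
  then show ?thesis using fundamental_imaginary[of "v # ws" a] wa v by simp
qed

lemma positive_root_lattice: "b \<in> positive_roots I E \<Longrightarrow> b \<in> root_lattice I"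
proof -
  assume b: "b \<in> positive_roots I E"
  show ?thesis
  proof (cases "b \<in> real_roots I E")
    case False
    then have "b \<in> imaginary_roots I E" "\<forall>u\<in>I. 0 \<le> b u" using b by (auto simp: positive_roots_def roots_def)
    then obtain ws a where "set ws \<subseteq> I" "a \<in> fundamental_region I E" "b = act ws a" by (rule imaginary_positive)
    then show ?thesis using act_lattice by (auto simp: fundamental_region_def)
  qed (rule real_root_lattice)
qed

lemma positive_root_nonzero:
  assumes b: "b \<in> positive_roots I E" shows "\<exists>u\<in>I. 0 < b u"
proof (rule ccontr)
  assume n: "\<not> ?thesis"
  have "b u = 0" for u
    using n b positive_root_lattice[OF b] by (cases "u \<in> I") (force simp: positive_roots_def root_lattice_def)+
  then have b0: "b = (\<lambda>u. 0)" by (simp add: fun_eq_iff)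
  show False
  proof (cases "b \<in> real_roots I E")
    case True
    then show False using real_root_form[OF True] b0 by (simp add: bilin_form_def)
  next
    case False
    then have "b \<in> imaginary_roots I E" "\<forall>u\<in>I. 0 \<le> b u" using b by (auto simp: positive_roots_def roots_def)
    then obtain ws a where wa: "set ws \<subseteq> I" "a \<in> fundamental_region I E" "b = act ws a" by (rule imaginary_positive)
    have "a = act (rev ws) (\<lambda>u. 0 * a u + 0 * a u)" using act_rev[OF wa(1), of a] wa(3) b0 by simp
    then have "a = (\<lambda>u. 0)" using act_comb[of "rev ws" 0 a 0 a] wa(1) by simp
    then show False using wa(2) by (simp add: fundamental_region_def)
  qed
qed

section \<open>The condition on decompositions under reflections\<close>

definition nondecomposable :: "(('v \<Rightarrow> int) \<Rightarrow> complex) \<Rightarrow> ('v \<Rightarrow> int) \<Rightarrow> bool" where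
  "nondecomposable \<chi> a \<longleftrightarrow> \<not> (\<exists>bs. length bs \<ge> 2 \<and> set bs \<subseteq> positive_roots I E \<and>
     a = (\<lambda>v. \<Sum>b\<leftarrow>bs. b v) \<and> (\<forall>b\<in>set bs. \<chi> b = 1))"

text \<open>The right-hand side of the theorem with the character as a parameter, so that it can
  follow the change of \<open>\<xi>\<close> under reflections.\<close>

definition good :: "(('v \<Rightarrow> int) \<Rightarrow> complex) \<Rightarrow> ('v \<Rightarrow> int) \<Rightarrow> bool" where
  "good \<chi> a \<longleftrightarrow> a \<in> positive_real_roots I E \<and> \<chi> a = 1 \<and> nondecomposable \<chi> a"

lemma s_sum_list: "v \<in> I \<Longrightarrow> s v (\<lambda>u. \<Sum>b\<leftarrow>bs. b u) = (\<lambda>u. \<Sum>b\<leftarrow>bs. s v b u)"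
proof (induction bs)
  case Nil
  then show ?case using s_comb[of v 0 "\<lambda>u. 0" 0 "\<lambda>u. 0"] by simp
next
  case (Cons b bs)
  then show ?case using s_comb[of v 1 b 1 "\<lambda>u. \<Sum>b\<leftarrow>bs. b u"] by simp
qed

text \<open>A decomposition of \<open>s v a\<close> reflects term by term to one of
  \<open>a\<close>. The only positive root that would become negative is \<open>coord_vec v\<close>,
  and it does not occur because its character value is not 1.\<close>

lemma good_reflect:
  assumes good: "good \<chi>' a" and v: "v \<in> I" and ne: "a \<noteq> coord_vec v"
    and eq: "\<And>b. b \<in> root_lattice I \<Longrightarrow> \<chi>' (s v b) = \<chi> b" and v1: "\<chi> (coord_vec v) \<noteq> 1"
  shows "good \<chi> (s v a)"
  unfolding good_def nondecomposable_def
proof (intro conjI notI)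
  have a: "a \<in> positive_real_roots I E" "\<chi>' a = 1" "nondecomposable \<chi>' a" using good by (auto simp: good_def)
  show sa: "s v a \<in> positive_real_roots I E" using real_root_reflect_positive[OF a(1) v ne] .
  have "s v a \<in> root_lattice I" using sa real_root_lattice by (auto simp: positive_real_roots_def)
  then show "\<chi> (s v a) = 1" using eq[of "s v a"] s_s[OF v] a(2) by simp
  assume "\<exists>bs. length bs \<ge> 2 \<and> set bs \<subseteq> positive_roots I E \<and>
     s v a = (\<lambda>v. \<Sum>b\<leftarrow>bs. b v) \<and> (\<forall>b\<in>set bs. \<chi> b = 1)"
  then obtain bs where bs: "length bs \<ge> 2" "set bs \<subseteq> positive_roots I E"
     "s v a = (\<lambda>v. \<Sum>b\<leftarrow>bs. b v)" "\<forall>b\<in>set bs. \<chi> b = 1" by blast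
  let ?cs = "map (s v) bs"
  have "set ?cs \<subseteq> positive_roots I E" using bs(2,4) v1 root_reflect_positive[OF _ v] by auto
  moreover have "\<forall>c\<in>set ?cs. \<chi>' c = 1" using bs(2,4) eq positive_root_lattice by auto
  moreover have "a = (\<lambda>u. \<Sum>b\<leftarrow>?cs. b u)"
    using arg_cong[OF bs(3), of "s v"] s_sum_list[OF v, of bs] s_s[OF v] by (simp add: comp_def)
  moreover have "length ?cs \<ge> 2" using bs(1) by simp
  ultimately show False using a(3) unfolding nondecomposable_def by blast
qed

text \<open>Otherwise \<open>s v a\<close> together with \<open>pr a v\<close> copies of
  \<open>coord_vec v\<close> is a forbidden decomposition of \<open>a\<close>.\<close>

lemma good_character:
  assumes good: "good \<chi> a" and v: "v \<in> I" and ne: "a \<noteq> coord_vec v" and pos: "pr a v > 0"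
    and hom: "\<And>b c. \<chi> (\<lambda>u. b u + c u) = \<chi> b * \<chi> c"
  shows "\<chi> (coord_vec v) \<noteq> 1"
proof
  assume v1: "\<chi> (coord_vec v) = 1"
  let ?t = "nat (pr a v)"
  let ?bs = "s v a # replicate ?t (coord_vec v)"
  have a: "a \<in> positive_real_roots I E" "\<chi> a = 1" "nondecomposable \<chi> a" using good by (auto simp: good_def)
  have sum: "a = (\<lambda>u. \<Sum>b\<leftarrow>?bs. b u)"
    using pos by (simp add: fun_eq_iff sum_list_replicate s_apply)
  have \<chi>sum: "\<chi> (\<lambda>u. b u + (\<Sum>c\<leftarrow>replicate m (coord_vec v). c u)) = \<chi> b" for b m
  proof (induction m arbitrary: b)
    case (Suc m)
    have "(\<lambda>u. b u + (\<Sum>c\<leftarrow>replicate (Suc m) (coord_vec v). c u)) =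
      (\<lambda>u. (b u + coord_vec v u) + (\<Sum>c\<leftarrow>replicate m (coord_vec v). c u))" by (simp add: add.assoc)
    then show ?case using Suc[of "\<lambda>u. b u + coord_vec v u"] hom[of b "coord_vec v"] v1 by simp
  qed simp
  have "\<chi> (s v a) = 1" using \<chi>sum[of "s v a" ?t] sum a(2) by simp
  moreover have "set ?bs \<subseteq> positive_roots I E"
    using positive_real_root[OF real_root_reflect_positive[OF a(1) v ne]]
      positive_real_root[OF coord_positive_real[OF v]] by auto
  moreover have "length ?bs \<ge> 2" using pos by simp
  moreover have "\<forall>b\<in>set ?bs. \<chi> b = 1" using calculation(1) v1 by auto
  ultimately show False using a(3) sum unfolding nondecomposable_def by blast
qed

text \<open>Each positive root has coordinate sum at least 1, so two of them cannot add up to a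
  coordinate vector.\<close>

lemma good_coord:
  assumes v: "v \<in> I" and 1: "\<chi> (coord_vec v) = 1"
  shows "good \<chi> (coord_vec v)"
  unfolding good_def nondecomposable_def
proof (intro conjI notI)
  show "coord_vec v \<in> positive_real_roots I E" using coord_positive_real[OF v] .
  show "\<chi> (coord_vec v) = 1" by (rule 1)
  assume "\<exists>bs. length bs \<ge> 2 \<and> set bs \<subseteq> positive_roots I E \<and>
     coord_vec v = (\<lambda>v. \<Sum>b\<leftarrow>bs. b v) \<and> (\<forall>b\<in>set bs. \<chi> b = 1)"
  then obtain bs where bs: "length bs \<ge> 2" "set bs \<subseteq> positive_roots I E"
     "coord_vec v = (\<lambda>v. \<Sum>b\<leftarrow>bs. b v)" by blast
  have size: "1 \<le> (\<Sum>u\<in>I. b u)" if b: "b \<in> positive_roots I E" for b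
  proof -
    obtain u where u: "u \<in> I" "0 < b u" using positive_root_nonzero[OF b] by blast
    have "b u \<le> (\<Sum>u\<in>I. b u)" using b u(1) finI by (intro member_le_sum) (auto simp: positive_roots_def)
    then show ?thesis using u by linarith
  qed
  have "set bs \<subseteq> positive_roots I E \<Longrightarrow> int (length bs) \<le> (\<Sum>u\<in>I. \<Sum>b\<leftarrow>bs. b u)" for bs
  proof (induction bs)
    case (Cons b bs)
    then show ?case using size[of b] by (simp add: sum.distrib)
  qed simp
  from this[OF bs(2)] have "int (length bs) \<le> (\<Sum>u\<in>I. coord_vec v u)" by (simp only: bs(3))
  also have "\<dots> = 1" using v finI by (simp add: coord_vec_def)
  finally show False using bs(1) by simp
qed

end


section \<open>The star-shaped graph\<close>

lemma prod_swap_at: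
  fixes f :: "nat \<Rightarrow> 'b::comm_monoid_mult"
  assumes "1 \<le> j" "Suc j \<le> m"
  shows "(\<Prod>l=1..m. swap_at j f l) = (\<Prod>l=1..m. f l)"
proof -
  let ?R = "{1..m} - {j, Suc j}"
  have split: "{1..m} = insert j (insert (Suc j) ?R)" using assms by auto
  have "(\<Prod>l\<in>?R. swap_at j f l) = (\<Prod>l\<in>?R. f l)" by (intro prod.cong) (auto simp: swap_at_def)
  then show ?thesis by (subst (1 2) split) (simp add: swap_at_def mult.left_commute)
qed

lemma swap_at_swap_at: "swap_at j (swap_at j x) = x"
  by (auto simp: swap_at_def fun_eq_iff)

lemma prod_powi: "c \<noteq> 0 \<Longrightarrow> (\<Prod>l\<in>L. c powi d l) = (c::complex) powi (\<Sum>l\<in>L. d l)"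
  by (induction L rule: infinite_finite_induct) (auto simp: power_int_add)

text \<open>The convolution multiplies the ratios of \<open>x i j\<close>, \<open>j > 1\<close>, to \<open>x i 1\<close> by \<open>Q\<close>; the factor on the
  first arm restores the product of the operators to \<open>1\<close>.\<close>

definition conv_xi :: "nat \<Rightarrow> (nat \<Rightarrow> nat \<Rightarrow> complex) \<Rightarrow> nat \<Rightarrow> nat \<Rightarrow> complex" where
  "conv_xi k x = (let Q = (\<Prod>i=1..k. x i 1) in
     (\<lambda>i j. x i j * (if i = 1 then inverse (Q\<^sup>2) else 1) * (if j = 1 then 1 else Q)))"

locale star =
  fixes k :: nat and w :: "nat \<Rightarrow> nat"
  assumes w: "\<And>i. i \<in> {1..k} \<Longrightarrow> w i \<ge> 1"
begin

abbreviation "I \<equiv> star_vertices k w"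
abbreviation "E \<equiv> star_edges k w"
abbreviation "ac \<equiv> arm_coord w"

lemma Centre_in: "Centre \<in> I" by (simp add: star_vertices_def)
lemma Arm_in: "Arm i j \<in> I \<longleftrightarrow> i \<in> {1..k} \<and> 1 \<le> j \<and> Suc j \<le> w i" by (auto simp: star_vertices_def)

lemma I_eq: "I = insert Centre ((\<lambda>(i, j). Arm i j) ` (SIGMA i:{1..k}. {1..w i - 1}))"
  by (auto simp: star_vertices_def)

lemma finite_I: "finite I" unfolding I_eq by auto

sublocale graph I E
proof
  show "finite I" by (rule finite_I)
  show "(v, u) \<in> E" if "(u, v) \<in> E" for u v using that by (auto simp: star_edges_def Let_def)
  show "(u, u) \<notin> E" for u by (auto simp: star_edges_def Let_def)
qed

lemma edge_Centre: "u \<in> I \<Longrightarrow> (u, Centre) \<in> E \<longleftrightarrow> (\<exists>i. u = Arm i 1)"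
  by (auto simp: star_edges_def Let_def)

lemma edge_Arm: "u \<in> I \<Longrightarrow> Arm i j \<in> I \<Longrightarrow> (u, Arm i j) \<in> E \<longleftrightarrow>
    (j = 1 \<and> u = Centre) \<or> (j \<noteq> 1 \<and> u = Arm i (j - 1)) \<or> u = Arm i (Suc j)"
  by (cases j) (auto simp: star_edges_def Let_def Arm_in)

lemma sum_I: "(\<Sum>v\<in>I. f v) = f Centre + (\<Sum>i=1..k. \<Sum>j=1..w i - 1. f (Arm i j))"
proof -
  have inj: "inj_on (\<lambda>(i, j). Arm i j) (SIGMA i:{1..k}. {1..w i - 1})" by (auto simp: inj_on_def)
  have "Centre \<notin> (\<lambda>(i, j). Arm i j) ` (SIGMA i:{1..k}. {1..w i - 1})" by auto
  then have "(\<Sum>v\<in>I. f v) = f Centre + (\<Sum>v\<in>(\<lambda>(i, j). Arm i j) ` (SIGMA i:{1..k}. {1..w i - 1}). f v)"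
    unfolding I_eq by (subst sum.insert) auto
  also have "(\<Sum>v\<in>(\<lambda>(i, j). Arm i j) ` (SIGMA i:{1..k}. {1..w i - 1}). f v) =
      (\<Sum>(i, j)\<in>(SIGMA i:{1..k}. {1..w i - 1}). f (Arm i j))"
    by (subst sum.reindex[OF inj]) (simp add: comp_def case_prod_unfold)
  also have "\<dots> = (\<Sum>i=1..k. \<Sum>j=1..w i - 1. f (Arm i j))" by (rule sum.Sigma[symmetric]) auto
  finally show ?thesis .
qed

lemma pr_nbrs: "v \<in> I \<Longrightarrow> pr a v = 2 * a v - (\<Sum>u\<in>{u \<in> I. (u, v) \<in> E}. a u)"
proof -
  assume v: "v \<in> I"
  have "pr a v = (\<Sum>u\<in>I. (if u = v then 2 * a u else 0) - (if (u, v) \<in> E then a u else 0))"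
    unfolding pr_eq[OF v] by (rule sum.cong) (auto simp: cartan_def irr)
  also have "\<dots> = 2 * a v - (\<Sum>u\<in>I. if (u, v) \<in> E then a u else 0)"
    using v finite_I by (simp add: sum_subtractf)
  also have "(\<Sum>u\<in>I. if (u, v) \<in> E then a u else 0) = (\<Sum>u\<in>{u \<in> I. (u, v) \<in> E}. a u)"
    using finite_I by (simp add: sum.inter_filter)
  finally show ?thesis .
qed

lemma pr_Centre: "pr a Centre = 2 * a Centre - (\<Sum>i=1..k. ac a i 1)"
proof -
  have eq: "{u \<in> I. (u, Centre) \<in> E} = (\<lambda>i. Arm i 1) ` {i \<in> {1..k}. w i \<noteq> 1}"
    using edge_Centre w by (force simp: Arm_in)
  have "(\<Sum>u\<in>{u \<in> I. (u, Centre) \<in> E}. a u) = (\<Sum>i\<in>{i \<in> {1..k}. w i \<noteq> 1}. a (Arm i 1))"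
    unfolding eq by (subst sum.reindex) (auto simp: inj_on_def)
  also have "\<dots> = (\<Sum>i=1..k. ac a i 1)"
    by (rule sum.mono_neutral_cong_left) (auto simp: arm_coord_def)
  finally show ?thesis using pr_nbrs[OF Centre_in] by simp
qed

lemma ac_simps: "ac a i 0 = a Centre" "i \<in> {1..k} \<Longrightarrow> ac a i (w i) = 0" "Arm i j \<in> I \<Longrightarrow> ac a i j = a (Arm i j)"
  using w[of i] by (auto simp: arm_coord_def Arm_in)

lemma pr_Arm:
  assumes v: "Arm i j \<in> I"
  shows "pr a (Arm i j) = 2 * ac a i j - ac a i (j - 1) - ac a i (Suc j)"
proof -
  let ?p = "if j = 1 then Centre else Arm i (j - 1)"
  have p: "?p \<in> I" "a ?p = ac a i (j - 1)" using v by (auto simp: Arm_in star_vertices_def arm_coord_def)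
  have nb: "{u \<in> I. (u, Arm i j) \<in> E} = {u \<in> I. u = ?p \<or> u = Arm i (Suc j)}"
    using edge_Arm[OF _ v] by (intro Collect_cong) auto
  have "(\<Sum>u\<in>{u \<in> I. (u, Arm i j) \<in> E}. a u) = ac a i (j - 1) + ac a i (Suc j)"
  proof (cases "Suc j = w i")
    case True
    then have "Arm i (Suc j) \<notin> I" by (auto simp: Arm_in)
    then have "{u \<in> I. (u, Arm i j) \<in> E} = {?p}" unfolding nb using p(1) by (intro equalityI subsetI) auto
    then show ?thesis using p(2) True by (simp add: arm_coord_def)
  next
    case False
    then have n: "Arm i (Suc j) \<in> I" using v by (auto simp: Arm_in)
    then have "{u \<in> I. (u, Arm i j) \<in> E} = {?p, Arm i (Suc j)}" unfolding nb using p(1) by (intro equalityI subsetI) auto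
    moreover have "?p \<noteq> Arm i (Suc j)" by auto
    ultimately show ?thesis using p(2) ac_simps(3)[OF n] by simp
  qed
  then show ?thesis using pr_nbrs[OF v] ac_simps(3)[OF v] by simp
qed

text \<open>Summation by parts. Once \<open>x 0\<close> is the centre and \<open>x (Suc m)\<close>
  is 0, the boundary terms join the centre term and complete the sum of squares.\<close>

lemma arm_form:
  fixes x :: "nat \<Rightarrow> int"
  shows "(\<Sum>j=1..m. (2 * x j - x (j - 1) - x (Suc j)) * x j) =
    (\<Sum>j=1..m. (x (j - 1) - x j)\<^sup>2) - (x 0)\<^sup>2 + x 0 * x 1 + (x m)\<^sup>2 - x m * x (Suc m)"
  by (induction m) (simp_all add: algebra_simps power2_eq_square)

text \<open>The form in terms of the drops along the arms. The squares of the drops on one arm add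
  up to a centraliser dimension, which connects the form with tuples.\<close>

lemma form_star:
  "bilin_form I E a a = 2 * (a Centre)\<^sup>2 - (\<Sum>i=1..k. (a Centre)\<^sup>2 - (\<Sum>j=1..w i. (ac a i (j - 1) - ac a i j)\<^sup>2))"
proof -
  have arm: "(\<Sum>j=1..w i - 1. pr a (Arm i j) * a (Arm i j)) =
      (\<Sum>j=1..w i. (ac a i (j - 1) - ac a i j)\<^sup>2) - (a Centre)\<^sup>2 + a Centre * ac a i 1" if i: "i \<in> {1..k}" for i
  proof -
    obtain m where m: "w i = Suc m" using w[OF i] by (cases "w i") auto
    have "(\<Sum>j=1..w i - 1. pr a (Arm i j) * a (Arm i j)) =
        (\<Sum>j=1..m. (2 * ac a i j - ac a i (j - 1) - ac a i (Suc j)) * ac a i j)"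
    proof (rule sum.cong)
      fix j assume "j \<in> {1..m}"
      then have v: "Arm i j \<in> I" using i m by (auto simp: Arm_in)
      show "pr a (Arm i j) * a (Arm i j) = (2 * ac a i j - ac a i (j - 1) - ac a i (Suc j)) * ac a i j"
        unfolding pr_Arm[OF v] ac_simps(3)[OF v, symmetric] by simp
    qed (simp add: m)
    then show ?thesis using ac_simps(2)[OF i, of a] unfolding arm_form m by (simp add: ac_simps(1))
  qed
  have "bilin_form I E a a = pr a Centre * a Centre + (\<Sum>i=1..k. \<Sum>j=1..w i - 1. pr a (Arm i j) * a (Arm i j))"
    by (subst form_eq) (rule sum_I)
  also have "\<dots> = pr a Centre * a Centre +
      (\<Sum>i=1..k. (\<Sum>j=1..w i. (ac a i (j - 1) - ac a i j)\<^sup>2) - (a Centre)\<^sup>2 + a Centre * ac a i 1)"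
    using arm by (intro arg_cong2[where f="(+)"] sum.cong) auto
  finally show ?thesis unfolding pr_Centre
    by (simp add: sum.distrib sum_subtractf sum_distrib_left power2_eq_square algebra_simps)
qed

lemma ac_s: "v \<in> I \<Longrightarrow> i \<in> {1..k} \<Longrightarrow> j \<le> w i \<Longrightarrow>
    ac (s v a) i j = ac a i j - pr a v * ac (coord_vec v) i j"
  by (auto simp: arm_coord_def s_apply)

lemma ac_coord_Arm: "Arm i j \<in> I \<Longrightarrow> ac (coord_vec (Arm i j)) i' j' = (if i' = i \<and> j' = j then 1 else 0)"
  by (auto simp: arm_coord_def coord_vec_def Arm_in)

lemma ac_coord_Centre: "ac (coord_vec Centre) i j = (if j = 0 then 1 else 0)"
  by (auto simp: arm_coord_def coord_vec_def)

section \<open>The character under swaps and convolution\<close>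

definition nz :: "(nat \<Rightarrow> nat \<Rightarrow> complex) \<Rightarrow> bool" where
  "nz x \<longleftrightarrow> (\<forall>i\<in>{1..k}. \<forall>j\<in>{1..w i}. x i j \<noteq> 0)"

definition swap_xi :: "nat \<Rightarrow> nat \<Rightarrow> (nat \<Rightarrow> nat \<Rightarrow> complex) \<Rightarrow> nat \<Rightarrow> nat \<Rightarrow> complex" where
  "swap_xi i j x = x(i := swap_at j (x i))"

abbreviation "\<chi> x \<equiv> xi_power k w x"

lemma \<chi>_hom: "nz x \<Longrightarrow> \<chi> x (\<lambda>u. b u + c u) = \<chi> x b * \<chi> x c"
proof -
  assume nz: "nz x"
  have "ac (\<lambda>u. b u + c u) i j = ac b i j + ac c i j" for i j by (simp add: arm_coord_def)
  then have "\<chi> x (\<lambda>u. b u + c u) =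
    (\<Prod>i=1..k. \<Prod>j=1..w i. x i j powi (ac b i (j - 1) - ac b i j) * x i j powi (ac c i (j - 1) - ac c i j))"
    unfolding xi_power_def using nz
    by (intro prod.cong) (auto simp: nz_def power_int_add[symmetric] algebra_simps)
  then show ?thesis by (simp add: xi_power_def prod.distrib)
qed

lemma \<chi>_Centre: "\<chi> x (coord_vec Centre) = (\<Prod>i=1..k. x i 1)"
  unfolding xi_power_def
proof (rule prod.cong)
  fix i assume i: "i \<in> {1..k}"
  have "(\<Prod>j=1..w i. x i j powi (ac (coord_vec Centre) i (j - 1) - ac (coord_vec Centre) i j)) =
      (\<Prod>j=1..w i. if j = 1 then x i 1 else 1)"
    by (rule prod.cong) (auto simp: ac_coord_Centre)
  also have "\<dots> = x i 1" using w[OF i] by simp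
  finally show "(\<Prod>j=1..w i. x i j powi (ac (coord_vec Centre) i (j - 1) - ac (coord_vec Centre) i j)) = x i 1" .
qed simp

lemma \<chi>_Arm:
  assumes v: "Arm i j \<in> I"
  shows "\<chi> x (coord_vec (Arm i j)) = inverse (x i j) * x i (Suc j)"
proof -
  have v': "i \<in> {1..k}" "1 \<le> j" "Suc j \<le> w i" using v by (auto simp: Arm_in)
  have "\<chi> x (coord_vec (Arm i j)) = (\<Prod>i'=1..k. if i' = i then inverse (x i j) * x i (Suc j) else 1)"
    unfolding xi_power_def
  proof (rule prod.cong)
    fix i' assume "i' \<in> {1..k}"
    show "(\<Prod>l=1..w i'. x i' l powi (ac (coord_vec (Arm i j)) i' (l - 1) - ac (coord_vec (Arm i j)) i' l)) =
      (if i' = i then inverse (x i j) * x i (Suc j) else 1)"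
    proof (cases "i' = i")
      case True
      have "(\<Prod>l=1..w i. x i l powi (ac (coord_vec (Arm i j)) i (l - 1) - ac (coord_vec (Arm i j)) i l)) =
        (\<Prod>l=1..w i. (if l = j then inverse (x i j) else 1) * (if l = Suc j then x i (Suc j) else 1))"
        using v' by (intro prod.cong) (auto simp: ac_coord_Arm[OF v] power_int_minus)
      also have "\<dots> = inverse (x i j) * x i (Suc j)" using v' by (simp add: prod.distrib)
      finally show ?thesis using True by simp
    qed (simp add: ac_coord_Arm[OF v])
  qed simp
  then show ?thesis using v' by simp
qed

text \<open>The reflection at an arm vertex exchanges the drops at \<open>j\<close> and
  \<open>j + 1\<close>; the parameters are exchanged along with them.\<close>

lemma \<chi>_swap:
  assumes v: "Arm i j \<in> I"
  shows "\<chi> (swap_xi i j x) (s (Arm i j) b) = \<chi> x b"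
  unfolding xi_power_def
proof (rule prod.cong)
  have v': "i \<in> {1..k}" "1 \<le> j" "Suc j \<le> w i" using v by (auto simp: Arm_in)
  fix i' assume i': "i' \<in> {1..k}"
  let ?b = "s (Arm i j) b"
  have acb: "ac ?b i' l = ac b i' l - (if i' = i \<and> l = j then pr b (Arm i j) else 0)" if "l \<le> w i'" for l
    using ac_s[OF v i' that] ac_coord_Arm[OF v] by simp
  show "(\<Prod>l=1..w i'. swap_xi i j x i' l powi (ac ?b i' (l - 1) - ac ?b i' l)) =
    (\<Prod>l=1..w i'. x i' l powi (ac b i' (l - 1) - ac b i' l))"
  proof (cases "i' = i")
    case True
    let ?f = "\<lambda>l. x i l powi (ac b i (l - 1) - ac b i l)"
    have "(\<Prod>l=1..w i. swap_xi i j x i l powi (ac ?b i (l - 1) - ac ?b i l)) = (\<Prod>l=1..w i. swap_at j ?f l)"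
    proof (rule prod.cong)
      fix l assume l: "l \<in> {1..w i}"
      then have "ac ?b i (l - 1) - ac ?b i l = swap_at j (\<lambda>l. ac b i (l - 1) - ac b i l) l"
        using acb[of l] acb[of "l - 1"] True pr_Arm[OF v, of b] v'(2) by (auto simp: swap_at_def)
      then show "swap_xi i j x i l powi (ac ?b i (l - 1) - ac ?b i l) = swap_at j ?f l"
        by (auto simp: swap_xi_def swap_at_def)
    qed simp
    then show ?thesis using prod_swap_at[OF v'(2,3)] True by simp
  next
    case False
    then show ?thesis using acb by (intro prod.cong) (auto simp: swap_xi_def)
  qed
qed simp

lemma nz_swap: "Arm i j \<in> I \<Longrightarrow> nz x \<Longrightarrow> nz (swap_xi i j x)"
  by (auto simp: nz_def swap_xi_def swap_at_def Arm_in)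

abbreviation "Q x \<equiv> \<Prod>i=1..k. x i (1::nat)"

lemma Q_nz: "nz x \<Longrightarrow> Q x \<noteq> (0::complex)"
  using w by (auto simp: nz_def)

lemma nz_conv: "nz x \<Longrightarrow> nz (conv_xi k x)"
  using Q_nz[of x] by (auto simp: nz_def conv_xi_def Let_def)

lemma Q_conv: "nz x \<Longrightarrow> 1 \<le> k \<Longrightarrow> Q (conv_xi k x) = inverse (Q x)"
proof -
  assume a: "nz x" "1 \<le> k"
  have "Q (conv_xi k x) = Q x * (\<Prod>i=1..k. if i = 1 then inverse ((Q x)\<^sup>2) else 1)"
    by (simp add: conv_xi_def Let_def prod.distrib)
  also have "(\<Prod>i=1..k. if i = 1 then inverse ((Q x)\<^sup>2) else 1) = inverse ((Q x)\<^sup>2)" using a(2) by simp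
  finally show ?thesis using Q_nz[OF a(1)] by (simp add: power2_eq_square)
qed

lemma conv_conv: "nz x \<Longrightarrow> 1 \<le> k \<Longrightarrow> conv_xi k (conv_xi k x) = x"
proof -
  assume a: "nz x" "1 \<le> k"
  define q where "q = Q x"
  have q: "q \<noteq> 0" using Q_nz[OF a(1)] by (simp add: q_def)
  have "conv_xi k (conv_xi k x) i j = x i j" for i j
    unfolding conv_xi_def[of k "conv_xi k x"] Let_def Q_conv[OF a]
    unfolding conv_xi_def Let_def q_def[symmetric]
    using q by (auto simp: power2_eq_square field_simps)
  then show ?thesis by (simp add: fun_eq_iff)
qed

lemma sum_drops: "(\<Sum>l=1..m. ac b i (l - 1) - ac b i l) = ac b i 0 - ac b i m"
  by (induction m) auto

text \<open>The reflection lowers the first drop of every arm by \<open>t\<close>, and all other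
  discrepancies are powers of \<open>q\<close>. Their exponents are \<open>-t\<close> from the first
  parameters, \<open>-2 (b_0 - t)\<close> from the correction on the first arm and the sum of the
  \<open>b_i1\<close> from the later parameters; they add up to 0 by the formula for
  \<open>t\<close>.\<close>

lemma \<chi>_conv:
  assumes nz: "nz x" and k: "1 \<le> k"
  shows "\<chi> (conv_xi k x) (s Centre b) = \<chi> x b"
proof -
  define q where "q = Q x"
  define t where "t = pr b Centre"
  define c where "c i = (if i = 1 then inverse (q\<^sup>2) else 1)" for i :: nat
  have q: "q \<noteq> 0" using Q_nz[OF nz] by (simp add: q_def)
  have c: "c i \<noteq> 0" for i using q by (simp add: c_def)
  let ?d = "\<lambda>i l. ac b i (l - 1) - ac b i l"
  have arm: "(\<Prod>l=1..w i. conv_xi k x i l powi (ac (s Centre b) i (l - 1) - ac (s Centre b) i l)) =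
      (\<Prod>l=1..w i. x i l powi ?d i l) * (x i 1 powi (- t) * (c i powi (b Centre - t) * q powi (ac b i 1)))"
    if i: "i \<in> {1..k}" for i
  proof -
    obtain m where m: "w i = Suc m" using w[OF i] by (cases "w i") auto
    have split: "{1..w i} = insert 1 {2..w i}" using m by auto
    have xnz: "x i l \<noteq> 0" if "l \<in> {1..w i}" for l using nz i that by (auto simp: nz_def)
    have acs: "ac (s Centre b) i l = ac b i l - (if l = 0 then t else 0)" if "l \<le> w i" for l
      using ac_s[OF Centre_in i that] ac_coord_Centre by (simp add: t_def)
    have "(\<Prod>l\<in>{2..w i}. conv_xi k x i l powi (ac (s Centre b) i (l - 1) - ac (s Centre b) i l)) =
        (\<Prod>l\<in>{2..w i}. x i l powi ?d i l * (c i powi ?d i l * q powi ?d i l))"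
    proof (rule prod.cong)
      fix l assume l: "l \<in> {2..w i}"
      then have "ac (s Centre b) i (l - 1) - ac (s Centre b) i l = ?d i l" using acs[of l] acs[of "l - 1"] by auto
      then show "conv_xi k x i l powi (ac (s Centre b) i (l - 1) - ac (s Centre b) i l) =
          x i l powi ?d i l * (c i powi ?d i l * q powi ?d i l)"
        using l by (simp add: conv_xi_def Let_def c_def q_def power_int_mult_distrib)
    qed simp
    also have "\<dots> = (\<Prod>l\<in>{2..w i}. x i l powi ?d i l) *
        (c i powi (\<Sum>l\<in>{2..w i}. ?d i l) * q powi (\<Sum>l\<in>{2..w i}. ?d i l))"
      by (simp only: prod.distrib prod_powi[OF c] prod_powi[OF q])
    also have "(\<Sum>l\<in>{2..w i}. ?d i l) = ac b i 1"
      using sum_drops[of b i "w i"] ac_simps(2)[OF i] unfolding split by (simp add: ac_simps(1))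
    finally have rest: "(\<Prod>l\<in>{2..w i}. conv_xi k x i l powi (ac (s Centre b) i (l - 1) - ac (s Centre b) i l)) =
        (\<Prod>l\<in>{2..w i}. x i l powi ?d i l) * (c i powi ac b i 1 * q powi ac b i 1)" .
    have "ac (s Centre b) i 0 - ac (s Centre b) i 1 = ?d i 1 + (- t)" using acs[of 0] acs[of 1] m by simp
    then have first: "conv_xi k x i 1 powi (ac (s Centre b) i 0 - ac (s Centre b) i 1) =
        x i 1 powi ?d i 1 * (x i 1 powi (- t) * c i powi (?d i 1 + (- t)))"
    proof -
      have "conv_xi k x i 1 = x i 1 * c i" by (simp add: conv_xi_def Let_def c_def q_def)
      moreover have "x i 1 powi (?d i 1 + (- t)) = x i 1 powi ?d i 1 * x i 1 powi (- t)"
        using xnz[of 1] m by (intro power_int_add) auto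
      ultimately show ?thesis
        unfolding \<open>ac (s Centre b) i 0 - ac (s Centre b) i 1 = ?d i 1 + (- t)\<close>
        by (simp only: power_int_mult_distrib mult.assoc)
    qed
    have cc: "c i powi (?d i 1 + (- t)) * c i powi ac b i 1 = c i powi (b Centre - t)"
      using c by (simp add: power_int_add[symmetric] ac_simps(1))
    have "(\<Prod>l=1..w i. conv_xi k x i l powi (ac (s Centre b) i (l - 1) - ac (s Centre b) i l)) =
        (x i 1 powi ?d i 1 * (\<Prod>l\<in>{2..w i}. x i l powi ?d i l)) *
        (x i 1 powi (- t) * ((c i powi (?d i 1 + (- t)) * c i powi ac b i 1) * q powi ac b i 1))"
    proof -
      let ?F = "\<lambda>l. conv_xi k x i l powi (ac (s Centre b) i (l - 1) - ac (s Centre b) i l)"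
      have "(\<Prod>l=1..w i. ?F l) = ?F 1 * (\<Prod>l\<in>{2..w i}. ?F l)"
        unfolding split by (subst prod.insert) simp_all
      also have "?F 1 = x i 1 powi ?d i 1 * (x i 1 powi (- t) * c i powi (?d i 1 + (- t)))"
        using first by simp
      also note rest
      finally show ?thesis by (simp only: mult_ac)
    qed
    also have "x i 1 powi ?d i 1 * (\<Prod>l\<in>{2..w i}. x i l powi ?d i l) = (\<Prod>l=1..w i. x i l powi ?d i l)"
      unfolding split by (subst prod.insert) simp_all
    finally show ?thesis unfolding cc .
  qed
  have "\<chi> (conv_xi k x) (s Centre b) = \<chi> x b *
      ((\<Prod>i=1..k. x i 1 powi (- t)) * ((\<Prod>i=1..k. c i powi (b Centre - t)) * (\<Prod>i=1..k. q powi ac b i 1)))"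
    unfolding xi_power_def using arm by (simp add: prod.distrib)
  also have "(\<Prod>i=1..k. x i 1 powi (- t)) = q powi (- t)"
    unfolding q_def by (induction k) (simp_all add: power_int_mult_distrib)
  also have "(\<Prod>i=1..k. c i powi (b Centre - t)) = inverse (q\<^sup>2) powi (b Centre - t)"
  proof -
    have "(\<Prod>i=1..k. c i powi (b Centre - t)) = (\<Prod>i=1..k. if i = 1 then inverse (q\<^sup>2) powi (b Centre - t) else 1)"
      by (rule prod.cong) (auto simp: c_def)
    then show ?thesis using k by simp
  qed
  also have "inverse (q\<^sup>2) = q powi (- 2)" by (simp add: power_int_minus)
  also have "(q powi (- 2)) powi (b Centre - t) = q powi (- 2 * (b Centre - t))" by (simp only: power_int_mult)
  also have "(\<Prod>i=1..k. q powi ac b i 1) = q powi (\<Sum>i=1..k. ac b i 1)" by (rule prod_powi[OF q])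
  also have "q powi (- t) * (q powi (- 2 * (b Centre - t)) * q powi (\<Sum>i=1..k. ac b i 1)) =
      q powi (- t + (- 2 * (b Centre - t) + (\<Sum>i=1..k. ac b i 1)))"
    using q by (simp only: power_int_add simp_thms)
  also have "- t + (- 2 * (b Centre - t) + (\<Sum>i=1..k. ac b i 1)) = 0"
    unfolding t_def pr_Centre by simp
  finally show ?thesis by simp
qed

lemma s_coord_neg: "v \<in> I \<Longrightarrow> s v (coord_vec v) v = - 1"
  using s_coord[of v v] by (simp add: cartan_def coord_vec_def)

lemma sum_s: "v \<in> I \<Longrightarrow> (\<Sum>u\<in>I. s v a u) = (\<Sum>u\<in>I. a u) - pr a v"
  using sum_coord[of v "\<lambda>_. pr a v"] by (simp add: s_apply sum_subtractf)

text \<open>The hypothesis on the arms is convexity. From the first positive arm coordinate on, the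
  sequence could never decrease, yet it ends in 0. The value 1 at the centre ensures that the first
  step does not go down.\<close>

lemma eq_coord_Centre:
  assumes a: "a \<in> root_lattice I" "\<forall>v\<in>I. 0 \<le> a v" "a Centre = 1"
    and arms: "\<And>i j. Arm i j \<in> I \<Longrightarrow> pr a (Arm i j) \<le> 0"
  shows "a = coord_vec Centre"
proof -
  have "a (Arm i j) = 0" if v: "Arm i j \<in> I" for i j
  proof (rule ccontr)
    let ?x = "ac a i"
    have i: "i \<in> {1..k}" using v by (simp add: Arm_in)
    assume "a (Arm i j) \<noteq> 0"
    moreover have "0 \<le> a (Arm i j)" using a(2) v by blast
    ultimately have ex: "1 \<le> j \<and> ?x j \<ge> 1" using v ac_simps(3)[OF v, of a] by (simp add: Arm_in)
    define m where "m = (LEAST j. 1 \<le> j \<and> ?x j \<ge> 1)"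
    have m: "1 \<le> m" "?x m \<ge> 1" "m \<le> j" using LeastI[where P="\<lambda>j. 1 \<le> j \<and> ?x j \<ge> 1", OF ex]
      Least_le[where P="\<lambda>j. 1 \<le> j \<and> ?x j \<ge> 1", OF ex] by (auto simp: m_def)
    have "?x (m - 1) \<le> 1"
    proof (cases "m = 1")
      case True then show ?thesis using a(3) by (simp add: ac_simps(1))
    next
      case False
      then have "\<not> (1 \<le> m - 1 \<and> ?x (m - 1) \<ge> 1)"
        using not_less_Least[where P="\<lambda>j. 1 \<le> j \<and> ?x j \<ge> 1", of "m - 1"] m(1) unfolding m_def by linarith
      then show ?thesis using False m(1) by linarith
    qed
    then have d: "?x (m - 1) \<le> ?x m" using m(2) by linarith
    have "m + l \<le> w i \<Longrightarrow> ?x (m + l) \<ge> 1 \<and> ?x (m + l - 1) \<le> ?x (m + l)" for l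
    proof (induction l)
      case 0 then show ?case using m d by simp
    next
      case (Suc l)
      then have IH: "?x (m + l) \<ge> 1" "?x (m + l - 1) \<le> ?x (m + l)" by auto
      have "Arm i (m + l) \<in> I" using i m(1) Suc.prems by (auto simp: Arm_in)
      then have "2 * ?x (m + l) - ?x (m + l - 1) - ?x (Suc (m + l)) \<le> 0" using arms pr_Arm by metis
      then show ?case using IH by simp
    qed
    from this[of "w i - m"] show False using ac_simps(2)[OF i] m(3) v by (simp add: Arm_in)
  qed
  then show ?thesis using a(1,3) by (auto simp: fun_eq_iff coord_vec_def root_lattice_def) (metis vertex.exhaust)
qed

text \<open>Keeps the convolution from reaching the zero space. Were the reflected centre 0, the
  first arm coordinates would add up to \<open>n = a Centre\<close>, and \<open>x \<le> x^2\<close>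
  for integers, applied to the drops and to these coordinates, would make the form at least
  \<open>2 n\<close>, which exceeds 2.\<close>

lemma reflected_centre_pos:
  assumes "bilin_form I E a a = 2" "a Centre \<ge> 2" "s Centre a Centre \<ge> 0"
  shows "s Centre a Centre \<ge> 1"
proof (rule ccontr)
  let ?n = "a Centre"
  assume "\<not> ?thesis"
  then have "s Centre a Centre = 0" using assms(3) by simp
  then have sum: "(\<Sum>i=1..k. ac a i 1) = ?n"
    using s_apply[of Centre a Centre] pr_Centre[of a] by (simp add: coord_vec_def[of Centre, THEN fun_cong, of Centre])
  have sq: "x \<le> x\<^sup>2" for x :: int by (cases "x \<le> 0") (auto simp: power2_eq_square intro: order_trans[of _ 0])
  have arm: "?n\<^sup>2 - (\<Sum>j=1..w i. (ac a i (j - 1) - ac a i j)\<^sup>2) \<le> 2 * ?n * ac a i 1 - 2 * ac a i 1"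
    if i: "i \<in> {1..k}" for i
  proof -
    have split: "{1..w i} = insert 1 {2..w i}" using w[OF i] by auto
    have "(\<Sum>j\<in>{2..w i}. ac a i (j - 1) - ac a i j) = ac a i 1"
      using sum_drops[of a i "w i"] ac_simps(2)[OF i] unfolding split by (simp add: ac_simps(1))
    moreover have "(\<Sum>j\<in>{2..w i}. ac a i (j - 1) - ac a i j) \<le> (\<Sum>j\<in>{2..w i}. (ac a i (j - 1) - ac a i j)\<^sup>2)"
      by (intro sum_mono sq)
    ultimately have "ac a i 1 \<le> (\<Sum>j\<in>{2..w i}. (ac a i (j - 1) - ac a i j)\<^sup>2)" by simp
    then have "(\<Sum>j=1..w i. (ac a i (j - 1) - ac a i j)\<^sup>2) \<ge> (?n - ac a i 1)\<^sup>2 + ac a i 1"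
      unfolding split by (simp add: ac_simps(1))
    moreover have "(?n - ac a i 1)\<^sup>2 = ?n\<^sup>2 - 2 * ?n * ac a i 1 + (ac a i 1)\<^sup>2" by (simp add: power2_diff)
    ultimately show ?thesis using sq[of "ac a i 1"] by linarith
  qed
  have "(\<Sum>i=1..k. ?n\<^sup>2 - (\<Sum>j=1..w i. (ac a i (j - 1) - ac a i j)\<^sup>2)) \<le> (\<Sum>i=1..k. 2 * ?n * ac a i 1 - 2 * ac a i 1)"
    by (rule sum_mono) (rule arm)
  also have "\<dots> = 2 * ?n * ?n - 2 * ?n" using sum by (simp add: sum_subtractf sum_distrib_left[symmetric])
  finally show False using assms(1,2) unfolding form_star by (simp add: power2_eq_square)
qed

end


section \<open>Irreducible systems of a given type\<close>

definition cspace :: "nat \<Rightarrow> (nat \<Rightarrow> complex) set" where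
  "cspace n = dsum {..<n} (\<lambda>_. UNIV)"

lemma cspace_iff: "x \<in> cspace n \<longleftrightarrow> (\<forall>i\<ge>n. x i = 0)"
  by (auto simp: cspace_def dsum_def not_less)

lemma span_one: "cv.span {1 :: complex} = UNIV"
  by (auto simp: cv.span_singleton cscale_complex_def image_iff)

lemma fsub_complex: "fsub (UNIV :: complex set)"
  unfolding fsub_def using span_one by (auto intro!: exI[of _ "{1}"])

lemma dim_complex: "cv.dim (UNIV :: complex set) = 1"
proof -
  have "cv.independent {1 :: complex}" by (simp add: cv.dependent_single)
  then have "cv.dim (cv.span {1 :: complex}) = 1" using cv.dim_span_eq_card_independent by fastforce
  then show ?thesis by (simp add: span_one)
qed

lemma fsub_cspace: "fsub (cspace n)" and dim_cspace: "cv.dim (cspace n) = n"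
  using fsub_dsum_dim[of "{..<n}" "\<lambda>_. UNIV :: complex set"] fsub_complex dim_complex
  by (auto simp: cspace_def)

lemma cprod_scale:
  assumes "\<And>i. i \<in> {1..m} \<Longrightarrow> clin (T i)"
  shows "cprod (\<lambda>i v. c i *c T i v) m v = (\<Prod>i=1..m. c i) *c cprod T m v"
  using assms
proof (induction m arbitrary: v)
  case (Suc m)
  have "clin (cprod T m)" using Suc.prems by (intro clin_cprod) auto
  then show ?case using Suc by (simp add: clin_scale cscale_cscale mult.commute)
qed (simp add: cscale_one)

context star
begin

text \<open>The rank condition includes \<open>j = w i\<close>, where \<open>ac\<close> is 0 by
  convention; it thereby contains the requirement that the full product of shifts annihilates
  \<open>A i\<close>.\<close>

definition system :: "(nat \<Rightarrow> nat \<Rightarrow> complex) \<Rightarrow> 'a::cvec set \<Rightarrow> (nat \<Rightarrow> 'a \<Rightarrow> 'a) \<Rightarrow> (vertex \<Rightarrow> int) \<Rightarrow> bool" where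
  "system x V A a \<longleftrightarrow> fsub V \<and> (\<forall>i\<in>{1..k}. clin (A i) \<and> (\<forall>v\<in>V. A i v \<in> V)) \<and>
     (\<forall>v\<in>V. cprod A k v = v) \<and> a \<in> root_lattice I \<and> a Centre = int (cv.dim V) \<and>
     (\<forall>i\<in>{1..k}. \<forall>j\<le>w i. ac a i j = int (cv.dim (img (A i) (x i) V j)))"

lemma systemD:
  assumes "system x V A a"
  shows "fsub V" "\<And>i. i \<in> {1..k} \<Longrightarrow> clin (A i)" "\<And>i v. i \<in> {1..k} \<Longrightarrow> v \<in> V \<Longrightarrow> A i v \<in> V"
    "\<And>v. v \<in> V \<Longrightarrow> cprod A k v = v" "a \<in> root_lattice I" "a Centre = int (cv.dim V)"
    "\<And>i j. i \<in> {1..k} \<Longrightarrow> j \<le> w i \<Longrightarrow> ac a i j = int (cv.dim (img (A i) (x i) V j))"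
  using assms unfolding system_def by blast+

lemma system_nonneg:
  assumes "system x V A a" "v \<in> I" shows "0 \<le> a v"
proof (cases v)
  case Centre then show ?thesis using systemD(6)[OF assms(1)] by simp
next
  case (Arm i j)
  then have "a v = ac a i j" "i \<in> {1..k}" "j \<le> w i" using assms(2) ac_simps(3) by (auto simp: Arm_in)
  then show ?thesis using systemD(7)[OF assms(1)] by simp
qed

text \<open>The convolution lives on families, hence on a different type. Moving it to a standard
  space keeps the inductions below within one type.\<close>

lemma system_transport:
  assumes sys: "system x V A a" and irr: "irred_family V k A"
  shows "\<exists>A2. system x (cspace (cv.dim V)) A2 a \<and> irred_family (cspace (cv.dim V)) k A2"
proof -
  let ?W = "cspace (cv.dim V)"
  note V = systemD(1)[OF sys] and A = systemD(2)[OF sys] and AV = systemD(3)[OF sys]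
  obtain f g where f: "clin f" and g: "clin g" and fg: "\<And>v. v \<in> V \<Longrightarrow> f v \<in> ?W \<and> g (f v) = v"
      and gf: "\<And>y. y \<in> ?W \<Longrightarrow> g y \<in> V \<and> f (g y) = y"
    by (rule iso_exists[OF V fsub_cspace[of "cv.dim V"]]) (simp add: dim_cspace, rule that)
  define A2 where "A2 i y = f (A i (g y))" for i y
  have A2: "clin (A2 i)" if "i \<in> {1..k}" for i
    unfolding A2_def using clin_comp[OF f clin_comp[OF A[OF that] g]] .
  have A2f: "A2 i (f v) = f (A i v)" if "v \<in> V" for i v using fg that by (simp add: A2_def)
  have fV: "f ` V = ?W"
  proof (intro antisym subsetI)
    fix y assume "y \<in> ?W" then show "y \<in> f ` V" using gf[of y] by (intro image_eqI[of _ _ "g y"]) auto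
  qed (use fg in auto)
  have finj: "v = 0" if "v \<in> V" "f v = 0" for v using fg[OF that(1)] that(2) clin_0[OF g] by simp
  have im: "img (A2 i) (x i) ?W j = f ` img (A i) (x i) V j" if i: "i \<in> {1..k}" for i j
  proof (induction j)
    case (Suc j)
    have "img (A i) (x i) V j \<subseteq> V" using img_subset[OF A[OF i] V AV[OF i]] .
    then have "A2 i (f v) - x i (Suc j) *c f v = f (A i v - x i (Suc j) *c v)" if "v \<in> img (A i) (x i) V j" for v
      using A2f that by (simp add: subset_iff clin_simps[OF f])
    then show ?case using Suc by (simp add: image_image cong: image_cong_simp)
  qed (simp add: fV)
  have "cprod A2 m (f v) = f (cprod A m v)" if "m \<le> k" "v \<in> V" for m v
    using that
  proof (induction m arbitrary: v)
    case (Suc m) then show ?case using A2f[of v "Suc m"] AV[of "Suc m" v] by simp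
  qed simp
  then have prod: "cprod A2 k y = y" if "y \<in> ?W" for y
    using systemD(4)[OF sys] gf[OF that] by (metis order_refl)
  have dimf: "cv.dim (f ` img (A i) (x i) V j) = cv.dim (img (A i) (x i) V j)" if i: "i \<in> {1..k}" for i j
    using finj img_subset[OF A[OF i] V AV[OF i]] by (intro dim_image_inj[OF f img_fsub[OF A[OF i] V]]) blast
  have A2W: "A2 i y \<in> ?W" if "i \<in> {1..k}" "y \<in> ?W" for i y
    unfolding A2_def using gf[OF that(2)] AV[OF that(1)] fg by blast
  have "system x ?W A2 a" unfolding system_def
    using fsub_cspace A2 A2W prod systemD(5,6,7)[OF sys] im dimf by (auto simp: dim_cspace)
  moreover have "irred_family ?W k A2"
    unfolding irred_family_def
  proof (intro allI impI)
    fix S assume "cv.subspace S \<and> S \<subseteq> ?W \<and> (\<forall>i\<in>{1..k}. \<forall>v\<in>S. A2 i v \<in> S)"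
    then have S: "cv.subspace S" "S \<subseteq> ?W" and inv: "\<And>i v. i \<in> {1..k} \<Longrightarrow> v \<in> S \<Longrightarrow> A2 i v \<in> S" by auto
    have gS: "f (g y) = y" "g y \<in> V" if "y \<in> S" for y using gf S(2) that by auto
    have "g ` S = {0} \<or> g ` S = V"
    proof (rule irred_familyD[OF irr subspace_image[OF g S(1)]])
      show "g ` S \<subseteq> V" using gS by auto
      fix i v assume i: "i \<in> {1..k}" and "v \<in> g ` S"
      then obtain y where y: "y \<in> S" "v = g y" by (elim imageE)
      have "g (A2 i y) = A i v" using fg AV[OF i gS(2)[OF y(1)]] y(2) by (simp add: A2_def)
      then show "A i v \<in> g ` S" using imageI[OF inv[OF i y(1)], of g] by simp
    qed
    moreover have "S = f ` g ` S" using gS(1) by (auto simp: image_image image_iff)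
    ultimately show "S = {0} \<or> S = ?W" using fV clin_0[OF f] by (metis image_empty image_insert)
  qed
  ultimately show ?thesis by blast
qed

lemma system_swap:
  assumes sys: "system x V A a" and v: "Arm i j \<in> I" and ne: "x i j \<noteq> x i (Suc j)"
  shows "system (swap_xi i j x) V A (s (Arm i j) a)"
proof -
  have v': "i \<in> {1..k}" "1 \<le> j" "Suc j \<le> w i" using v by (auto simp: Arm_in)
  obtain j0 where j0: "j = Suc j0" using v'(2) by (cases j) auto
  note D = systemD[OF sys]
  note V = D(1) and A = D(2)[OF v'(1)] and AV = D(3)[OF v'(1)]
  let ?a = "s (Arm i j) a"
  have Ai: "ac ?a i' l = int (cv.dim (img (A i') (swap_xi i j x i') V l))" if i': "i' \<in> {1..k}" "l \<le> w i'" for i' l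
  proof (cases "i' = i")
    case False
    then have "ac ?a i' l = ac a i' l" using ac_s[OF v i'] ac_coord_Arm[OF v] by simp
    then show ?thesis using D(7)[OF i'] False by (simp add: swap_xi_def)
  next
    case True
    show ?thesis
    proof (cases "l = j")
      case False
      then have "ac ?a i' l = ac a i' l" using ac_s[OF v i'] ac_coord_Arm[OF v] by simp
      then show ?thesis using D(7)[OF i'] True img_swap[OF A v'(2) False] by (simp add: swap_xi_def)
    next
      case eq: True
      have "ac ?a i j = ac a i (j - 1) + ac a i (Suc j) - ac a i j"
        using ac_s[OF v v'(1), of j] ac_coord_Arm[OF v] pr_Arm[OF v, of a] v'(3) by simp
      moreover have "cv.dim (img (A i) (swap_at j (x i)) V j) + cv.dim (img (A i) (x i) V j)
        = cv.dim (img (A i) (x i) V (j - 1)) + cv.dim (img (A i) (x i) V (Suc j))"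
        using dim_img_swap[OF A V AV, of "x i" j0] ne unfolding j0 by simp
      ultimately show ?thesis using D(7)[OF v'(1), of "j - 1"] D(7)[OF v'(1), of j] D(7)[OF v'(1), of "Suc j"] v'(3) True eq
        by (simp add: swap_xi_def)
    qed
  qed
  have "?a Centre = a Centre" by (simp add: s_apply coord_vec_def[of "Arm i j", THEN fun_cong, of Centre])
  then show ?thesis unfolding system_def using D(1-6) Ai s_lattice[OF v] by auto
qed

lemma system_pr_Arm:
  assumes sys: "system x V A a" and v: "Arm i j \<in> I" and eq: "x i j = x i (Suc j)"
  shows "pr a (Arm i j) \<le> 0"
proof -
  have v': "i \<in> {1..k}" "1 \<le> j" "Suc j \<le> w i" using v by (auto simp: Arm_in)
  obtain j0 where j0: "j = Suc j0" using v'(2) by (cases j) auto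
  note D = systemD[OF sys]
  have "2 * cv.dim (img (A i) (x i) V j) \<le> cv.dim (img (A i) (x i) V j0) + cv.dim (img (A i) (x i) V (Suc j))"
    using dim_shift_repeat[OF D(2)[OF v'(1)] img_fsub[OF D(2)[OF v'(1)] D(1)]
        img_invariant[OF D(2)[OF v'(1)] D(3)[OF v'(1)]], of "x i" j0 "x i j"] eq
    unfolding j0 by simp
  then show ?thesis
    using pr_Arm[OF v, of a] D(7)[OF v'(1), of j0] D(7)[OF v'(1), of j] D(7)[OF v'(1), of "Suc j"] v'(3) j0 by simp
qed

abbreviation "normalized x A \<equiv> (\<lambda>i v. inverse (x i (1::nat)) *c A i v)"

lemma normalized_prod:
  assumes "system x V A a" "nz x" "v \<in> V" shows "Q x *c cprod (normalized x A) k v = v"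
proof -
  have "cprod (normalized x A) k v = inverse (Q x) *c v"
  proof -
    have "(\<Prod>i=1..k. inverse (x i 1)) = inverse (Q x)"
      using prod_inversef[of "\<lambda>i. x i 1" "{1..k}"] by (simp add: comp_def)
    then show ?thesis
      using cprod_scale[of k A "\<lambda>i. inverse (x i 1)" v] systemD(2,4)[OF assms(1)] assms(3) by simp
  qed
  then show ?thesis using Q_nz[OF assms(2)] by (simp add: cscale_cscale cscale_one)
qed

lemma normalized_shift:
  assumes sys: "system x V A a" and nz: "nz x" and i: "i \<in> {1..k}"
  shows "(\<lambda>v. normalized x A i v - v) ` V = img (A i) (x i) V 1"
proof -
  have x1: "x i 1 \<noteq> 0" using nz i w[OF i] by (auto simp: nz_def)
  note D = systemD[OF sys]
  have "(\<lambda>v. normalized x A i v - v) ` V = (\<lambda>v. inverse (x i 1) *c v) ` (\<lambda>v. A i v - x i 1 *c v) ` V"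
    using x1 by (simp add: image_image cv.scale_right_diff_distrib cscale_cscale cscale_one)
  also have "\<dots> = (\<lambda>v. A i v - x i 1 *c v) ` V"
    using x1 by (intro image_cscale subspace_image[OF clin_shift[OF D(2)[OF i]]] fsubD[OF D(1)]) auto
  finally show ?thesis by simp
qed

lemma irred_normalized:
  assumes irr: "irred_family V k A" and nz: "nz x"
  shows "irred_family V k (normalized x A)"
  unfolding irred_family_def
proof (intro allI impI)
  fix S assume S: "cv.subspace S \<and> S \<subseteq> V \<and> (\<forall>i\<in>{1..k}. \<forall>v\<in>S. normalized x A i v \<in> S)"
  show "S = {0} \<or> S = V"
  proof (rule irred_familyD[OF irr])
    fix i v assume i: "i \<in> {1..k}" and v: "v \<in> S"
    have "x i 1 \<noteq> 0" using nz i w[OF i] by (auto simp: nz_def)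
    then have "A i v = x i 1 *c normalized x A i v" by (simp add: cscale_cscale cscale_one)
    also have "\<dots> \<in> S" by (rule cv.subspace_scale) (use S i v in blast)+
    finally show "A i v \<in> S" .
  qed (use S in auto)
qed

text \<open>For \<open>Q x = 1\<close> the tuple divided by its first parameters still has product
  1. The fixed space of its \<open>i\<close>-th member has dimension
  \<open>cv.dim V - ac a i 1\<close>, so \<open>scott_irreducible\<close> becomes the claim.\<close>

lemma system_pr_Centre:
  assumes sys: "system x V A a" and nz: "nz x" and irr: "irred_family V k A" and n: "cv.dim V \<ge> 2" and Q: "Q x = 1"
  shows "pr a Centre \<le> 0"
proof -
  note D = systemD[OF sys]
  let ?B = "normalized x A"
  have k: "k \<ge> 1"
  proof (rule ccontr)
    assume "\<not> k \<ge> 1"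
    then have "cv.dim V \<le> 1" using irred_family_scalars[OF irr D(1), of "\<lambda>_. 0"] by auto
    then show False using n by simp
  qed
  interpret monodromy V k ?B
  proof
    show "clin (?B i)" if "i \<in> {1..k}" for i using clin_cscale[OF D(2)[OF that]] .
    show "?B i v \<in> V" if "i \<in> {1..k}" "v \<in> V" for i v using fsub_scale[OF D(1) D(3)[OF that]] .
    show "cprod ?B k v = v" if "v \<in> V" for v using normalized_prod[OF sys nz that] Q by (simp add: cscale_one)
  qed (use D(1) k in auto)
  have fixd: "int (cv.dim {v \<in> V. ?B i v = v}) = int (cv.dim V) - ac a i 1" if i: "i \<in> {1..k}" for i
  proof -
    have "clin (\<lambda>v. ?B i v - v)" by (intro clin_sub clin_cscale clin_id D(2)[OF i])
    from rank_nullity[OF this D(1)] have "cv.dim V = cv.dim (img (A i) (x i) V 1) + cv.dim {v \<in> V. ?B i v - v = 0}"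
      unfolding normalized_shift[OF sys nz i] .
    then show ?thesis using D(7)[OF i, of 1] w[OF i] by simp
  qed
  have "(\<Sum>i\<in>{1..k}. int (cv.dim {v \<in> V. ?B i v = v})) + 2 * int (cv.dim V) \<le> int k * int (cv.dim V)"
    using scott_irreducible[OF irred_normalized[OF irr nz] n]
    unfolding of_nat_le_iff[where 'a=int, symmetric] by simp
  then show ?thesis using fixd D(6) unfolding pr_Centre by (simp add: sum_subtractf)
qed

text \<open>The normalised tuple is convolved and then rescaled by the new first parameters. The
  disjunction excludes a space of dimension at most 1 whose convolution is zero; the descent from a
  tuple uses its first alternative, the way back its second.\<close>

lemma system_conv:
  assumes sys: "system x V A a" and nz: "nz x" and irr: "irred_family V k A" and Q: "Q x \<noteq> 1"
    and n: "cv.dim V \<ge> 2 \<or> s Centre a Centre \<ge> 1"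
  obtains n2 A2 where "system (conv_xi k x) (cspace n2) A2 (s Centre a)" "irred_family (cspace n2) k A2"
proof -
  note D = systemD[OF sys]
  have k: "1 \<le> k" using Q by (cases k) auto
  let ?B = "normalized x A" let ?q = "Q x" let ?x = "conv_xi k x"
  interpret convolution V k ?B ?q
  proof
    show "clin (?B i)" if "i \<in> {1..k}" for i using clin_cscale[OF D(2)[OF that]] .
    show "?B i v \<in> V" if "i \<in> {1..k}" "v \<in> V" for i v using fsub_scale[OF D(1) D(3)[OF that]] .
    show "?q *c cprod ?B k v = v" if "v \<in> V" for v using normalized_prod[OF sys nz that] .
  qed (use D(1) Q Q_nz[OF nz] in auto)
  let ?A = "\<lambda>i y. ?x i 1 *c B' i y"
  let ?a = "s Centre a"
  have dimW: "int (cv.dim (W i)) = ac a i 1" if i: "i \<in> {1..k}" for i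
    unfolding normalized_shift[OF sys nz i] using D(7)[OF i, of 1] w[OF i] by simp
  have dV: "?a Centre = int (cv.dim V')"
  proof -
    have "int (cv.dim V') + int (cv.dim V) = (\<Sum>i\<in>{1..k}. int (cv.dim (W i)))"
      using arg_cong[OF dim_V', of int] by simp
    then have "int (cv.dim V') + a Centre = (\<Sum>i\<in>{1..k}. ac a i 1)" using dimW D(6) by simp
    then show ?thesis
      using s_apply[of Centre a Centre] pr_Centre[of a] by (simp add: coord_vec_def[of Centre, THEN fun_cong, of Centre])
  qed
  have n': "cv.dim V \<ge> 2 \<or> cv.dim V' \<ge> 1" using n dV by auto
  note irrB = irred_normalized[OF irr nz]
  have irrA: "irred_family V' k ?A"
    unfolding irred_family_def
  proof (intro allI impI)
    fix S assume S: "cv.subspace S \<and> S \<subseteq> V' \<and> (\<forall>i\<in>{1..k}. \<forall>v\<in>S. ?A i v \<in> S)"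
    show "S = {0} \<or> S = V'"
    proof (rule irred_familyD[OF irred_convolution[OF irrB]])
      fix i v assume i: "i \<in> {1..k}" and v: "v \<in> S"
      have "?x i 1 \<noteq> 0" using nz_conv[OF nz] i w[OF i] unfolding nz_def by auto
      then have "B' i v = inverse (?x i 1) *c ?A i v" by (simp add: cscale_cscale cscale_one)
      also have "\<dots> \<in> S" by (rule cv.subspace_scale) (use S i v in blast)+
      finally show "B' i v \<in> S" .
    qed (use S in auto)
  qed
  have "system ?x V' ?A ?a"
    unfolding system_def
  proof (intro conjI ballI allI impI)
    show "fsub V'" by (rule V')
    show "clin (?A i)" if "i \<in> {1..k}" for i using clin_cscale[OF clin_B'[OF that]] .
    show "?A i v \<in> V'" if "i \<in> {1..k}" "v \<in> V'" for i v using fsub_scale[OF V' B'_V'[OF that]] .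
    show "cprod ?A k v = v" if v: "v \<in> V'" for v
    proof -
      have "cprod ?A k v = Q ?x *c (?q *c v)"
        using cprod_scale[of k B' "\<lambda>i. ?x i 1" v] clin_B' cprod_B'[OF v] by simp
      then show ?thesis using Q_conv[OF nz k] Q_nz[OF nz] by (simp add: cscale_cscale cscale_one)
    qed
    show "?a \<in> root_lattice I" using s_lattice[OF Centre_in D(5)] .
    show "?a Centre = int (cv.dim V')" by (rule dV)
    fix i j assume i: "i \<in> {1..k}" and j: "j \<le> w i"
    show "ac ?a i j = int (cv.dim (img (?A i) (?x i) V' j))"
    proof (cases j)
      case 0 then show ?thesis using dV by (simp add: ac_simps(1))
    next
      case (Suc m)
      have x1: "x i 1 \<noteq> 0" "?x i 1 \<noteq> 0" using nz nz_conv[OF nz] i w[OF i] unfolding nz_def by auto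
      have "cv.dim (img (?A i) (?x i) V' (Suc m)) = cv.dim (img (\<lambda>v. x i 1 *c ?B i v) (x i) V (Suc m))"
      proof (rule img_convolution[OF irrB n' i x1])
        show "?x i l = (?x i 1 * ?q / x i 1) * x i l" if "2 \<le> l" for l
          using that x1(1) by (simp add: conv_xi_def Let_def)
      qed simp_all
      also have "(\<lambda>v. x i 1 *c ?B i v) = A i" using x1 by (simp add: cscale_cscale cscale_one)
      finally show ?thesis using D(7)[OF i j] ac_s[OF Centre_in i j] Suc by (simp add: ac_coord_Centre)
    qed
  qed
  then show ?thesis using system_transport[OF _ irrA] that by blast
qed

section \<open>Descent along reflections\<close>

lemma size_decreases:
  assumes "v \<in> I" "pr a v > 0" "\<And>u. u \<in> I \<Longrightarrow> 0 \<le> s v a u"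
  shows "nat (\<Sum>u\<in>I. s v a u) < nat (\<Sum>u\<in>I. a u)"
  using assms sum_s[OF assms(1), of a] sum_nonneg[of I "s v a"] by auto

text \<open>Positivity of the form provides a vertex at which the form is positive. Arm vertices are
  treated first, so that the centre is reached with convex arms; in dimension 1 this leaves only
  \<open>coord_vec Centre\<close>, and in higher dimension the convolution applies.\<close>

lemma system_good:
  assumes "system x (cspace n) A a" "nz x" "irred_family (cspace n) k A" "n \<ge> 1" "bilin_form I E a a > 0"
  shows "good (\<chi> x) a"
  using assms
proof (induction "nat (\<Sum>u\<in>I. a u)" arbitrary: x n A a rule: less_induct)
  case less
  note sys = less.prems(1) and nz = less.prems(2) and irr = less.prems(3)
  note D = systemD[OF sys]
  have lift: "good (\<chi> x) a"
    if v: "v \<in> I" and p: "pr a v > 0" and sy: "system y (cspace m) A' (s v a)" and ny: "nz y"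
      and ir: "irred_family (cspace m) k A'" and m: "m \<ge> 1"
      and \<chi>: "\<And>b. \<chi> y (s v b) = \<chi> x b" and v1: "\<chi> x (coord_vec v) \<noteq> 1" for v y m A'
  proof -
    have "good (\<chi> y) (s v a)"
    proof (rule less.hyps[OF _ sy ny ir m])
      show "nat (\<Sum>u\<in>I. s v a u) < nat (\<Sum>u\<in>I. a u)"
        using size_decreases[OF v p] system_nonneg[OF sy] by blast
      show "0 < bilin_form I E (s v a) (s v a)" using form_s_s[OF v] less.prems(5) by simp
    qed
    moreover have "s v a \<noteq> coord_vec v"
    proof
      assume "s v a = coord_vec v"
      then have "a v = - 1" using s_s[OF v, of a] s_coord_neg[OF v] by metis
      then show False using system_nonneg[OF sys v] by simp
    qed
    ultimately show ?thesis using good_reflect[of "\<chi> y" "s v a" v "\<chi> x"] v \<chi> v1 s_s[OF v, of a] by simp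
  qed
  have "\<exists>v\<in>I. pr a v > 0"
  proof (rule ccontr)
    assume "\<not> ?thesis"
    then have "(\<Sum>v\<in>I. pr a v * a v) \<le> 0"
      using system_nonneg[OF sys] by (intro sum_nonpos) (auto intro!: mult_nonpos_nonneg simp: not_less)
    then show False using less.prems(5) by (subst (asm) form_eq) simp
  qed
  then obtain v where v: "v \<in> I" "pr a v > 0" by blast
  show ?case
  proof (cases "\<exists>i j. Arm i j \<in> I \<and> pr a (Arm i j) > 0")
    case True
    then obtain i j where ij: "Arm i j \<in> I" "pr a (Arm i j) > 0" by blast
    have ne: "x i j \<noteq> x i (Suc j)" using system_pr_Arm[OF sys ij(1)] ij(2) by auto
    have "x i j \<noteq> 0" using nz ij(1) by (auto simp: nz_def Arm_in)
    then have "\<chi> x (coord_vec (Arm i j)) \<noteq> 1"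
      using ne \<chi>_Arm[OF ij(1), of x] by (auto simp: field_simps)
    then show ?thesis
      using lift[OF ij system_swap[OF sys ij(1) ne] nz_swap[OF ij(1) nz] irr less.prems(4) \<chi>_swap[OF ij(1)]] by blast
  next
    case noarm: False
    then have vC: "v = Centre" using v by (cases v) auto
    show ?thesis
    proof (cases "n = 1")
      case True
      have aC: "a Centre = 1" using D(6) True by (simp add: dim_cspace)
      have eq: "a = coord_vec Centre"
        using noarm system_nonneg[OF sys] by (intro eq_coord_Centre[OF D(5) _ aC]) (auto simp: not_less)
      obtain e where e: "e \<in> cspace n" "e \<noteq> 0"
        using fsub_dim_0[OF fsub_cspace[of n]] less.prems(4) fsub_zero_mem[OF fsub_cspace[of n]] by (auto simp: dim_cspace)
      have scal: "A i v = x i 1 *c v" if i: "i \<in> {1..k}" and v: "v \<in> cspace n" for i v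
      proof -
        have "cv.dim (img (A i) (x i) (cspace n) 1) = 0"
          using D(7)[OF i, of 1] w[OF i] eq by (simp add: ac_coord_Centre)
        then have "img (A i) (x i) (cspace n) 1 = {0}" using fsub_dim_0[OF img_fsub[OF D(2)[OF i] D(1)]] by blast
        moreover have "A i v - x i 1 *c v \<in> img (A i) (x i) (cspace n) 1" using v by simp
        ultimately show ?thesis by (metis eq_iff_diff_eq_0 singletonD)
      qed
      have "m \<le> k \<Longrightarrow> u \<in> cspace n \<Longrightarrow> cprod A m u = (\<Prod>i=1..m. x i 1) *c u" for m u
      proof (induction m arbitrary: u)
        case (Suc m)
        have "cprod A (Suc m) u = cprod A m (x (Suc m) 1 *c u)" using scal[of "Suc m" u] Suc.prems by simp
        also have "\<dots> = (\<Prod>i=1..m. x i 1) *c (x (Suc m) 1 *c u)"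
          using Suc.prems fsub_scale[OF fsub_cspace] by (intro Suc.IH) auto
        finally show ?case by (simp add: cscale_cscale)
      qed (simp add: cscale_one)
      then have "Q x *c e = 1 *c e" using D(4)[OF e(1)] e(1) by (simp add: cscale_one)
      then have "Q x = 1" using e(2) cv.scale_right_imp_eq by blast
      then show ?thesis unfolding eq using good_coord[of Centre "\<chi> x", OF Centre_in] \<chi>_Centre[of x] by simp
    next
      case False
      then have n2: "cv.dim (cspace n) \<ge> 2" using less.prems(4) by (simp add: dim_cspace)
      have Q1: "Q x \<noteq> 1" using system_pr_Centre[OF sys nz irr n2] v vC by auto
      then have k: "1 \<le> k" by (cases k) auto
      obtain m A2 where A2: "system (conv_xi k x) (cspace m) A2 (s Centre a)" "irred_family (cspace m) k A2"
        by (rule system_conv[OF sys nz irr Q1 disjI1[OF n2]]) (rule that)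
      \<comment> \<open>If the convolution were zero, all first arm coordinates would vanish and the
        reflected centre would be \<open>- a Centre\<close>, which is negative.\<close>
      have "m \<ge> 1"
      proof (rule ccontr)
        assume m0: "\<not> m \<ge> 1"
        have "ac a i 1 = 0" if i: "i \<in> {1..k}" for i
        proof -
          have "cspace m = {0}" using m0 fsub_dim_0[OF fsub_cspace[of m]] by (simp add: dim_cspace)
          then have "img (A2 i) (conv_xi k x i) (cspace m) 1 = {0}"
            using clin_0[OF systemD(2)[OF A2(1) i]] by simp
          then have "ac (s Centre a) i 1 = 0"
            using systemD(7)[OF A2(1) i, of 1] w[OF i] by (simp add: dim_zero_space)
          then show ?thesis using ac_s[OF Centre_in i, of 1] w[OF i] by (simp add: ac_coord_Centre)
        qed
        then have "pr a Centre = 2 * a Centre" unfolding pr_Centre by simp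
        then have "s Centre a Centre = - a Centre" by (simp add: s_apply coord_vec_def[of Centre, THEN fun_cong, of Centre])
        then show False using systemD(6)[OF A2(1)] D(6) n2 by simp
      qed
      then show ?thesis
        using lift[OF Centre_in _ A2(1) nz_conv[OF nz] A2(2)] v vC \<chi>_conv[OF nz k] \<chi>_Centre[of x] Q1 by simp
    qed
  qed
qed

text \<open>The same descent, now led by the root. At \<open>coord_vec Centre\<close> a tuple
  exists, and it is carried back by a second swap or convolution, as both are involutions on the
  parameters. A positive centre coordinate is maintained, so the descent never ends at an arm
  vertex.\<close>

lemma good_system:
  assumes "good (\<chi> x) a" "nz x" "a Centre \<ge> 1"
  shows "\<exists>n A. system x (cspace n) A a \<and> irred_family (cspace n) k A"
  using assms
proof (induction "nat (\<Sum>u\<in>I. a u)" arbitrary: x a rule: less_induct)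
  case less
  note good = less.prems(1) and nz = less.prems(2)
  have apos: "a \<in> positive_real_roots I E" and a1: "\<chi> x a = 1" using good by (auto simp: good_def)
  have lat: "a \<in> root_lattice I" and nonneg: "\<forall>v\<in>I. 0 \<le> a v" and form: "bilin_form I E a a = 2"
    using apos real_root_lattice real_root_form by (auto simp: positive_real_roots_def)
  have red: "good (\<chi> y) (s v a) \<and> nat (\<Sum>u\<in>I. s v a u) < nat (\<Sum>u\<in>I. a u) \<and> s v a \<in> positive_real_roots I E"
    if v: "v \<in> I" and p: "pr a v > 0" and ne: "a \<noteq> coord_vec v"
      and \<chi>: "\<And>b. \<chi> y (s v b) = \<chi> x b" and ny: "nz y" for v y
  proof -
    have sp: "s v a \<in> positive_real_roots I E" using real_root_reflect_positive[OF apos v ne] .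
    have v1: "\<chi> x (coord_vec v) \<noteq> 1" using good_character[OF good v ne p] \<chi>_hom[OF nz] by blast
    \<comment> \<open>The reflection negates \<open>coord_vec v\<close>, so the two characters take
      inverse values there. \<open>good_reflect\<close> is then applied with the roles of
      \<open>x\<close> and \<open>y\<close> exchanged.\<close>
    have "\<chi> y (coord_vec v) \<noteq> 1"
    proof
      assume y1: "\<chi> y (coord_vec v) = 1"
      have "\<chi> x (coord_vec v) = \<chi> y (\<lambda>u. - coord_vec v u)"
        using \<chi>[of "coord_vec v"] s_coord[OF v v] by (simp add: cartan_def)
      moreover have "\<chi> y (\<lambda>u. coord_vec v u + - coord_vec v u) = \<chi> y (coord_vec v) * \<chi> y (\<lambda>u. - coord_vec v u)"
        by (rule \<chi>_hom[OF ny])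
      moreover have "\<chi> y (\<lambda>u. coord_vec v u + - coord_vec v u) = 1" by (simp add: xi_power_def arm_coord_def)
      ultimately show False using v1 y1 by simp
    qed
    moreover have "\<chi> x (s v b) = \<chi> y b" for b using \<chi>[of "s v b"] s_s[OF v] by simp
    ultimately have "good (\<chi> y) (s v a)" using good_reflect[OF good v ne, of "\<chi> y"] by blast
    moreover have "nat (\<Sum>u\<in>I. s v a u) < nat (\<Sum>u\<in>I. a u)"
      using size_decreases[OF v p] sp by (auto simp: positive_real_roots_def)
    ultimately show ?thesis using sp by blast
  qed
  show ?case
  proof (cases "\<exists>i j. Arm i j \<in> I \<and> pr a (Arm i j) > 0")
    case True
    then obtain i j where ij: "Arm i j \<in> I" "pr a (Arm i j) > 0" by blast
    let ?y = "swap_xi i j x"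
    have ne: "a \<noteq> coord_vec (Arm i j)" using less.prems(3) by (auto simp: coord_vec_def)
    note R = red[OF ij ne \<chi>_swap[OF ij(1)] nz_swap[OF ij(1) nz]]
    have "s (Arm i j) a Centre = a Centre" by (simp add: s_apply coord_vec_def[of "Arm i j", THEN fun_cong, of Centre])
    then obtain n A where nA: "system ?y (cspace n) A (s (Arm i j) a)" "irred_family (cspace n) k A"
      using less.hyps[of "s (Arm i j) a" ?y] R nz_swap[OF ij(1) nz] less.prems(3) by auto
    have "x i j \<noteq> 0" using nz ij(1) by (auto simp: nz_def Arm_in)
    then have "x i j \<noteq> x i (Suc j)"
      using good_character[OF good ij(1) ne ij(2) \<chi>_hom[OF nz]] \<chi>_Arm[OF ij(1), of x] by auto
    then have "?y i j \<noteq> ?y i (Suc j)" by (simp add: swap_xi_def swap_at_def)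
    from system_swap[OF nA(1) ij(1) this] have "system (swap_xi i j ?y) (cspace n) A a"
      using s_s[OF ij(1), of a] by simp
    moreover have "swap_xi i j ?y = x" by (simp add: swap_xi_def swap_at_swap_at)
    ultimately show ?thesis using nA(2) by auto
  next
    case noarm: False
    show ?thesis
    proof (cases "a Centre = 1")
      case True
      have eq: "a = coord_vec Centre"
        using noarm nonneg by (intro eq_coord_Centre[OF lat _ True]) (auto simp: not_less)
      have Q1: "Q x = 1" using a1 \<chi>_Centre[of x] unfolding eq by simp
      \<comment> \<open>The bottom of the descent: scalars on a line, whose product is
        \<open>Q x = 1\<close>.\<close>
      let ?A = "\<lambda>i v. x i 1 *c v"
      have cp: "cprod ?A m v = (\<Prod>i=1..m. x i 1) *c v" for m and v :: "nat \<Rightarrow> complex"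
      proof -
        have "cprod (\<lambda>i v. v) m v = v" for v :: "nat \<Rightarrow> complex" by (induction m) auto
        then show ?thesis using cprod_scale[of m "\<lambda>i v. v" "\<lambda>i. x i 1" v] by (simp add: clin_id)
      qed
      have im: "cv.dim (img (?A i) (x i) (cspace 1) j) = (if j = 0 then 1 else 0)" for i j
      proof (cases j)
        case 0 then show ?thesis by (simp add: dim_cspace)
      next
        case (Suc m)
        have z: "img (?A i) (x i) (cspace 1) (Suc m) = {0}" for m
        proof (induction m)
          case 0 show ?case using fsub_zero_mem[OF fsub_cspace[of 1]] by (simp add: image_constant_conv) auto
        qed (simp add: fun_eq_iff cscale_fun_apply)
        then show ?thesis using Suc by (simp only: dim_zero_space) simp
      qed
      have "system x (cspace 1) ?A a"
        unfolding system_def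
        using fsub_cspace[of 1] cp Q1 lat im fsub_scale[OF fsub_cspace[of 1]] clin_cscale[OF clin_id]
        by (auto simp: eq dim_cspace cscale_one ac_coord_Centre coord_vec_def[of Centre, THEN fun_cong, of Centre])
      moreover have "irred_family (cspace 1) k ?A"
        unfolding irred_family_def
      proof (intro allI impI)
        fix S assume "cv.subspace S \<and> S \<subseteq> cspace 1 \<and> (\<forall>i\<in>{1..k}. \<forall>v\<in>S. ?A i v \<in> S)"
        then have S: "cv.subspace S" "S \<subseteq> cspace 1" by auto
        then have fS: "fsub S" using fsub_subset[OF fsub_cspace] by blast
        show "S = {0} \<or> S = cspace 1"
        proof (cases "cv.dim S = 0")
          case True then show ?thesis using fsub_dim_0[OF fS] by simp
        next
          case False
          then show ?thesis using fsub_dim_eq[OF fsub_cspace S] by (simp add: dim_cspace)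
        qed
      qed
      ultimately show ?thesis by blast
    next
      case False
      have n2: "a Centre \<ge> 2" using False less.prems(3) by simp
      have "\<exists>v\<in>I. pr a v > 0"
      proof (rule ccontr)
        assume "\<not> ?thesis"
        then have "(\<Sum>v\<in>I. pr a v * a v) \<le> 0"
          using nonneg by (intro sum_nonpos) (auto intro!: mult_nonpos_nonneg simp: not_less)
        then show False using form by (subst (asm) form_eq) simp
      qed
      then have p: "pr a Centre > 0" using noarm by (metis vertex.exhaust)
      have ne: "a \<noteq> coord_vec Centre" using n2 by (auto simp: coord_vec_def)
      have Q1: "Q x \<noteq> 1" using good_character[OF good Centre_in ne p \<chi>_hom[OF nz]] \<chi>_Centre[of x] by simp
      then have k: "1 \<le> k" by (cases k) auto
      let ?y = "conv_xi k x"
      note R = red[OF Centre_in p ne \<chi>_conv[OF nz k] nz_conv[OF nz]]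
      have "s Centre a Centre \<ge> 0" using R Centre_in by (auto simp: positive_real_roots_def)
      then have c1: "s Centre a Centre \<ge> 1" using reflected_centre_pos[OF form n2] by simp
      then obtain n A where nA: "system ?y (cspace n) A (s Centre a)" "irred_family (cspace n) k A"
        using less.hyps[of "s Centre a" ?y] R nz_conv[OF nz] by auto
      have "Q ?y \<noteq> 1" using Q_conv[OF nz k] Q1 by simp
      moreover have "cv.dim (cspace n) \<ge> 2 \<or> s Centre (s Centre a) Centre \<ge> 1" using s_s[OF Centre_in, of a] n2 by simp
      ultimately obtain n2 A2 where "system (conv_xi k ?y) (cspace n2) A2 (s Centre (s Centre a))" "irred_family (cspace n2) k A2"
        by (rule system_conv[OF nA(1) nz_conv[OF nz] nA(2)]) (rule that)
      then show ?thesis using conv_conv[OF nz k] s_s[OF Centre_in, of a] by auto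
    qed
  qed
qed

end


section \<open>Matrices as functions\<close>

type_synonym cmat = "nat \<Rightarrow> nat \<Rightarrow> complex"

text \<open>As functions, matrices belong to a \<open>cvec\<close> type and spaces of matrices fall
  under the linear algebra above. Members of \<open>gl\<close> vanish outside the index range, so
  equality of functions is equality of matrices.\<close>

locale mats =
  fixes n :: nat
begin

abbreviation "V \<equiv> cspace n"

definition mm :: "cmat \<Rightarrow> cmat \<Rightarrow> cmat" where "mm M N = (\<lambda>a b. \<Sum>c<n. M a c * N c b)"
definition mv :: "cmat \<Rightarrow> (nat \<Rightarrow> complex) \<Rightarrow> nat \<Rightarrow> complex" where "mv M x = (\<lambda>a. \<Sum>c<n. M a c * x c)"
definition one :: cmat where "one = (\<lambda>a b. if a = b \<and> a < n then 1 else 0)"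
definition gl :: "cmat set" where "gl = dsum {..<n} (\<lambda>_. V)"

lemma gl_iff: "M \<in> gl \<longleftrightarrow> (\<forall>a b. \<not> (a < n \<and> b < n) \<longrightarrow> M a b = 0)"
  unfolding gl_def dsum_def cspace_iff by (auto simp: fun_eq_iff not_less)

lemma gl_zero: "M \<in> gl \<Longrightarrow> \<not> a < n \<or> \<not> b < n \<Longrightarrow> M a b = 0" by (auto simp: gl_iff)

lemma fsub_gl: "fsub gl" and dim_gl: "cv.dim gl = n * n"
  using fsub_dsum_dim[of "{..<n}" "\<lambda>_. V"] fsub_cspace by (auto simp: gl_def dim_cspace)

lemma one_gl: "one \<in> gl" by (auto simp: gl_iff one_def)
lemma mm_gl: "M \<in> gl \<Longrightarrow> N \<in> gl \<Longrightarrow> mm M N \<in> gl" by (auto simp: gl_iff mm_def)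

lemma mm_assoc: "mm (mm M N) P = mm M (mm N P)"
proof (intro ext)
  fix a b
  have "mm (mm M N) P a b = (\<Sum>c<n. \<Sum>d<n. M a d * N d c * P c b)"
    by (simp add: mm_def sum_distrib_right)
  also have "\<dots> = (\<Sum>d<n. \<Sum>c<n. M a d * N d c * P c b)" by (rule sum.swap)
  also have "\<dots> = mm M (mm N P) a b" by (simp add: mm_def sum_distrib_left mult.assoc)
  finally show "mm (mm M N) P a b = mm M (mm N P) a b" .
qed

lemma mm_one: "M \<in> gl \<Longrightarrow> mm one M = M" "M \<in> gl \<Longrightarrow> mm M one = M"
proof -
  assume M: "M \<in> gl"
  have "(\<Sum>c<n. (if a = c \<and> a < n then 1 else 0) * M c b) = (\<Sum>c<n. if c = a then M a b else 0)" for a b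
    by (rule sum.cong) auto
  then show "mm one M = M" using gl_zero[OF M] by (auto simp: mm_def one_def fun_eq_iff)
  have "(\<Sum>c<n. M a c * (if c = b \<and> c < n then 1 else 0)) = (\<Sum>c<n. if c = b then M a b else 0)" for a b
    by (rule sum.cong) auto
  then show "mm M one = M" using gl_zero[OF M] by (auto simp: mm_def one_def fun_eq_iff)
qed

lemma clin_mm_left: "clin (\<lambda>M. mm M N)"
  unfolding mm_def by (intro clinI) (simp_all add: fun_eq_iff cscale_fun_apply cscale_complex_def algebra_simps sum.distrib sum_distrib_left)
lemma clin_mm_right: "clin (mm M)"
  unfolding mm_def by (intro clinI) (simp_all add: fun_eq_iff cscale_fun_apply cscale_complex_def algebra_simps sum.distrib sum_distrib_left)
lemma clin_mv: "clin (mv M)"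
  unfolding mv_def by (intro clinI) (simp_all add: fun_eq_iff cscale_fun_apply cscale_complex_def algebra_simps sum.distrib sum_distrib_left)
lemma clin_mv_left: "clin mv"
  unfolding mv_def by (intro clinI) (simp_all add: fun_eq_iff cscale_fun_apply cscale_complex_def algebra_simps sum.distrib sum_distrib_left)

lemma mv_mm: "mv (mm M N) x = mv M (mv N x)"
proof
  fix a
  have "mv (mm M N) x a = (\<Sum>c<n. \<Sum>d<n. M a d * N d c * x c)" by (simp add: mm_def mv_def sum_distrib_right)
  also have "\<dots> = (\<Sum>d<n. \<Sum>c<n. M a d * N d c * x c)" by (rule sum.swap)
  also have "\<dots> = mv M (mv N x) a" by (simp add: mv_def sum_distrib_left mult.assoc)
  finally show "mv (mm M N) x a = mv M (mv N x) a" .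
qed

lemma mv_V: "M \<in> gl \<Longrightarrow> mv M x \<in> V" by (auto simp: cspace_iff mv_def gl_iff)

lemma mv_one: "x \<in> V \<Longrightarrow> mv one x = x"
proof
  fix a assume x: "x \<in> V"
  have "(\<Sum>c<n. (if a = c \<and> a < n then 1 else 0) * x c) = (\<Sum>c<n. if c = a then x a else 0)"
    by (rule sum.cong) auto
  then show "mv one x a = x a" using x by (auto simp: mv_def one_def cspace_iff)
qed

lemma mv_trunc: "mv M (mv one x) = mv M x"
proof -
  have "mv one x c = x c" if "c < n" for c
  proof -
    have "(\<Sum>d<n. (if c = d \<and> c < n then 1 else 0) * x d) = (\<Sum>d<n. if d = c then x c else 0)"
      by (rule sum.cong) (use that in auto)
    then show ?thesis using that by (simp add: mv_def one_def)
  qed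
  then show ?thesis by (simp add: mv_def[of M])
qed

definition ev :: "nat \<Rightarrow> nat \<Rightarrow> complex" where "ev b = (\<lambda>a. if a = b then 1 else 0)"

lemma ev_V: "b < n \<Longrightarrow> ev b \<in> V" by (auto simp: ev_def cspace_iff)

lemma mv_ev: "b < n \<Longrightarrow> mv M (ev b) = (\<lambda>a. M a b)"
proof
  fix a assume "b < n"
  have "(\<Sum>c<n. M a c * (if c = b then 1 else 0)) = (\<Sum>c<n. if c = b then M a b else 0)"
    by (rule sum.cong) auto
  then show "mv M (ev b) a = M a b" using \<open>b < n\<close> by (simp add: mv_def ev_def)
qed

lemma cspace_expand: "x \<in> V \<Longrightarrow> x = (\<Sum>b<n. x b *c ev b)"
proof
  fix a assume x: "x \<in> V"
  have "(\<Sum>b<n. x b *c ev b) a = (\<Sum>b<n. if b = a then x a else 0)"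
    unfolding sum_fun_apply by (rule sum.cong) (auto simp: ev_def cscale_fun_apply cscale_complex_def)
  then show "x a = (\<Sum>b<n. x b *c ev b) a" using x by (auto simp: cspace_iff not_less)
qed

lemma gl_eqI: "M \<in> gl \<Longrightarrow> N \<in> gl \<Longrightarrow> (\<And>x. x \<in> V \<Longrightarrow> mv M x = mv N x) \<Longrightarrow> M = N"
proof (intro ext)
  fix a b assume M: "M \<in> gl" and N: "N \<in> gl" and eq: "\<And>x. x \<in> V \<Longrightarrow> mv M x = mv N x"
  show "M a b = N a b"
  proof (cases "b < n")
    case True
    then show ?thesis using eq[OF ev_V[OF True]] mv_ev[OF True] by (metis (no_types))
  qed (simp add: gl_zero[OF M] gl_zero[OF N])
qed

definition mo :: "((nat \<Rightarrow> complex) \<Rightarrow> nat \<Rightarrow> complex) \<Rightarrow> cmat" where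
  "mo f = (\<lambda>a b. if a < n \<and> b < n then f (ev b) a else 0)"

lemma mo_gl: "mo f \<in> gl" by (auto simp: gl_iff mo_def)

lemma mv_mo:
  assumes f: "clin f" "\<And>x. x \<in> V \<Longrightarrow> f x \<in> V" and x: "x \<in> V" shows "mv (mo f) x = f x"
proof
  fix a
  have "f x a = f (\<Sum>b<n. x b *c ev b) a" using cspace_expand[OF x] by simp
  also have "\<dots> = (\<Sum>b<n. x b * f (ev b) a)"
    by (simp add: clin_sum[OF f(1)] clin_scale[OF f(1)] sum_fun_apply cscale_fun_apply cscale_complex_def)
  also have "\<dots> = mv (mo f) x a"
  proof (cases "a < n")
    case True then show ?thesis by (simp add: mv_def mo_def mult.commute)
  next
    case False
    then have "f (ev b) a = 0" if "b < n" for b using f(2)[OF ev_V[OF that]] by (auto simp: cspace_iff not_less)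
    then show ?thesis using False by (simp add: mv_def mo_def)
  qed
  finally show "mv (mo f) x a = f x a" by simp
qed

definition invertible2 :: "cmat \<Rightarrow> cmat \<Rightarrow> bool" where
  "invertible2 M N \<longleftrightarrow> M \<in> gl \<and> N \<in> gl \<and> mm M N = one \<and> mm N M = one"

lemma inverse_exists:
  assumes M: "M \<in> gl" and inj: "\<And>x. x \<in> V \<Longrightarrow> mv M x = 0 \<Longrightarrow> x = 0"
  shows "\<exists>N. invertible2 M N"
proof -
  obtain r where r: "clin r" "\<And>y. r y \<in> V" "\<And>x. x \<in> V \<Longrightarrow> r (mv M x) = x"
    by (rule linear_retraction[OF clin_mv fsubD[OF fsub_cspace] inj]) (assumption, assumption, rule that)
  have im: "mv M ` V = V"
    by (rule inj_image_eq[OF clin_mv fsub_cspace fsub_cspace inj]) (use mv_V[OF M] in auto)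
  have r2: "mv M (r y) = y" if y: "y \<in> V" for y
  proof -
    have "y \<in> mv M ` V" using y im by simp
    then obtain x where "x \<in> V" "y = mv M x" by (elim imageE)
    then show ?thesis using r(3) by simp
  qed
  have rm: "mv (mo r) x = r x" if "x \<in> V" for x using mv_mo[OF r(1) r(2) that] .
  have "mm M (mo r) = one"
    by (rule gl_eqI[OF mm_gl[OF M mo_gl] one_gl]) (simp add: mv_mm rm r2 mv_one)
  moreover have "mm (mo r) M = one"
    by (rule gl_eqI[OF mm_gl[OF mo_gl M] one_gl]) (simp add: mv_mm rm mv_V[OF M] r(3) mv_one)
  ultimately show ?thesis using M mo_gl unfolding invertible2_def by blast
qed

text \<open>\<open>mv one\<close> is the projection onto \<open>V\<close> that represents linear
  maps in \<open>homs\<close>; with it, \<open>mv\<close> maps the commutant isomorphically onto the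
  centraliser.\<close>

lemma dim_commutant:
  assumes A: "A \<in> gl" and z: "img (mv A) x V w = {0}"
  shows "cv.dim {M \<in> gl. mm M A = mm A M} = (\<Sum>j<w. (cv.dim (img (mv A) x V j) - cv.dim (img (mv A) x V (Suc j)))\<^sup>2)"
proof -
  let ?C = "{M \<in> gl. mm M A = mm A M}"
  have "cv.subspace ?C"
    using fsubD[OF fsub_gl] by (intro subspaceI)
      (auto simp: cv.subspace_def clin_simps[OF clin_mm_left] clin_simps[OF clin_mm_right])
  then have C: "fsub ?C" using fsub_subset[OF fsub_gl] by auto
  have "mv ` ?C = centralizer (mv A) (mv one) V"
  proof (intro antisym subsetI)
    fix h assume "h \<in> mv ` ?C"
    then obtain M where M: "M \<in> gl" "mm M A = mm A M" "h = mv M" by auto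
    then show "h \<in> centralizer (mv A) (mv one) V"
      unfolding centralizer_def homs_def using clin_mv[of M] mv_V[OF M(1)] mv_mm[of M A] mv_mm[of A M] mv_trunc by auto
  next
    fix h assume "h \<in> centralizer (mv A) (mv one) V"
    then have h: "clin h" "\<And>x. h (mv one x) = h x" "\<And>x. x \<in> V \<Longrightarrow> h x \<in> V" "\<And>x. x \<in> V \<Longrightarrow> h (mv A x) = mv A (h x)"
      by (auto simp: centralizer_def homs_def)
    have m: "mv (mo h) x = h x" if "x \<in> V" for x using mv_mo[OF h(1,3) that] .
    have "mv (mo h) x = h x" for x using m[OF mv_V[OF one_gl], of x] h(2) mv_trunc by simp
    then have "h = mv (mo h)" by auto
    moreover have "mm (mo h) A = mm A (mo h)"
      by (rule gl_eqI[OF mm_gl[OF mo_gl A] mm_gl[OF A mo_gl]]) (simp add: mv_mm m mv_V[OF A] h)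
    ultimately show "h \<in> mv ` ?C" using mo_gl by blast
  qed
  moreover have "M = 0" if "M \<in> ?C" "mv M = 0" for M
    using that gl_eqI[of M 0] fsub_zero_mem[OF fsub_gl] clin_0[OF clin_mv_left] by auto
  then have "cv.dim (mv ` ?C) = cv.dim ?C" by (rule dim_image_inj[OF clin_mv_left C])
  ultimately have "cv.dim ?C = cv.dim (centralizer (mv A) (mv one) V)" by simp
  also have "\<dots> = (\<Sum>j<w. (cv.dim (img (mv A) x V j) - cv.dim (img (mv A) x V (Suc j)))\<^sup>2)"
    by (rule dim_centralizer[OF clin_mv fsub_cspace mv_V[OF A] z clin_mv mv_V[OF one_gl] mv_one])
  finally show ?thesis .
qed

text \<open>Left multiplication by \<open>G\<close> carries the commutant of \<open>A\<close> onto
  the intertwiners.\<close>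

lemma dim_intertwiners:
  assumes A: "A \<in> gl" and G: "invertible2 G G'" and B: "B = mm G (mm A G')"
  shows "cv.dim {M \<in> gl. mm B M = mm M A} = cv.dim {M \<in> gl. mm M A = mm A M}"
proof -
  let ?C = "{M \<in> gl. mm M A = mm A M}"
  have g: "G \<in> gl" "G' \<in> gl" "mm G G' = one" "mm G' G = one" using G by (auto simp: invertible2_def)
  have "cv.subspace ?C"
    using fsubD[OF fsub_gl] by (intro subspaceI)
      (auto simp: cv.subspace_def clin_simps[OF clin_mm_left] clin_simps[OF clin_mm_right])
  then have C: "fsub ?C" using fsub_subset[OF fsub_gl] by auto
  have inj: "mm G' (mm G M) = M" "mm G (mm G' M) = M" if "M \<in> gl" for M
    using that g by (simp_all add: mm_assoc[symmetric] mm_one)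
  have "mm G ` ?C = {M \<in> gl. mm B M = mm M A}"
  proof (intro antisym subsetI)
    fix N assume "N \<in> mm G ` ?C"
    then obtain M where M: "M \<in> gl" "mm M A = mm A M" "N = mm G M" by auto
    have "mm B N = mm G (mm A (mm G' (mm G M)))" unfolding B M(3) by (simp add: mm_assoc)
    then show "N \<in> {M \<in> gl. mm B M = mm M A}" using M g inj(1)[OF M(1)] by (simp add: mm_gl mm_assoc)
  next
    fix N assume N: "N \<in> {M \<in> gl. mm B M = mm M A}"
    have "mm (mm G' N) A = mm G' (mm B N)" using N by (simp add: mm_assoc)
    also have "\<dots> = mm G' (mm G (mm A (mm G' N)))" unfolding B by (simp add: mm_assoc)
    also have "\<dots> = mm A (mm G' N)" using N g A by (intro inj(1) mm_gl) auto
    finally show "N \<in> mm G ` ?C" using N g inj(2)[of N] by (intro image_eqI[of _ _ "mm G' N"]) (auto simp: mm_gl)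
  qed
  moreover have "M = 0" if "M \<in> ?C" "mm G M = 0" for M
    using inj(1)[of M] that clin_0[OF clin_mm_right[of G']] by simp
  then have "cv.dim (mm G ` ?C) = cv.dim ?C" by (rule dim_image_inj[OF clin_mm_right C])
  ultimately show ?thesis by simp
qed

primrec mprod :: "(nat \<Rightarrow> cmat) \<Rightarrow> nat \<Rightarrow> cmat" where
  "mprod A 0 = one"
| "mprod A (Suc m) = mm (mprod A m) (A (Suc m))"

lemma mprod_gl: "(\<And>i. i \<in> {1..m} \<Longrightarrow> A i \<in> gl) \<Longrightarrow> mprod A m \<in> gl"
  by (induction m) (auto simp: one_gl mm_gl)

lemma cprod_mv: "x \<in> V \<Longrightarrow> (\<And>i. i \<in> {1..m} \<Longrightarrow> A i \<in> gl) \<Longrightarrow> cprod (\<lambda>i. mv (A i)) m x = mv (mprod A m) x"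
  by (induction m arbitrary: x) (auto simp: mv_one mv_mm mv_V)

text \<open>The product in reversed order; applied to the inverses it inverts
  \<open>mprod\<close>.\<close>

primrec rprod :: "(nat \<Rightarrow> cmat) \<Rightarrow> nat \<Rightarrow> cmat" where
  "rprod A 0 = one"
| "rprod A (Suc m) = mm (A (Suc m)) (rprod A m)"

lemma rprod_gl: "(\<And>i. i \<in> {1..m} \<Longrightarrow> A i \<in> gl) \<Longrightarrow> rprod A m \<in> gl"
  by (induction m) (auto simp: one_gl mm_gl)

lemma rprod_mprod:
  "(\<And>i. i \<in> {1..m} \<Longrightarrow> invertible2 (A i) (A' i)) \<Longrightarrow> mm (mprod A m) (rprod A' m) = one"
proof (induction m)
  case (Suc m)
  have g: "A (Suc m) \<in> gl" "A' (Suc m) \<in> gl" "mm (A (Suc m)) (A' (Suc m)) = one"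
    using Suc.prems[of "Suc m"] by (auto simp: invertible2_def)
  have r: "rprod A' m \<in> gl" using Suc.prems by (intro rprod_gl) (auto simp: invertible2_def)
  have "mm (mprod A (Suc m)) (rprod A' (Suc m)) = mm (mprod A m) (mm (mm (A (Suc m)) (A' (Suc m))) (rprod A' m))"
    by (simp add: mm_assoc)
  then show ?case using Suc g r by (simp add: mm_one)
qed (simp add: mm_one one_gl)

definition elem :: "nat \<Rightarrow> nat \<Rightarrow> cmat" where "elem b j = (\<lambda>a c. if a = b \<and> c = j then 1 else 0)"

lemma elem_gl: "b < n \<Longrightarrow> j < n \<Longrightarrow> elem b j \<in> gl" by (auto simp: elem_def gl_iff)

lemma gl_expand: "M \<in> gl \<Longrightarrow> M = (\<Sum>b<n. \<Sum>j<n. M b j *c elem b j)"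
proof (intro ext)
  fix a c assume M: "M \<in> gl"
  have "(\<Sum>b<n. \<Sum>j<n. M b j *c elem b j) a c = (\<Sum>b<n. \<Sum>j<n. if j = c then if b = a then M a c else 0 else 0)"
    unfolding sum_fun_apply by (intro sum.cong) (auto simp: elem_def cscale_fun_apply cscale_complex_def)
  also have "\<dots> = M a c" using gl_zero[OF M, of a c] by (cases "c < n"; cases "a < n") simp_all
  finally show "M a c = (\<Sum>b<n. \<Sum>j<n. M b j *c elem b j) a c" by simp
qed

end

section \<open>Intertwiners of two solutions\<close>

locale hom_system = mats n for n +
  fixes k :: nat and A A' B B' :: "nat \<Rightarrow> cmat"
  assumes k: "k \<ge> 1"
    and invA: "\<And>i. i \<in> {1..k} \<Longrightarrow> invertible2 (A i) (A' i)"
    and invB: "\<And>i. i \<in> {1..k} \<Longrightarrow> invertible2 (B i) (B' i)"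
    and prodA: "mprod A k = one" and prodB: "mprod B k = one"
begin

text \<open>The action on homomorphisms from the tuple \<open>A\<close> to the tuple
  \<open>B\<close>: a matrix is fixed by \<open>T i\<close> exactly if it intertwines
  \<open>A i\<close> and \<open>B i\<close>.\<close>

definition T :: "nat \<Rightarrow> cmat \<Rightarrow> cmat" where "T i M = mm (B i) (mm M (A' i))"

lemma gls: "i \<in> {1..k} \<Longrightarrow> A i \<in> gl" "i \<in> {1..k} \<Longrightarrow> A' i \<in> gl" "i \<in> {1..k} \<Longrightarrow> B i \<in> gl"
  using invA invB by (auto simp: invertible2_def)

lemma A'A: "i \<in> {1..k} \<Longrightarrow> mm (A' i) (A i) = one" "i \<in> {1..k} \<Longrightarrow> mm (A i) (A' i) = one"
  using invA by (auto simp: invertible2_def)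

lemma cprod_T: "m \<le> k \<Longrightarrow> M \<in> gl \<Longrightarrow> cprod T m M = mm (mprod B m) (mm M (rprod A' m))"
proof (induction m arbitrary: M)
  case (Suc m)
  have "mm (B (Suc m)) (mm M (A' (Suc m))) \<in> gl" using Suc.prems gls by (intro mm_gl) auto
  then show ?case using Suc by (simp add: T_def mm_assoc)
qed (simp add: mm_one one_gl mm_gl)

sublocale monodromy gl k T
proof
  show "fsub gl" by (rule fsub_gl)
  show "1 \<le> k" by (rule k)
  show "clin (T i)" for i unfolding T_def using clin_comp[OF clin_mm_right clin_mm_left] .
  show "T i M \<in> gl" if "i \<in> {1..k}" "M \<in> gl" for i M unfolding T_def using gls[OF that(1)] that(2) by (intro mm_gl)
  fix M assume M: "M \<in> gl"
  have "rprod A' k = one"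
    using rprod_mprod[of k A A', OF invA] prodA rprod_gl[of k A'] gls(2) by (simp add: mm_one)
  then show "cprod T k M = M" using cprod_T[OF order_refl M] prodB M by (simp add: mm_one)
qed

lemma T_fixed:
  assumes i: "i \<in> {1..k}" and M: "M \<in> gl" shows "T i M = M \<longleftrightarrow> mm (B i) M = mm M (A i)"
proof
  assume "T i M = M"
  then have "mm M (A i) = mm (mm (B i) (mm M (A' i))) (A i)" by (simp add: T_def)
  then show "mm (B i) M = mm M (A i)" using A'A[OF i] M by (simp add: mm_assoc mm_one)
next
  assume "mm (B i) M = mm M (A i)"
  then have "T i M = mm (mm M (A i)) (A' i)" by (simp add: T_def mm_assoc[symmetric])
  then show "T i M = M" using A'A[OF i] M by (simp add: mm_assoc mm_one)
qed

lemma Fix_eq: "i \<in> {1..k} \<Longrightarrow> {M \<in> gl. T i M = M} = {M \<in> gl. mm (B i) M = mm M (A i)}"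
  using T_fixed by auto

text \<open>The trace form identifies functionals invariant under \<open>T\<close> with intertwiners in the other
  direction.\<close>

lemma annihilator:
  assumes R: "cv.subspace R" "R \<subseteq> gl" "R \<noteq> gl" and fox: "fox T k ` Hs \<subseteq> R"
  obtains h where "h \<in> gl" "h \<noteq> 0" "\<And>i. i \<in> {1..k} \<Longrightarrow> mm (A i) h = mm h (B i)"
    "\<And>M. M \<in> R \<Longrightarrow> (\<Sum>b<n. \<Sum>j<n. M b j * h j b) = 0"
proof -
  obtain M0 where M0: "M0 \<in> gl" "M0 \<notin> R" using R by auto
  obtain l :: "cmat \<Rightarrow> complex" where l: "clin l" "\<And>M. M \<in> R \<Longrightarrow> l M = 0" "l M0 = 1"
    by (rule separating_functional[OF R(1) M0(2)]) (rule that)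
  define h :: cmat where "h = (\<lambda>j b. if j < n \<and> b < n then l (elem b j) else 0)"
  have h: "h \<in> gl" by (auto simp: gl_iff h_def)
  have lM: "l M = (\<Sum>b<n. \<Sum>j<n. M b j * h j b)" if "M \<in> gl" for M
  proof -
    have "l M = l (\<Sum>b<n. \<Sum>j<n. M b j *c elem b j)" using gl_expand[OF that] by simp
    also have "\<dots> = (\<Sum>b<n. \<Sum>j<n. M b j * l (elem b j))"
      by (simp add: clin_sum[OF l(1)] clin_scale[OF l(1)] cscale_complex_def)
    finally show ?thesis by (simp add: h_def)
  qed
  have "h \<noteq> 0" using lM[OF M0(1)] l(3) by auto
  moreover have "mm (A i) h = mm h (B i)" if i: "i \<in> {1..k}" for i
  proof (intro ext)
    fix j b
    show "mm (A i) h j b = mm h (B i) j b"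
    proof (cases "j < n \<and> b < n")
      case False then show ?thesis using gl_zero[OF mm_gl[OF gls(1)[OF i] h]] gl_zero[OF mm_gl[OF h gls(3)[OF i]]] by metis
    next
      case True
      \<comment> \<open>Test with a matrix unit: \<open>B i N - N A i\<close> is a difference
        \<open>T i M - M\<close> with \<open>M = N A i\<close>, so \<open>l\<close> kills it. The
        value of \<open>l\<close> on its two terms is the entry at \<open>(j, b)\<close> of
        \<open>h B i\<close> and of \<open>A i h\<close>.\<close>
      let ?N = "elem b j"
      have N: "?N \<in> gl" using elem_gl True by blast
      have NA: "mm ?N (A i) \<in> gl" using mm_gl[OF N gls(1)[OF i]] .
      have BN: "mm (B i) ?N \<in> gl" using mm_gl[OF gls(3)[OF i] N] .
      have "T i (mm ?N (A i)) = mm (B i) ?N" using A'A(2)[OF i] N by (simp add: T_def mm_assoc mm_one)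
      then have "mm (B i) ?N - mm ?N (A i) \<in> R" using fox_range_T[OF i NA] fox by auto
      then have "l (mm (B i) ?N - mm ?N (A i)) = 0" by (rule l(2))
      then have "l (mm (B i) ?N) = l (mm ?N (A i))" by (simp add: clin_diff[OF l(1)])
      moreover have "mm ?N (A i) a c = (if a = b then A i j c else 0)" for a c
      proof -
        have "mm ?N (A i) a c = (\<Sum>d<n. if d = j then if a = b then A i j c else 0 else 0)"
          unfolding mm_def by (rule sum.cong) (auto simp: elem_def)
        then show ?thesis using True by simp
      qed
      then have "l (mm ?N (A i)) = (\<Sum>a<n. if a = b then \<Sum>c<n. A i j c * h c b else 0)"
        unfolding lM[OF NA] by (intro sum.cong) auto
      moreover have "mm (B i) ?N a c = (if c = j then B i a b else 0)" for a c
      proof -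
        have "mm (B i) ?N a c = (\<Sum>d<n. if d = b then if c = j then B i a b else 0 else 0)"
          unfolding mm_def by (rule sum.cong) (auto simp: elem_def)
        then show ?thesis using True by simp
      qed
      then have "l (mm (B i) ?N) = (\<Sum>a<n. \<Sum>c<n. if c = j then B i a b * h j a else 0)"
        unfolding lM[OF BN] by (intro sum.cong) auto
      ultimately show ?thesis using True by (simp add: mm_def mult.commute)
    qed
  qed
  moreover have "(\<Sum>b<n. \<Sum>j<n. M b j * h j b) = 0" if "M \<in> R" for M using lM[of M] l(2) that R(2) by auto
  ultimately show ?thesis using that[OF h] by blast
qed

text \<open>The hypothesis is incompatible with both \<open>Inv = 0\<close> and \<open>fox\<close>
  being onto. A nonzero invariant intertwines from \<open>A\<close> to \<open>B\<close>; if the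
  range of \<open>fox\<close> is proper, its annihilator intertwines from \<open>B\<close> to
  \<open>A\<close>.\<close>

lemma intertwiner:
  assumes "(\<Sum>i\<in>{1..k}. cv.dim {M \<in> gl. mm (B i) M = mm M (A i)}) + 2 * (n * n) \<ge> k * (n * n) + 2"
  shows "(\<exists>h\<in>gl. h \<noteq> 0 \<and> (\<forall>i\<in>{1..k}. mm (B i) h = mm h (A i))) \<or>
    (\<exists>h\<in>gl. h \<noteq> 0 \<and> (\<forall>i\<in>{1..k}. mm (A i) h = mm h (B i)))"
proof (cases "fox T k ` Hs = gl")
  case False
  then show ?thesis
    using annihilator[OF fsubD[OF fsub_image[OF clin_fox fsub_Hs]] fox_range_subset False order_refl] by metis
next
  case True
  have "(\<Sum>i\<in>{1..k}. cv.dim {M \<in> gl. mm (B i) M = mm M (A i)}) = (\<Sum>i\<in>{1..k}. cv.dim {M \<in> gl. T i M = M})"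
    using Fix_eq by (intro sum.cong) auto
  then have "(\<Sum>i\<in>{1..k}. cv.dim {M \<in> gl. mm (B i) M = mm M (A i)}) + n * n \<le> cv.dim Inv + (k - 1) * (n * n)"
    using scott True by (simp add: dim_gl)
  moreover have "k * (n * n) = (k - 1) * (n * n) + n * n" using k by (cases k) auto
  ultimately have "cv.dim Inv \<noteq> 0" using assms by linarith
  then have "Inv \<noteq> {0}" using fsub_dim_0[OF fsub_Inv] by simp
  then obtain h where "h \<in> Inv" "h \<noteq> 0" using fsub_zero_mem[OF fsub_Inv] by auto
  then show ?thesis using T_fixed by auto
qed

end


section \<open>Translation from library matrices\<close>

context mats
begin

definition fm :: "complex mat \<Rightarrow> cmat" where "fm A = (\<lambda>a b. if a < n \<and> b < n then A $$ (a, b) else 0)"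
definition tm :: "cmat \<Rightarrow> complex mat" where "tm M = mat n n (\<lambda>(a, b). M a b)"

lemma fm_gl: "fm A \<in> gl" by (auto simp: gl_iff fm_def)
lemma tm_carrier: "tm M \<in> carrier_mat n n" by (simp add: tm_def)
lemma fm_tm: "M \<in> gl \<Longrightarrow> fm (tm M) = M" by (auto simp: gl_iff fm_def tm_def fun_eq_iff)
lemma tm_fm: "A \<in> carrier_mat n n \<Longrightarrow> tm (fm A) = A" by (auto simp: fm_def tm_def)

lemma fm_inj: "A \<in> carrier_mat n n \<Longrightarrow> B \<in> carrier_mat n n \<Longrightarrow> fm A = fm B \<Longrightarrow> A = B"
  using tm_fm by metis

lemma fm_mult: "A \<in> carrier_mat n n \<Longrightarrow> B \<in> carrier_mat n n \<Longrightarrow> fm (A * B) = mm (fm A) (fm B)"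
  by (auto simp: fm_def mm_def fun_eq_iff scalar_prod_def atLeast0LessThan intro!: sum.cong)

lemma tm_mult: "M \<in> gl \<Longrightarrow> N \<in> gl \<Longrightarrow> tm (mm M N) = tm M * tm N"
  using fm_inj[OF tm_carrier mult_carrier_mat[OF tm_carrier tm_carrier]]
  by (simp add: fm_tm mm_gl fm_mult tm_carrier)

lemma fm_one: "fm (1\<^sub>m n) = one" by (auto simp: fm_def one_def fun_eq_iff)

lemma tm_one: "tm one = 1\<^sub>m n" using tm_fm[of "1\<^sub>m n"] fm_one by simp

lemma fm_shift: "A \<in> carrier_mat n n \<Longrightarrow> fm (A - c \<cdot>\<^sub>m 1\<^sub>m n) = fm A - c *c one"
  by (auto simp: fm_def one_def fun_eq_iff cscale_fun_apply cscale_complex_def)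

lemma mv_fm_shift: "A \<in> carrier_mat n n \<Longrightarrow> x \<in> V \<Longrightarrow> mv (fm (A - c \<cdot>\<^sub>m 1\<^sub>m n)) x = mv (fm A) x - c *c x"
  by (simp add: fm_shift clin_diff[OF clin_mv_left] clin_scale[OF clin_mv_left] mv_one cscale_fun_apply)

text \<open>\<open>mat_prod\<close> multiplies from the right end and \<open>mprod\<close> from the
  left; associativity, for matrices of known size, lets the last factor be split off.\<close>

lemma mat_prod_Suc:
  assumes "\<And>i. i \<in> {1..Suc m} \<Longrightarrow> M i \<in> carrier_mat n n"
  shows "mat_prod n M (Suc m) = mat_prod n M m * M (Suc m)"
proof -
  have carrier: "foldr (\<lambda>l P. M l * P) xs P \<in> carrier_mat n n"
    if "set xs \<subseteq> {1..m}" "P \<in> carrier_mat n n" for xs P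
    using that by (induction xs) (auto intro!: mult_carrier_mat[of _ n n] assms)
  have "foldr (\<lambda>l P. M l * P) xs N = foldr (\<lambda>l P. M l * P) xs (1\<^sub>m n) * N"
    if "set xs \<subseteq> {1..m}" "N \<in> carrier_mat n n" for xs N
    using that
  proof (induction xs)
    case (Cons i xs)
    have "i \<in> {1..Suc m}" using Cons.prems(1) by auto
    then have Mi: "M i \<in> carrier_mat n n" by (rule assms)
    have F: "foldr (\<lambda>l P. M l * P) xs (1\<^sub>m n) \<in> carrier_mat n n" using Cons.prems by (intro carrier) auto
    have "foldr (\<lambda>l P. M l * P) xs N = foldr (\<lambda>l P. M l * P) xs (1\<^sub>m n) * N" using Cons.prems by (intro Cons.IH) auto
    then show ?case using assoc_mult_mat[OF Mi F Cons.prems(2)] by simp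
  qed simp
  moreover have "set [1..<Suc m] \<subseteq> {1..m}" by auto
  moreover have "M (Suc m) \<in> carrier_mat n n" using assms by auto
  ultimately have "foldr (\<lambda>l P. M l * P) [1..<Suc m] (M (Suc m)) =
      foldr (\<lambda>l P. M l * P) [1..<Suc m] (1\<^sub>m n) * M (Suc m)" by blast
  then show ?thesis using \<open>M (Suc m) \<in> carrier_mat n n\<close> by (simp add: mat_prod_def)
qed

lemma mat_prod_carrier:
  assumes "\<And>i. i \<in> {1..m} \<Longrightarrow> M i \<in> carrier_mat n n"
  shows "mat_prod n M m \<in> carrier_mat n n"
  using assms
proof (induction m)
  case (Suc m)
  then have "mat_prod n M m \<in> carrier_mat n n" "M (Suc m) \<in> carrier_mat n n" by auto
  then show ?case using mat_prod_Suc[of m M] Suc.prems by simp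
qed (simp add: mat_prod_def)

lemma fm_mat_prod:
  assumes "\<And>i. i \<in> {1..m} \<Longrightarrow> M i \<in> carrier_mat n n"
  shows "fm (mat_prod n M m) = mprod (\<lambda>i. fm (M i)) m"
  using assms
proof (induction m)
  case (Suc m)
  have "mat_prod n M m \<in> carrier_mat n n" using Suc.prems by (intro mat_prod_carrier) auto
  then show ?case using Suc mat_prod_Suc[of m M] by (simp add: fm_mult)
qed (simp add: mat_prod_def fm_one)

text \<open>The matrix product applies its last factor first, whereas \<open>img\<close> starts with
  the first shift. The factors commute, and the induction therefore carries commutation with
  \<open>fm A\<close> along.\<close>

lemma img_shifted_prod:
  assumes A: "A \<in> carrier_mat n n"
  shows "mv (fm (shifted_prod n A x j)) ` V = img (mv (fm A)) x V j"
proof -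
  let ?N = "\<lambda>i. fm (A - x i \<cdot>\<^sub>m 1\<^sub>m n)"
  have carrier: "A - x i \<cdot>\<^sub>m 1\<^sub>m n \<in> carrier_mat n n" for i
    by (intro minus_carrier_mat smult_carrier_mat one_carrier_mat)
  have "mv (mprod ?N j) ` V = img (mv (fm A)) x V j \<and>
      (\<forall>v\<in>V. mv (mprod ?N j) (mv (fm A) v) = mv (fm A) (mv (mprod ?N j) v))"
  proof (induction j)
    case 0
    have "mv one ` V = (\<lambda>v. v) ` V" by (rule image_cong) (simp_all add: mv_one)
    then show ?case using mv_V[OF fm_gl] by (simp add: mv_one)
  next
    case (Suc j)
    have comm: "mv (mprod ?N j) (mv (fm A) v) = mv (fm A) (mv (mprod ?N j) v)" if "v \<in> V" for v
      using conjunct2[OF Suc.IH] that by (rule bspec)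
    have N: "mv (?N i) v = mv (fm A) v - x i *c v" if "v \<in> V" for v i using mv_fm_shift[OF A that] .
    have P: "mprod ?N j \<in> gl" by (rule mprod_gl) (rule fm_gl)
    have step: "mv (mprod ?N (Suc j)) v = mv (fm A) (mv (mprod ?N j) v) - x (Suc j) *c mv (mprod ?N j) v" if "v \<in> V" for v
      using comm[OF that] N[OF that, of "Suc j"] by (simp add: mv_mm clin_simps[OF clin_mv])
    have "mv (mprod ?N (Suc j)) ` V = (\<lambda>v. mv (fm A) v - x (Suc j) *c v) ` mv (mprod ?N j) ` V"
      unfolding image_image using step by (intro image_cong) auto
    moreover have "mv (mprod ?N (Suc j)) (mv (fm A) v) = mv (fm A) (mv (mprod ?N (Suc j)) v)" if "v \<in> V" for v
      using step[OF that] step[OF mv_V[OF fm_gl]] comm[OF that] by (simp add: clin_simps[OF clin_mv])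
    ultimately show ?case using Suc by simp
  qed
  then show ?thesis unfolding shifted_prod_def using fm_mat_prod[of j "\<lambda>j. A - x j \<cdot>\<^sub>m 1\<^sub>m n"] carrier by simp
qed

definition vf :: "complex vec \<Rightarrow> nat \<Rightarrow> complex" where "vf v = (\<lambda>a. if a < n then v $ a else 0)"

lemma vf_inj: "inj_on vf (carrier_vec n)"
proof (rule inj_onI, rule eq_vecI)
  fix u v a assume *: "u \<in> carrier_vec n" "v \<in> carrier_vec n" "vf u = vf v" "a < dim_vec v"
  have "vf u a = vf v a" using *(3) by (rule fun_cong)
  then show "u $ a = v $ a" using *(2,4) by (simp add: vf_def)
qed auto

lemma vf_V: "vf v \<in> V" by (auto simp: vf_def cspace_iff)

lemma vf_vec: "x \<in> V \<Longrightarrow> vf (vec n x) = x" by (auto simp: vf_def cspace_iff fun_eq_iff)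

lemma vf_mult: "A \<in> carrier_mat n n \<Longrightarrow> v \<in> carrier_vec n \<Longrightarrow> vf (A *\<^sub>v v) = mv (fm A) (vf v)"
  by (auto simp: vf_def mv_def fm_def fun_eq_iff scalar_prod_def atLeast0LessThan intro!: sum.cong)

lemma vf_lincomb:
  assumes "finite S" "S \<subseteq> carrier_vec n"
  shows "vf (LinearCombinations.module.lincomb (module_vec TYPE(complex) n) c S) = (\<Sum>v\<in>S. c v *c vf v)"
proof
  fix a
  interpret vs: vec_space "TYPE(complex)" n .
  show "vf (vs.lincomb c S) a = (\<Sum>v\<in>S. c v *c vf v) a"
  proof (cases "a < n")
    case True
    then show ?thesis using vs.lincomb_index[OF True assms(2), of c]
      by (simp add: sum_fun_apply vf_def cscale_fun_apply cscale_complex_def)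
  qed (simp add: sum_fun_apply vf_def cscale_fun_apply cscale_complex_def)
qed

lemma lin_dep_iff:
  assumes S: "finite S" "S \<subseteq> carrier_vec n"
  shows "LinearCombinations.module.lin_dep class_ring (module_vec TYPE(complex) n) S \<longleftrightarrow> cv.dependent (vf ` S)"
proof -
  interpret vs: vec_space "TYPE(complex)" n .
  have inj: "inj_on vf B" if "B \<subseteq> S" for B using vf_inj S(2) that inj_on_subset by blast
  have vf0: "vf (0\<^sub>v n) = 0" by (auto simp: vf_def fun_eq_iff)
  show ?thesis
  proof
    assume "vs.lin_dep S"
    then obtain B c v where B: "finite B" "B \<subseteq> S" "vs.lincomb c B = 0\<^sub>v n" "v \<in> B" "c v \<noteq> 0"
      unfolding vs.lin_dep_def by (auto simp: module_vec_simps class_ring_simps)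
    have "(\<Sum>v\<in>B. c v *c vf v) = 0" using vf_lincomb[OF B(1) subset_trans[OF B(2) S(2)], of c] B(3) vf0 by simp
    then have "(\<Sum>y\<in>vf ` B. c (the_inv_into B vf y) *c y) = 0"
      using inj[OF B(2)] by (simp add: sum.reindex the_inv_into_f_f)
    moreover have "c (the_inv_into B vf (vf v)) \<noteq> 0" using B inj[OF B(2)] by (simp add: the_inv_into_f_f)
    ultimately show "cv.dependent (vf ` S)"
      unfolding cv.dependent_explicit using B(1,2,4) by (intro exI[of _ "vf ` B"] exI[of _ "\<lambda>y. c (the_inv_into B vf y)"]) auto
  next
    assume "cv.dependent (vf ` S)"
    then obtain t u where t: "finite t" "t \<subseteq> vf ` S" "(\<Sum>y\<in>t. u y *c y) = 0" "\<exists>y\<in>t. u y \<noteq> 0"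
      unfolding cv.dependent_explicit by blast
    define B where "B = {v \<in> S. vf v \<in> t}"
    have B: "B \<subseteq> S" "finite B" using S by (auto simp: B_def)
    have tB: "t = vf ` B" using t(2) by (auto simp: B_def)
    let ?c = "\<lambda>v. u (vf v)"
    have "vf (vs.lincomb ?c B) = 0"
      using vf_lincomb[OF B(2) subset_trans[OF B(1) S(2)], of ?c] t(3) inj[OF B(1)] unfolding tB by (simp add: sum.reindex)
    then have "vs.lincomb ?c B = 0\<^sub>v n"
      using inj_onD[OF vf_inj, of "vs.lincomb ?c B" "0\<^sub>v n"] vf0 vs.lincomb_closed[of B ?c] B(1) S(2) by (auto simp: class_ring_simps)
    moreover obtain v where "v \<in> B" "?c v \<noteq> 0" using t(4) unfolding tB by blast
    ultimately show "vs.lin_dep S" unfolding vs.lin_dep_def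
      using B by (intro exI[of _ B] exI[of _ ?c] exI[of _ v]) (auto simp: module_vec_simps class_ring_simps)
  qed
qed

text \<open>A maximal independent set of columns computes \<open>rank\<close>, and \<open>vf\<close>
  maps it to a basis of the range.\<close>

lemma rank_eq_dim:
  assumes A: "A \<in> carrier_mat n n" shows "vec_space.rank n A = cv.dim (mv (fm A) ` V)"
proof -
  interpret vs: vec_space "TYPE(complex)" n .
  let ?C = "set (cols A)"
  have C: "finite ?C" "?C \<subseteq> carrier_vec n" using cols_dim[of A] A by auto
  obtain S where S: "maximal S (\<lambda>T. T \<subseteq> ?C \<and> vs.lin_indpt T)"
    using maximal_exists_superset[of ?C "\<lambda>T. T \<subseteq> ?C \<and> vs.lin_indpt T" "{}"] C(1)
    by (auto simp: vs.lin_dep_def)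
  then have SC: "S \<subseteq> ?C" "vs.lin_indpt S" by (auto simp: maximal_def)
  have max: "T = S" if "S \<subseteq> T" "T \<subseteq> ?C" "vs.lin_indpt T" for T using S that unfolding maximal_def by blast
  have fS: "finite S" "S \<subseteq> carrier_vec n" using SC C finite_subset by auto
  have ind: "cv.independent (vf ` S)" using lin_dep_iff[OF fS] SC by blast
  have "vf ` ?C \<subseteq> cv.span (vf ` S)"
  proof (rule image_subsetI, rule ccontr)
    fix c assume c: "c \<in> ?C" "vf c \<notin> cv.span (vf ` S)"
    then have "cv.independent (vf ` insert c S)" using ind by (simp add: cv.independent_insert)
    moreover have "finite (insert c S)" "insert c S \<subseteq> carrier_vec n" using fS c(1) C(2) by auto
    ultimately have "vs.lin_indpt (insert c S)" using lin_dep_iff by blast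
    then have "insert c S = S" using max[of "insert c S"] c(1) SC by blast
    then show False using c(2) cv.span_base by blast
  qed
  moreover have cols: "vf ` ?C = (\<lambda>b. mv (fm A) (ev b)) ` {..<n}"
  proof -
    have "vf (col A b) = mv (fm A) (ev b)" if "b < n" for b
      using that A by (auto simp: mv_ev[OF that] vf_def fm_def fun_eq_iff)
    moreover have "?C = (\<lambda>b. col A b) ` {..<n}" using A by (auto simp: cols_def)
    ultimately show ?thesis by (auto simp: image_image)
  qed
  have "mv (fm A) ` V \<subseteq> cv.span (vf ` ?C)"
  proof (rule image_subsetI)
    fix x assume x: "x \<in> V"
    have "mv (fm A) x = (\<Sum>b<n. x b *c mv (fm A) (ev b))"
      by (subst cspace_expand[OF x]) (simp add: clin_simps[OF clin_mv])
    also have "\<dots> \<in> cv.span (vf ` ?C)" unfolding cols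
      by (intro cv.span_sum cv.span_scale cv.span_base) auto
    finally show "mv (fm A) x \<in> cv.span (vf ` ?C)" .
  qed
  ultimately have sp: "mv (fm A) ` V \<subseteq> cv.span (vf ` S)"
    using cv.span_minimal[of "vf ` ?C" "cv.span (vf ` S)"] by auto
  have "vf ` S \<subseteq> mv (fm A) ` V" using SC(1) cols ev_V by blast
  then have "cv.dim (mv (fm A) ` V) = card (vf ` S)"
    using cv.basis_card_eq_dim[OF _ sp ind] by simp
  also have "\<dots> = card S" using card_image inj_on_subset[OF vf_inj fS(2)] by blast
  finally show ?thesis using vs.rank_card_indpt[OF A S] by simp
qed

lemma rank_shifted_prod:
  assumes "A \<in> carrier_mat n n"
  shows "vec_space.rank n (shifted_prod n A x j) = cv.dim (img (mv (fm A)) x V j)"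
proof -
  have "shifted_prod n A x j \<in> carrier_mat n n"
    unfolding shifted_prod_def by (intro mat_prod_carrier minus_carrier_mat smult_carrier_mat one_carrier_mat)
  then show ?thesis using rank_eq_dim img_shifted_prod[OF assms] by simp
qed

lemma GL_invertible2: "A \<in> GL n \<Longrightarrow> \<exists>N. invertible2 (fm A) N"
proof -
  assume A: "A \<in> GL n"
  then have c: "A \<in> carrier_mat n n" and "invertible_mat A" by (auto simp: GL_def)
  then obtain B where B: "A * B = 1\<^sub>m n" "B * A = 1\<^sub>m (dim_row B)"
    unfolding invertible_mat_def inverts_mat_def using c by auto
  have "dim_col B = n" using arg_cong[OF B(1), of dim_col] by simp
  moreover have "dim_row B = n" using arg_cong[OF B(2), of dim_col] c by simp
  ultimately have Bc: "B \<in> carrier_mat n n" by auto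
  then show ?thesis using fm_gl B c fm_mult[of A B] fm_mult[of B A] fm_one unfolding invertible2_def
    by (intro exI[of _ "fm B"]) auto
qed

lemma similar_iff:
  assumes M: "M \<in> gl" and N: "N \<in> gl"
  shows "similar_mat (tm N) (tm M) \<longleftrightarrow> (\<exists>G G'. invertible2 G G' \<and> N = mm G (mm M G'))"
proof
  assume "similar_mat (tm N) (tm M)"
  then obtain P R where "similar_mat_wit (tm N) (tm M) P R" by (auto simp: similar_mat_def)
  then have PR: "P \<in> carrier_mat n n" "R \<in> carrier_mat n n" "P * R = 1\<^sub>m n" "R * P = 1\<^sub>m n" "tm N = P * tm M * R"
    unfolding similar_mat_wit_def Let_def by (auto simp: tm_def)
  have "invertible2 (fm P) (fm R)" unfolding invertible2_def
    using PR fm_gl fm_mult[of P R] fm_mult[of R P] fm_one by simp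
  moreover have "N = mm (fm P) (mm M (fm R))"
    using arg_cong[OF PR(5), of fm] PR(1,2) tm_carrier[of M] fm_tm[OF M] fm_tm[OF N]
    by (simp add: fm_mult mm_assoc)
  ultimately show "\<exists>G G'. invertible2 G G' \<and> N = mm G (mm M G')" by blast
next
  assume "\<exists>G G'. invertible2 G G' \<and> N = mm G (mm M G')"
  then obtain G G' where G: "G \<in> gl" "G' \<in> gl" "mm G G' = one" "mm G' G = one" "N = mm G (mm M G')"
    unfolding invertible2_def by blast
  have "tm N = tm G * tm M * tm G'"
    unfolding G(5) using G(1,2) M by (simp add: tm_mult mm_gl assoc_mult_mat[of _ n n _ n _ n] tm_carrier)
  moreover have "tm G * tm G' = 1\<^sub>m n" "tm G' * tm G = 1\<^sub>m n"
    using G tm_mult[of G G'] tm_mult[of G' G] tm_one by simp_all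
  ultimately show "similar_mat (tm N) (tm M)"
    using tm_carrier mult_carrier_mat[OF mult_carrier_mat[OF tm_carrier tm_carrier] tm_carrier]
    by (intro similar_matI[of _ _ "tm G" "tm G'" n]) auto
qed

lemma simultaneously_conjugate_iff:
  assumes "\<And>i. i \<in> {1..k} \<Longrightarrow> A i \<in> carrier_mat n n" "\<And>i. i \<in> {1..k} \<Longrightarrow> B i \<in> carrier_mat n n"
  shows "simultaneously_conjugate n k A B \<longleftrightarrow>
    (\<exists>G G'. invertible2 G G' \<and> (\<forall>i\<in>{1..k}. mm (fm (B i)) G = mm G (fm (A i))))"
proof
  assume "simultaneously_conjugate n k A B"
  then obtain P R where PR: "P \<in> carrier_mat n n" "R \<in> carrier_mat n n" "P * R = 1\<^sub>m n" "R * P = 1\<^sub>m n"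
    "\<And>i. i \<in> {1..k} \<Longrightarrow> B i = P * A i * R" unfolding simultaneously_conjugate_def by blast
  have inv: "mm (fm R) (fm P) = one" "mm (fm P) (fm R) = one"
    using PR fm_mult[of P R] fm_mult[of R P] fm_one by simp_all
  have "mm (fm (B i)) (fm P) = mm (fm P) (fm (A i))" if i: "i \<in> {1..k}" for i
    using PR(1,2) assms(1)[OF i] inv by (simp add: PR(5)[OF i] fm_mult mm_assoc mm_one fm_gl)
  then show "\<exists>G G'. invertible2 G G' \<and> (\<forall>i\<in>{1..k}. mm (fm (B i)) G = mm G (fm (A i)))"
    using inv fm_gl unfolding invertible2_def by blast
next
  assume "\<exists>G G'. invertible2 G G' \<and> (\<forall>i\<in>{1..k}. mm (fm (B i)) G = mm G (fm (A i)))"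
  then obtain G G' where G: "G \<in> gl" "G' \<in> gl" "mm G G' = one" "mm G' G = one"
    "\<And>i. i \<in> {1..k} \<Longrightarrow> mm (fm (B i)) G = mm G (fm (A i))" unfolding invertible2_def by blast
  have "B i = tm G * A i * tm G'" if i: "i \<in> {1..k}" for i
  proof (rule fm_inj[OF assms(2)[OF i]])
    show "tm G * A i * tm G' \<in> carrier_mat n n" using assms(1)[OF i] tm_carrier by (intro mult_carrier_mat) auto
    have "fm (tm G * A i * tm G') = mm (mm (fm (B i)) G) G'"
      using assms(1)[OF i] G(1,2) G(5)[OF i] tm_carrier mult_carrier_mat[OF tm_carrier assms(1)[OF i]] by (simp add: fm_mult fm_tm)
    then show "fm (B i) = fm (tm G * A i * tm G')" using G(3) fm_gl by (simp add: mm_assoc mm_one)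
  qed
  moreover have "tm G * tm G' = 1\<^sub>m n" "tm G' * tm G = 1\<^sub>m n"
    using G tm_mult[of G G'] tm_mult[of G' G] tm_one by simp_all
  ultimately show "simultaneously_conjugate n k A B" unfolding simultaneously_conjugate_def
    using tm_carrier by blast
qed

lemma subspace_vf:
  assumes "cv.subspace S" "S \<subseteq> V"
  shows "VectorSpace.subspace class_ring {v \<in> carrier_vec n. vf v \<in> S} (module_vec TYPE(complex) n)"
proof -
  interpret vs: vec_space "TYPE(complex)" n .
  have "vf (u + v) = vf u + vf v" if "u \<in> carrier_vec n" "v \<in> carrier_vec n" for u v
    using that by (auto simp: vf_def fun_eq_iff)
  moreover have "vf (c \<cdot>\<^sub>v v) = c *c vf v" if "v \<in> carrier_vec n" for c v
    using that by (auto simp: vf_def fun_eq_iff cscale_fun_apply cscale_complex_def)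
  moreover have "vf (0\<^sub>v n) = 0" by (auto simp: vf_def fun_eq_iff)
  ultimately show ?thesis
    using assms vs.module_axioms vs.vectorspace_axioms unfolding VectorSpace.subspace_def submodule_def
    by (auto simp: module_vec_simps class_ring_simps cv.subspace_def)
qed

lemma subspace_image_vf:
  assumes "VectorSpace.subspace class_ring U (module_vec TYPE(complex) n)"
  shows "cv.subspace (vf ` U)" "U \<subseteq> carrier_vec n"
proof -
  have U: "U \<subseteq> carrier_vec n" "\<And>u v. u \<in> U \<Longrightarrow> v \<in> U \<Longrightarrow> u + v \<in> U" "0\<^sub>v n \<in> U" "\<And>c v. v \<in> U \<Longrightarrow> c \<cdot>\<^sub>v v \<in> U"
    using assms unfolding VectorSpace.subspace_def submodule_def by (auto simp: module_vec_simps class_ring_simps)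
  show "U \<subseteq> carrier_vec n" by (rule U(1))
  have "vf (u + v) = vf u + vf v" if "u \<in> U" "v \<in> U" for u v
    using that U(1) by (auto simp: vf_def fun_eq_iff)
  moreover have "vf (c \<cdot>\<^sub>v v) = c *c vf v" if "v \<in> U" for c v
    using that U(1) by (auto simp: vf_def fun_eq_iff cscale_fun_apply cscale_complex_def)
  moreover have "vf (0\<^sub>v n) = 0" by (auto simp: vf_def fun_eq_iff)
  ultimately show "cv.subspace (vf ` U)"
    using U by (intro subspaceI) (auto simp: image_iff, metis+)
qed

lemma irreducible_tuple_iff:
  assumes A: "\<And>i. i \<in> {1..k} \<Longrightarrow> A i \<in> carrier_mat n n"
  shows "irreducible_tuple n k A \<longleftrightarrow> irred_family V k (\<lambda>i. mv (fm (A i)))"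
proof
  assume irr: "irreducible_tuple n k A"
  show "irred_family V k (\<lambda>i. mv (fm (A i)))"
    unfolding irred_family_def
  proof (intro allI impI)
    fix S assume "cv.subspace S \<and> S \<subseteq> V \<and> (\<forall>i\<in>{1..k}. \<forall>v\<in>S. mv (fm (A i)) v \<in> S)"
    then have S: "cv.subspace S" "S \<subseteq> V" and inv: "\<And>i v. i \<in> {1..k} \<Longrightarrow> v \<in> S \<Longrightarrow> mv (fm (A i)) v \<in> S" by auto
    let ?U = "{v \<in> carrier_vec n. vf v \<in> S}"
    have "A i *\<^sub>v u \<in> ?U" if "i \<in> {1..k}" "u \<in> ?U" for i u
      using that A[OF that(1)] inv vf_mult[OF A[OF that(1)]] by auto
    then have "?U = {0\<^sub>v n} \<or> ?U = carrier_vec n"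
      using irr subspace_vf[OF S] unfolding irreducible_tuple_def by blast
    moreover have "S = vf ` ?U"
    proof (intro antisym subsetI)
      fix x assume x: "x \<in> S"
      then have "vf (vec n x) = x" using vf_vec S(2) by blast
      then show "x \<in> vf ` ?U" using x by (intro image_eqI[of _ _ "vec n x"]) auto
    qed auto
    moreover have "vf ` carrier_vec n = V"
    proof (intro antisym subsetI)
      fix x assume "x \<in> V"
      then show "x \<in> vf ` carrier_vec n" using vf_vec by (intro image_eqI[of _ _ "vec n x"]) auto
    qed (use vf_V in auto)
    moreover have "vf (0\<^sub>v n) = 0" by (auto simp: vf_def fun_eq_iff)
    ultimately show "S = {0} \<or> S = V" by (elim disjE) simp_all
  qed
next
  assume irr: "irred_family V k (\<lambda>i. mv (fm (A i)))"
  show "irreducible_tuple n k A" unfolding irreducible_tuple_def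
  proof (intro allI impI)
    fix U assume a: "VectorSpace.subspace class_ring U (module_vec TYPE(complex) n) \<and> (\<forall>i\<in>{1..k}. \<forall>u\<in>U. A i *\<^sub>v u \<in> U)"
    then have sU: "cv.subspace (vf ` U)" and Uc: "U \<subseteq> carrier_vec n" using subspace_image_vf by blast+
    have "vf ` U = {0} \<or> vf ` U = V"
    proof (rule irred_familyD[OF irr sU])
      show "vf ` U \<subseteq> V" using vf_V by auto
      fix i x assume i: "i \<in> {1..k}" and "x \<in> vf ` U"
      then obtain u where u: "u \<in> U" "x = vf u" by (elim imageE)
      then have "mv (fm (A i)) x = vf (A i *\<^sub>v u)" using vf_mult[OF A[OF i]] Uc by auto
      then show "mv (fm (A i)) x \<in> vf ` U" using a i u(1) by auto
    qed
    then show "U = {0\<^sub>v n} \<or> U = carrier_vec n"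
    proof
      assume z: "vf ` U = {0}"
      have vf0: "vf (0\<^sub>v n) = 0" by (auto simp: vf_def fun_eq_iff)
      have "u = 0\<^sub>v n" if "u \<in> U" for u
      proof (rule inj_onD[OF vf_inj])
        have "vf u \<in> {0}" unfolding z[symmetric] using that by blast
        then show "vf u = vf (0\<^sub>v n)" using vf0 by simp
      qed (use that Uc in auto)
      moreover have "U \<noteq> {}" using z by auto
      ultimately show ?thesis by auto
    next
      assume f: "vf ` U = V"
      have "v \<in> U" if "v \<in> carrier_vec n" for v
      proof -
        have "vf v \<in> vf ` U" unfolding f by (rule vf_V)
        then obtain u where "u \<in> U" "vf v = vf u" by (elim imageE)
        then show ?thesis using inj_onD[OF vf_inj, of v u] that Uc by auto
      qed
      then show ?thesis using Uc by auto
    qed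
  qed
qed

end


section \<open>A Newton iteration\<close>

text \<open>A seminorm suffices: families of matrices are total functions, and entries outside the
  index range are not seen. Limits are taken only in finitely many complex coordinates.\<close>

locale cseminorm =
  fixes N :: "'a::cvec \<Rightarrow> real"
  assumes N_ge: "N x \<ge> 0" and N_add: "N (x + y) \<le> N x + N y" and N_scale: "N (c *c x) = cmod c * N x"
begin

lemma N_0: "N 0 = 0" using N_scale[of 0 0] by simp

lemma N_sum: "N (\<Sum>i\<in>S. f i) \<le> (\<Sum>i\<in>S. N (f i))"
proof (induction S rule: infinite_finite_induct)
  case (insert i S)
  then show ?case using N_add[of "f i" "sum f S"] by simp
qed (simp_all add: N_0)

text \<open>Strict differentiability at 0, with a bounded derivative: the estimate concerns two
  nearby points, which is the form that a contraction argument needs. It is stable under sums and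
  products, so polynomial expressions are covered.\<close>

definition sdiff :: "('a \<Rightarrow> complex) \<Rightarrow> ('a \<Rightarrow> complex) \<Rightarrow> bool" where
  "sdiff f L \<longleftrightarrow> clin L \<and> (\<exists>K. \<forall>x. cmod (L x) \<le> K * N x) \<and>
     (\<forall>e>0. \<exists>d>0. \<forall>x y. N x < d \<longrightarrow> N y < d \<longrightarrow> cmod (f x - f y - L (x - y)) \<le> e * N (x - y))"

lemma sdiff_linear: "clin L \<Longrightarrow> (\<And>x. cmod (L x) \<le> K * N x) \<Longrightarrow> sdiff L L"
  unfolding sdiff_def by (auto simp: clin_diff N_ge intro: exI[of _ 1])

lemma sdiff_const: "sdiff (\<lambda>_. c) (\<lambda>_. 0)"
  unfolding sdiff_def by (auto simp: N_ge clin_zero intro: exI[of _ 0] exI[of _ 1])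

lemma sdiff_add:
  assumes f: "sdiff f L" and g: "sdiff g M" shows "sdiff (\<lambda>x. f x + g x) (\<lambda>x. L x + M x)"
  unfolding sdiff_def
proof (intro conjI allI impI)
  show "clin (\<lambda>x. L x + M x)" using f g by (auto simp: sdiff_def intro: clin_plus)
  obtain K K' where "\<And>x. cmod (L x) \<le> K * N x" "\<And>x. cmod (M x) \<le> K' * N x"
    using f g unfolding sdiff_def by blast
  then have "cmod (L x + M x) \<le> (K + K') * N x" for x
    by (simp add: norm_triangle_le add_mono distrib_right)
  then show "\<exists>K. \<forall>x. cmod (L x + M x) \<le> K * N x" by blast
next
  fix e :: real assume "e > 0"
  then have e: "e / 2 > 0" by simp
  obtain d where d: "d > 0" "\<And>x y. N x < d \<Longrightarrow> N y < d \<Longrightarrow> cmod (f x - f y - L (x - y)) \<le> e / 2 * N (x - y)"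
    using f e unfolding sdiff_def by meson
  obtain d' where d': "d' > 0" "\<And>x y. N x < d' \<Longrightarrow> N y < d' \<Longrightarrow> cmod (g x - g y - M (x - y)) \<le> e / 2 * N (x - y)"
    using g e unfolding sdiff_def by meson
  have "cmod (f x + g x - (f y + g y) - (L (x - y) + M (x - y))) \<le> e * N (x - y)"
    if "N x < min d d'" "N y < min d d'" for x y
  proof -
    have "f x + g x - (f y + g y) - (L (x - y) + M (x - y)) = (f x - f y - L (x - y)) + (g x - g y - M (x - y))"
      by simp
    then show ?thesis using norm_triangle_ineq d(2)[of x y] d'(2)[of x y] that
      by (smt (verit, best) field_sum_of_halves distrib_right min_less_iff_conj)
  qed
  then show "\<exists>d>0. \<forall>x y. N x < d \<longrightarrow> N y < d \<longrightarrow>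
      cmod (f x + g x - (f y + g y) - (L (x - y) + M (x - y))) \<le> e * N (x - y)"
    using d(1) d'(1) by (intro exI[of _ "min d d'"]) auto
qed

lemma sdiff_sum: "(\<And>i. i \<in> S \<Longrightarrow> sdiff (f i) (L i)) \<Longrightarrow> sdiff (\<lambda>x. \<Sum>i\<in>S. f i x) (\<lambda>x. \<Sum>i\<in>S. L i x)"
proof (induction S rule: infinite_finite_induct)
  case (insert i S)
  then show ?case using sdiff_add[of "f i" "L i"] by simp
qed (simp_all add: sdiff_const)

lemma sdiff_bound:
  assumes "sdiff f L"
  obtains K d where "K \<ge> 0" "d > 0" "\<And>x. cmod (L x) \<le> K * N x" "\<And>x. N x < d \<Longrightarrow> cmod (f x - f 0) \<le> K * N x"
proof -
  obtain K where K: "\<And>x. cmod (L x) \<le> K * N x" using assms unfolding sdiff_def by blast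
  have "\<exists>d>0. \<forall>x y. N x < d \<longrightarrow> N y < d \<longrightarrow> cmod (f x - f y - L (x - y)) \<le> 1 * N (x - y)"
    using assms unfolding sdiff_def by (elim conjE allE[of _ "1::real"]) simp
  then obtain d where d: "d > 0" "\<And>x y. N x < d \<Longrightarrow> N y < d \<Longrightarrow> cmod (f x - f y - L (x - y)) \<le> 1 * N (x - y)"
    by (elim exE conjE) (rule that, auto)
  have K': "cmod (L x) \<le> (\<bar>K\<bar> + 1) * N x" for x
    by (rule order_trans[OF K[of x] mult_right_mono]) (use N_ge in auto)
  have "cmod (f x - f 0) \<le> (\<bar>K\<bar> + 1) * N x" if "N x < d" for x
  proof -
    have "cmod (f x - f 0) \<le> cmod (f x - f 0 - L x) + cmod (L x)"
      using norm_triangle_ineq[of "f x - f 0 - L x" "L x"] by simp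
    also have "\<dots> \<le> N x + K * N x" using d(2)[of x 0] d(1) that K[of x] by (simp add: N_0)
    also have "\<dots> \<le> (\<bar>K\<bar> + 1) * N x" using mult_right_mono[of K "\<bar>K\<bar>" "N x"] N_ge[of x] by (simp add: distrib_right)
    finally show ?thesis .
  qed
  then show ?thesis using that[of "\<bar>K\<bar> + 1" d] d(1) K' by auto
qed

lemma sdiff_mult:
  assumes f: "sdiff f L" and g: "sdiff g M" shows "sdiff (\<lambda>x. f x * g x) (\<lambda>x. f 0 * M x + L x * g 0)"
proof -
  obtain K1 d1 where 1: "K1 \<ge> 0" "d1 > 0" "\<And>x. cmod (L x) \<le> K1 * N x" "\<And>x. N x < d1 \<Longrightarrow> cmod (f x - f 0) \<le> K1 * N x"
    by (rule sdiff_bound[OF f]) (rule that)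
  obtain K2 d2 where 2: "K2 \<ge> 0" "d2 > 0" "\<And>x. cmod (M x) \<le> K2 * N x" "\<And>x. N x < d2 \<Longrightarrow> cmod (g x - g 0) \<le> K2 * N x"
    by (rule sdiff_bound[OF g]) (rule that)
  have clin: "clin L" "clin M" using f g by (auto simp: sdiff_def)
  show ?thesis unfolding sdiff_def
  proof (intro conjI allI impI)
    show "clin (\<lambda>x. f 0 * M x + L x * g 0)"
      using clin by (intro clinI) (simp_all add: clin_simps cscale_complex_def algebra_simps)
    have "cmod (f 0 * M x + L x * g 0) \<le> (cmod (f 0) * K2 + K1 * cmod (g 0)) * N x" for x
    proof -
      have "cmod (f 0 * M x + L x * g 0) \<le> cmod (f 0) * cmod (M x) + cmod (L x) * cmod (g 0)"
        by (metis norm_mult norm_triangle_ineq)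
      also have "\<dots> \<le> cmod (f 0) * (K2 * N x) + (K1 * N x) * cmod (g 0)"
        using 1(3) 2(3) by (intro add_mono mult_left_mono mult_right_mono) auto
      finally show ?thesis by (simp add: algebra_simps)
    qed
    then show "\<exists>K. \<forall>x. cmod (f 0 * M x + L x * g 0) \<le> K * N x" by blast
  next
    fix e :: real assume "e > 0"
    \<comment> \<open>\<open>Q\<close> bounds the values near 0 and the slopes. The error of the
      product splits into four terms, each of which is at most \<open>e' * Q\<close>, that is
      \<open>e / 4\<close>, times the distance.\<close>
    define Q where "Q = cmod (f 0) + cmod (g 0) + K1 + K2 + 1"
    have Q: "Q \<ge> 1" using 1(1) 2(1) by (simp add: Q_def)
    define e' where "e' = e / (4 * Q)"
    have e': "e' > 0" using \<open>e > 0\<close> Q by (simp add: e'_def)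
    obtain d3 where d3: "d3 > 0" "\<And>x y. N x < d3 \<Longrightarrow> N y < d3 \<Longrightarrow> cmod (f x - f y - L (x - y)) \<le> e' * N (x - y)"
      using f e' unfolding sdiff_def by meson
    obtain d4 where d4: "d4 > 0" "\<And>x y. N x < d4 \<Longrightarrow> N y < d4 \<Longrightarrow> cmod (g x - g y - M (x - y)) \<le> e' * N (x - y)"
      using g e' unfolding sdiff_def by meson
    define d where "d = Min {d1, d2, d3, d4, 1, e' / Q}"
    have d: "d > 0" "d \<le> d1" "d \<le> d2" "d \<le> d3" "d \<le> d4" "d \<le> 1" "d \<le> e' / Q"
    proof -
      have "e' / Q > 0" using e' Q by simp
      then show "d > 0" using 1(2) 2(2) d3(1) d4(1) by (simp add: d_def)
    qed (simp_all add: d_def)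
    have dQ: "d * Q \<le> e'" using d(7) Q pos_le_divide_eq[of Q d e'] by simp
    have "cmod (f x * g x - f y * g y - (f 0 * M (x - y) + L (x - y) * g 0)) \<le> e * N (x - y)"
      if x: "N x < d" and y: "N y < d" for x y
    proof -
      let ?n = "N (x - y)"
      have n: "?n \<ge> 0" by (rule N_ge)
      have fx: "cmod (f x - f 0) \<le> K1 * d" "cmod (g y - g 0) \<le> K2 * d"
      proof -
        have "cmod (f x - f 0) \<le> K1 * N x" using 1(4)[of x] x d(2) by simp
        also have "\<dots> \<le> K1 * d" using x 1(1) by (intro mult_left_mono) auto
        finally show "cmod (f x - f 0) \<le> K1 * d" .
        have "cmod (g y - g 0) \<le> K2 * N y" using 2(4)[of y] y d(3) by simp
        also have "\<dots> \<le> K2 * d" using y 2(1) by (intro mult_left_mono) auto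
        finally show "cmod (g y - g 0) \<le> K2 * d" .
      qed
      have "K1 * d \<le> K1" "K2 * d \<le> K2" using d 1(1) 2(1) by (simp_all add: mult_left_le)
      then have fQ: "cmod (f x) \<le> Q" "cmod (g y) \<le> Q"
        using fx norm_triangle_ineq[of "f x - f 0" "f 0"] norm_triangle_ineq[of "g y - g 0" "g 0"] 1(1) 2(1)
          norm_ge_zero[of "f 0"] norm_ge_zero[of "g 0"] unfolding Q_def diff_add_cancel by linarith+
      have dd: "0 \<le> d" using d by simp
      have "K1 * d * K2 \<le> d * Q * Q" "K2 * d * K1 \<le> d * Q * Q"
      proof -
        have KQ: "K1 \<le> Q" "K2 \<le> Q" using 1(1) 2(1) by (simp_all add: Q_def)
        have "K1 * d * K2 \<le> Q * d * Q" using KQ 1(1) 2(1) dd Q by (intro mult_mono) auto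
        moreover have "K2 * d * K1 \<le> Q * d * Q" using KQ 1(1) 2(1) dd Q by (intro mult_mono) auto
        ultimately show "K1 * d * K2 \<le> d * Q * Q" "K2 * d * K1 \<le> d * Q * Q" by (simp_all add: mult.commute)
      qed
      moreover have "d * Q * Q \<le> e' * Q" using dQ Q by (intro mult_right_mono) auto
      ultimately have KK: "K1 * d * K2 \<le> e' * Q" "K2 * d * K1 \<le> e' * Q" by linarith+
      have i: "cmod (f x * (g x - g y - M (x - y))) \<le> Q * (e' * ?n)"
        unfolding norm_mult using fQ d4(2)[of x y] x y d Q by (intro mult_mono) auto
      have ii: "cmod ((f x - f 0) * M (x - y)) \<le> (e' * Q) * ?n"
      proof -
        have "cmod ((f x - f 0) * M (x - y)) \<le> (K1 * d) * (K2 * ?n)"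
          unfolding norm_mult using fx 2(3) 1(1) dd by (intro mult_mono) auto
        also have "\<dots> = (K1 * d * K2) * ?n" by simp
        also have "\<dots> \<le> (e' * Q) * ?n" using KK n by (intro mult_right_mono) auto
        finally show ?thesis .
      qed
      have iii: "cmod (g y * (f x - f y - L (x - y))) \<le> Q * (e' * ?n)"
        unfolding norm_mult using fQ d3(2)[of x y] x y d Q by (intro mult_mono) auto
      have iv: "cmod ((g y - g 0) * L (x - y)) \<le> (e' * Q) * ?n"
      proof -
        have "cmod ((g y - g 0) * L (x - y)) \<le> (K2 * d) * (K1 * ?n)"
          unfolding norm_mult using fx 1(3) 2(1) dd by (intro mult_mono) auto
        also have "\<dots> = (K2 * d * K1) * ?n" by simp
        also have "\<dots> \<le> (e' * Q) * ?n" using KK n by (intro mult_right_mono) auto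
        finally show ?thesis .
      qed
      have "f x * g x - f y * g y - (f 0 * M (x - y) + L (x - y) * g 0) =
        f x * (g x - g y - M (x - y)) + (f x - f 0) * M (x - y) + g y * (f x - f y - L (x - y)) + (g y - g 0) * L (x - y)"
        by (simp add: algebra_simps)
      then have "cmod (f x * g x - f y * g y - (f 0 * M (x - y) + L (x - y) * g 0)) \<le> 4 * (Q * (e' * ?n))"
        using i ii iii iv
          norm_triangle_ineq[of "f x * (g x - g y - M (x - y)) + (f x - f 0) * M (x - y) + g y * (f x - f y - L (x - y))" "(g y - g 0) * L (x - y)"]
          norm_triangle_ineq[of "f x * (g x - g y - M (x - y)) + (f x - f 0) * M (x - y)" "g y * (f x - f y - L (x - y))"]
          norm_triangle_ineq[of "f x * (g x - g y - M (x - y))" "(f x - f 0) * M (x - y)"]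
        by (simp add: mult_ac)
      also have "\<dots> = e * ?n" using Q by (simp add: e'_def)
      finally show ?thesis .
    qed
    then show "\<exists>d>0. \<forall>x y. N x < d \<longrightarrow> N y < d \<longrightarrow>
        cmod (f x * g x - f y * g y - (f 0 * M (x - y) + L (x - y) * g 0)) \<le> e * N (x - y)"
      using d(1) by blast
  qed
qed

text \<open>A simplified Newton iteration that keeps the derivative at 0, with right inverse given
  by the \<open>u l\<close>. It starts at \<open>t v\<close>, where the residual is
  \<open>o(t)\<close> because the derivative kills \<open>v\<close>; the correction is therefore
  \<open>o(t)\<close> as well, and the solutions found are tangent to \<open>v\<close>.\<close>

lemma newton:
  fixes f L :: "'k \<Rightarrow> 'a \<Rightarrow> complex"
  assumes J: "finite J" and f: "\<And>j. j \<in> J \<Longrightarrow> sdiff (f j) (L j)" and f0: "\<And>j. j \<in> J \<Longrightarrow> f j 0 = 0"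
    and Lv: "\<And>j. j \<in> J \<Longrightarrow> L j v = 0"
    and Lu: "\<And>j l. j \<in> J \<Longrightarrow> l \<in> J \<Longrightarrow> L j (u l) = (if j = l then 1 else 0)" and e: "e > 0"
  shows "\<exists>d>0. \<forall>t. 0 < t \<and> t < d \<longrightarrow> (\<exists>x. (\<forall>j\<in>J. f j x = 0) \<and> N (x - of_real t *c v) \<le> e * t)"
proof -
  define S where "S = (\<lambda>y::'k \<Rightarrow> complex. \<Sum>l\<in>J. y l *c u l)"
  define C where "C = 1 + (\<Sum>l\<in>J. N (u l))"
  define nr where "nr = (\<lambda>y::'k \<Rightarrow> complex. \<Sum>l\<in>J. cmod (y l))"
  have C: "C \<ge> 1" by (simp add: C_def N_ge sum_nonneg)
  have nr_ge: "nr y \<ge> 0" for y by (simp add: nr_def sum_nonneg)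
  have nr_le: "cmod (y j) \<le> nr y" if "j \<in> J" for y j
    unfolding nr_def using member_le_sum[OF that, of "\<lambda>l. cmod (y l)"] J by simp
  have NS: "N (S y) \<le> C * nr y" for y
  proof -
    have "N (S y) \<le> (\<Sum>l\<in>J. cmod (y l) * N (u l))" unfolding S_def using N_sum[of "\<lambda>l. y l *c u l" J] by (simp add: N_scale)
    also have "\<dots> \<le> (\<Sum>l\<in>J. nr y * N (u l))" using nr_le N_ge by (intro sum_mono mult_right_mono) auto
    also have "\<dots> \<le> C * nr y" using nr_ge[of y] by (simp add: C_def sum_distrib_left[symmetric] algebra_simps)
    finally show ?thesis .
  qed
  have linL: "clin (L j)" if "j \<in> J" for j using f[OF that] by (simp add: sdiff_def)
  have LS: "L j (S y) = y j" if "j \<in> J" for j y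
  proof -
    have "L j (S y) = (\<Sum>l\<in>J. y l * L j (u l))"
      by (simp add: S_def clin_sum[OF linL[OF that]] clin_scale[OF linL[OF that]] cscale_complex_def)
    also have "\<dots> = (\<Sum>l\<in>J. if j = l then y l else 0)" using Lu[OF that] by (intro sum.cong) auto
    finally show ?thesis using that J by simp
  qed
  have Sdiff: "S y - S z = S (\<lambda>l. y l - z l)" for y z
    by (simp add: S_def sum_subtractf cv.scale_left_diff_distrib)
  define q where "q = real (card J)"
  have q: "q \<ge> 0" by (simp add: q_def)
  \<comment> \<open>The first bound makes the residual halve in each step (\<open>\<eta>1\<close>),
    the second keeps the total correction below \<open>e * t\<close>
    (\<open>\<eta>2\<close>).\<close>
  define \<eta> where "\<eta> = min (1 / (2 * (q + 1) * C)) (e / (2 * C * (q + 1) * (N v + 1)))"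
  have pos: "2 * (q + 1) * C > 0" "2 * C * (q + 1) * (N v + 1) > 0" using q C N_ge[of v] by (auto intro!: mult_pos_pos)
  then have \<eta>: "\<eta> > 0" using e by (simp add: \<eta>_def)
  have "\<eta> * (2 * (q + 1) * C) \<le> 1" using pos(1) pos_le_divide_eq[OF pos(1), of \<eta> 1] by (simp add: \<eta>_def)
  moreover have "q * \<eta> * C \<le> (q + 1) * \<eta> * C" using \<eta> C by (intro mult_right_mono) auto
  moreover have "\<eta> * (2 * (q + 1) * C) = 2 * ((q + 1) * \<eta> * C)" by simp
  ultimately have \<eta>1: "q * \<eta> * C \<le> 1 / 2" by linarith
  have "\<eta> * (2 * C * (q + 1) * (N v + 1)) \<le> e" using pos(2) pos_le_divide_eq[OF pos(2), of \<eta> e] by (simp add: \<eta>_def)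
  moreover have "2 * C * (q * \<eta> * N v) \<le> 2 * C * ((q + 1) * \<eta> * (N v + 1))"
    using q C \<eta> N_ge[of v] by (intro mult_left_mono mult_mono) auto
  moreover have "\<eta> * (2 * C * (q + 1) * (N v + 1)) = 2 * C * ((q + 1) * \<eta> * (N v + 1))" by simp
  ultimately have \<eta>2: "2 * C * (q * \<eta> * N v) \<le> e" by linarith
  have "\<forall>j\<in>J. \<exists>d>0. \<forall>x y. N x < d \<longrightarrow> N y < d \<longrightarrow> cmod (f j x - f j y - L j (x - y)) \<le> \<eta> * N (x - y)"
    using f \<eta> unfolding sdiff_def by blast
  then obtain dd where dd: "\<And>j. j \<in> J \<Longrightarrow> dd j > 0"
    "\<And>j x y. j \<in> J \<Longrightarrow> N x < dd j \<Longrightarrow> N y < dd j \<Longrightarrow> cmod (f j x - f j y - L j (x - y)) \<le> \<eta> * N (x - y)"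
    by metis
  define d0 where "d0 = Min (insert 1 (dd ` J))"
  have d0: "d0 > 0" using J dd(1) by (auto simp: d0_def)
  have d0le: "d0 \<le> dd j" if "j \<in> J" for j using J that by (auto simp: d0_def)
  have est: "cmod (f j x - f j y - L j (x - y)) \<le> \<eta> * N (x - y)" if "j \<in> J" "N x < d0" "N y < d0" for j x y
    using dd(2)[OF that(1)] d0le[OF that(1)] that by simp
  have pos3: "N v + e + 1 > 0" using N_ge[of v] e by linarith
  show ?thesis
  proof (intro exI[of _ "d0 / (N v + e + 1)"] conjI allI impI)
    show "d0 / (N v + e + 1) > 0" using d0 pos3 by simp
    fix t :: real assume t: "0 < t \<and> t < d0 / (N v + e + 1)"
    then have "t * (N v + e + 1) < d0" using pos3 by (simp add: pos_less_divide_eq)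
    then have tb: "t * N v + e * t < d0" using t by (simp add: algebra_simps)
    define p where "p = of_real t *c v"
    have Np: "N p = t * N v" using t by (simp add: p_def N_scale)
    have Lp: "L j p = 0" if "j \<in> J" for j using Lv[OF that] clin_scale[OF linL[OF that]] by (simp add: p_def)
    \<comment> \<open>The iteration takes place in coordinates: \<open>L j (S y) = y j\<close>, so
      subtracting the residual is the Newton step with the derivative at 0.\<close>
    define Y where "Y = rec_nat (\<lambda>_. 0) (\<lambda>_ y. (\<lambda>j. y j - f j (p + S y)))"
    have Y0: "Y 0 = (\<lambda>_. 0)" and YS: "Y (Suc m) = (\<lambda>j. Y m j - f j (p + S (Y m)))" for m
      by (simp_all add: Y_def)
    define r where "r = (\<lambda>m. nr (\<lambda>j. f j (p + S (Y m))))"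
    define \<rho> where "\<rho> = q * \<eta> * (t * N v)"
    have \<rho>: "\<rho> \<ge> 0" using q \<eta> t N_ge[of v] by (simp add: \<rho>_def)
    have \<rho>2: "C * (2 * \<rho>) \<le> e * t"
    proof -
      have "C * (2 * \<rho>) = (2 * C * (q * \<eta> * N v)) * t" unfolding \<rho>_def by (simp only: mult_ac)
      moreover have "(2 * C * (q * \<eta> * N v)) * t \<le> e * t" using mult_right_mono[OF \<eta>2, of t] t by simp
      ultimately show ?thesis by linarith
    qed
    have ball: "N (p + S y) < d0" if "nr y \<le> 2 * \<rho>" for y
    proof -
      have "N (S y) \<le> C * (2 * \<rho>)" using NS[of y] mult_left_mono[OF that, of C] C by linarith
      then show ?thesis using N_add[of p "S y"] Np \<rho>2 tb by linarith
    qed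
    have r0: "r 0 \<le> \<rho>"
    proof -
      have "cmod (f j p) \<le> \<eta> * (t * N v)" if "j \<in> J" for j
        using est[OF that, of p 0] Lp[OF that] f0[OF that] d0 tb Np t e by (simp add: N_0) (smt (verit) mult_pos_pos)
      then have "(\<Sum>j\<in>J. cmod (f j p)) \<le> (\<Sum>j\<in>J. \<eta> * (t * N v))" by (rule sum_mono)
      then show ?thesis by (simp add: r_def nr_def Y0 S_def \<rho>_def q_def mult.assoc)
    qed
    \<comment> \<open>The two bounds need each other: halving residuals sum to a geometric series,
      and that sum keeps the iterates in the ball where \<open>est\<close> holds.\<close>
    have main: "r m \<le> \<rho> * (1/2) ^ m \<and> nr (Y m) \<le> 2 * \<rho> * (1 - (1/2) ^ m)" for m
    proof (induction m)
      case 0 show ?case using r0 by (simp add: Y0 nr_def)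
    next
      case (Suc m)
      have pw: "2 * \<rho> * (1 - (1/2) ^ m) \<le> 2 * \<rho>" for m using \<rho> by (simp add: algebra_simps)
      have "nr (Y (Suc m)) \<le> (\<Sum>l\<in>J. cmod (Y m l) + cmod (f l (p + S (Y m))))"
        unfolding nr_def YS by (intro sum_mono norm_triangle_ineq4)
      also have "\<dots> = nr (Y m) + r m" by (simp add: nr_def r_def sum.distrib)
      also have "\<dots> \<le> 2 * \<rho> * (1 - (1/2) ^ Suc m)" using Suc by (simp add: algebra_simps)
      finally have n: "nr (Y (Suc m)) \<le> 2 * \<rho> * (1 - (1/2) ^ Suc m)" .
      have b: "N (p + S (Y m)) < d0" "N (p + S (Y (Suc m))) < d0"
        using ball[of "Y m"] ball[of "Y (Suc m)"] n Suc pw[of m] pw[of "Suc m"] by linarith+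
      have df: "p + S (Y (Suc m)) - (p + S (Y m)) = S (\<lambda>j. - f j (p + S (Y m)))" by (simp add: Sdiff YS)
      have "cmod (f j (p + S (Y (Suc m)))) \<le> \<eta> * (C * r m)" if j: "j \<in> J" for j
      proof -
        have "cmod (f j (p + S (Y (Suc m)))) \<le> \<eta> * N (S (\<lambda>j. - f j (p + S (Y m))))"
          using est[OF j b(2) b(1)] unfolding df by (simp add: LS[OF j])
        also have "\<dots> \<le> \<eta> * (C * r m)" using NS[of "\<lambda>j. - f j (p + S (Y m))"] \<eta> by (simp add: nr_def r_def)
        finally show ?thesis .
      qed
      then have "r (Suc m) \<le> (\<Sum>j\<in>J. \<eta> * (C * r m))" unfolding r_def[of ] nr_def by (intro sum_mono) (simp add: r_def nr_def)
      also have "\<dots> = (q * \<eta> * C) * r m" by (simp add: q_def)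
      also have "\<dots> \<le> 1/2 * r m" using \<eta>1 nr_ge by (intro mult_right_mono) (simp_all add: r_def)
      finally show ?case using Suc n by simp
    qed
    have "\<exists>y. \<forall>j\<in>J. (\<lambda>m. Y m j) \<longlonglongrightarrow> y j"
    proof -
      have "\<exists>l. (\<lambda>m. Y m j) \<longlonglongrightarrow> l" if j: "j \<in> J" for j
      proof -
        have "cmod (Y (Suc m) j - Y m j) \<le> \<rho> * (1/2) ^ m" for m
          using nr_le[OF j, of "\<lambda>j. f j (p + S (Y m))"] main[of m] by (simp add: YS r_def)
        moreover have "summable (\<lambda>m. \<rho> * (1/2::real) ^ m)" by (intro summable_mult summable_geometric) simp
        ultimately have "summable (\<lambda>m. Y (Suc m) j - Y m j)"
          by (intro summable_comparison_test[of "\<lambda>m. Y (Suc m) j - Y m j" "\<lambda>m. \<rho> * (1/2) ^ m"]) blast+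
        then have "(\<lambda>m. \<Sum>i<m. Y (Suc i) j - Y i j) \<longlonglongrightarrow> suminf (\<lambda>m. Y (Suc m) j - Y m j)" by (rule summable_LIMSEQ)
        then have "(\<lambda>m. Y m j) \<longlonglongrightarrow> suminf (\<lambda>m. Y (Suc m) j - Y m j)"
          using sum_lessThan_telescope[of "\<lambda>i. Y i j"] by (simp add: Y0)
        then show ?thesis by (rule exI)
      qed
      then show ?thesis by metis
    qed
    then obtain y where y: "\<And>j. j \<in> J \<Longrightarrow> (\<lambda>m. Y m j) \<longlonglongrightarrow> y j" by (elim exE) (rule that, blast)
    have "(\<lambda>m. nr (Y m)) \<longlonglongrightarrow> nr y" unfolding nr_def by (intro tendsto_sum tendsto_norm y)
    moreover have "nr (Y m) \<le> 2 * \<rho>" for m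
    proof -
      have "2 * \<rho> * (1 - (1/2) ^ m) \<le> 2 * \<rho>" using \<rho> by (simp add: algebra_simps)
      then show ?thesis using main[of m] by linarith
    qed
    ultimately have ny: "nr y \<le> 2 * \<rho>" by (intro LIMSEQ_le_const2) auto
    have nYy: "(\<lambda>m. nr (\<lambda>j. y j - Y m j)) \<longlonglongrightarrow> 0"
    proof -
      have "(\<lambda>m. nr (\<lambda>j. y j - Y m j)) \<longlonglongrightarrow> nr (\<lambda>j. y j - y j)" unfolding nr_def
        by (intro tendsto_sum tendsto_norm tendsto_diff tendsto_const y)
      then show ?thesis by (simp add: nr_def)
    qed
    have "f j (p + S y) = 0" if j: "j \<in> J" for j
    proof -
      have le: "cmod (f j (p + S y)) \<le> \<rho> * (1/2) ^ m + (1 + \<eta> * C) * nr (\<lambda>j. y j - Y m j)" for m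
      proof -
        let ?D = "\<lambda>j. y j - Y m j"
        have b: "N (p + S (Y m)) < d0" by (rule ball) (use \<open>\<And>m. nr (Y m) \<le> 2 * \<rho>\<close> in auto)
        have "cmod (f j (p + S y) - f j (p + S (Y m)) - ?D j) \<le> \<eta> * N (S ?D)"
          using est[OF j ball[OF ny] b] by (simp add: Sdiff LS[OF j])
        also have "\<dots> \<le> \<eta> * (C * nr ?D)" using NS[of ?D] \<eta> by simp
        finally have 1: "cmod (f j (p + S y) - f j (p + S (Y m)) - ?D j) \<le> \<eta> * (C * nr ?D)" .
        have 2: "cmod (?D j) \<le> nr ?D" using nr_le[OF j, of ?D] by simp
        have 3: "cmod (f j (p + S (Y m))) \<le> \<rho> * (1/2) ^ m"
          using nr_le[OF j, of "\<lambda>j. f j (p + S (Y m))"] main[of m] by (simp add: r_def)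
        have "f j (p + S y) = (f j (p + S y) - f j (p + S (Y m)) - ?D j) + ?D j + f j (p + S (Y m))" by simp
        then have "cmod (f j (p + S y)) \<le> cmod (f j (p + S y) - f j (p + S (Y m)) - ?D j) + cmod (?D j) + cmod (f j (p + S (Y m)))"
          using norm_triangle_ineq[of "f j (p + S y) - f j (p + S (Y m)) - ?D j" "?D j"]
            norm_triangle_ineq[of "(f j (p + S y) - f j (p + S (Y m)) - ?D j) + ?D j" "f j (p + S (Y m))"] by simp
        then show ?thesis using 1 2 3 by (simp add: algebra_simps)
      qed
      have "(\<lambda>m. \<rho> * (1/2) ^ m + (1 + \<eta> * C) * nr (\<lambda>j. y j - Y m j)) \<longlonglongrightarrow> \<rho> * 0 + (1 + \<eta> * C) * 0"
        by (intro tendsto_add tendsto_mult tendsto_const nYy LIMSEQ_power_zero) simp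
      then have "(\<lambda>m. \<rho> * (1/2) ^ m + (1 + \<eta> * C) * nr (\<lambda>j. y j - Y m j)) \<longlonglongrightarrow> 0" by simp
      then have "cmod (f j (p + S y)) \<le> 0" using le by (intro LIMSEQ_le_const) auto
      then show ?thesis by simp
    qed
    moreover have "N (p + S y - of_real t *c v) \<le> e * t"
    proof -
      have "N (S y) \<le> C * (2 * \<rho>)" using NS[of y] mult_left_mono[OF ny, of C] C by linarith
      then show ?thesis using \<rho>2 by (simp add: p_def)
    qed
    ultimately show "\<exists>x. (\<forall>j\<in>J. f j x = 0) \<and> N (x - of_real t *c v) \<le> e * t" by blast
  qed
qed

end


section \<open>Deforming irreducible tuples\<close>

context mats
begin

definition nm :: "cmat \<Rightarrow> real" where "nm M = (\<Sum>a<n. \<Sum>b<n. cmod (M a b))"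

lemma nm_ge: "nm M \<ge> 0" by (simp add: nm_def sum_nonneg)

lemma nm_entry: "a < n \<Longrightarrow> b < n \<Longrightarrow> cmod (M a b) \<le> nm M"
  unfolding nm_def
  using member_le_sum[of b "{..<n}" "\<lambda>b. cmod (M a b)"] member_le_sum[of a "{..<n}" "\<lambda>a. \<Sum>b<n. cmod (M a b)"]
  by (simp add: sum_nonneg)

lemma nm_add: "nm (M + N) \<le> nm M + nm N"
  unfolding nm_def sum.distrib[symmetric] by (intro sum_mono) (simp add: norm_triangle_ineq)

lemma nm_scale: "nm (c *c M) = cmod c * nm M"
  by (simp add: nm_def cscale_fun_apply cscale_complex_def norm_mult sum_distrib_left)

lemma nm_minus: "nm (- M) = nm M" by (simp add: nm_def)

lemma nm_one: "nm one \<le> n"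
proof -
  have "nm one = (\<Sum>a<n. \<Sum>b<n. if b = a then 1 else 0)"
    unfolding nm_def one_def by (intro sum.cong) auto
  then show ?thesis by simp
qed

lemma nm_eq_0: "M \<in> gl \<Longrightarrow> nm M = 0 \<Longrightarrow> M = 0"
proof (intro ext)
  fix a b assume M: "M \<in> gl" "nm M = 0"
  show "M a b = 0 a b"
    using nm_entry[of a b M] M(2) gl_zero[OF M(1), of a b] by (cases "a < n \<and> b < n") auto
qed

lemma nm_mm: "nm (mm M N) \<le> nm M * nm N"
proof -
  have row: "(\<Sum>b<n. cmod (N c b)) \<le> nm N" if "c < n" for c
    unfolding nm_def using member_le_sum[of c "{..<n}" "\<lambda>c. \<Sum>b<n. cmod (N c b)"] that by (simp add: sum_nonneg)
  have "nm (mm M N) \<le> (\<Sum>a<n. \<Sum>b<n. \<Sum>c<n. cmod (M a c) * cmod (N c b))"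
    unfolding nm_def mm_def by (intro sum_mono sum_norm_le) (simp add: norm_mult)
  also have "\<dots> = (\<Sum>a<n. \<Sum>c<n. cmod (M a c) * (\<Sum>b<n. cmod (N c b)))"
    unfolding sum_distrib_left by (rule sum.cong[OF HOL.refl]) (rule sum.swap)
  also have "\<dots> \<le> (\<Sum>a<n. \<Sum>c<n. cmod (M a c) * nm N)"
    using row by (intro sum_mono mult_left_mono) auto
  also have "\<dots> = nm M * nm N" by (simp add: nm_def sum_distrib_right)
  finally show ?thesis .
qed

text \<open>It is enough to show injectivity, and a nonzero \<open>x\<close> with
  \<open>x = - E x\<close> contradicts \<open>nm E < 1\<close> in the sum norm.\<close>

lemma near_one_invertible:
  assumes E: "E \<in> gl" and small: "nm E < 1" shows "\<exists>N. invertible2 (one + E) N"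
proof (rule inverse_exists)
  show "one + E \<in> gl" using fsub_add[OF fsub_gl one_gl E] .
  fix x assume x: "x \<in> V" and "mv (one + E) x = 0"
  then have "x + mv E x = 0" by (simp add: clin_add[OF clin_mv_left] mv_one)
  then have eq: "x = - mv E x" by (simp add: eq_neg_iff_add_eq_0)
  have coord: "x a = - (\<Sum>c<n. E a c * x c)" for a
    using fun_cong[OF eq, of a] by (simp add: mv_def)
  let ?s = "\<Sum>a<n. cmod (x a)"
  have "?s \<le> (\<Sum>a<n. \<Sum>c<n. cmod (E a c) * ?s)"
  proof (rule sum_mono)
    fix a assume "a \<in> {..<n}"
    have "cmod (x a) \<le> (\<Sum>c<n. cmod (E a c * x c))" unfolding coord[of a] norm_minus_cancel by (rule norm_sum)
    also have "\<dots> \<le> (\<Sum>c<n. cmod (E a c) * ?s)"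
      unfolding norm_mult by (intro sum_mono mult_left_mono member_le_sum) auto
    finally show "cmod (x a) \<le> (\<Sum>c<n. cmod (E a c) * ?s)" .
  qed
  also have "\<dots> = nm E * ?s" by (simp add: nm_def sum_distrib_right)
  finally have "(1 - nm E) * ?s \<le> 0" by (simp add: algebra_simps)
  then have "?s \<le> 0" using small by (simp add: mult_le_0_iff)
  then have s0: "?s = 0" using sum_nonneg[of "{..<n}" "\<lambda>a. cmod (x a)"] by simp
  have "x a = 0" for a
  proof (cases "a < n")
    case True
    have "cmod (x a) \<le> ?s" using True by (intro member_le_sum) auto
    then show ?thesis using s0 by simp
  next
    case False then show ?thesis using x by (simp add: cspace_iff)
  qed
  then show "x = 0" by auto
qed

text \<open>Schur's lemma: an eigenspace of \<open>Z\<close> is invariant under all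
  \<open>A i\<close>.\<close>

lemma commutant_scalar:
  assumes n: "n \<ge> 1" and A: "\<And>i. i \<in> {1..k} \<Longrightarrow> A i \<in> gl" and irr: "irred_family V k (\<lambda>i. mv (A i))"
    and Z: "Z \<in> gl" and comm: "\<And>i. i \<in> {1..k} \<Longrightarrow> mm (A i) Z = mm Z (A i)"
  obtains s where "Z = s *c one"
proof -
  have "spectrum (tm Z) \<noteq> {}" by (rule spectrum_non_empty[OF tm_carrier]) (use n in auto)
  then obtain s v where v: "v \<in> carrier_vec n" "v \<noteq> 0\<^sub>v n" "tm Z *\<^sub>v v = s \<cdot>\<^sub>v v"
    using tm_carrier[of Z] by (auto simp: spectrum_def eigenvalue_def eigenvector_def)
  have "vf v \<noteq> vf (0\<^sub>v n)" using inj_onD[OF vf_inj _ v(1)] v(2) by auto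
  moreover have "vf (0\<^sub>v n) = 0" by (auto simp: vf_def fun_eq_iff)
  ultimately have v0: "vf v \<noteq> 0" by simp
  have "mv Z (vf v) = vf (s \<cdot>\<^sub>v v)" using vf_mult[OF tm_carrier[of Z] v(1)] v(3) fm_tm[OF Z] by simp
  also have "\<dots> = s *c vf v" using v(1) by (auto simp: vf_def fun_eq_iff cscale_fun_apply cscale_complex_def)
  finally have ev: "mv Z (vf v) - s *c vf v = 0" by simp
  let ?S = "{x \<in> V. mv Z x - s *c x = 0}"
  have "cv.subspace ?S"
    by (rule subspace_ker[OF clin_sub[OF clin_mv clin_cscale[OF clin_id]] fsubD[OF fsub_cspace]])
  moreover have "mv (A i) x \<in> ?S" if i: "i \<in> {1..k}" and x: "x \<in> ?S" for i x
  proof -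
    have "mv Z (mv (A i) x) = mv (A i) (mv Z x)" using comm[OF i] by (simp add: mv_mm[symmetric])
    also have "mv Z x = s *c x" using x by simp
    finally show ?thesis using mv_V[OF A[OF i]] by (simp add: clin_scale[OF clin_mv])
  qed
  ultimately have "?S = {0} \<or> ?S = V" by (intro irred_familyD[OF irr]) auto
  moreover have "vf v \<in> ?S" using ev vf_V by simp
  ultimately have S: "?S = V" using v0 by auto
  have "mv Z x = mv (s *c one) x" if "x \<in> V" for x
  proof -
    have "x \<in> ?S" unfolding S by (rule that)
    then show ?thesis using that by (simp add: clin_scale[OF clin_mv_left] cscale_fun_apply mv_one)
  qed
  then have "Z = s *c one" by (intro gl_eqI[OF Z fsub_scale[OF fsub_gl one_gl]])
  then show ?thesis by (rule that)
qed

definition dt :: "cmat \<Rightarrow> complex" where "dt M = det (tm M)"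

lemma dt_mm: "M \<in> gl \<Longrightarrow> N \<in> gl \<Longrightarrow> dt (mm M N) = dt M * dt N"
  by (simp add: dt_def tm_mult det_mult[OF tm_carrier tm_carrier])

lemma dt_one: "dt one = 1" by (simp add: dt_def tm_one)

lemma dt_scalar: "dt (c *c one) = c ^ n"
proof -
  have "tm (c *c one) = c \<cdot>\<^sub>m 1\<^sub>m n"
    by (auto simp: tm_def one_def cscale_fun_apply cscale_complex_def)
  then show ?thesis by (simp add: dt_def)
qed

lemma dt_conj: "invertible2 G G' \<Longrightarrow> A \<in> gl \<Longrightarrow> dt (mm G (mm A G')) = dt A"
proof -
  assume G: "invertible2 G G'" and A: "A \<in> gl"
  then have g: "G \<in> gl" "G' \<in> gl" by (auto simp: invertible2_def)
  have "dt G * dt G' = 1" using G dt_mm[OF g] dt_one by (simp add: invertible2_def)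
  then show ?thesis using g A by (simp add: dt_mm mm_gl)
qed

lemma dt_mprod: "(\<And>i. i \<in> {1..m} \<Longrightarrow> A i \<in> gl) \<Longrightarrow> dt (mprod A m) = (\<Prod>i\<in>{1..m}. dt (A i))"
proof (induction m)
  case (Suc m)
  have "dt (mprod A (Suc m)) = dt (mprod A m) * dt (A (Suc m))"
    using dt_mm[OF mprod_gl, of m A "A (Suc m)"] Suc.prems by simp
  also have "dt (mprod A m) = (\<Prod>i\<in>{1..m}. dt (A i))" using Suc by auto
  finally show ?case by simp
qed (simp add: dt_one)

lemma invertible2_mprod:
  "(\<And>i. i \<in> {1..m} \<Longrightarrow> invertible2 (A i) (A' i)) \<Longrightarrow> invertible2 (mprod A m) (rprod A' m)"
proof (induction m)
  case (Suc m)
  have g: "A (Suc m) \<in> gl" "A' (Suc m) \<in> gl" "mm (A' (Suc m)) (A (Suc m)) = one" "mm (A (Suc m)) (A' (Suc m)) = one"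
    using Suc.prems[of "Suc m"] by (auto simp: invertible2_def)
  have r: "mprod A m \<in> gl" "rprod A' m \<in> gl" "mm (rprod A' m) (mprod A m) = one" "mm (mprod A m) (rprod A' m) = one"
    using Suc by (auto simp: invertible2_def)
  have "mm (rprod A' (Suc m)) (mprod A (Suc m)) = mm (A' (Suc m)) (mm (mm (rprod A' m) (mprod A m)) (A (Suc m)))"
    by (simp add: mm_assoc)
  moreover have "mm (mprod A (Suc m)) (rprod A' (Suc m)) = mm (mprod A m) (mm (mm (A (Suc m)) (A' (Suc m))) (rprod A' m))"
    by (simp add: mm_assoc)
  ultimately show ?case using g r by (simp add: invertible2_def mm_one mm_gl)
qed (simp add: invertible2_def mm_one one_gl)

lemma mprod_cong: "(\<And>i. i \<in> {1..m} \<Longrightarrow> A i = B i) \<Longrightarrow> mprod A m = mprod B m"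
  by (induction m) auto

lemma mprod_one: "mprod (\<lambda>_. one) m = one"
  by (induction m) (simp_all add: mm_one one_gl)

text \<open>The derivative of \<open>mprod\<close> at \<open>A\<close> in the direction
  \<open>X\<close>, by the product rule.\<close>

primrec dprod :: "(nat \<Rightarrow> cmat) \<Rightarrow> (nat \<Rightarrow> cmat) \<Rightarrow> nat \<Rightarrow> cmat" where
  "dprod A X 0 = 0"
| "dprod A X (Suc m) = mm (mprod A m) (X (Suc m)) + mm (dprod A X m) (A (Suc m))"

lemma dprod_one:
  "(\<And>i. i \<in> {1..m} \<Longrightarrow> X i \<in> gl) \<Longrightarrow> dprod (\<lambda>_. one) X m = (\<Sum>i\<in>{1..m}. X i)"
proof (induction m)
  case (Suc m)
  have "(\<Sum>i\<in>{1..m}. X i) \<in> gl" using Suc.prems by (intro cv.subspace_sum[OF fsubD[OF fsub_gl]]) auto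
  moreover have "dprod (\<lambda>_. one) X m = (\<Sum>i\<in>{1..m}. X i)" using Suc by auto
  ultimately show ?case using Suc.prems[of "Suc m"] by (simp add: mprod_one mm_one add.commute del: plus_fun_apply)
qed simp

text \<open>The range starts at index 0, where the scalar unknown will be stored, and stops before
  \<open>k\<close>, where there is no unknown.\<close>

definition ns :: "nat \<Rightarrow> (nat \<Rightarrow> cmat) \<Rightarrow> real" where "ns k x = (\<Sum>i<k. nm (x i))"

lemma ns_seminorm: "cseminorm (ns k)"
proof
  show "ns k x \<ge> 0" for x by (simp add: ns_def nm_ge sum_nonneg)
  show "ns k (x + y) \<le> ns k x + ns k y" for x y
    unfolding ns_def sum.distrib[symmetric] by (intro sum_mono) (simp add: nm_add)
  show "ns k (c *c x) = cmod c * ns k x" for c x by (simp add: ns_def cscale_fun_apply nm_scale sum_distrib_left)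
qed

lemma ns_entry: "i < k \<Longrightarrow> a < n \<Longrightarrow> b < n \<Longrightarrow> cmod (x i a b) \<le> ns k x"
  unfolding ns_def using nm_entry[of a b "x i"] member_le_sum[of i "{..<k}" "\<lambda>i. nm (x i)"] nm_ge by fastforce

end

section \<open>The product equation and its linearisation\<close>

locale deformation = mats n for n +
  fixes k :: nat
begin

sublocale cseminorm "ns k" by (rule ns_seminorm)

definition msdiff :: "((nat \<Rightarrow> cmat) \<Rightarrow> cmat) \<Rightarrow> ((nat \<Rightarrow> cmat) \<Rightarrow> cmat) \<Rightarrow> bool" where
  "msdiff F D \<longleftrightarrow> (\<forall>a b. sdiff (\<lambda>x. F x a b) (\<lambda>x. D x a b))"

lemma msdiff_const: "msdiff (\<lambda>_. M) (\<lambda>_. 0)"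
  unfolding msdiff_def by (simp add: sdiff_const)

lemma msdiff_mm:
  "msdiff F D \<Longrightarrow> msdiff G D' \<Longrightarrow> msdiff (\<lambda>x. mm (F x) (G x)) (\<lambda>x. mm (F 0) (D' x) + mm (D x) (G 0))"
  unfolding msdiff_def mm_def plus_fun_apply sum.distrib[symmetric]
  by (intro allI sdiff_sum sdiff_mult) auto

lemma msdiff_mprod:
  assumes "\<And>i. i \<in> {1..m} \<Longrightarrow> msdiff (F i) (D i)"
  shows "msdiff (\<lambda>x. mprod (\<lambda>i. F i x) m) (\<lambda>x. dprod (\<lambda>i. F i 0) (\<lambda>i. D i x) m)"
  using assms
proof (induction m)
  case (Suc m)
  have "msdiff (\<lambda>x. mprod (\<lambda>i. F i x) m) (\<lambda>x. dprod (\<lambda>i. F i 0) (\<lambda>i. D i x) m)"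
    by (rule Suc.IH) (rule Suc.prems, simp)
  moreover have "msdiff (F (Suc m)) (D (Suc m))" by (rule Suc.prems) simp
  ultimately show ?case using msdiff_mm by (simp only: mprod.simps dprod.simps)
qed (simp add: msdiff_const)

text \<open>Cuts an arbitrary family down to its admissible unknowns. There is none at
  \<open>k\<close>, since \<open>A i\<close> is conjugated by the product of the factors before
  \<open>i\<close> only.\<close>

definition pt :: "nat \<Rightarrow> (nat \<Rightarrow> cmat) \<Rightarrow> cmat" where
  "pt i x = (\<lambda>a b. if a < n \<and> b < n \<and> 1 \<le> i \<and> i < k then x i a b else 0)"

lemma pt_gl: "pt i x \<in> gl" by (auto simp: pt_def gl_iff)

lemma pt_0: "pt i 0 = 0" by (auto simp: pt_def fun_eq_iff)

lemma msdiff_pt: "msdiff (\<lambda>x. M + pt i x) (pt i)"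
  unfolding msdiff_def
proof (intro allI)
  fix a b
  have "clin (\<lambda>x. pt i x a b)"
    unfolding pt_def by (intro clinI) (simp_all add: cscale_fun_apply cscale_complex_def)
  moreover have "cmod (pt i x a b) \<le> 1 * ns k x" for x
    using ns_entry[of i k a b x] N_ge[of x] by (simp add: pt_def)
  ultimately have "sdiff (\<lambda>x. pt i x a b) (\<lambda>x. pt i x a b)" by (rule sdiff_linear)
  from sdiff_add[OF sdiff_const this, of "M a b"] show "sdiff (\<lambda>x. (M + pt i x) a b) (\<lambda>x. pt i x a b)" by simp
qed

end


text \<open>Both tuples are \<open>A\<close>, so \<open>T i\<close> is conjugation by
  \<open>A i\<close> and \<open>Inv\<close> is the commutant.\<close>

locale irreducible_system = hom_system n k A A' A A' + deformation n k
  for n k :: nat and A A' :: "nat \<Rightarrow> cmat" +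
  assumes n: "n \<ge> 1" and irr: "irred_family (cspace n) k (\<lambda>i. mv (A i))"
begin

lemma schur: "M \<in> gl \<Longrightarrow> (\<And>i. i \<in> {1..k} \<Longrightarrow> mm (A i) M = mm M (A i)) \<Longrightarrow> \<exists>s. M = s *c one"
  using commutant_scalar[of k A M, OF n gls(1) irr] by metis

lemma one_nonzero: "one \<noteq> 0"
proof
  assume "one = 0"
  then have "one 0 0 = 0" by simp
  then show False using n by (simp add: one_def)
qed

lemma scalar_comm: "M \<in> gl \<Longrightarrow> mm M (s *c one) = s *c M" "M \<in> gl \<Longrightarrow> mm (s *c one) M = s *c M"
  by (simp_all add: clin_scale[OF clin_mm_right] clin_scale[OF clin_mm_left] mm_one)

lemma dim_Inv: "cv.dim Inv = 1"
proof -
  have "Inv = cv.span {one}"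
  proof (intro antisym subsetI)
    fix M assume "M \<in> Inv"
    then have "\<exists>s. M = s *c one" using T_fixed by (intro schur) auto
    then show "M \<in> cv.span {one}" by (auto simp: cv.span_singleton)
  next
    fix M assume "M \<in> cv.span {one}"
    then obtain s where M: "M = s *c one" by (auto simp: cv.span_singleton)
    then have "M \<in> gl" using fsub_scale[OF fsub_gl one_gl] by simp
    then show "M \<in> Inv" using T_fixed scalar_comm gls(1) M by auto
  qed
  moreover have "cv.dim (cv.span {one}) = 1"
    using cv.dim_span_eq_card_independent[of "{one}"] one_nonzero by (simp add: cv.dim_span)
  ultimately show ?thesis by simp
qed

text \<open>If the range of \<open>fox\<close> and the scalars did not span \<open>gl\<close>, the
  trace form would give a nonzero \<open>h\<close> that commutes with all \<open>A i\<close> and is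
  orthogonal to \<open>one\<close>. By Schur \<open>h\<close> is a scalar, and its trace
  vanishes.\<close>

lemma fox_onto: "M \<in> gl \<Longrightarrow> \<exists>H\<in>Hs. \<exists>s. M = fox T k H + s *c one"
proof -
  let ?R = "{fox T k H + s *c one | H s. H \<in> Hs}"
  have 0: "0 \<in> ?R"
  proof -
    have "0 = fox T k 0 + 0 *c one" by (simp add: clin_0[OF clin_fox])
    then show ?thesis using fsub_zero_mem[OF fsub_Hs] by blast
  qed
  have add: "x + y \<in> ?R" if xy: "x \<in> ?R" "y \<in> ?R" for x y
  proof -
    obtain H s H' s' where *: "H \<in> Hs" "x = fox T k H + s *c one" "H' \<in> Hs" "y = fox T k H' + s' *c one"
      using xy by (elim CollectE exE conjE) (rule that)
    have "x + y = fox T k (H + H') + (s + s') *c one"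
      unfolding *(2,4) clin_add[OF clin_fox] cv.scale_left_distrib by (simp only: add_ac)
    moreover have "H + H' \<in> Hs" using fsub_add[OF fsub_Hs *(1,3)] .
    ultimately show ?thesis by blast
  qed
  have scale: "c *c x \<in> ?R" if x: "x \<in> ?R" for c x
  proof -
    obtain H s where *: "H \<in> Hs" "x = fox T k H + s *c one" using x by (elim CollectE exE conjE) (rule that)
    have "c *c x = fox T k (c *c H) + (c * s) *c one"
      unfolding *(2) clin_scale[OF clin_fox] by (simp only: cv.scale_right_distrib cscale_cscale)
    moreover have "c *c H \<in> Hs" using fsub_scale[OF fsub_Hs *(1)] .
    ultimately show ?thesis by blast
  qed
  have sub: "cv.subspace ?R" using 0 add scale by (rule subspaceI)
  have R: "?R \<subseteq> gl"
  proof
    fix x assume "x \<in> ?R"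
    then obtain H s where *: "H \<in> Hs" "x = fox T k H + s *c one" by (elim CollectE exE conjE) (rule that)
    then show "x \<in> gl" using fsub_add[OF fsub_gl _ fsub_scale[OF fsub_gl one_gl]] fox_range_subset by blast
  qed
  have "fox T k H \<in> ?R" if "H \<in> Hs" for H
  proof -
    have "fox T k H = fox T k H + 0 *c one" by simp
    then show ?thesis using that by blast
  qed
  then have fr: "fox T k ` Hs \<subseteq> ?R" by blast
  have "one \<in> ?R"
  proof -
    have "one = fox T k 0 + 1 *c one" by (simp add: clin_0[OF clin_fox] cscale_one)
    then show ?thesis using fsub_zero_mem[OF fsub_Hs] by blast
  qed
  have "?R = gl"
  proof (rule ccontr)
    assume "?R \<noteq> gl"
    then obtain h where h: "h \<in> gl" "h \<noteq> 0" "\<And>i. i \<in> {1..k} \<Longrightarrow> mm (A i) h = mm h (A i)"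
      "\<And>M. M \<in> ?R \<Longrightarrow> (\<Sum>b<n. \<Sum>j<n. M b j * h j b) = 0"
      by (rule annihilator[OF sub R _ fr]) (rule that)
    obtain s where s: "h = s *c one" using schur[OF h(1,3)] by blast
    have "(\<Sum>b<n. \<Sum>j<n. one b j * h j b) = (\<Sum>b<n. \<Sum>j<n. if j = b then s else 0)"
      unfolding s by (intro sum.cong) (auto simp: one_def cscale_fun_apply cscale_complex_def)
    then have "of_nat n * s = 0" using h(4)[OF \<open>one \<in> ?R\<close>] by simp
    then have "s = 0" using n by simp
    then show False using h(2) s by simp
  qed
  moreover assume "M \<in> gl"
  ultimately have "M \<in> ?R" by simp
  then show ?thesis by blast
qed

text \<open>Moving \<open>P i\<close> to the front, past \<open>A 1 ... A i\<close>, turns it into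
  \<open>cprod T i (P i)\<close>; this makes the derivative of the product the first part of
  \<open>fox\<close>.\<close>

lemma dprod_fox:
  "m \<le> k \<Longrightarrow> (\<And>i. i \<in> {1..k} \<Longrightarrow> P i \<in> gl) \<Longrightarrow>
    dprod A (\<lambda>i. mm (A i) (P i)) m = mm (\<Sum>i\<in>{1..m}. cprod T i (P i)) (mprod A m)"
proof (induction m)
  case (Suc m)
  have inv: "invertible2 (mprod A (Suc m)) (rprod A' (Suc m))" using Suc.prems(1) invA by (intro invertible2_mprod) auto
  then have g: "mprod A (Suc m) \<in> gl" "mm (rprod A' (Suc m)) (mprod A (Suc m)) = one" by (simp_all add: invertible2_def)
  have P: "P (Suc m) \<in> gl" using Suc.prems by auto
  have "mm (cprod T (Suc m) (P (Suc m))) (mprod A (Suc m)) =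
      mm (mprod A (Suc m)) (mm (P (Suc m)) (mm (rprod A' (Suc m)) (mprod A (Suc m))))"
    unfolding cprod_T[OF Suc.prems(1) P] by (simp only: mm_assoc)
  also have "\<dots> = mm (mprod A (Suc m)) (P (Suc m))" by (simp only: g(2) mm_one(2)[OF P])
  also have "\<dots> = mm (mprod A m) (mm (A (Suc m)) (P (Suc m)))" by (simp add: mm_assoc)
  finally have 1: "mm (cprod T (Suc m) (P (Suc m))) (mprod A (Suc m)) = mm (mprod A m) (mm (A (Suc m)) (P (Suc m)))" .
  have 2: "dprod A (\<lambda>i. mm (A i) (P i)) m = mm (\<Sum>i\<in>{1..m}. cprod T i (P i)) (mprod A m)"
    using Suc.prems by (intro Suc.IH) auto
  have "(\<Sum>i\<in>{1..Suc m}. cprod T i (P i)) = cprod T (Suc m) (P (Suc m)) + (\<Sum>i\<in>{1..m}. cprod T i (P i))"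
    by (simp add: add.commute)
  then have "mm (\<Sum>i\<in>{1..Suc m}. cprod T i (P i)) (mprod A (Suc m)) =
      mm (cprod T (Suc m) (P (Suc m))) (mprod A (Suc m)) + mm (\<Sum>i\<in>{1..m}. cprod T i (P i)) (mm (mprod A m) (A (Suc m)))"
    by (simp only: clin_add[OF clin_mm_left] mprod.simps)
  then show ?case using 1 2 by (simp only: dprod.simps mm_assoc)
qed (simp add: clin_0[OF clin_mm_left])

text \<open>The unknowns are \<open>x i\<close> for \<open>1 \<le> i < k\<close> and the number \<open>x 0 0 0\<close>, which makes up for the codimension one
  of the range of \<open>fox\<close>.\<close>

definition FF :: "(nat \<Rightarrow> cmat) \<Rightarrow> cmat" where
  "FF x = mprod (\<lambda>i. mm (A i) (one + pt i x)) k - (1 + x 0 0 0) *c mprod (\<lambda>i. one + pt i x) k"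

definition DF :: "(nat \<Rightarrow> cmat) \<Rightarrow> cmat" where
  "DF x = fox T k (\<lambda>i. pt i x) - x 0 0 0 *c one"

text \<open>The right-hand side has the shape that the product rule gives for \<open>FF\<close> at
  0, where the scalar factor and both products are 1.\<close>

lemma DF_eq: "DF x = dprod A (\<lambda>i. mm (A i) (pt i x)) k - (1 *c dprod (\<lambda>_. one) (\<lambda>i. pt i x) k + x 0 0 0 *c one)"
proof -
  have pk: "pt k x = 0" by (simp add: pt_def fun_eq_iff)
  have ins: "{1..k} = insert k {1..<k}" using k by auto
  have cg: "cprod T i (pt i x) \<in> gl" if "i \<in> {1..k}" for i using M_closed[of i "pt i x"] pt_gl that by auto
  then have sg: "(\<Sum>i\<in>{1..k}. cprod T i (pt i x)) \<in> gl" by (intro cv.subspace_sum[OF fsubD[OF fsub_gl]])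
  have "dprod A (\<lambda>i. mm (A i) (pt i x)) k = (\<Sum>i\<in>{1..k}. cprod T i (pt i x))"
    using dprod_fox[OF order_refl, of "\<lambda>i. pt i x"] pt_gl prodA sg by (simp add: mm_one)
  moreover have "(\<Sum>i\<in>{1..k}. cprod T i (pt i x)) = (\<Sum>i\<in>{1..<k}. cprod T i (pt i x))"
    unfolding ins by (simp add: pk clin_0[OF clin_M])
  moreover have "dprod (\<lambda>_. one) (\<lambda>i. pt i x) k = (\<Sum>i\<in>{1..<k}. pt i x)"
    using dprod_one[of k "\<lambda>i. pt i x"] pt_gl unfolding ins by (simp add: pk)
  ultimately show ?thesis by (simp add: DF_def fox_def sum_subtractf cscale_one diff_diff_add)
qed

lemma FF_0: "FF 0 = 0"
proof -
  have "mprod (\<lambda>i. mm (A i) (one + pt i 0)) k = one"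
    using mprod_cong[of k "\<lambda>i. mm (A i) (one + pt i 0)" A] gls(1) prodA by (simp add: pt_0 mm_one del: zero_fun_apply)
  moreover have "mprod (\<lambda>i. one + pt i 0) k = one" using mprod_one[of k] by (simp add: pt_0)
  ultimately show ?thesis by (simp add: FF_def cscale_one)
qed

lemma msdiff_FF: "msdiff FF DF"
proof -
  have h: "msdiff (\<lambda>x. one + pt i x) (pt i)" for i by (rule msdiff_pt)
  have h0: "one + pt i 0 = one" for i by (simp add: pt_0)
  have Ah: "msdiff (\<lambda>x. mm (A i) (one + pt i x)) (\<lambda>x. mm (A i) (pt i x))" for i
    using msdiff_mm[OF msdiff_const h, of "A i"] by (simp add: clin_0[OF clin_mm_left])
  have 1: "msdiff (\<lambda>x. mprod (\<lambda>i. mm (A i) (one + pt i x)) k) (\<lambda>x. dprod A (\<lambda>i. mm (A i) (pt i x)) k)"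
  proof -
    have eq: "dprod (\<lambda>i. mm (A i) (one + pt i 0)) X m = dprod A X m" if "m \<le> k" for X m
      using that
    proof (induction m)
      case (Suc m)
      have "mprod (\<lambda>i. mm (A i) (one + pt i 0)) m = mprod A m"
        using Suc.prems gls(1) by (intro mprod_cong) (simp add: h0 mm_one)
      moreover have "mm (A (Suc m)) (one + pt (Suc m) 0) = A (Suc m)"
        using Suc.prems gls(1)[of "Suc m"] by (simp only: h0) (simp add: mm_one)
      moreover have "dprod (\<lambda>i. mm (A i) (one + pt i 0)) X m = dprod A X m" by (rule Suc.IH[OF Suc_leD[OF Suc.prems]])
      ultimately show ?case by (simp only: dprod.simps)
    qed simp
    show ?thesis using msdiff_mprod[of k "\<lambda>i x. mm (A i) (one + pt i x)" "\<lambda>i x. mm (A i) (pt i x)", OF Ah]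
      by (simp only: eq[OF order_refl])
  qed
  have 2: "msdiff (\<lambda>x. mprod (\<lambda>i. one + pt i x) k) (\<lambda>x. dprod (\<lambda>_. one) (\<lambda>i. pt i x) k)"
    using msdiff_mprod[of k "\<lambda>i x. one + pt i x" pt, OF h] by (simp only: h0)
  have c0: "sdiff (\<lambda>x::nat \<Rightarrow> cmat. x 0 0 0) (\<lambda>x. x 0 0 0)"
    by (rule sdiff_linear[of _ 1]) (use ns_entry[of 0 k 0 0] n k in \<open>auto intro!: clinI simp: cscale_fun_apply\<close>)
  have c1: "sdiff (\<lambda>x::nat \<Rightarrow> cmat. 1 + x 0 0 0) (\<lambda>x. x 0 0 0)" using sdiff_add[OF sdiff_const c0, of 1] by simp
  have m0: "mprod (\<lambda>i. one + pt i 0) k = one" using mprod_one[of k] by (simp only: h0)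
  show ?thesis unfolding msdiff_def
  proof (intro allI)
    fix a b
    have s1: "sdiff (\<lambda>x. mprod (\<lambda>i. mm (A i) (one + pt i x)) k a b) (\<lambda>x. dprod A (\<lambda>i. mm (A i) (pt i x)) k a b)"
      using 1 unfolding msdiff_def by blast
    have s2: "sdiff (\<lambda>x. mprod (\<lambda>i. one + pt i x) k a b) (\<lambda>x. dprod (\<lambda>_. one) (\<lambda>i. pt i x) k a b)"
      using 2 unfolding msdiff_def by blast
    have s3: "sdiff (\<lambda>x. (- 1) * ((1 + x 0 0 0) * mprod (\<lambda>i. one + pt i x) k a b))
       (\<lambda>x. (- 1) * (dprod (\<lambda>_. one) (\<lambda>i. pt i x) k a b + x 0 0 0 * one a b))"
      using sdiff_mult[OF sdiff_const sdiff_mult[OF c1 s2], of "- 1"] unfolding m0 by (simp add: zero_fun_apply)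
    have "FF x a b = mprod (\<lambda>i. mm (A i) (one + pt i x)) k a b + (- 1) * ((1 + x 0 0 0) * mprod (\<lambda>i. one + pt i x) k a b)" for x
      by (simp add: FF_def cscale_fun_apply cscale_complex_def)
    moreover have "DF x a b = dprod A (\<lambda>i. mm (A i) (pt i x)) k a b + (- 1) * (dprod (\<lambda>_. one) (\<lambda>i. pt i x) k a b + x 0 0 0 * one a b)" for x
      unfolding DF_eq by (simp add: cscale_fun_apply cscale_complex_def)
    ultimately show "sdiff (\<lambda>x. FF x a b) (\<lambda>x. DF x a b)" using sdiff_add[OF s1 s3] by simp
  qed
qed

lemma FF_gl: "FF x \<in> gl"
proof -
  have "one + pt i x \<in> gl" for i using fsub_add[OF fsub_gl one_gl pt_gl] .
  then show ?thesis unfolding FF_def using gls(1)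
    by (intro fsub_diff[OF fsub_gl] fsub_scale[OF fsub_gl] mprod_gl mm_gl) auto
qed

abbreviation nh :: "(nat \<Rightarrow> cmat) \<Rightarrow> real" where "nh x \<equiv> \<Sum>i\<in>{1..<k}. nm (x i)"

lemma pt_Hs: "H \<in> Hs \<Longrightarrow> i \<in> {1..<k} \<Longrightarrow> pt i H = H i"
  using gl_zero[OF dsumD(1)[of H "{1..<k}" "\<lambda>_. gl" i]] by (auto simp: pt_def fun_eq_iff)

text \<open>The Newton iteration for the entries of \<open>FF\<close>, in the direction
  \<open>H\<close> with scalar part 0. A right inverse of \<open>DF\<close> comes from
  \<open>fox_onto\<close>.\<close>

lemma deform:
  assumes H: "H \<in> Hs" "fox T k H = 0" and e: "e > 0"
  shows "\<exists>d>0. \<forall>t. 0 < t \<and> t < d \<longrightarrow> (\<exists>x c. x \<in> Hs \<and>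
    mprod (\<lambda>i. mm (A i) (one + x i)) k = (1 + c) *c mprod (\<lambda>i. one + x i) k \<and>
    nh (x - of_real t *c H) \<le> e * t \<and> cmod c \<le> e * t)"
proof -
  have H0: "H 0 = 0" using dsumD(2)[OF H(1), of 0] by simp
  have foxpt: "fox T k (\<lambda>i. pt i H') = fox T k H'" if "H' \<in> Hs" for H'
    unfolding fox_def using pt_Hs[OF that] by (intro sum.cong) auto
  have DH: "DF H = 0" using foxpt[OF H(1)] H(2) H0 by (simp add: DF_def)
  have "\<exists>u. DF u = M" if M: "M \<in> gl" for M
  proof -
    obtain H' s where H': "H' \<in> Hs" "M = fox T k H' + s *c one" using fox_onto[OF M] by blast
    \<comment> \<open>The sign is that of the scalar term in \<open>DF\<close>, which is
      subtracted.\<close>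
    let ?u = "\<lambda>i. if i = 0 then (\<lambda>_ _. - s) else H' i"
    have "fox T k (\<lambda>i. pt i ?u) = fox T k H'"
      unfolding fox_def using pt_Hs[OF H'(1)] by (intro sum.cong) (auto simp: pt_def)
    then have "DF ?u = M" unfolding DF_def H'(2) by (simp add: cv.scale_minus_left)
    then show ?thesis by blast
  qed
  then obtain u where u: "\<And>M. M \<in> gl \<Longrightarrow> DF (u M) = M" by metis
  have "\<exists>d>0. \<forall>t. 0 < t \<and> t < d \<longrightarrow> (\<exists>x. (\<forall>j\<in>{..<n}\<times>{..<n}. (\<lambda>(a, b) x. FF x a b) j x = 0) \<and>
      ns k (x - of_real t *c H) \<le> e * t)"
  proof (rule newton[where L = "\<lambda>(a, b) x. DF x a b" and u = "\<lambda>(a, b). u (elem a b)", OF _ _ _ _ _ e])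
    show "finite ({..<n} \<times> {..<n})" by simp
    fix j assume "j \<in> {..<n} \<times> {..<n}"
    then obtain a b where j: "j = (a, b)" "a < n" "b < n" by auto
    show "sdiff ((\<lambda>(a, b) x. FF x a b) j) ((\<lambda>(a, b) x. DF x a b) j)"
      using msdiff_FF unfolding msdiff_def j by simp
    show "(\<lambda>(a, b) x. FF x a b) j 0 = 0" by (simp add: j FF_0)
    show "(\<lambda>(a, b) x. DF x a b) j H = 0" by (simp add: j DH)
    fix l assume "l \<in> {..<n} \<times> {..<n}"
    then obtain a' b' where l: "l = (a', b')" "a' < n" "b' < n" by auto
    show "(\<lambda>(a, b) x. DF x a b) j (case l of (a, b) \<Rightarrow> u (elem a b)) = (if j = l then 1 else 0)"
      using u[OF elem_gl[OF l(2,3)]] by (simp add: j l elem_def)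
  qed
  then obtain d where d: "d > 0" "\<And>t. 0 < t \<and> t < d \<Longrightarrow> \<exists>x. (\<forall>j\<in>{..<n}\<times>{..<n}. (\<lambda>(a, b) x. FF x a b) j x = 0) \<and>
      ns k (x - of_real t *c H) \<le> e * t" by (elim exE conjE) (rule that, auto)
  show ?thesis
  proof (intro exI[of _ d] conjI allI impI d(1))
    fix t assume t: "0 < t \<and> t < d"
    obtain x where x: "\<forall>j\<in>{..<n}\<times>{..<n}. (\<lambda>(a, b) x. FF x a b) j x = 0" "ns k (x - of_real t *c H) \<le> e * t"
      using d(2)[OF t] by (elim exE conjE) (rule that)
    have "FF x a b = 0" for a b
      using x(1) gl_zero[OF FF_gl, of a b x] by (cases "a < n \<and> b < n") auto
    then have F: "FF x = 0" by (auto simp: fun_eq_iff)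
    let ?y = "\<lambda>i. pt i x"
    have yH: "?y \<in> Hs"
    proof (rule dsumI)
      show "pt i x = 0" if "i \<notin> {1..<k}" for i using that by (auto simp: pt_def fun_eq_iff)
    qed (rule pt_gl)
    have "mprod (\<lambda>i. mm (A i) (one + ?y i)) k = (1 + x 0 0 0) *c mprod (\<lambda>i. one + ?y i) k"
      using F unfolding FF_def by (simp only: right_minus_eq)
    moreover have "nh (?y - of_real t *c H) \<le> e * t"
    proof -
      have "nm ((?y - of_real t *c H) i) = nm ((x - of_real t *c H) i)" if "i \<in> {1..<k}" for i
        unfolding nm_def using that by (intro sum.cong) (auto simp: pt_def)
      then have "nh (?y - of_real t *c H) = nh (x - of_real t *c H)" by (intro sum.cong) auto
      also have "\<dots> \<le> ns k (x - of_real t *c H)" unfolding ns_def using nm_ge by (intro sum_mono2) auto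
      finally show ?thesis using x(2) by simp
    qed
    moreover have "cmod (x 0 0 0) \<le> e * t"
      using ns_entry[of 0 k 0 0 "x - of_real t *c H"] n k x(2) H0 by (simp add: cscale_fun_apply)
    ultimately show "\<exists>x c. x \<in> Hs \<and> mprod (\<lambda>i. mm (A i) (one + x i)) k = (1 + c) *c mprod (\<lambda>i. one + x i) k \<and>
      nh (x - of_real t *c H) \<le> e * t \<and> cmod c \<le> e * t" using yH by blast
  qed
qed

end


section \<open>Tangent vectors of a rigid system\<close>

context irreducible_system
begin

text \<open>The bound holds on \<open>Hs\<close>, where a family is determined by the finitely many
  entries that \<open>nh\<close> sees.\<close>

lemma clin_bounded:
  fixes f :: "(nat \<Rightarrow> cmat) \<Rightarrow> complex"
  assumes f: "clin f"
  obtains K where "K \<ge> 0" "\<And>y. y \<in> Hs \<Longrightarrow> cmod (f y) \<le> K * nh y"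
proof -
  define U where "U = (\<lambda>i a b (j::nat). if j = i then elem a b else (0::cmat))"
  define K where "K = (\<Sum>i\<in>{1..<k}. \<Sum>a<n. \<Sum>b<n. cmod (f (U i a b)))"
  have K: "K \<ge> 0" by (simp add: K_def sum_nonneg)
  have fU: "cmod (f (U i a b)) \<le> K" if "i \<in> {1..<k}" "a < n" "b < n" for i a b
  proof -
    have "cmod (f (U i a b)) \<le> (\<Sum>b<n. cmod (f (U i a b)))" using that by (intro member_le_sum) auto
    also have "\<dots> \<le> (\<Sum>a<n. \<Sum>b<n. cmod (f (U i a b)))"
      using that member_le_sum[of a "{..<n}" "\<lambda>a. \<Sum>b<n. cmod (f (U i a b))"] by (simp add: sum_nonneg)
    also have "\<dots> \<le> K" unfolding K_def
      using that member_le_sum[of i "{1..<k}" "\<lambda>i. \<Sum>a<n. \<Sum>b<n. cmod (f (U i a b))"] by (simp add: sum_nonneg)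
    finally show ?thesis .
  qed
  have "cmod (f y) \<le> K * nh y" if y: "y \<in> Hs" for y
  proof -
    have "y = (\<Sum>i\<in>{1..<k}. \<Sum>a<n. \<Sum>b<n. y i a b *c U i a b)"
    proof
      fix j
      have "(\<Sum>i\<in>{1..<k}. \<Sum>a<n. \<Sum>b<n. y i a b *c U i a b) j = (\<Sum>i\<in>{1..<k}. if i = j then \<Sum>a<n. \<Sum>b<n. y j a b *c elem a b else 0)"
      proof (rule trans[OF sum_fun_apply sum.cong])
        fix i
        show "(\<Sum>a<n. \<Sum>b<n. y i a b *c U i a b) j = (if i = j then \<Sum>a<n. \<Sum>b<n. y j a b *c elem a b else 0)"
          by (simp add: fun_eq_iff sum_fun_apply cscale_fun_apply U_def)
      qed simp
      also have "\<dots> = y j"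
        using gl_expand[of "y j"] dsumD(1)[OF y, of j] dsumD(2)[OF y, of j] by (cases "j \<in> {1..<k}") auto
      finally show "y j = (\<Sum>i\<in>{1..<k}. \<Sum>a<n. \<Sum>b<n. y i a b *c U i a b) j" by simp
    qed
    then have "f y = f (\<Sum>i\<in>{1..<k}. \<Sum>a<n. \<Sum>b<n. y i a b *c U i a b)" by (rule arg_cong)
    also have "\<dots> = (\<Sum>i\<in>{1..<k}. \<Sum>a<n. \<Sum>b<n. y i a b * f (U i a b))"
      by (simp add: clin_sum[OF f] clin_scale[OF f] cscale_complex_def)
    finally have "cmod (f y) \<le> (\<Sum>i\<in>{1..<k}. \<Sum>a<n. \<Sum>b<n. cmod (y i a b) * cmod (f (U i a b)))"
      by (auto intro!: sum_norm_le simp: norm_mult)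
    also have "\<dots> \<le> (\<Sum>i\<in>{1..<k}. \<Sum>a<n. \<Sum>b<n. cmod (y i a b) * K)"
      using fU by (intro sum_mono mult_left_mono) auto
    also have "\<dots> = K * nh y" by (simp add: nm_def sum_distrib_left mult.commute)
    finally show ?thesis .
  qed
  then show ?thesis using that K by blast
qed

lemma clin_bounded_family:
  fixes s :: "(nat \<Rightarrow> cmat) \<Rightarrow> nat \<Rightarrow> cmat"
  assumes s: "clin s"
  obtains K where "K \<ge> 0" "\<And>y. y \<in> Hs \<Longrightarrow> (\<Sum>i\<in>{1..k}. nm (s y i)) \<le> K * nh y"
proof -
  have "\<exists>K. K \<ge> 0 \<and> (\<forall>y\<in>Hs. cmod (s y i a b) \<le> K * nh y)" for i a b
  proof -
    have "clin (\<lambda>y. s y i)" using clin_comp[OF clin_apply s] .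
    then have "clin (\<lambda>y. s y i a)" by (rule clin_comp[OF clin_apply])
    then have "clin (\<lambda>y. s y i a b)" by (rule clin_comp[OF clin_apply])
    then obtain K where "K \<ge> 0" "\<And>y. y \<in> Hs \<Longrightarrow> cmod (s y i a b) \<le> K * nh y" by (rule clin_bounded) (rule that)
    then show ?thesis by blast
  qed
  then obtain K where K: "\<And>i a b. K i a b \<ge> 0" "\<And>i a b y. y \<in> Hs \<Longrightarrow> cmod (s y i a b) \<le> K i a b * nh y" by metis
  show ?thesis
  proof (rule that[of "\<Sum>i\<in>{1..k}. \<Sum>a<n. \<Sum>b<n. K i a b"])
    show "0 \<le> (\<Sum>i\<in>{1..k}. \<Sum>a<n. \<Sum>b<n. K i a b)" using K(1) by (simp add: sum_nonneg)
    fix y assume "y \<in> Hs"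
    then show "(\<Sum>i\<in>{1..k}. nm (s y i)) \<le> (\<Sum>i\<in>{1..k}. \<Sum>a<n. \<Sum>b<n. K i a b) * nh y"
      unfolding nm_def[of "s y _"] sum_distrib_right[of _ _ "nh y"] by (intro sum_mono) (rule K(2))
  qed
qed

end

locale rigid_system = irreducible_system +
  assumes rigid: "\<And>B. (\<And>i. i \<in> {1..k} \<Longrightarrow> \<exists>G G'. invertible2 G G' \<and> B i = mm G (mm (A i) G')) \<Longrightarrow>
    mprod B k = one \<Longrightarrow> \<exists>P P'. invertible2 P P' \<and> (\<forall>i\<in>{1..k}. mm (B i) P = mm P (A i))"
begin

lemma roots_of_unity_isolated: "\<exists>d>0. \<forall>c. cmod c < d \<longrightarrow> (1 + c) ^ n = 1 \<longrightarrow> c = 0"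
proof -
  let ?S = "{z::complex. z ^ n = 1} - {1}"
  have fin: "finite ?S" using finite_roots_unity[OF n] by blast
  define d where "d = Min (insert 1 ((\<lambda>z. cmod (z - 1)) ` ?S))"
  have "d > 0" unfolding d_def using fin by (subst Min_gr_iff) auto
  moreover have "c = 0" if "cmod c < d" "(1 + c) ^ n = 1" for c
  proof (rule ccontr)
    assume "c \<noteq> 0"
    then have "1 + c \<in> ?S" using that by simp
    then have "cmod (1 + c - 1) \<in> insert 1 ((\<lambda>z. cmod (z - 1)) ` ?S)" by blast
    then have "d \<le> cmod (1 + c - 1)" unfolding d_def using fin by (intro Min_le) auto
    then show False using that by simp
  qed
  ultimately show ?thesis by blast
qed

text \<open>Conjugating \<open>A i\<close> by the partial products of the \<open>one + x i\<close> gives another solution, and the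
  conjugator \<open>P\<close> provided by rigidity becomes the element \<open>z\<close> of the product of the centralisers.\<close>

lemma rigid_deformation:
  assumes x: "x \<in> Hs" and small: "\<And>i. i \<in> {1..<k} \<Longrightarrow> nm (x i) < 1"
    and eq: "mprod (\<lambda>i. mm (A i) (one + x i)) k = (1 + c) *c mprod (\<lambda>i. one + x i) k"
    and c: "(1 + c) ^ n = 1 \<Longrightarrow> c = 0"
  obtains z where "z \<in> Zs" "z 1 \<noteq> 0" "\<And>i. i \<in> {1..<k} \<Longrightarrow> z i = mm (one + x i) (z (Suc i))"
proof -
  let ?h = "\<lambda>i. one + x i"
  have xg: "x i \<in> gl" for i
    using dsumD[OF x, of i] fsub_zero_mem[OF fsub_gl] by (cases "i \<in> {1..<k}") auto
  have "\<exists>N. invertible2 (?h i) N" for i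
  proof (cases "i \<in> {1..<k}")
    case True then show ?thesis by (intro near_one_invertible xg small)
  next
    case False
    then have "?h i = one" using dsumD(2)[OF x, of i] by simp
    then have "invertible2 (?h i) one" using one_gl mm_one by (simp add: invertible2_def)
    then show ?thesis by blast
  qed
  then obtain h' where h': "\<And>i. invertible2 (?h i) (h' i)" by metis
  define G where "G = (\<lambda>i. mprod ?h (i - 1))"
  define G' where "G' = (\<lambda>i. rprod h' (i - 1))"
  have G: "invertible2 (G i) (G' i)" for i unfolding G_def G'_def by (rule invertible2_mprod[OF h'])
  then have g: "G i \<in> gl" "G' i \<in> gl" "mm (G i) (G' i) = one" "mm (G' i) (G i) = one" for i by (auto simp: invertible2_def)
  define B where "B = (\<lambda>i. mm (G i) (mm (A i) (G' i)))"
  have Bgl: "B i \<in> gl" if "i \<in> {1..k}" for i unfolding B_def using g gls(1)[OF that] by (intro mm_gl)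
  have hg: "?h i \<in> gl" for i using h'[of i] by (simp add: invertible2_def)
  have cancel: "mm (G' i) (mm (G i) M) = M" if "M \<in> gl" for M i
    using that g(4)[of i] by (simp add: mm_assoc[symmetric] mm_one)
  \<comment> \<open>Consecutive conjugators differ by one factor \<open>?h i\<close>, so all inner
    ones cancel; at \<open>m = k\<close> the left side of \<open>eq\<close> appears.\<close>
  have tele: "m \<le> k \<Longrightarrow> mm (mprod B m) (mprod ?h m) = mprod (\<lambda>i. mm (A i) (?h i)) m" for m
  proof (induction m)
    case (Suc m)
    have Am: "A (Suc m) \<in> gl" using Suc.prems gls(1) by auto
    have "mm (mprod B (Suc m)) (mprod ?h (Suc m)) =
        mm (mprod B m) (mm (G (Suc m)) (mm (A (Suc m)) (mm (G' (Suc m)) (mm (G (Suc m)) (?h (Suc m))))))"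
      unfolding mprod.simps B_def mm_assoc by (simp add: G_def)
    also have "\<dots> = mm (mprod B m) (mm (mprod ?h m) (mm (A (Suc m)) (?h (Suc m))))"
      unfolding cancel[OF hg] by (simp add: G_def)
    also have "\<dots> = mm (mm (mprod B m) (mprod ?h m)) (mm (A (Suc m)) (?h (Suc m)))" by (simp only: mm_assoc)
    also have "\<dots> = mprod (\<lambda>i. mm (A i) (?h i)) (Suc m)" unfolding Suc.IH[OF Suc_leD[OF Suc.prems]] by (simp only: mprod.simps)
    finally show ?case .
  qed (simp add: mm_one one_gl)
  have prodB: "mprod B k = (1 + c) *c one"
  proof -
    obtain R where R: "invertible2 (mprod ?h k) R" using invertible2_mprod[of k ?h h', OF h'] by blast
    then have r: "mm (mprod ?h k) R = one" by (simp add: invertible2_def)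
    have "mprod B k = mm (mprod B k) (mm (mprod ?h k) R)" using mm_one(2)[OF mprod_gl[of k B, OF Bgl]] r by simp
    also have "\<dots> = mm (mm (mprod B k) (mprod ?h k)) R" by (simp only: mm_assoc)
    also have "\<dots> = mm ((1 + c) *c mprod ?h k) R" using tele[OF order_refl] eq by simp
    also have "\<dots> = (1 + c) *c one" by (simp only: clin_scale[OF clin_mm_left] r)
    finally show ?thesis .
  qed
  \<comment> \<open>Conjugation preserves determinants, so \<open>(1 + c) ^ n\<close> is the
    determinant of the original product, which is 1.\<close>
  have "(1 + c) ^ n = dt (mprod B k)" by (simp add: prodB dt_scalar)
  also have "\<dots> = (\<Prod>i\<in>{1..k}. dt (B i))" by (rule dt_mprod[OF Bgl])
  also have "\<dots> = (\<Prod>i\<in>{1..k}. dt (A i))" unfolding B_def by (rule prod.cong) (simp_all add: dt_conj[OF G] gls(1))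
  also have "\<dots> = dt (mprod A k)" by (rule dt_mprod[OF gls(1), symmetric])
  also have "\<dots> = 1" by (simp add: prodA dt_one)
  finally have "c = 0" by (rule c)
  then have "mprod B k = one" using prodB by (simp add: cscale_one)
  then obtain P P' where P: "invertible2 P P'" "\<And>i. i \<in> {1..k} \<Longrightarrow> mm (B i) P = mm P (A i)"
    using rigid[of B] G unfolding B_def by blast
  have Pg: "P \<in> gl" using P by (simp add: invertible2_def)
  define z where "z = (\<lambda>i. if i \<in> {1..k} then mm (G' i) P else 0)"
  show ?thesis
  proof (rule that[of z])
    show "z \<in> Zs"
    proof (rule dsumI)
      fix i assume i: "i \<in> {1..k}"
      have zg: "mm (G' i) P \<in> gl" using mm_gl g Pg by blast
      have "mm (mm (G' i) P) (A i) = mm (G' i) (mm (B i) P)" using P(2)[OF i] by (simp add: mm_assoc)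
      also have "\<dots> = mm (G' i) (mm (G i) (mm (A i) (mm (G' i) P)))" by (simp add: B_def mm_assoc)
      also have "\<dots> = mm (A i) (mm (G' i) P)" by (rule cancel[OF mm_gl[OF gls(1)[OF i] zg]])
      finally show "z i \<in> Fix i" using i zg T_fixed[OF i zg] by (simp add: z_def)
    qed (auto simp: z_def)
    have "G' 1 = one" by (simp add: G'_def)
    then have z1: "z 1 = P" using k mm_one(1)[OF Pg] by (simp add: z_def)
    show "z 1 \<noteq> 0"
    proof
      assume "z 1 = 0"
      then have "one = 0" using P(1) z1 clin_0[OF clin_mm_left, of P'] by (simp add: invertible2_def)
      then show False using one_nonzero by simp
    qed
    fix i assume i: "i \<in> {1..<k}"
    have "G' (Suc i) = mm (h' i) (G' i)" using i by (cases i) (auto simp: G'_def)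
    then have "mm (?h i) (z (Suc i)) = mm (mm (?h i) (h' i)) (mm (G' i) P)" using i by (simp add: z_def mm_assoc)
    also have "\<dots> = mm (G' i) P" using h'[of i] mm_gl[OF g(2) Pg] by (simp add: invertible2_def mm_one)
    finally show "z i = mm (?h i) (z (Suc i))" using i by (simp add: z_def)
  qed
qed

lemma nm_sum_scalar: "nm (M + c *c one) \<le> nm M + cmod c * n"
  using nm_add[of M "c *c one"] mult_left_mono[OF nm_one norm_ge_zero[of c]] by (simp add: nm_scale)

text \<open>Were \<open>H\<close> not tangent to the orbit, a functional \<open>\<Lambda>\<close> would separate it from the directions of
  conjugation. Along solutions \<open>x\<close> approaching \<open>t H\<close>, the element \<open>z\<close> is \<open>\<tau>\<close> times the identity up to
  \<open>O(t)\<close>, whence \<open>0 = \<Lambda> (succ_diffs k z) = - \<tau> t + o(t)\<close>.\<close>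

lemma tangent_trivial:
  assumes H: "H \<in> Hs" "fox T k H = 0" shows "H \<in> succ_diffs k ` Zs"
proof (rule ccontr)
  let ?D = "succ_diffs k"
  assume "H \<notin> ?D ` Zs"
  then obtain \<Lambda> :: "(nat \<Rightarrow> cmat) \<Rightarrow> complex" where \<Lambda>: "clin \<Lambda>" "\<And>y. y \<in> ?D ` Zs \<Longrightarrow> \<Lambda> y = 0" "\<Lambda> H = 1"
    by (rule separating_functional[OF fsubD[OF fsub_image[OF clin_succ_diffs fsub_Zs]]]) (rule that)
  obtain K1 where K1: "K1 \<ge> 0" "\<And>y. y \<in> Hs \<Longrightarrow> cmod (\<Lambda> y) \<le> K1 * nh y" by (rule clin_bounded[OF \<Lambda>(1)]) (rule that)
  \<comment> \<open>The deviation of \<open>z\<close> from the scalar given by one of its entries.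
    By Schur it vanishes when all differences do, so it factors through them and is bounded by
    them.\<close>
  define g where "g = (\<lambda>(z::nat \<Rightarrow> cmat) i. if i \<in> {1..k} then z i - z 1 0 0 *c one else 0)"
  have "clin g"
    unfolding g_def by (intro clinI) (auto simp: fun_eq_iff cscale_fun_apply cscale_complex_def algebra_simps)
  moreover have "g z = 0" if z: "z \<in> Zs" "?D z = 0" for z
  proof -
    have const: "z i = z 1" if i: "i \<in> {1..k}" for i
    proof -
      have "Suc m \<le> k \<Longrightarrow> z (Suc m) = z 1" for m
      proof (induction m)
        case (Suc m)
        have "?D z (Suc m) = 0" using z(2) by simp
        then show ?case using Suc by (simp add: succ_diffs_def)
      qed simp
      from this[of "i - 1"] show ?thesis using i by simp
    qed
    have zi: "z i \<in> gl \<and> T i (z i) = z i" if "i \<in> {1..k}" for i using dsumD(1)[OF z(1) that] by simp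
    have "\<exists>s. z 1 = s *c one"
    proof (rule schur)
      show "z 1 \<in> gl" using zi[of 1] k by simp
      show "mm (A i) (z 1) = mm (z 1) (A i)" if "i \<in> {1..k}" for i
      proof (rule iffD1[OF T_fixed[OF that]])
        show "z 1 \<in> gl" "T i (z 1) = z 1" using zi[OF that] const[OF that] by simp_all
      qed
    qed
    then obtain s where s: "z 1 = s *c one" by blast
    have "z 1 0 0 = s" unfolding s using n by (simp add: one_def cscale_fun_apply cscale_complex_def)
    then have "g z i = 0" for i using const[of i] s by (simp add: g_def)
    then show ?thesis by (auto simp: fun_eq_iff)
  qed
  ultimately obtain s where s: "clin s" "\<And>z. z \<in> Zs \<Longrightarrow> s (?D z) = g z"
    by (rule linear_factor[OF clin_succ_diffs _ fsubD[OF fsub_Zs]]) (assumption, assumption, rule that)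
  obtain K2 where K2: "K2 \<ge> 0" "\<And>y. y \<in> Hs \<Longrightarrow> (\<Sum>i\<in>{1..k}. nm (s y i)) \<le> K2 * nh y"
    by (rule clin_bounded_family[OF s(1)]) (rule that)
  have nh0: "nh y \<ge> 0" for y by (simp add: sum_nonneg nm_ge)
  \<comment> \<open>With this \<open>e\<close>, replacing \<open>x\<close> by \<open>t H\<close>
    under \<open>\<Lambda>\<close> costs at most half of the main term \<open>t\<close>.\<close>
  define e where "e = 1 / (2 * (K1 + 1))"
  have e: "e > 0" "e \<le> 1" "K1 * e \<le> 1 / 2" using K1(1) by (auto simp: e_def field_simps)
  define L where "L = nh H + 1"
  have L: "L \<ge> 1" using nh0[of H] by (simp add: L_def)
  obtain d where d: "d > 0" "\<And>t. 0 < t \<and> t < d \<Longrightarrow> \<exists>x c. x \<in> Hs \<and>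
      mprod (\<lambda>i. mm (A i) (one + x i)) k = (1 + c) *c mprod (\<lambda>i. one + x i) k \<and>
      nh (x - of_real t *c H) \<le> e * t \<and> cmod c \<le> e * t"
    using deform[OF H e(1)] by (elim exE conjE) (rule that, auto)
  obtain d' where d': "d' > 0" "\<And>c. cmod c < d' \<Longrightarrow> (1 + c) ^ n = 1 \<Longrightarrow> c = 0"
    using roots_of_unity_isolated by (elim exE conjE) (rule that, auto)
  \<comment> \<open>The constant of the second order term: \<open>\<Lambda> \<rho>\<close> is at
    most \<open>t * Q\<close> times \<open>t * cmod \<tau>\<close>. The choice of \<open>t\<close>
    makes this a quarter of the main term, and \<open>1/2 + 1/4 < 1\<close> gives the
    contradiction.\<close>
  define Q where "Q = K1 * L * (K2 * L) * (2 * k * n)"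
  have Q: "Q \<ge> 0" using K1 K2 L by (simp add: Q_def)
  define a where "a = L + K2 * L + Q"
  have a: "a \<ge> 1" "L \<le> a" "K2 * L \<le> a" "Q \<le> a" using L K2(1) Q by (auto simp: a_def intro: order_trans[of _ L])
  define t where "t = min (min (d / 2) (d' / 2)) (1 / (4 * a))"
  have t: "t > 0" "t < d" "t < d'" using d(1) d'(1) a(1) by (auto simp: t_def)
  have "t * a \<le> 1 / (4 * a) * a" using a(1) by (intro mult_right_mono) (simp_all add: t_def)
  then have ta: "t * a \<le> 1 / 4" using a(1) by simp
  have small: "t * L \<le> 1 / 4" "t * (K2 * L) \<le> 1 / 4" "t * Q \<le> 1 / 4"
    using ta mult_left_mono[OF a(2), of t] mult_left_mono[OF a(3), of t] mult_left_mono[OF a(4), of t] t(1) by linarith+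
  obtain x c where x: "x \<in> Hs" "mprod (\<lambda>i. mm (A i) (one + x i)) k = (1 + c) *c mprod (\<lambda>i. one + x i) k"
      "nh (x - of_real t *c H) \<le> e * t" "cmod c \<le> e * t"
    using d(2)[OF conjI[OF t(1,2)]] by (elim conjE exE) (rule that)
  have nhx: "nh x \<le> t * L"
  proof -
    have "nm (x i) \<le> t * nm (H i) + nm ((x - of_real t *c H) i)" for i
      using nm_add[of "of_real t *c H i" "(x - of_real t *c H) i"] t(1) by (simp add: nm_scale cscale_fun_apply del: minus_fun_apply')
    then have "nh x \<le> (\<Sum>i\<in>{1..<k}. t * nm (H i) + nm ((x - of_real t *c H) i))" by (intro sum_mono)
    also have "\<dots> = t * nh H + nh (x - of_real t *c H)" by (simp only: sum.distrib sum_distrib_left)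
    also have "\<dots> \<le> t * nh H + e * t" using x(3) by simp
    also have "\<dots> \<le> t * L" using e(2) t(1) by (simp add: L_def algebra_simps)
    finally show ?thesis .
  qed
  have nmx: "nm (x i) < 1" if "i \<in> {1..<k}" for i
  proof -
    have "nm (x i) \<le> nh x" using that nm_ge by (intro member_le_sum) auto
    then show ?thesis using nhx small(1) by linarith
  qed
  have c: "c = 0" if "(1 + c) ^ n = 1"
  proof (rule d'(2)[OF _ that])
    have "e * t \<le> 1 * t" using e(2) t(1) by (intro mult_right_mono) auto
    then show "cmod c < d'" using x(4) t(3) by linarith
  qed
  obtain z where z: "z \<in> Zs" "z 1 \<noteq> 0" "\<And>i. i \<in> {1..<k} \<Longrightarrow> z i = mm (one + x i) (z (Suc i))"
    by (rule rigid_deformation[OF x(1) nmx x(2) c]) (assumption, assumption, rule that)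
  have zg: "z i \<in> gl" if "i \<in> {1..k}" for i using dsumD(1)[OF z(1) that] by simp
  define \<zeta> where "\<zeta> = (\<Sum>i\<in>{1..k}. nm (z i))"
  have z\<zeta>: "nm (z i) \<le> \<zeta>" if "i \<in> {1..k}" for i unfolding \<zeta>_def using that nm_ge by (intro member_le_sum) auto
  have "nm (z 1) \<noteq> 0" using nm_eq_0[OF zg[of 1]] z(2) k by auto
  then have \<zeta>: "\<zeta> > 0" using z\<zeta>[of 1] nm_ge[of "z 1"] k by simp
  have D: "?D z i = - mm (x i) (z (Suc i))" if i: "i \<in> {1..<k}" for i
  proof -
    have "z i = z (Suc i) + mm (x i) (z (Suc i))"
      using z(3)[OF i] zg[of "Suc i"] i by (simp add: clin_add[OF clin_mm_left] mm_one)
    then show ?thesis using i by (simp add: succ_diffs_def)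
  qed
  have nhD: "nh (?D z) \<le> t * L * \<zeta>"
  proof -
    have "nm (?D z i) \<le> nm (x i) * \<zeta>" if i: "i \<in> {1..<k}" for i
      unfolding D[OF i] nm_minus using nm_mm[of "x i" "z (Suc i)"] mult_left_mono[OF z\<zeta>[of "Suc i"] nm_ge[of "x i"]] i by simp
    then have "nh (?D z) \<le> nh x * \<zeta>" unfolding sum_distrib_right by (intro sum_mono)
    also have "\<dots> \<le> t * L * \<zeta>" using nhx \<zeta> by (intro mult_right_mono) auto
    finally show ?thesis .
  qed
  define \<tau> where "\<tau> = z 1 0 0"
  define r where "r = s (?D z)"
  have r: "z i = r i + \<tau> *c one" if "i \<in> {1..k}" for i
    using s(2)[OF z(1)] that by (simp add: r_def g_def \<tau>_def)
  have nr: "(\<Sum>i\<in>{1..k}. nm (r i)) \<le> t * (K2 * L) * \<zeta>"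
  proof -
    have "(\<Sum>i\<in>{1..k}. nm (r i)) \<le> K2 * nh (?D z)" unfolding r_def by (rule K2(2)[OF diffs_Zs[OF z(1)]])
    also have "\<dots> \<le> K2 * (t * L * \<zeta>)" using nhD K2(1) by (rule mult_left_mono)
    finally show ?thesis by (simp add: mult_ac)
  qed
  \<comment> \<open>The nonscalar part of \<open>z\<close> is at most a quarter of its size
    \<open>\<zeta>\<close>, so the scalar \<open>\<tau>\<close> controls \<open>\<zeta>\<close>; in
    particular \<open>\<tau>\<close> cannot be 0.\<close>
  have \<zeta>\<tau>: "\<zeta> \<le> 2 * k * n * cmod \<tau>"
  proof -
    have "\<zeta> \<le> (\<Sum>i\<in>{1..k}. nm (r i) + cmod \<tau> * n)" unfolding \<zeta>_def using r nm_sum_scalar by (intro sum_mono) simp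
    also have "\<dots> \<le> t * (K2 * L) * \<zeta> + k * (cmod \<tau> * n)" using nr by (simp add: sum.distrib)
    also have "\<dots> \<le> 1 / 4 * \<zeta> + k * (cmod \<tau> * n)" using mult_right_mono[OF small(2), of \<zeta>] \<zeta> by simp
    finally have "3 / 4 * \<zeta> \<le> k * (cmod \<tau> * n)" by simp
    then have "2 * (3 / 4 * \<zeta>) \<le> 2 * (k * (cmod \<tau> * n))" by (rule mult_left_mono) simp
    then show ?thesis using \<zeta> by (simp add: mult_ac)
  qed
  define \<rho> where "\<rho> = (\<lambda>i. if i \<in> {1..<k} then mm (x i) (r (Suc i)) else 0)"
  have rg: "r i \<in> gl" if "i \<in> {1..k}" for i
  proof -
    have "r i = z i - \<tau> *c one" using r[OF that] by simp
    then show ?thesis using fsub_diff[OF fsub_gl zg[OF that] fsub_scale[OF fsub_gl one_gl]] by simp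
  qed
  have xg: "x i \<in> gl" if "i \<in> {1..<k}" for i using dsumD(1)[OF x(1) that] .
  have \<rho>H: "\<rho> \<in> Hs" unfolding \<rho>_def using xg rg by (intro dsumI) (auto intro!: mm_gl)
  have D\<rho>: "?D z = - (\<tau> *c x + \<rho>)"
  proof
    fix i
    show "?D z i = (- (\<tau> *c x + \<rho>)) i"
    proof (cases "i \<in> {1..<k}")
      case True
      have "z (Suc i) = r (Suc i) + \<tau> *c one" using r[of "Suc i"] True by simp
      then have "mm (x i) (z (Suc i)) = mm (x i) (r (Suc i)) + \<tau> *c x i"
        by (simp only: clin_add[OF clin_mm_right] scalar_comm(1)[OF xg[OF True]])
      then show ?thesis using True D[OF True] by (simp add: \<rho>_def cscale_fun_apply)
    next
      case False
      then show ?thesis using dsumD(2)[OF x(1) False] by (auto simp: \<rho>_def succ_diffs_def cscale_fun_apply)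
    qed
  qed
  let ?E = "x - of_real t *c H"
  have EH: "?E \<in> Hs" using fsub_diff[OF fsub_Hs x(1) fsub_scale[OF fsub_Hs H(1)]] .
  have "\<Lambda> (?D z) = 0" using \<Lambda>(2) z(1) by blast
  then have rel: "\<tau> * \<Lambda> x + \<Lambda> \<rho> = 0"
    unfolding D\<rho> clin_minus[OF \<Lambda>(1)] clin_add[OF \<Lambda>(1)] clin_scale[OF \<Lambda>(1)] cscale_complex_def by (simp only: neg_equal_0_iff_equal)
  have \<Lambda>x: "\<Lambda> x = t + \<Lambda> ?E"
    by (simp add: clin_diff[OF \<Lambda>(1)] clin_scale[OF \<Lambda>(1)] \<Lambda>(3) cscale_complex_def)
  have "\<tau> * of_real t - (- (\<tau> * \<Lambda> ?E) - \<Lambda> \<rho>) = \<tau> * \<Lambda> x + \<Lambda> \<rho>" unfolding \<Lambda>x by (simp only: algebra_simps) simp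
  then have "\<tau> * of_real t = - (\<tau> * \<Lambda> ?E) - \<Lambda> \<rho>" unfolding rel by (simp only: right_minus_eq)
  then have "cmod (\<tau> * of_real t) \<le> cmod (\<tau> * \<Lambda> ?E) + cmod (\<Lambda> \<rho>)"
    using norm_triangle_ineq4[of "- (\<tau> * \<Lambda> ?E)" "\<Lambda> \<rho>"] by simp
  then have main: "cmod \<tau> * t \<le> cmod \<tau> * cmod (\<Lambda> ?E) + cmod (\<Lambda> \<rho>)" using t(1) by (simp add: norm_mult)
  have "cmod (\<Lambda> ?E) \<le> K1 * (e * t)" using K1(2)[OF EH] mult_left_mono[OF x(3) K1(1)] by linarith
  also have "\<dots> \<le> 1 / 2 * t" using mult_right_mono[OF e(3), of t] t(1) by simp
  finally have 1: "cmod \<tau> * cmod (\<Lambda> ?E) \<le> cmod \<tau> * (1 / 2 * t)" by (intro mult_left_mono) auto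
  have "nh \<rho> \<le> (t * L) * (t * (K2 * L) * \<zeta>)"
  proof -
    have "nm (r (Suc i)) \<le> t * (K2 * L) * \<zeta>" if i: "i \<in> {1..<k}" for i
    proof -
      have "nm (r (Suc i)) \<le> (\<Sum>i\<in>{1..k}. nm (r i))" using i nm_ge by (intro member_le_sum) auto
      then show ?thesis using nr by linarith
    qed
    then have "nm (\<rho> i) \<le> nm (x i) * (t * (K2 * L) * \<zeta>)" if i: "i \<in> {1..<k}" for i
      using nm_mm[of "x i" "r (Suc i)"] mult_left_mono[of "nm (r (Suc i))" "t * (K2 * L) * \<zeta>" "nm (x i)"] nm_ge i
      by (simp add: \<rho>_def)
    then have "nh \<rho> \<le> nh x * (t * (K2 * L) * \<zeta>)" unfolding sum_distrib_right by (intro sum_mono)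
    also have "\<dots> \<le> (t * L) * (t * (K2 * L) * \<zeta>)" using nhx t(1) K2(1) L \<zeta> by (intro mult_right_mono) auto
    finally show ?thesis .
  qed
  also have "\<dots> \<le> (t * L) * (t * (K2 * L) * (2 * k * n * cmod \<tau>))"
    using \<zeta>\<tau> t(1) K2(1) L by (intro mult_left_mono) auto
  finally have "K1 * nh \<rho> \<le> K1 * ((t * L) * (t * (K2 * L) * (2 * k * n * cmod \<tau>)))" using K1(1) by (rule mult_left_mono)
  also have "\<dots> = (t * Q) * (t * cmod \<tau>)" by (simp add: Q_def)
  also have "\<dots> \<le> 1 / 4 * (t * cmod \<tau>)" using small(3) t(1) by (intro mult_right_mono) auto
  finally have 2: "cmod (\<Lambda> \<rho>) \<le> 1 / 4 * (t * cmod \<tau>)" using K1(2)[OF \<rho>H] by linarith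
  have "cmod \<tau> * t \<le> 0" using main 1 2 by (simp add: algebra_simps)
  then have "\<tau> = 0" using t(1) by (simp add: mult_le_0_iff)
  then show False using \<zeta>\<tau> \<zeta> by simp
qed

text \<open>By \<open>tangent_trivial\<close> the complex is exact at \<open>Hs\<close>, so the
  dimension count is an equality with \<open>dim Inv = 1\<close>. Bounding the rank of
  \<open>fox\<close> by \<open>n * n\<close> makes the form at least 1, and positivity is all that
  \<open>system_good\<close> asks for.\<close>

lemma rigid_dims: "(\<Sum>i\<in>{1..k}. cv.dim {M \<in> gl. mm (A i) M = mm M (A i)}) + 2 * (n * n) \<ge> k * (n * n) + 1"
proof -
  have "(\<Sum>i\<in>{1..k}. cv.dim {M \<in> gl. mm (A i) M = mm M (A i)}) = (\<Sum>i\<in>{1..k}. cv.dim (Fix i))"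
    using Fix_eq by (intro sum.cong) auto
  moreover have "succ_diffs k ` Zs = {H \<in> Hs. fox T k H = 0}"
    using diffs_in_fox_ker tangent_trivial by blast
  then have "cv.dim (succ_diffs k ` Zs) = cv.dim {H \<in> Hs. fox T k H = 0}" by simp
  moreover have "cv.dim (fox T k ` Hs) \<le> n * n"
    using fsub_dim_subset[OF fsub_gl fsub_image[OF clin_fox fsub_Hs] fox_range_subset] by (simp add: dim_gl)
  moreover have "k * (n * n) = (k - 1) * (n * n) + n * n" using k by (cases k) auto
  ultimately show ?thesis using dim_diffs dim_Inv dim_fox by (simp add: dim_gl)
qed

end


section \<open>Conjugacy classes and solutions\<close>

context mats
begin

lemma invertible2_conj:
  assumes G: "invertible2 G G'" and A: "invertible2 A A'"
  shows "invertible2 (mm G (mm A G')) (mm G (mm A' G'))"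
proof -
  have g: "G \<in> gl" "G' \<in> gl" "mm G G' = one" "mm G' G = one" "A \<in> gl" "A' \<in> gl" "mm A A' = one" "mm A' A = one"
    using G A by (auto simp: invertible2_def)
  have "mm (mm G (mm X G')) (mm G (mm Y G')) = mm G (mm (mm X Y) G')" if "X \<in> gl" "Y \<in> gl" for X Y
  proof -
    have "mm (mm G (mm X G')) (mm G (mm Y G')) = mm G (mm X (mm (mm G' G) (mm Y G')))" by (simp add: mm_assoc)
    also have "\<dots> = mm G (mm X (mm Y G'))" using that g by (simp add: mm_one mm_gl)
    finally show ?thesis by (simp add: mm_assoc)
  qed
  then show ?thesis using g by (simp add: invertible2_def mm_gl mm_one)
qed

end

locale multiplicative_problem = star k w + mats n
  for k :: nat and w :: "nat \<Rightarrow> nat" and n :: nat +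
  fixes C :: "nat \<Rightarrow> complex mat set" and \<xi> :: "nat \<Rightarrow> nat \<Rightarrow> complex" and \<alpha> :: "vertex \<Rightarrow> int"
  assumes n_pos: "n \<ge> 1"
    and classes: "\<And>i. i \<in> {1..k} \<Longrightarrow> GL_conjugacy_class n (C i)"
    and nonzero: "nz \<xi>"
    and annihilates: "\<And>i M. i \<in> {1..k} \<Longrightarrow> M \<in> C i \<Longrightarrow> shifted_prod n M (\<xi> i) (w i) = 0\<^sub>m n n"
    and lattice: "\<alpha> \<in> root_lattice I"
    and centre: "\<alpha> Centre = int n"
    and arm: "\<And>i j M. i \<in> {1..k} \<Longrightarrow> j \<in> {1..w i - 1} \<Longrightarrow> M \<in> C i \<Longrightarrow>
      \<alpha> (Arm i j) = int (vec_space.rank n (shifted_prod n M (\<xi> i) j))"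
begin

lemma class_carrier:
  assumes i: "i \<in> {1..k}" and M: "M \<in> C i"
  shows "M \<in> carrier_mat n n" "\<exists>N. invertible2 (fm M) N"
proof -
  obtain A where A: "A \<in> GL n" "similar_mat M A" using classes[OF i] M unfolding GL_conjugacy_class_def by auto
  have c: "A \<in> carrier_mat n n" using A(1) by (simp add: GL_def)
  obtain d where d: "{M, A} \<subseteq> carrier_mat d d" using similar_matD[OF A(2)] by auto
  then show Mc: "M \<in> carrier_mat n n" using c by auto
  have "similar_mat (tm (fm M)) (tm (fm A))" using A(2) by (simp add: tm_fm Mc c)
  then obtain G G' where G: "invertible2 G G'" "fm M = mm G (mm (fm A) G')" using similar_iff[OF fm_gl fm_gl] by blast
  obtain N where "invertible2 (fm A) N" using GL_invertible2[OF A(1)] by blast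
  from invertible2_conj[OF G(1) this] show "\<exists>N. invertible2 (fm M) N" unfolding G(2) by blast
qed

lemma class_iff:
  assumes i: "i \<in> {1..k}" and M: "M \<in> C i" and N: "N \<in> gl"
  shows "tm N \<in> C i \<longleftrightarrow> (\<exists>G G'. invertible2 G G' \<and> N = mm G (mm (fm M) G'))"
proof -
  obtain A where A: "C i = {B. similar_mat B A}" using classes[OF i] unfolding GL_conjugacy_class_def by auto
  have "tm N \<in> C i \<longleftrightarrow> similar_mat (tm N) M"
    using M unfolding A by (auto intro: similar_mat_trans similar_mat_sym)
  also have "\<dots> \<longleftrightarrow> similar_mat (tm N) (tm (fm M))" by (simp add: tm_fm class_carrier(1)[OF i M])
  finally show ?thesis using similar_iff[OF fm_gl N] by simp
qed

lemma class_nonempty: "i \<in> {1..k} \<Longrightarrow> \<exists>M. M \<in> C i"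
  using classes[of i] similar_mat_refl unfolding GL_conjugacy_class_def GL_def by blast

lemma class_annihilated:
  assumes i: "i \<in> {1..k}" and M: "M \<in> C i" shows "img (mv (fm M)) (\<xi> i) V (w i) = {0}"
proof -
  have "fm (0\<^sub>m n n) = 0" by (auto simp: fm_def fun_eq_iff)
  then have "mv (fm (0\<^sub>m n n)) ` V = {0}" using fsub_zero_mem[OF fsub_cspace] clin_0[OF clin_mv_left] by auto
  then show ?thesis using img_shifted_prod[OF class_carrier(1)[OF i M], of "\<xi> i" "w i"] annihilates[OF i M] by simp
qed

lemma class_dims:
  assumes i: "i \<in> {1..k}" and M: "M \<in> C i" and j: "j \<le> w i"
  shows "ac \<alpha> i j = int (cv.dim (img (mv (fm M)) (\<xi> i) V j))"
proof -
  consider "j = 0" | "j \<noteq> 0" "j = w i" | "j \<in> {1..w i - 1}" "j \<noteq> 0" "j \<noteq> w i" using j by fastforce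
  then show ?thesis
  proof cases
    case 1 then show ?thesis by (simp add: arm_coord_def centre dim_cspace)
  next
    case 2
    then have "cv.dim (img (mv (fm M)) (\<xi> i) V j) = 0" using class_annihilated[OF i M] by (simp add: dim_zero_space)
    then show ?thesis using 2 by (simp add: arm_coord_def)
  next
    case 3
    then show ?thesis using arm[OF i 3(1) M] rank_shifted_prod[OF class_carrier(1)[OF i M]] by (simp add: arm_coord_def)
  qed
qed

lemma commutant_dim:
  assumes i: "i \<in> {1..k}" and M: "M \<in> C i"
  shows "int (cv.dim {X \<in> gl. mm X (fm M) = mm (fm M) X}) = (\<Sum>j=1..w i. (ac \<alpha> i (j - 1) - ac \<alpha> i j)\<^sup>2)"
proof -
  let ?d = "\<lambda>j. cv.dim (img (mv (fm M)) (\<xi> i) V j)"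
  have "int (cv.dim {X \<in> gl. mm X (fm M) = mm (fm M) X}) = (\<Sum>j<w i. int ((?d j - ?d (Suc j))\<^sup>2))"
    using dim_commutant[OF fm_gl class_annihilated[OF i M]] by simp
  also have "\<dots> = (\<Sum>j<w i. (ac \<alpha> i j - ac \<alpha> i (Suc j))\<^sup>2)"
  proof (rule sum.cong)
    fix j assume "j \<in> {..<w i}"
    then show "int ((?d j - ?d (Suc j))\<^sup>2) = (ac \<alpha> i j - ac \<alpha> i (Suc j))\<^sup>2"
      using class_dims[OF i M, of j] class_dims[OF i M, of "Suc j"] dim_img_antimono[OF clin_mv fsub_cspace mv_V[OF fm_gl]]
      by (simp add: of_nat_diff)
  qed simp
  also have "\<dots> = (\<Sum>j=1..w i. (ac \<alpha> i (j - 1) - ac \<alpha> i j)\<^sup>2)" by (simp add: sum.atLeast1_atMost_eq)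
  finally show ?thesis .
qed

lemma form_commutants:
  assumes "\<And>i. i \<in> {1..k} \<Longrightarrow> M i \<in> C i"
  shows "bilin_form I E \<alpha> \<alpha> = int (2 * (n * n)) - int (k * (n * n)) + int (\<Sum>i\<in>{1..k}. cv.dim {X \<in> gl. mm X (fm (M i)) = mm (fm (M i)) X})"
proof -
  have "(\<Sum>i=1..k. (\<alpha> Centre)\<^sup>2 - (\<Sum>j=1..w i. (ac \<alpha> i (j - 1) - ac \<alpha> i j)\<^sup>2)) =
      (\<Sum>i\<in>{1..k}. int (n * n) - int (cv.dim {X \<in> gl. mm X (fm (M i)) = mm (fm (M i)) X}))"
    using commutant_dim assms by (intro sum.cong) (simp_all add: centre power2_eq_square)
  then show ?thesis unfolding form_star by (simp add: centre power2_eq_square sum_subtractf)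
qed

lemma solution_prod:
  assumes A: "is_solution n k C A" shows "mprod (\<lambda>i. fm (A i)) k = one"
proof -
  have c: "A i \<in> carrier_mat n n" if "i \<in> {1..k}" for i
    using A class_carrier(1)[OF that] that unfolding is_solution_def by blast
  show ?thesis using A fm_mat_prod[of k A, OF c] by (simp add: is_solution_def fm_one)
qed

lemma solutionI:
  assumes B: "\<And>i. i \<in> {1..k} \<Longrightarrow> B i \<in> gl" "\<And>i. i \<in> {1..k} \<Longrightarrow> tm (B i) \<in> C i" "mprod B k = one"
  shows "is_solution n k C (\<lambda>i. tm (B i))"
proof -
  have "fm (mat_prod n (\<lambda>i. tm (B i)) k) = mprod (\<lambda>i. fm (tm (B i))) k" by (rule fm_mat_prod) (rule tm_carrier)
  also have "\<dots> = mprod B k" by (rule mprod_cong) (simp add: fm_tm B(1))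
  finally have "mat_prod n (\<lambda>i. tm (B i)) k = 1\<^sub>m n"
    using B(3) by (intro fm_inj[OF mat_prod_carrier[OF tm_carrier]]) (simp_all add: fm_one)
  then show ?thesis using B(2) by (simp add: is_solution_def)
qed

lemma solution_system:
  assumes A: "is_solution n k C A" shows "system \<xi> V (\<lambda>i. mv (fm (A i))) \<alpha>"
proof -
  have "cprod (\<lambda>i. mv (fm (A i))) k v = v" if "v \<in> V" for v
    using cprod_mv[OF that, of k "\<lambda>i. fm (A i)"] solution_prod[OF A] that by (simp add: fm_gl mv_one)
  moreover have "A i \<in> C i" if "i \<in> {1..k}" for i using A that by (simp add: is_solution_def)
  ultimately show ?thesis unfolding system_def
    using fsub_cspace clin_mv mv_V[OF fm_gl] lattice class_dims by (simp add: centre dim_cspace)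
qed

lemma rigid_good:
  assumes A: "rigid_solution n k C A" and irr: "irreducible_tuple n k A"
  shows "good (\<chi> \<xi>) \<alpha>"
proof -
  have sol: "is_solution n k C A" using A by (simp add: rigid_solution_def)
  then have AC: "A i \<in> C i" if "i \<in> {1..k}" for i using that by (simp add: is_solution_def)
  have c: "A i \<in> carrier_mat n n" if "i \<in> {1..k}" for i using class_carrier(1)[OF that AC[OF that]] .
  have irr': "irred_family V k (\<lambda>i. mv (fm (A i)))" using irr irreducible_tuple_iff[of k A, OF c] by simp
  have "bilin_form I E \<alpha> \<alpha> > 0"
  \<comment> \<open>The monodromy argument assumes a factor; for the empty product the form is
    \<open>2 n^2\<close>.\<close>
  proof (cases "k = 0")
    case True
    then show ?thesis using form_commutants[of A] n_pos by simp
  next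
    case False
    have "\<exists>N. i \<in> {1..k} \<longrightarrow> invertible2 (fm (A i)) N" for i using class_carrier(2)[OF _ AC] by blast
    then obtain A' where A': "\<And>i. i \<in> {1..k} \<Longrightarrow> invertible2 (fm (A i)) (A' i)" by metis
    interpret rs: rigid_system n k "\<lambda>i. fm (A i)" A'
    proof
      show "k \<ge> 1" using False by simp
      show "invertible2 (fm (A i)) (A' i)" if "i \<in> {1..k}" for i using A'[OF that] .
      show "mprod (\<lambda>i. fm (A i)) k = one" using solution_prod[OF sol] .
      show "n \<ge> 1" by (rule n_pos)
      show "irred_family V k (\<lambda>i. mv (fm (A i)))" by (rule irr')
      fix B assume B: "\<And>i. i \<in> {1..k} \<Longrightarrow> \<exists>G G'. invertible2 G G' \<and> B i = mm G (mm (fm (A i)) G')" "mprod B k = one"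
      have Bg: "B i \<in> gl" if "i \<in> {1..k}" for i using B(1)[OF that] by (auto simp: invertible2_def intro!: mm_gl fm_gl)
      have "is_solution n k C (\<lambda>i. tm (B i))"
        using class_iff[OF _ AC Bg] B by (intro solutionI Bg) auto
      then have "simultaneously_conjugate n k A (\<lambda>i. tm (B i))" using A by (simp add: rigid_solution_def)
      then obtain G G' where "invertible2 G G'" "\<And>i. i \<in> {1..k} \<Longrightarrow> mm (fm (tm (B i))) G = mm G (fm (A i))"
        using simultaneously_conjugate_iff[of k A "\<lambda>i. tm (B i)", OF c tm_carrier] by blast
      then show "\<exists>P P'. invertible2 P P' \<and> (\<forall>i\<in>{1..k}. mm (B i) P = mm P (fm (A i)))" using fm_tm[OF Bg] by auto
    qed
    have "{X \<in> gl. mm X (fm (A i)) = mm (fm (A i)) X} = {X \<in> gl. mm (fm (A i)) X = mm X (fm (A i))}" for i by auto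
    then have "(\<Sum>i\<in>{1..k}. cv.dim {X \<in> gl. mm X (fm (A i)) = mm (fm (A i)) X}) + 2 * (n * n) \<ge> k * (n * n) + 1"
      using rs.rigid_dims by (simp only:)
    then show ?thesis using form_commutants[of A, OF AC] by linarith
  qed
  then show ?thesis using system_good[OF solution_system[OF sol] nonzero irr' n_pos] by blast
qed

text \<open>\<open>good_system\<close> yields operators with the prescribed ranks;
  \<open>intertwiner_exists\<close> then places them in the given conjugacy classes.\<close>

lemma good_irreducible:
  assumes "good (\<chi> \<xi>) \<alpha>"
  obtains A where "is_solution n k C A" "irreducible_tuple n k A"
proof -
  obtain m F where F: "system \<xi> (cspace m) F \<alpha>" "irred_family (cspace m) k F"
    using good_system[OF assms nonzero] centre n_pos by auto
  have m: "m = n" using systemD(6)[OF F(1)] centre by (simp add: dim_cspace)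
  note F = F[unfolded m]
  note S = systemD[OF F(1)]
  let ?B = "\<lambda>i. mo (F i)"
  have mv: "mv (?B i) v = F i v" if "i \<in> {1..k}" "v \<in> V" for i v
    by (rule mv_mo[OF S(2)[OF that(1)] _ that(2)]) (rule S(3)[OF that(1)])
  have B: "tm (?B i) \<in> C i" if i: "i \<in> {1..k}" for i
  proof -
    obtain M where M: "M \<in> C i" using class_nonempty[OF i] by blast
    have "img (F i) (\<xi> i) V (w i) = {0}"
    proof -
      have "int (cv.dim (img (F i) (\<xi> i) V (w i))) = ac \<alpha> i (w i)" using S(7)[OF i order_refl] by simp
      also have "\<dots> = 0" using class_dims[OF i M order_refl] class_annihilated[OF i M] by (simp add: dim_zero_space)
      finally show ?thesis using fsub_dim_0[OF img_fsub[OF S(2)[OF i] S(1)]] by simp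
    qed
    moreover have "cv.dim (img (mv (fm M)) (\<xi> i) V j) = cv.dim (img (F i) (\<xi> i) V j)" if "j \<le> w i" for j
      using class_dims[OF i M that] S(7)[OF i that] by simp
    ultimately have "\<exists>h. clin h \<and> h ` V = V \<and> (\<forall>v\<in>V. h v = 0 \<longrightarrow> v = 0) \<and> (\<forall>v\<in>V. h (mv (fm M) v) = F i (h v))"
      by (intro intertwiner_exists[OF clin_mv fsub_cspace mv_V[OF fm_gl] class_annihilated[OF i M] S(2)[OF i] S(1) S(3)[OF i]])
    then obtain h where h: "clin h" "h ` V = V" "\<forall>v\<in>V. h v = 0 \<longrightarrow> v = 0" "\<forall>v\<in>V. h (mv (fm M) v) = F i (h v)"
      by (elim exE conjE) (rule that)
    have hV: "h v \<in> V" if "v \<in> V" for v using h(2) that by blast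
    have mh: "mv (mo h) v = h v" if "v \<in> V" for v by (rule mv_mo[OF h(1) hV that])
    obtain H where H: "invertible2 (mo h) H" using inverse_exists[OF mo_gl, of h] mh h(3) by auto
    have "mm (?B i) (mo h) = mm (mo h) (fm M)"
      by (rule gl_eqI[OF mm_gl[OF mo_gl mo_gl] mm_gl[OF mo_gl fm_gl]])
        (simp add: mv_mm mh mv[OF i] hV mv_V[OF fm_gl] h(4))
    then have "mm (mo h) (mm (fm M) H) = mm (?B i) (mm (mo h) H)" by (simp add: mm_assoc[symmetric])
    then have "?B i = mm (mo h) (mm (fm M) H)" using H mo_gl by (simp add: invertible2_def mm_one)
    then show ?thesis using class_iff[OF i M mo_gl] H by blast
  qed
  have "mprod ?B k = one"
  proof (rule gl_eqI[OF mprod_gl one_gl])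
    fix v assume v: "v \<in> V"
    have "cprod (\<lambda>i. mv (?B i)) m v = cprod F m v" if "m \<le> k" "v \<in> V" for m v
      using that
    proof (induction m arbitrary: v)
      case (Suc m) then show ?case using mv[of "Suc m"] S(3)[of "Suc m"] by simp
    qed simp
    from this[OF order_refl v] have "cprod (\<lambda>i. mv (?B i)) k v = v" using S(4)[OF v] by simp
    then show "mv (mprod ?B k) v = mv one v" using cprod_mv[OF v, of k ?B] mo_gl v by (simp add: mv_one)
  qed (rule mo_gl)
  then have "is_solution n k C (\<lambda>i. tm (?B i))" using B by (intro solutionI mo_gl) auto
  moreover have "irred_family V k (\<lambda>i. mv (fm (tm (?B i))))"
    unfolding irred_family_def
  proof (intro allI impI)
    fix U assume U: "cv.subspace U \<and> U \<subseteq> V \<and> (\<forall>i\<in>{1..k}. \<forall>v\<in>U. mv (fm (tm (?B i))) v \<in> U)"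
    then have "F i v \<in> U" if "i \<in> {1..k}" "v \<in> U" for i v
      using that mv[of i v] fm_tm[OF mo_gl, of "F i"] by fastforce
    then show "U = {0} \<or> U = V" using irred_familyD[OF F(2)] U by blast
  qed
  ultimately show ?thesis using that irreducible_tuple_iff[of k "\<lambda>i. tm (?B i)", OF tm_carrier] by blast
qed

text \<open>Irreducibility is known for \<open>A\<close> alone, so the two directions differ: an
  intertwiner from \<open>A\<close> has an invariant kernel, one into \<open>A\<close> an invariant
  range. Since both tuples act on the same space, \<open>h\<close> is invertible in either
  case.\<close>

lemma irreducible_intertwiner:
  assumes irr: "irred_family V k (\<lambda>i. mv (A i))" and A: "\<And>i. i \<in> {1..k} \<Longrightarrow> A i \<in> gl"
    and h: "h \<in> gl" "h \<noteq> 0"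
    and eq: "(\<forall>i\<in>{1..k}. mm (B i) h = mm h (A i)) \<or> (\<forall>i\<in>{1..k}. mm (A i) h = mm h (B i))"
    and B: "\<And>i. i \<in> {1..k} \<Longrightarrow> B i \<in> gl"
  shows "\<exists>P P'. invertible2 P P' \<and> (\<forall>i\<in>{1..k}. mm (B i) P = mm P (A i))"
proof -
  have nz: "\<exists>x\<in>V. mv h x \<noteq> 0"
  proof (rule ccontr)
    assume "\<not> (\<exists>x\<in>V. mv h x \<noteq> 0)"
    then have "h = 0" by (intro gl_eqI[OF h(1) fsub_zero_mem[OF fsub_gl]]) (simp add: clin_0[OF clin_mv_left])
    then show False using h(2) by simp
  qed
  from eq show ?thesis
  proof
    assume e: "\<forall>i\<in>{1..k}. mm (B i) h = mm h (A i)"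
    let ?K = "{x \<in> V. mv h x = 0}"
    have "?K = {0} \<or> ?K = V"
    proof (rule irred_familyD[OF irr])
      show "cv.subspace ?K" by (rule subspace_ker[OF clin_mv fsubD[OF fsub_cspace]])
      show "mv (A i) x \<in> ?K" if "i \<in> {1..k}" "x \<in> ?K" for i x
      proof -
        have "mv h (mv (A i) x) = mv (mm h (A i)) x" by (simp add: mv_mm)
        also have "\<dots> = mv (B i) (mv h x)" using e that(1) by (simp add: mv_mm[symmetric])
        also have "\<dots> = 0" using that(2) by (simp add: clin_0[OF clin_mv])
        finally show ?thesis using mv_V[OF A[OF that(1)]] by simp
      qed
    qed auto
    then have "?K = {0}" using nz by blast
    then obtain N where "invertible2 h N" using inverse_exists[OF h(1)] by blast
    then show ?thesis using e by blast
  next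
    assume e: "\<forall>i\<in>{1..k}. mm (A i) h = mm h (B i)"
    let ?R = "mv h ` V"
    have R: "fsub ?R" by (rule fsub_image[OF clin_mv fsub_cspace])
    have RV: "?R \<subseteq> V" using mv_V[OF h(1)] by blast
    have "?R = {0} \<or> ?R = V"
    proof (rule irred_familyD[OF irr fsubD[OF R] RV])
      show "mv (A i) y \<in> ?R" if i: "i \<in> {1..k}" and y: "y \<in> ?R" for i y
      proof -
        obtain x where x: "x \<in> V" "y = mv h x" using y by (elim imageE)
        have "mv (A i) y = mv (mm (A i) h) x" by (simp add: x(2) mv_mm)
        also have "\<dots> = mv h (mv (B i) x)" using e i by (simp add: mv_mm)
        finally show ?thesis using mv_V[OF B[OF i]] by (rule image_eqI)
      qed
    qed
    then have onto: "?R = V" using nz by blast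
    have "x = 0" if "x \<in> V" "mv h x = 0" for x
      using surj_imp_inj[of "mv h" V x] clin_mv fsub_cspace onto that by simp
    then obtain N where N: "invertible2 h N" using inverse_exists[OF h(1)] by blast
    then have g: "N \<in> gl" "mm h N = one" "mm N h = one" by (auto simp: invertible2_def)
    have "mm (B i) N = mm N (A i)" if i: "i \<in> {1..k}" for i
    proof -
      have "mm (B i) N = mm (mm N h) (mm (B i) N)" using g B[OF i] by (simp add: mm_one mm_gl)
      also have "\<dots> = mm N (mm (mm h (B i)) N)" by (simp add: mm_assoc)
      also have "mm h (B i) = mm (A i) h" using e i by simp
      also have "mm N (mm (mm (A i) h) N) = mm N (A i)" using g A[OF i] by (simp add: mm_assoc mm_one)
      finally show ?thesis .
    qed
    moreover have "invertible2 N h" using N by (auto simp: invertible2_def)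
    ultimately show ?thesis by blast
  qed
qed

lemma good_rigid:
  assumes good: "good (\<chi> \<xi>) \<alpha>" and A: "is_solution n k C A" and irr: "irreducible_tuple n k A"
  shows "rigid_solution n k C A"
  unfolding rigid_solution_def
proof (intro conjI allI impI A)
  fix B assume B: "is_solution n k C B"
  have AC: "A i \<in> C i" "B i \<in> C i" if "i \<in> {1..k}" for i using that A B by (simp_all add: is_solution_def)
  have c: "A i \<in> carrier_mat n n" "B i \<in> carrier_mat n n" if "i \<in> {1..k}" for i
    using class_carrier(1)[OF that] AC[OF that] by blast+
  have irr': "irred_family V k (\<lambda>i. mv (fm (A i)))" using irr irreducible_tuple_iff[of k A, OF c(1)] by simp
  have "\<exists>P P'. invertible2 P P' \<and> (\<forall>i\<in>{1..k}. mm (fm (B i)) P = mm P (fm (A i)))"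
  proof (cases "k = 0")
    case True
    have "invertible2 one one" by (simp add: invertible2_def one_gl mm_one)
    then show ?thesis using True by auto
  next
    case False
    have "\<exists>N. i \<in> {1..k} \<longrightarrow> invertible2 (fm (A i)) N" "\<exists>N. i \<in> {1..k} \<longrightarrow> invertible2 (fm (B i)) N" for i
      using class_carrier(2)[of i "A i"] class_carrier(2)[of i "B i"] AC by blast+
    then obtain A' B' where inv: "\<And>i. i \<in> {1..k} \<Longrightarrow> invertible2 (fm (A i)) (A' i)" "\<And>i. i \<in> {1..k} \<Longrightarrow> invertible2 (fm (B i)) (B' i)"
      by metis
    interpret hs: hom_system n k "\<lambda>i. fm (A i)" A' "\<lambda>i. fm (B i)" B'
      by unfold_locales (use False inv solution_prod[OF A] solution_prod[OF B] in auto)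
    have dims: "cv.dim {M \<in> gl. mm (fm (B i)) M = mm M (fm (A i))} = cv.dim {M \<in> gl. mm M (fm (A i)) = mm (fm (A i)) M}"
      if i: "i \<in> {1..k}" for i
    proof -
      have "tm (fm (B i)) \<in> C i" using AC(2)[OF i] by (simp add: tm_fm c(2)[OF i])
      then obtain G G' where "invertible2 G G'" "fm (B i) = mm G (mm (fm (A i)) G')"
        using class_iff[OF i AC(1)[OF i] fm_gl] by blast
      then show ?thesis by (rule dim_intertwiners[OF fm_gl])
    qed
    have "bilin_form I E \<alpha> \<alpha> = 2"
      using good real_root_form by (simp add: good_def positive_real_roots_def)
    then have "(\<Sum>i\<in>{1..k}. cv.dim {M \<in> gl. mm (fm (B i)) M = mm M (fm (A i))}) + 2 * (n * n) \<ge> k * (n * n) + 2"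
    proof -
      have "(\<Sum>i\<in>{1..k}. cv.dim {M \<in> gl. mm (fm (B i)) M = mm M (fm (A i))}) =
          (\<Sum>i\<in>{1..k}. cv.dim {X \<in> gl. mm X (fm (A i)) = mm (fm (A i)) X})"
        using dims by (intro sum.cong) auto
      then show ?thesis using form_commutants[of A, OF AC(1)] \<open>bilin_form I E \<alpha> \<alpha> = 2\<close> by linarith
    qed
    from hs.intertwiner[OF this]
    obtain h where "h \<in> gl" "h \<noteq> 0" "(\<forall>i\<in>{1..k}. mm (fm (B i)) h = mm h (fm (A i))) \<or> (\<forall>i\<in>{1..k}. mm (fm (A i)) h = mm h (fm (B i)))"
      by blast
    then show ?thesis by (intro irreducible_intertwiner[OF irr' fm_gl _ _ _ fm_gl])
  qed
  then show "simultaneously_conjugate n k A B" using simultaneously_conjugate_iff[of k A B, OF c] by blast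
qed

end

theorem theorem1p5:
  fixes n k :: nat
    and C :: "nat \<Rightarrow> complex mat set"
    and w :: "nat \<Rightarrow> nat"
    and \<xi> :: "nat \<Rightarrow> nat \<Rightarrow> complex"
    and \<alpha> :: "vertex \<Rightarrow> int"
  assumes n_pos: "n \<ge> 1"
    and C: "\<And>i. i \<in> {1..k} \<Longrightarrow> GL_conjugacy_class n (C i)"
    and w_pos: "\<And>i. i \<in> {1..k} \<Longrightarrow> w i \<ge> 1"
    and \<xi>_nonzero: "\<And>i j. i \<in> {1..k} \<Longrightarrow> j \<in> {1..w i} \<Longrightarrow> \<xi> i j \<noteq> 0"
    and \<xi>_annihilates:
      "\<And>i A. i \<in> {1..k} \<Longrightarrow> A \<in> C i \<Longrightarrow> shifted_prod n A (\<xi> i) (w i) = 0\<^sub>m n n"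
    and \<alpha>_lattice: "\<alpha> \<in> root_lattice (star_vertices k w)"
    and \<alpha>_centre: "\<alpha> Centre = int n"
    and \<alpha>_arm:
      "\<And>i j A. i \<in> {1..k} \<Longrightarrow> j \<in> {1..w i - 1} \<Longrightarrow> A \<in> C i \<Longrightarrow>
         \<alpha> (Arm i j) = int (vec_space.rank n (shifted_prod n A (\<xi> i) j))"
  shows "(\<exists>A. rigid_solution n k C A \<and> irreducible_tuple n k A) \<longleftrightarrow>
         \<alpha> \<in> positive_real_roots (star_vertices k w) (star_edges k w) \<and>
         xi_power k w \<xi> \<alpha> = 1 \<and>
         \<not> (\<exists>bs. length bs \<ge> 2 \<and> set bs \<subseteq> positive_roots (star_vertices k w) (star_edges k w) \<and>
                 \<alpha> = (\<lambda>v. \<Sum>b\<leftarrow>bs. b v) \<and>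
                 (\<forall>b\<in>set bs. xi_power k w \<xi> b = 1))"
proof -
  interpret star k w by unfold_locales (rule w_pos)
  interpret multiplicative_problem k w n C \<xi> \<alpha>
  proof
    show "nz \<xi>" unfolding nz_def using \<xi>_nonzero by blast
  qed (fact n_pos C \<xi>_annihilates \<alpha>_lattice \<alpha>_centre \<alpha>_arm)+
  have "(\<exists>A. rigid_solution n k C A \<and> irreducible_tuple n k A) \<longleftrightarrow> good (\<chi> \<xi>) \<alpha>"
    using rigid_good good_irreducible good_rigid by metis
  then show ?thesis unfolding good_def nondecomposable_def .
qed

end
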